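(* Let $Q=(I,\Omega)$ be an arbitrary finite quiver (multiple arrows, oriented cycles and edge loops allowed) and $\mathbf{F}_q$ a finite field. Let $\mathbf d\in\mathbf{N}^I$ be an isotropic cuspidal dimension of $Q$ over $\mathbf{F}_q$, i.e. there is a nonzero cuspidal function of dimension $\mathbf d$ in $\mathbf{H}_{Q,\mathbf{F}_q}$ and $(\mathbf d,\mathbf d)=0$. Then the support $\mathrm{supp}\,\mathbf d$ of $\mathbf d$ (the full subquiver of $Q$ on the vertices $i$ with $d_i\neq0$) is an affine quiver.
   Context: On $\mathbf{Z}^I$ the Euler form is $\langle \mathbf d,\mathbf d'\rangle=\sum_{i\in I} d_id'_i-\sum_{\alpha:i\to j}d_id'_j$ and its symmetrization is $(\mathbf d,\mathbf d')=\langle\mathbf d,\mathbf d'\rangle+\langle\mathbf d',\mathbf d\rangle$. Representations are finite dimensional over $\mathbf{F}_q$; let $\nu=\sqrt q$, $a_M=|\mathrm{Aut}(M)|$, and let $F^R_{M,N}$ be the number of subrepresentations $X\subset R$ with $X\simeq N$, $R/X\simeq M$. The Hall algebra $\mathbf{H}_{Q,\mathbf{F}_q}=\bigoplus_{[M]}\mathbf{C}[M]$ (over isomorphism classes), graded by dimension vector, has multiplication $[M]\star[N]=\nu^{\langle \dim M,\dim N\rangle}\sum_{[R]}F^R_{M,N}[R]$, unit $1=[0]$, and comultiplication $\Delta([R])=\sum_{[U],[V]}\nu^{\langle \dim U,\dim V\rangle}F^R_{U,V}\frac{a_Ua_V}{a_R}[U]\otimes[V]$. A function $f\in\mathbf{H}_{Q,\mathbf{F}_q}$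 is cuspidal if $\Delta(f)=f\otimes1+1\otimes f$. An affine quiver is a quiver whose underlying graph is an extended Dynkin diagram of type $A_n^{(1)}$ ($n\geq0$, where $A_0^{(1)}$ is the Jordan quiver: one vertex, one loop), $D_n^{(1)}$ ($n\ge4$) or $E_6^{(1)},E_7^{(1)},E_8^{(1)}$, with any orientation (cyclic orientations allowed). *)

theory Defs
  imports
    "Graph_Theory.Digraph_Component"
    "Jordan_Normal_Form.VS_Connect"
    "HOL-Algebra.AbelCoset"
    "HOL-Library.Cardinality"
    "HOL-Library.Poly_Mapping"
begin

section \<open>Euler form\<close>

text \<open>
  A quiver is a \<open>fin_digraph\<close>: an arrow \<open>\<alpha> : i \<rightarrow> j\<close> is an arc with tail \<open>i\<close> and head \<open>j\<close>;
  parallel arcs, loops and oriented cycles are allowed. Dimension vectors are functions on the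
  vertex type, of which only the values on \<^term>\<open>verts Q\<close> are ever used.
\<close>

definition euler_form :: "('v, 'e) pre_digraph \<Rightarrow> ('v \<Rightarrow> int) \<Rightarrow> ('v \<Rightarrow> int) \<Rightarrow> int" where
  "euler_form Q d d' =
     (\<Sum>i\<in>verts Q. d i * d' i) - (\<Sum>a\<in>arcs Q. d (tail Q a) * d' (head Q a))"

definition sym_euler_form :: "('v, 'e) pre_digraph \<Rightarrow> ('v \<Rightarrow> int) \<Rightarrow> ('v \<Rightarrow> int) \<Rightarrow> int" where
  "sym_euler_form Q d d' = euler_form Q d d' + euler_form Q d' d"

section \<open>Representations\<close>

text \<open>
  The finite field is the type \<open>'k\<close>, seen as \<^term>\<open>class_ring\<close>. The carrier type \<open>'b\<close> of the
  spaces is a parameter, since a quotient of a representation lives on cosets, of type \<open>'b set\<close>.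
\<close>

record ('v, 'e, 'k, 'b) quiver_rep =
  rep_space :: "'v \<Rightarrow> ('k, 'b) module"
  rep_map :: "'e \<Rightarrow> 'b \<Rightarrow> 'b"

definition is_rep ::
  "('v, 'e) pre_digraph \<Rightarrow> ('v, 'e, 'k::field, 'b) quiver_rep \<Rightarrow> bool" where
  "is_rep Q M \<longleftrightarrow>
     (\<forall>i\<in>verts Q. vectorspace class_ring (rep_space M i) \<and>
                  vectorspace.fin_dim class_ring (rep_space M i)) \<and>
     (\<forall>a\<in>arcs Q. linear_map class_ring (rep_space M (tail Q a)) (rep_space M (head Q a))
                   (rep_map M a))"

definition rep_dim :: "('v, 'e, 'k::field, 'b) quiver_rep \<Rightarrow> 'v \<Rightarrow> nat" where
  "rep_dim M i = vectorspace.dim class_ring (rep_space M i)"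

definition is_rep_iso ::
  "('v, 'e) pre_digraph \<Rightarrow> ('v, 'e, 'k::field, 'b) quiver_rep \<Rightarrow>
   ('v, 'e, 'k, 'c) quiver_rep \<Rightarrow> ('v \<Rightarrow> 'b \<Rightarrow> 'c) \<Rightarrow> bool" where
  "is_rep_iso Q M N g \<longleftrightarrow>
     (\<forall>i\<in>verts Q. linear_map class_ring (rep_space M i) (rep_space N i) (g i) \<and>
                  bij_betw (g i) (carrier (rep_space M i)) (carrier (rep_space N i))) \<and>
     (\<forall>a\<in>arcs Q. \<forall>x\<in>carrier (rep_space M (tail Q a)).
        g (head Q a) (rep_map M a x) = rep_map N a (g (tail Q a) x))"

definition rep_isomorphic ::
  "('v, 'e) pre_digraph \<Rightarrow> ('v, 'e, 'k::field, 'b) quiver_rep \<Rightarrow>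
   ('v, 'e, 'k, 'c) quiver_rep \<Rightarrow> bool" where
  "rep_isomorphic Q M N \<longleftrightarrow> (\<exists>g. is_rep_iso Q M N g)"

text \<open>
  Families of maps and families of subsets are taken extensional, so that distinct functions are
  distinct automorphisms, respectively distinct subrepresentations, and counting is correct.
\<close>

definition rep_automorphisms ::
  "('v, 'e) pre_digraph \<Rightarrow> ('v, 'e, 'k::field, 'b) quiver_rep \<Rightarrow> ('v \<Rightarrow> 'b \<Rightarrow> 'b) set" where
  "rep_automorphisms Q M =
     {g \<in> (\<Pi>\<^sub>E i\<in>verts Q. carrier (rep_space M i) \<rightarrow>\<^sub>E carrier (rep_space M i)).
        is_rep_iso Q M M g}"

definition subreps ::
  "('v, 'e) pre_digraph \<Rightarrow> ('v, 'e, 'k::field, 'b) quiver_rep \<Rightarrow> ('v \<Rightarrow> 'b set) set" where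
  "subreps Q R =
     {X \<in> (\<Pi>\<^sub>E i\<in>verts Q. Pow (carrier (rep_space R i))).
        (\<forall>i\<in>verts Q. subspace class_ring (X i) (rep_space R i)) \<and>
        (\<forall>a\<in>arcs Q. rep_map R a ` X (tail Q a) \<subseteq> X (head Q a))}"

definition subrep ::
  "('v, 'e, 'k, 'b) quiver_rep \<Rightarrow> ('v \<Rightarrow> 'b set) \<Rightarrow> ('v, 'e, 'k, 'b) quiver_rep" where
  "subrep R X = R\<lparr>rep_space := \<lambda>i. (rep_space R i)\<lparr>carrier := X i\<rparr>\<rparr>"

text \<open>
  The unions below are over equal sets: \<open>c (x + W) = c x + W\<close> and \<open>f (x + W) = f x + W'\<close> for any
  choice of \<open>x\<close> in the coset. The fields \<open>mult\<close> and \<open>one\<close> of a \<open>module\<close> record carry no meaning.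
\<close>

definition quotient_module :: "('k, 'b) module \<Rightarrow> 'b set \<Rightarrow> ('k, 'b set) module" where
  "quotient_module V W =
     \<lparr>carrier = a_rcosets\<^bsub>V\<^esub> W, mult = undefined, one = undefined, zero = W,
      add = set_add V, smult = (\<lambda>c C. \<Union>x\<in>C. W +>\<^bsub>V\<^esub> (c \<odot>\<^bsub>V\<^esub> x))\<rparr>"

definition quotient_rep ::
  "('v, 'e) pre_digraph \<Rightarrow> ('v, 'e, 'k, 'b) quiver_rep \<Rightarrow> ('v \<Rightarrow> 'b set) \<Rightarrow>
   ('v, 'e, 'k, 'b set) quiver_rep" where
  "quotient_rep Q R X =
     \<lparr>rep_space = (\<lambda>i. quotient_module (rep_space R i) (X i)),
      rep_map = (\<lambda>a C. \<Union>x\<in>C. X (head Q a) +>\<^bsub>rep_space R (head Q a)\<^esub> rep_map R a x)\<rparr>"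

definition aut_count ::
  "('v, 'e) pre_digraph \<Rightarrow> ('v, 'e, 'k::field, 'b) quiver_rep \<Rightarrow> nat" where
  "aut_count Q M = card (rep_automorphisms Q M)"

text \<open>\<open>hall_number Q R M N\<close> is the number of \<open>X \<subseteq> R\<close> with \<open>X \<simeq> N\<close> and
  \<open>R/X \<simeq> M\<close>.\<close>

definition hall_number ::
  "('v, 'e) pre_digraph \<Rightarrow> ('v, 'e, 'k::field, 'b) quiver_rep \<Rightarrow>
   ('v, 'e, 'k, 'c) quiver_rep \<Rightarrow> ('v, 'e, 'k, 'd) quiver_rep \<Rightarrow> nat" where
  "hall_number Q R M N =
     card {X \<in> subreps Q R. rep_isomorphic Q (subrep R X) N \<and>
                            rep_isomorphic Q (quotient_rep Q R X) M}"

section \<open>The Hall algebra and its comultiplication\<close>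

text \<open>
  Isomorphism classes are formed among the representations with carriers in \<open>'k vec\<close>. This type
  contains every coordinate space \<open>module_vec TYPE('k) n\<close>, so every finite-dimensional
  representation, on whatever carrier type, is isomorphic to one of these.
\<close>

type_synonym ('v, 'e, 'k) iso_class = "('v, 'e, 'k, 'k vec) quiver_rep set"

definition iso_classes :: "('v, 'e) pre_digraph \<Rightarrow> ('v, 'e, 'k::field) iso_class set" where
  "iso_classes Q = {M. is_rep Q M} // {(M, N). is_rep Q M \<and> is_rep Q N \<and> rep_isomorphic Q M N}"

definition class_rep :: "('v, 'e, 'k) iso_class \<Rightarrow> ('v, 'e, 'k, 'k vec) quiver_rep" where
  "class_rep U = (SOME M. M \<in> U)"

definition zero_class :: "('v, 'e) pre_digraph \<Rightarrow> ('v, 'e, 'k::field) iso_class" where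
  "zero_class Q = {M. is_rep Q M \<and> (\<forall>i\<in>verts Q. rep_dim M i = 0)}"

type_synonym ('v, 'e, 'k) hall_element = "('v, 'e, 'k) iso_class \<Rightarrow>\<^sub>0 complex"

definition hall_algebra :: "('v, 'e) pre_digraph \<Rightarrow> ('v, 'e, 'k::field) hall_element set" where
  "hall_algebra Q = {f. Poly_Mapping.keys f \<subseteq> iso_classes Q}"

definition hall_unit :: "('v, 'e) pre_digraph \<Rightarrow> ('v, 'e, 'k::field) hall_element" where
  "hall_unit Q = Poly_Mapping.single (zero_class Q) 1"

text \<open>
  Elements of the tensor square are represented by their coefficients on the basis
  \<open>[U] \<otimes> [V]\<close>, i.e. as functions of the pair \<open>([U], [V])\<close> that vanish off pairs of isomorphism
  classes.
\<close>

definition hall_tensor ::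
  "('v, 'e, 'k) hall_element \<Rightarrow> ('v, 'e, 'k) hall_element \<Rightarrow>
   ('v, 'e, 'k) iso_class \<times> ('v, 'e, 'k) iso_class \<Rightarrow> complex" where
  "hall_tensor f g = (\<lambda>(U, V). Poly_Mapping.lookup f U * Poly_Mapping.lookup g V)"

text \<open>The coefficient of \<open>[U] \<otimes> [V]\<close> in \<open>\<Delta>([R])\<close>; here \<open>\<nu> = \<surd>q\<close> with \<open>q = CARD('k)\<close>.\<close>

definition comult_coeff ::
  "('v, 'e) pre_digraph \<Rightarrow> ('v, 'e, 'k::{field, finite}, 'k vec) quiver_rep \<Rightarrow>
   ('v, 'e, 'k, 'k vec) quiver_rep \<Rightarrow> ('v, 'e, 'k, 'k vec) quiver_rep \<Rightarrow> complex" where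
  "comult_coeff Q R U V =
     complex_of_real (sqrt (real CARD('k)))
       powi euler_form Q (\<lambda>i. int (rep_dim U i)) (\<lambda>i. int (rep_dim V i))
     * of_nat (hall_number Q R U V)
     * (of_nat (aut_count Q U) * of_nat (aut_count Q V) / of_nat (aut_count Q R))"

definition hall_comult ::
  "('v, 'e) pre_digraph \<Rightarrow> ('v, 'e, 'k::{field, finite}) hall_element \<Rightarrow>
   ('v, 'e, 'k) iso_class \<times> ('v, 'e, 'k) iso_class \<Rightarrow> complex" where
  "hall_comult Q f = (\<lambda>(U, V).
     if U \<in> iso_classes Q \<and> V \<in> iso_classes Q
     then \<Sum>R\<in>Poly_Mapping.keys f.
            Poly_Mapping.lookup f R * comult_coeff Q (class_rep R) (class_rep U) (class_rep V)
     else 0)"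

definition cuspidal ::
  "('v, 'e) pre_digraph \<Rightarrow> ('v, 'e, 'k::{field, finite}) hall_element \<Rightarrow> bool" where
  "cuspidal Q f \<longleftrightarrow> f \<in> hall_algebra Q \<and>
     hall_comult Q f = (\<lambda>p. hall_tensor f (hall_unit Q) p + hall_tensor (hall_unit Q) f p)"

definition homogeneous ::
  "('v, 'e) pre_digraph \<Rightarrow> ('v \<Rightarrow> nat) \<Rightarrow> ('v, 'e, 'k::field) hall_element \<Rightarrow> bool" where
  "homogeneous Q d f \<longleftrightarrow>
     (\<forall>U\<in>Poly_Mapping.keys f. \<forall>M\<in>U. \<forall>i\<in>verts Q. rep_dim M i = d i)"

definition cuspidal_dimension ::
  "('v, 'e) pre_digraph \<Rightarrow> 'k::{field, finite} itself \<Rightarrow> ('v \<Rightarrow> nat) \<Rightarrow> bool" where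
  "cuspidal_dimension Q _ d \<longleftrightarrow>
     (\<exists>f :: ('v, 'e, 'k) hall_element. f \<noteq> 0 \<and> cuspidal Q f \<and> homogeneous Q d f)"

definition isotropic :: "('v, 'e) pre_digraph \<Rightarrow> ('v \<Rightarrow> nat) \<Rightarrow> bool" where
  "isotropic Q d \<longleftrightarrow> sym_euler_form Q (\<lambda>i. int (d i)) (\<lambda>i. int (d i)) = 0"

section \<open>Affine quivers\<close>

definition supp :: "('v, 'e) pre_digraph \<Rightarrow> ('v \<Rightarrow> nat) \<Rightarrow> ('v, 'e) pre_digraph" where
  "supp Q d = induce_subgraph Q {i \<in> verts Q. d i \<noteq> 0}"

definition same_underlying_graph ::
  "('v, 'e) pre_digraph \<Rightarrow> ('w, 'f) pre_digraph \<Rightarrow> bool" where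
  "same_underlying_graph G H \<longleftrightarrow>
     (\<exists>\<phi> \<psi>. bij_betw \<phi> (verts G) (verts H) \<and> bij_betw \<psi> (arcs G) (arcs H) \<and>
        (\<forall>a\<in>arcs G. \<phi> ` {tail G a, head G a} = {tail H (\<psi> a), head H (\<psi> a)}))"

text \<open>
  The graph on the vertices \<open>0, \<dots>, n - 1\<close> with the listed edges, repetitions giving multiple
  edges. Its orientation is arbitrary and is forgotten in \<open>is_affine_quiver\<close>.
\<close>

definition graph_of_edges :: "nat \<Rightarrow> (nat \<times> nat) list \<Rightarrow> (nat, nat) pre_digraph" where
  "graph_of_edges n es =
     \<lparr>verts = {..<n}, arcs = {..<length es},
      tail = (\<lambda>k. fst (es ! k)), head = (\<lambda>k. snd (es ! k))\<rparr>"

text \<open>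
  \<open>affine_A 0\<close> is one vertex with a loop, \<open>affine_A 1\<close> two vertices joined by two edges. The exceptional
  diagrams are stars centred at \<open>0\<close>, with arms of lengths \<open>2, 2, 2\<close>, then \<open>1, 3, 3\<close>, then
  \<open>1, 2, 5\<close>.
\<close>

definition affine_A :: "nat \<Rightarrow> (nat, nat) pre_digraph" where
  "affine_A n = graph_of_edges (n + 1) (map (\<lambda>i. (i, (i + 1) mod (n + 1))) [0..<n + 1])"

definition affine_D :: "nat \<Rightarrow> (nat, nat) pre_digraph" where
  "affine_D n = graph_of_edges (n + 1)
     ([(0, 2), (1, 2)] @ map (\<lambda>i. (i, i + 1)) [2..<n - 2] @ [(n - 2, n - 1), (n - 2, n)])"

definition affine_E6 :: "(nat, nat) pre_digraph" where
  "affine_E6 = graph_of_edges 7 [(0, 1), (1, 2), (0, 3), (3, 4), (0, 5), (5, 6)]"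

definition affine_E7 :: "(nat, nat) pre_digraph" where
  "affine_E7 = graph_of_edges 8 [(0, 1), (0, 2), (2, 3), (3, 4), (0, 5), (5, 6), (6, 7)]"

definition affine_E8 :: "(nat, nat) pre_digraph" where
  "affine_E8 = graph_of_edges 9
     [(0, 1), (0, 2), (2, 3), (0, 4), (4, 5), (5, 6), (6, 7), (7, 8)]"

definition is_affine_quiver :: "('v, 'e) pre_digraph \<Rightarrow> bool" where
  "is_affine_quiver Q \<longleftrightarrow>
     (\<exists>n. same_underlying_graph Q (affine_A n)) \<or>
     (\<exists>n\<ge>4. same_underlying_graph Q (affine_D n)) \<or>
     same_underlying_graph Q affine_E6 \<or>
     same_underlying_graph Q affine_E7 \<or>
     same_underlying_graph Q affine_E8"

end

theory Submission
  imports Defs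
begin

text \<open>
  Evaluating a function \<open>f\<close> of dimension \<open>d\<close> on matrix representations turns cuspidality into
  vanishing statements: for every representation preserving a proper nonzero family of coordinate
  subspaces, the sum of \<open>f\<close> over all ways of changing the off-diagonal block (the extensions of the
  quotient by the subrepresentation) is \<open>0\<close>.

  Fix a loopless vertex \<open>i\<close> and all matrices on arcs not touching \<open>i\<close>. The remaining matrices form
  \<open>m\<close> vectors and \<open>m'\<close> covectors in a space of dimension \<open>n = d i\<close>, and \<open>f\<close> becomes an invariant
  function of them whose sums along lines and hyperplanes vanish. Extend it to dimension \<open>n + 1\<close> along the
  hyperplane embeddings \<open>\<iota>\<close> and along the projections \<open>\<pi>\<close> with a line as kernel: extensions along
  different hyperplanes, or different lines, are orthogonal, while the inner product for \<open>\<iota>\<close> and \<open>\<pi>\<close>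
  is the squared norm if \<open>\<pi> \<iota>\<close> is invertible and \<open>0\<close> otherwise. Cauchy-Schwarz for the sums over all
  hyperplanes and all lines forces \<open>2 n \<le> m + m'\<close>, that is \<open>(d, e\<^sub>i) \<le> 0\<close>. As \<open>(d, d) = \<Sum> d\<^sub>i (d, e\<^sub>i)\<close>
  vanishes, \<open>d\<close> is a strictly positive null vector of its support. The support is connected, since
  otherwise the vanishing statement for one of its components has a single summand.

  A connected graph with a positive null vector contains an affine diagram: otherwise it is a tree
  on which \<open>d\<close> is harmonic, and the lengths of the arms at a branch vertex satisfy the equation of
  \<open>E\<^sub>6\<close>, \<open>E\<^sub>7\<close> or \<open>E\<^sub>8\<close>, or there is a second branching and a \<open>D\<^sub>n\<close>. Pairing the two null vectors
  shows that it is equal to that diagram.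
\<close>

section \<open>Invariant functions on pairs of matrices\<close>

text \<open>The inequality at a vertex compares powers of q. Measured by the norm of the given
  function, an extension along a hyperplane has squared norm at most q^m', because covectors of the
  hyperplane can be lifted in that many ways, and an extension along a projection has at most q^m. A
  hyperplane of k^(n+1) is transversal to q^n lines. If P counts the hyperplanes, and equally the
  lines, Cauchy-Schwarz reads (P q^n)^2 \<le> (P q^m') (P q^m). Two points shape the rest. A
  coefficient of the coproduct involves Hall numbers and orders of automorphism groups, whereas the
  estimate needs unweighted sums over matrices; counting adapted frames in two ways turns one into
  the other. And the inequality fails for the simple representation at a loopless vertex, which is
  cuspidal, so each vanishing statement must be supplied with a nonzero subrepresentation and a
  nonzero quotient; isotropy is what excludes this simple. At a vertex with a loop the inequality is
  immediate.\<close>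

lemma sum_mult_squared_le:
  fixes a b :: "'i \<Rightarrow> real"
  shows "(\<Sum>i\<in>I. a i * b i)\<^sup>2 \<le> (\<Sum>i\<in>I. (a i)\<^sup>2) * (\<Sum>i\<in>I. (b i)\<^sup>2)"
proof -
  \<comment> \<open>Lagrange's identity: the defect in Cauchy-Schwarz is half the sum of the squared
    2 x 2 minors.\<close>
  have "0 \<le> (\<Sum>i\<in>I. \<Sum>j\<in>I. (a i * b j - a j * b i)\<^sup>2)"
    by (intro sum_nonneg) auto
  also have "\<dots> = (\<Sum>i\<in>I. \<Sum>j\<in>I. (a i)\<^sup>2 * (b j)\<^sup>2 + (a j)\<^sup>2 * (b i)\<^sup>2 - 2 * ((a i * b i) * (a j * b j)))"
    by (intro sum.cong refl) (simp add: power2_eq_square algebra_simps)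
  also have "\<dots> = 2 * ((\<Sum>i\<in>I. (a i)\<^sup>2) * (\<Sum>i\<in>I. (b i)\<^sup>2)) - 2 * (\<Sum>i\<in>I. a i * b i)\<^sup>2"
  proof -
    have "(\<Sum>i\<in>I. \<Sum>j\<in>I. (a j)\<^sup>2 * (b i)\<^sup>2) = (\<Sum>i\<in>I. (a i)\<^sup>2) * (\<Sum>i\<in>I. (b i)\<^sup>2)"
      by (subst sum.swap) (simp add: sum_product)
    then show ?thesis
      by (simp add: sum.distrib sum_subtractf sum_product power2_eq_square flip: sum_distrib_left)
  qed
  finally show ?thesis by simp
qed

text \<open>Each map \<open>s _ y\<close> permutes \<open>A\<close>, so averaging over
  \<open>Y\<close> does not change the sum, and the average vanishes term by term. In this way one
  vanishing sum along a hyperplane kills a whole inner product.\<close>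

lemma sum_translate_eq_0:
  fixes \<phi> :: "'a \<Rightarrow> real"
  assumes "finite A" "finite Y" "Y \<noteq> {}"
    and bij: "\<And>y. y \<in> Y \<Longrightarrow> bij_betw (\<lambda>a. s a y) A A"
    and zero: "\<And>a. a \<in> A \<Longrightarrow> (\<Sum>y\<in>Y. \<phi> (s a y)) = 0"
  shows "(\<Sum>a\<in>A. \<phi> a) = 0"
proof -
  have "real (card Y) * (\<Sum>a\<in>A. \<phi> a) = (\<Sum>y\<in>Y. \<Sum>a\<in>A. \<phi> a)"
    by simp
  also have "\<dots> = (\<Sum>y\<in>Y. \<Sum>a\<in>A. \<phi> (s a y))"
    by (rule sum.cong[OF refl]) (rule sum.reindex_bij_betw[OF bij, symmetric])
  also have "\<dots> = (\<Sum>a\<in>A. \<Sum>y\<in>Y. \<phi> (s a y))"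
    by (rule sum.swap)
  also have "\<dots> = 0" using zero by simp
  finally show ?thesis using assms by simp
qed

section \<open>Vectors, covectors and base changes as matrices\<close>

lemma bij_betw_carrier_mat:
  "bij_betw (\<lambda>f. mat n m f) (({..<n} \<times> {..<m}) \<rightarrow>\<^sub>E (UNIV :: 'k set)) (carrier_mat n m)"
proof (rule bij_betwI[where g = "\<lambda>A. restrict (\<lambda>p. A $$ p) ({..<n} \<times> {..<m})"])
  fix f :: "nat \<times> nat \<Rightarrow> 'k" assume "f \<in> ({..<n} \<times> {..<m}) \<rightarrow>\<^sub>E UNIV"
  then show "restrict (\<lambda>p. mat n m f $$ p) ({..<n} \<times> {..<m}) = f"
    by (auto simp: PiE_def extensional_def restrict_def)
qed auto

lemma finite_carrier_mat [simp]: "finite (carrier_mat n m :: 'k :: finite mat set)"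
  using bij_betw_finite[OF bij_betw_carrier_mat[where 'k = 'k, of n m]] by (auto intro!: finite_PiE)

lemma card_carrier_mat: "card (carrier_mat n m :: 'k :: finite mat set) = CARD('k) ^ (n * m)"
  using bij_betw_same_card[OF bij_betw_carrier_mat[where 'k = 'k, of n m]]
  by (simp add: card_PiE)

lemma zero_in_carrier_mat: "0\<^sub>m n m \<in> carrier_mat n m" by simp

lemma bij_betw_add_mat:
  assumes "B \<in> carrier_mat n m"
  shows "bij_betw (\<lambda>A. A + B) (carrier_mat n m) (carrier_mat n m :: 'k :: ring_1 mat set)"
  by (rule bij_betwI[where g = "\<lambda>A. A - B"]) (use assms in \<open>auto intro!: eq_matI\<close>)

lemma bij_betw_mult_mat_left:
  fixes h h' :: "'k :: field mat"
  assumes "h \<in> carrier_mat n n" "h' \<in> carrier_mat n n" "h * h' = 1\<^sub>m n" "h' * h = 1\<^sub>m n"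
  shows "bij_betw (\<lambda>A. h * A) (carrier_mat n m) (carrier_mat n m)"
  by (rule bij_betwI[where g = "\<lambda>A. h' * A"])
     (use assms in \<open>auto simp: assoc_mult_mat[symmetric, of _ n n _ n _ m]
        simp del: assoc_mult_mat\<close>)

text \<open>Vectors are kept as one-column matrices and covectors as one-row matrices, so that every
  composition below is a matrix product under one associativity rule.\<close>

lemma det_0_iff_mat_prod_zero:
  fixes A :: "'k :: field mat"
  assumes A: "A \<in> carrier_mat n n"
  shows "det A = 0 \<longleftrightarrow> (\<exists>w \<in> carrier_mat n 1. w \<noteq> 0\<^sub>m n 1 \<and> A * w = 0\<^sub>m n 1)"
proof -
  let ?c = "\<lambda>v. mat_of_cols n [v]"
  have 1: "?c v \<in> carrier_mat n 1" "?c v \<noteq> 0\<^sub>m n 1 \<longleftrightarrow> v \<noteq> 0\<^sub>v n"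
    "A * ?c v = ?c (A *\<^sub>v v)" if "v \<in> carrier_vec n" for v
    using that A by (auto simp: mat_eq_iff vec_eq_iff mat_of_cols_index scalar_prod_def)
  have 2: "?c (col w 0) = w" "col w 0 \<in> carrier_vec n" if "w \<in> carrier_mat n 1" for w :: "'k mat"
    using that by (auto simp: mat_eq_iff mat_of_cols_index)
  show ?thesis (is "?L \<longleftrightarrow> ?R")
  proof
    assume ?L
    then obtain v where v: "v \<in> carrier_vec n" "v \<noteq> 0\<^sub>v n" "A *\<^sub>v v = 0\<^sub>v n"
      unfolding det_0_iff_vec_prod_zero_field[OF A] by blast
    have "A * ?c v = 0\<^sub>m n 1"
      using 1(3)[OF v(1)] v(3) by (auto simp: mat_eq_iff mat_of_cols_index)
    with 1(1)[OF v(1)] 1(2)[OF v(1)] v(2) show ?R by blast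
  next
    assume ?R
    then obtain w where w: "w \<in> carrier_mat n 1" "w \<noteq> 0\<^sub>m n 1" "A * w = 0\<^sub>m n 1" by blast
    have "col w 0 \<noteq> 0\<^sub>v n" using 1(2)[OF 2(2)[OF w(1)]] 2(1)[OF w(1)] w(2) by simp
    moreover have "A *\<^sub>v col w 0 = 0\<^sub>v n"
      using w col_mult2[OF A w(1), of 0] by simp
    ultimately show ?L
      unfolding det_0_iff_vec_prod_zero_field[OF A] using 2(2)[OF w(1)] by blast
  qed
qed

lemma det_0_iff_mat_prod_zero_left:
  fixes A :: "'k :: field mat"
  assumes A: "A \<in> carrier_mat n n"
  shows "det A = 0 \<longleftrightarrow> (\<exists>w \<in> carrier_mat 1 n. w \<noteq> 0\<^sub>m 1 n \<and> w * A = 0\<^sub>m 1 n)"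
proof -
  have "det A = 0 \<longleftrightarrow> det (transpose_mat A) = 0" using det_transpose[OF A] by simp
  also have "\<dots> \<longleftrightarrow> (\<exists>w \<in> carrier_mat n 1. w \<noteq> 0\<^sub>m n 1 \<and> transpose_mat A * w = 0\<^sub>m n 1)"
    using A by (intro det_0_iff_mat_prod_zero) simp
  also have "\<dots> \<longleftrightarrow> (\<exists>w \<in> carrier_mat 1 n. w \<noteq> 0\<^sub>m 1 n \<and> w * A = 0\<^sub>m 1 n)"
  proof -
    have *: "transpose_mat A * w = transpose_mat (transpose_mat w * A)" if "w \<in> carrier_mat n 1" for w
      using that A by (simp add: transpose_mult[of _ 1 n _ n])
    have z: "transpose_mat w = 0\<^sub>m a b \<longleftrightarrow> w = 0\<^sub>m b a" for a b and w :: "'k mat"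
      by (auto simp: mat_eq_iff)
    show ?thesis
    proof safe
      fix w assume "w \<in> carrier_mat n 1" "w \<noteq> 0\<^sub>m n 1" "transpose_mat A * w = 0\<^sub>m n 1"
      then show "\<exists>w \<in> carrier_mat 1 n. w \<noteq> 0\<^sub>m 1 n \<and> w * A = 0\<^sub>m 1 n"
        using * z by (intro bexI[of _ "transpose_mat w"]) auto
    next
      fix w assume "w \<in> carrier_mat 1 n" "w \<noteq> 0\<^sub>m 1 n" "w * A = 0\<^sub>m 1 n"
      then show "\<exists>w \<in> carrier_mat n 1. w \<noteq> 0\<^sub>m n 1 \<and> transpose_mat A * w = 0\<^sub>m n 1"
        using *[of "transpose_mat w"] z by (intro bexI[of _ "transpose_mat w"]) auto
    qed
  qed
  finally show ?thesis .
qed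

lemma invertible_matE:
  fixes A :: "'k :: field mat"
  assumes A: "A \<in> carrier_mat n n" and "det A \<noteq> 0"
  obtains B where "B \<in> carrier_mat n n" "A * B = 1\<^sub>m n" "B * A = 1\<^sub>m n"
proof -
  from det_non_zero_imp_unit[OF assms, of "()"]
  show ?thesis using that
    unfolding Units_def by (auto simp: ring_mat_def)
qed

text \<open>A nonzero vector is part of a basis. This moves an arbitrary line, or after
  transposition an arbitrary hyperplane, to the one given by coordinate 0.\<close>

lemma ex_invertible_mat_first_col:
  fixes p :: "'k :: field mat"
  assumes p: "p \<in> carrier_mat n 1" "p \<noteq> 0\<^sub>m n 1"
  obtains g h where "g \<in> carrier_mat n n" "h \<in> carrier_mat n n" "g * h = 1\<^sub>m n" "h * g = 1\<^sub>m n"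
    "\<And>r. r < n \<Longrightarrow> g $$ (r, 0) = p $$ (r, 0)"
proof -
  from p obtain j where j: "j < n" "p $$ (j, 0) \<noteq> 0"
    by (force simp: mat_eq_iff)
  \<comment> \<open>In the identity, \<open>p\<close> replaces the first column. If its nonzero
    entry lies in a row \<open>j\<close> other than 0, column \<open>j\<close> takes over the unit
    vector that \<open>p\<close> has displaced.\<close>
  define g where "g = mat n n (\<lambda>(r, c). if c = 0 then p $$ (r, 0) else if c = j then of_bool (r = 0)
    else of_bool (r = c))"
  have g: "g \<in> carrier_mat n n" by (simp add: g_def)
  have "det g \<noteq> 0"
  proof
    assume "det g = 0"
    then obtain w where w: "w \<in> carrier_vec n" "w \<noteq> 0\<^sub>v n" "g *\<^sub>v w = 0\<^sub>v n"
      unfolding det_0_iff_vec_prod_zero_field[OF g] by blast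
    have row: "(\<Sum>c<n. g $$ (r, c) * w $ c) = 0" if "r < n" for r
    proof -
      have "(g *\<^sub>v w) $ r = 0" using w that by simp
      then show ?thesis using g w(1) that by (simp add: scalar_prod_def atLeast0LessThan)
    qed
    have split: "(\<Sum>c<n. g $$ (r, c) * w $ c) =
        p $$ (r, 0) * w $ 0 + (\<Sum>c\<in>{..<n} - {0}. g $$ (r, c) * w $ c)" if "r < n" for r
      using that by (subst sum.remove[of _ 0]) (auto simp: g_def)
    have others: "(\<Sum>c\<in>{..<n} - {0}. g $$ (r, c) * w $ c) =
       (if r = 0 then (if j = 0 then 0 else w $ j) else if r = j then 0 else w $ r)" if "r < n" for r
    proof -
      have "(\<Sum>c\<in>{..<n} - {0}. g $$ (r, c) * w $ c) =
        (\<Sum>c\<in>{..<n} - {0}. if c = (if r = 0 then j else r) then (if r \<noteq> 0 \<and> r = j then 0 else w $ c) else 0)"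
        using that by (intro sum.cong refl) (auto simp: g_def)
      also have "\<dots> = (if r = 0 then (if j = 0 then 0 else w $ j) else if r = j then 0 else w $ r)"
        using that j by (subst sum.delta) auto
      finally show ?thesis .
    qed
    have eq: "p $$ (r, 0) * w $ 0 + (if r = 0 then (if j = 0 then 0 else w $ j) else if r = j then 0 else w $ r) = 0"
      if "r < n" for r using row[OF that] split[OF that] others[OF that] by simp
    \<comment> \<open>The only nonzero entry of row \<open>j\<close> of \<open>g\<close> is that of
      \<open>p\<close>; once \<open>w $ 0\<close> is gone, row 0 yields
      \<open>w $ j\<close>.\<close>
    have w0: "w $ 0 = 0" using eq[OF j(1)] j(2) by (auto split: if_splits)
    have wj: "w $ j = 0" using eq[of 0] j(1) w0 by (auto split: if_splits)
    have "w $ r = 0" if "r < n" for r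
      using eq[OF that] w0 wj by (auto split: if_splits)
    then have "w = 0\<^sub>v n" using w(1) by (intro eq_vecI) auto
    with w(2) show False by simp
  qed
  with g obtain h where "h \<in> carrier_mat n n" "g * h = 1\<^sub>m n" "h * g = 1\<^sub>m n"
    by (rule invertible_matE)
  moreover have "g $$ (r, 0) = p $$ (r, 0)" if "r < n" for r
    using that by (simp add: g_def)
  ultimately show ?thesis using g that by blast
qed

text \<open>The sequence 0 -> k^n -> k^(n+1) -> k -> 0 with last map \<open>\<theta>\<close> splits:
  \<open>\<iota>\<close> parametrizes the hyperplane, \<open>\<tau>\<close> retracts onto it and
  \<open>\<rho>\<close> spans a complement.\<close>

lemma hyperplane_frame:
  fixes \<theta> :: "'k :: field mat"
  assumes \<theta>: "\<theta> \<in> carrier_mat 1 (Suc n)" "\<theta> \<noteq> 0\<^sub>m 1 (Suc n)"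
  obtains \<iota> \<tau> \<rho> where "\<iota> \<in> carrier_mat (Suc n) n" "\<tau> \<in> carrier_mat n (Suc n)" "\<rho> \<in> carrier_mat (Suc n) 1"
    "\<tau> * \<iota> = 1\<^sub>m n" "\<theta> * \<iota> = 0\<^sub>m 1 n" "\<iota> * \<tau> + \<rho> * \<theta> = 1\<^sub>m (Suc n)"
proof -
  have "transpose_mat \<theta> \<in> carrier_mat (Suc n) 1" "transpose_mat \<theta> \<noteq> 0\<^sub>m (Suc n) 1"
    using \<theta> by (auto simp: mat_eq_iff)
  then obtain g' h' where g': "g' \<in> carrier_mat (Suc n) (Suc n)" "h' \<in> carrier_mat (Suc n) (Suc n)"
    "g' * h' = 1\<^sub>m (Suc n)" "h' * g' = 1\<^sub>m (Suc n)"
    "\<And>r. r < Suc n \<Longrightarrow> g' $$ (r, 0) = transpose_mat \<theta> $$ (r, 0)"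
    by (rule ex_invertible_mat_first_col) metis
  \<comment> \<open>\<open>g\<close> has \<open>\<theta>\<close> as its first row, so in the new
    coordinates \<open>\<theta>\<close> is the first coordinate function \<open>K\<close>, and
    \<open>J\<close> forgets that coordinate. The frame will be \<open>\<iota>\<close> = h J^T,
    \<open>\<tau>\<close> = J g, \<open>\<rho>\<close> = h K^T.\<close>
  define g where "g = transpose_mat g'"
  define h where "h = transpose_mat h'"
  define J :: "'k mat" where "J = mat n (Suc n) (\<lambda>(r, c). of_bool (c = Suc r))"
  define K :: "'k mat" where "K = mat 1 (Suc n) (\<lambda>(r, c). of_bool (c = 0))"
  have gh: "g \<in> carrier_mat (Suc n) (Suc n)" "h \<in> carrier_mat (Suc n) (Suc n)"
    "g * h = 1\<^sub>m (Suc n)" "h * g = 1\<^sub>m (Suc n)"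
    using g'(1,2) transpose_mult[OF g'(1,2), symmetric] transpose_mult[OF g'(2,1), symmetric]
    by (simp_all add: g_def h_def g'(3,4) del: transpose_mult)
  have J: "J \<in> carrier_mat n (Suc n)" and K: "K \<in> carrier_mat 1 (Suc n)" by (auto simp: J_def K_def)
  note tr = transpose_carrier_mat[THEN iffD2]
  have \<theta>g: "\<theta> = K * g"
    using \<theta> g' by (intro eq_matI) (auto simp: g_def K_def scalar_prod_def sum.delta if_distrib cong: if_cong)
  have JJ: "J * transpose_mat J = 1\<^sub>m n"
    by (intro eq_matI) (auto simp: J_def scalar_prod_def of_bool_def if_distrib cong: if_cong)
  have KJ: "K * transpose_mat J = 0\<^sub>m 1 n"
    by (intro eq_matI) (auto simp: J_def K_def scalar_prod_def of_bool_def if_distrib cong: if_cong)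
  have JK: "transpose_mat J * J + transpose_mat K * K = 1\<^sub>m (Suc n)"
  proof (intro eq_matI)
    fix r c assume "r < dim_row (1\<^sub>m (Suc n) :: 'k mat)" "c < dim_col (1\<^sub>m (Suc n) :: 'k mat)"
    then have rc: "r < Suc n" "c < Suc n" by auto
    have "(\<Sum>b<n. of_bool (r = Suc b) * of_bool (c = Suc b)) = (of_bool (r = c \<and> r \<noteq> 0) :: 'k)"
      using rc by (cases r) (auto simp: of_bool_def if_distrib sum.delta cong: if_cong)
    then show "(transpose_mat J * J + transpose_mat K * K) $$ (r, c) = 1\<^sub>m (Suc n) $$ (r, c)"
      using rc by (auto simp: J_def K_def scalar_prod_def atLeast0LessThan)
  qed (auto simp: J_def K_def)
  have g_cancel: "g * (h * B) = B" "h * (g * B) = B" if "B \<in> carrier_mat (Suc n) c" for B c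
    using that gh assoc_mult_mat[OF gh(1,2) that] assoc_mult_mat[OF gh(2,1) that] by simp_all
  have hJ: "h * transpose_mat J \<in> carrier_mat (Suc n) n" using gh J by simp
  have 1: "(J * g) * (h * transpose_mat J) = 1\<^sub>m n"
    using assoc_mult_mat[OF J gh(1) hJ] g_cancel(1)[of "transpose_mat J" n] J JJ by simp
  have 2: "\<theta> * (h * transpose_mat J) = 0\<^sub>m 1 n"
    using assoc_mult_mat[OF K gh(1) hJ] g_cancel(1)[of "transpose_mat J" n] J KJ \<theta>g by simp
  have "(h * transpose_mat J) * (J * g) + (h * transpose_mat K) * \<theta>
      = h * ((transpose_mat J * J) * g + (transpose_mat K * K) * g)"
  proof -
    have "(h * transpose_mat J) * (J * g) = h * ((transpose_mat J * J) * g)"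
      using gh J assoc_mult_mat[of h "Suc n" "Suc n" "transpose_mat J" n "J * g" "Suc n"]
        assoc_mult_mat[of "transpose_mat J" "Suc n" n J "Suc n" g "Suc n"] by simp
    moreover have "(h * transpose_mat K) * \<theta> = h * ((transpose_mat K * K) * g)"
      unfolding \<theta>g
      using gh K assoc_mult_mat[of h "Suc n" "Suc n" "transpose_mat K" 1 "K * g" "Suc n"]
        assoc_mult_mat[of "transpose_mat K" "Suc n" 1 K "Suc n" g "Suc n"] by simp
    ultimately show ?thesis
      using gh J K
        mult_add_distrib_mat[of h "Suc n" "Suc n" "(transpose_mat J * J) * g" "Suc n" "(transpose_mat K * K) * g"]
      by simp
  qed
  also have "(transpose_mat J * J) * g + (transpose_mat K * K) * g = g"
    using gh J K add_mult_distrib_mat[of "transpose_mat J * J" "Suc n" "Suc n" "transpose_mat K * K" g "Suc n"]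
    unfolding JK by simp
  also have "h * g = 1\<^sub>m (Suc n)" by (rule gh)
  finally have 3: "(h * transpose_mat J) * (J * g) + (h * transpose_mat K) * \<theta> = 1\<^sub>m (Suc n)" .
  show ?thesis
    by (rule that[OF _ _ _ 1 2 3]) (use gh J K in auto)
qed

lemma mat_split_right:
  fixes A :: "'k :: comm_ring_1 mat"
  assumes "A \<in> carrier_mat n a" "B \<in> carrier_mat a n" "C \<in> carrier_mat n b" "D \<in> carrier_mat b n"
    and id: "A * B + C * D = 1\<^sub>m n" and z: "z \<in> carrier_mat c n"
  shows "z = z * A * B + z * C * D"
proof -
  have "z = z * (A * B + C * D)" unfolding id using z by simp
  also have "\<dots> = z * (A * B) + z * (C * D)"
    using assms by (intro mult_add_distrib_mat) auto
  also have "\<dots> = z * A * B + z * C * D"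
    unfolding assoc_mult_mat[OF z assms(1,2)] assoc_mult_mat[OF z assms(3,4)] ..
  finally show ?thesis .
qed

lemma mat_split_left:
  fixes A :: "'k :: comm_ring_1 mat"
  assumes "A \<in> carrier_mat n a" "B \<in> carrier_mat a n" "C \<in> carrier_mat n b" "D \<in> carrier_mat b n"
    and id: "A * B + C * D = 1\<^sub>m n" and v: "v \<in> carrier_mat n c"
  shows "v = A * (B * v) + C * (D * v)"
proof -
  have "v = (A * B + C * D) * v" unfolding id using v by simp
  also have "\<dots> = (A * B) * v + (C * D) * v"
    using assms by (intro add_mult_distrib_mat) auto
  also have "\<dots> = A * (B * v) + C * (D * v)"
    unfolding assoc_mult_mat[OF assms(1,2) v] assoc_mult_mat[OF assms(3,4) v] ..
  finally show ?thesis .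
qed

lemma mult_mat_1_1:
  fixes A :: "'k :: comm_ring_1 mat"
  assumes "A \<in> carrier_mat 1 1"
  shows "B \<in> carrier_mat 1 n \<Longrightarrow> A * B = A $$ (0, 0) \<cdot>\<^sub>m B"
    and "B \<in> carrier_mat n 1 \<Longrightarrow> B * A = A $$ (0, 0) \<cdot>\<^sub>m B"
  using assms by (auto intro!: eq_matI simp: scalar_prod_def mult.commute)

text \<open>
  \<open>F\<close> is a function of a matrix \<open>x\<close> of \<open>m\<close> column vectors in \<open>k\<^sup>n\<close> and a matrix \<open>z\<close> of \<open>m'\<close> covectors,
  invariant under base change of \<open>k\<^sup>n\<close>.
\<close>

locale invariant_matrix_function =
  fixes n m m' :: nat and F :: "'k::{field, finite} mat \<Rightarrow> 'k mat \<Rightarrow> real"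
  assumes F_invariant: "\<And>h h' x z. \<lbrakk>h \<in> carrier_mat n n; h' \<in> carrier_mat n n; h * h' = 1\<^sub>m n;
      h' * h = 1\<^sub>m n; x \<in> carrier_mat n m; z \<in> carrier_mat m' n\<rbrakk> \<Longrightarrow> F (h * x) z = F x (z * h)"
    and sum_line: "\<And>p x z. \<lbrakk>p \<in> carrier_mat n 1; p \<noteq> 0\<^sub>m n 1; x \<in> carrier_mat n m;
      z \<in> carrier_mat m' n; z * p = 0\<^sub>m m' 1\<rbrakk> \<Longrightarrow> (\<Sum>y\<in>carrier_mat 1 m. F (x + p * y) z) = 0"
    and sum_hyperplane: "\<And>p x z. \<lbrakk>p \<in> carrier_mat 1 n; p \<noteq> 0\<^sub>m 1 n; x \<in> carrier_mat n m;
      z \<in> carrier_mat m' n; p * x = 0\<^sub>m 1 m\<rbrakk> \<Longrightarrow> (\<Sum>y\<in>carrier_mat m' 1. F x (z + y * p)) = 0"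
begin

definition norm2 :: real where
  "norm2 = (\<Sum>x\<in>carrier_mat n m. \<Sum>z\<in>carrier_mat m' n. (F x z)\<^sup>2)"

text \<open>The inner product of the extensions along \<open>\<iota>\<close> and
  \<open>\<pi>\<close>, which sees these maps only through
  \<open>h = \<pi> * \<iota>\<close>.\<close>

definition twist :: "'k mat \<Rightarrow> real" where
  "twist h = (\<Sum>x\<in>carrier_mat n m. \<Sum>z\<in>carrier_mat m' n. F x (z * h) * F (h * x) z)"

lemma twist_invertible:
  assumes h: "h \<in> carrier_mat n n" "det h \<noteq> 0"
  shows "twist h = norm2"
proof -
  from h obtain h' where h': "h' \<in> carrier_mat n n" "h * h' = 1\<^sub>m n" "h' * h = 1\<^sub>m n"
    by (rule invertible_matE)
  have "twist h = (\<Sum>x\<in>carrier_mat n m. \<Sum>z\<in>carrier_mat m' n. (F (h * x) z)\<^sup>2)"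
    unfolding twist_def using F_invariant[OF h(1) h'] by (simp add: power2_eq_square)
  also have "\<dots> = norm2"
    unfolding norm2_def
    by (rule sum.reindex_bij_betw[OF bij_betw_mult_mat_left[OF h(1) h'],
          where g = "\<lambda>x. \<Sum>z\<in>carrier_mat m' n. (F x z)\<^sup>2"])
  finally show ?thesis .
qed

text \<open>Let \<open>p * h = 0\<close>. Shifting \<open>z\<close> by multiples of \<open>p\<close>
  leaves the factor with \<open>z * h\<close> alone, and the vectors \<open>h * x\<close> lie in the
  hyperplane of \<open>p\<close>, so the other factor sums to zero.\<close>

lemma twist_singular:
  assumes h: "h \<in> carrier_mat n n" "det h = 0"
  shows "twist h = 0"
proof -
  from h obtain p where p: "p \<in> carrier_mat 1 n" "p \<noteq> 0\<^sub>m 1 n" "p * h = 0\<^sub>m 1 n"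
    using det_0_iff_mat_prod_zero_left[OF h(1)] by blast
  have "(\<Sum>z\<in>carrier_mat m' n. F x (z * h) * F (h * x) z) = 0" if x: "x \<in> carrier_mat n m" for x
  proof (rule sum_translate_eq_0[where s = "\<lambda>z y. z + y * p" and Y = "carrier_mat m' 1"])
    fix y :: "'k mat" assume "y \<in> carrier_mat m' 1"
    then show "bij_betw (\<lambda>z. z + y * p) (carrier_mat m' n) (carrier_mat m' n)"
      using p by (intro bij_betw_add_mat) auto
  next
    fix z :: "'k mat" assume z: "z \<in> carrier_mat m' n"
    have eq: "(z + y * p) * h = z * h" if y: "y \<in> carrier_mat m' 1" for y
    proof -
      have "(z + y * p) * h = z * h + y * (p * h)"
        using y p h z add_mult_distrib_mat[of z m' n "y * p" h n] assoc_mult_mat[of y m' 1 p n h n]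
        by simp
      then show ?thesis using p y z h by (auto intro!: eq_matI)
    qed
    have "p * (h * x) = 0\<^sub>m 1 m"
      using assoc_mult_mat[OF p(1) h(1) x] p(3) x by simp
    then have "(\<Sum>y\<in>carrier_mat m' 1. F (h * x) (z + y * p)) = 0"
      using sum_hyperplane[OF p(1,2) _ z] h(1) x by simp
    then show "(\<Sum>y\<in>carrier_mat m' 1. F x ((z + y * p) * h) * F (h * x) (z + y * p)) = 0"
      by (simp add: eq flip: sum_distrib_left)
  qed (use zero_in_carrier_mat in auto)
  then show ?thesis unfolding twist_def by simp
qed

text \<open>Extension by zero off the hyperplane: the vectors have to lie in the image of
  \<open>\<iota>\<close>, the covectors are restricted to it. For injective \<open>\<iota>\<close>
  the sum has at most one nonzero term, which spares naming the preimage.\<close>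

definition ext_row :: "'k mat \<Rightarrow> 'k mat \<Rightarrow> 'k mat \<Rightarrow> real" where
  "ext_row \<iota> x z = (\<Sum>x'\<in>carrier_mat n m. if \<iota> * x' = x then F x' (z * \<iota>) else 0)"

text \<open>The dual construction: the covectors have to factor through \<open>\<pi>\<close>, the
  vectors are projected.\<close>

definition ext_col :: "'k mat \<Rightarrow> 'k mat \<Rightarrow> 'k mat \<Rightarrow> real" where
  "ext_col \<pi> x z = (\<Sum>z'\<in>carrier_mat m' n. if z' * \<pi> = z then F (\<pi> * x) z' else 0)"

abbreviation inner2 :: "('k mat \<Rightarrow> 'k mat \<Rightarrow> real) \<Rightarrow> ('k mat \<Rightarrow> 'k mat \<Rightarrow> real) \<Rightarrow> real" where
  "inner2 f g \<equiv> (\<Sum>x\<in>carrier_mat (Suc n) m. \<Sum>z\<in>carrier_mat m' (Suc n). f x z * g x z)"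

lemma inner2_ext_row:
  assumes \<iota>: "\<iota> \<in> carrier_mat (Suc n) n" and "\<iota>' \<in> carrier_mat (Suc n) n"
  shows "inner2 (ext_row \<iota>) (ext_row \<iota>') = (\<Sum>x\<in>carrier_mat n m. \<Sum>x'\<in>carrier_mat n m.
    if \<iota> * x = \<iota>' * x' then \<Sum>z\<in>carrier_mat m' (Suc n). F x (z * \<iota>) * F x' (z * \<iota>') else 0)"
proof -
  have "inner2 (ext_row \<iota>) (ext_row \<iota>') =
    (\<Sum>X\<in>carrier_mat (Suc n) m. \<Sum>z\<in>carrier_mat m' (Suc n). \<Sum>x\<in>carrier_mat n m. \<Sum>x'\<in>carrier_mat n m.
      if \<iota> * x = X \<and> \<iota>' * x' = X then F x (z * \<iota>) * F x' (z * \<iota>') else 0)"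
    unfolding ext_row_def sum_product by (intro sum.cong refl) auto
  also have "\<dots> = (\<Sum>X\<in>carrier_mat (Suc n) m. \<Sum>x\<in>carrier_mat n m. \<Sum>x'\<in>carrier_mat n m.
    \<Sum>z\<in>carrier_mat m' (Suc n). if \<iota> * x = X \<and> \<iota>' * x' = X then F x (z * \<iota>) * F x' (z * \<iota>') else 0)"
    by (subst sum.swap, rule sum.cong[OF refl], subst sum.swap, rule refl)
  also have "\<dots> = (\<Sum>x\<in>carrier_mat n m. \<Sum>x'\<in>carrier_mat n m. \<Sum>X\<in>carrier_mat (Suc n) m.
    \<Sum>z\<in>carrier_mat m' (Suc n). if \<iota> * x = X \<and> \<iota>' * x' = X then F x (z * \<iota>) * F x' (z * \<iota>') else 0)"
    by (subst sum.swap, rule sum.cong[OF refl], rule sum.swap)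
  also have "\<dots> = (\<Sum>x\<in>carrier_mat n m. \<Sum>x'\<in>carrier_mat n m.
    if \<iota> * x = \<iota>' * x' then \<Sum>z\<in>carrier_mat m' (Suc n). F x (z * \<iota>) * F x' (z * \<iota>') else 0)"
  proof (intro sum.cong refl)
    fix x x' :: "'k mat" assume x: "x \<in> carrier_mat n m" "x' \<in> carrier_mat n m"
    have "(\<Sum>X\<in>carrier_mat (Suc n) m. \<Sum>z\<in>carrier_mat m' (Suc n).
        if \<iota> * x = X \<and> \<iota>' * x' = X then F x (z * \<iota>) * F x' (z * \<iota>') else 0)
      = (\<Sum>X\<in>carrier_mat (Suc n) m. if \<iota> * x = X then
          (if \<iota> * x = \<iota>' * x' then \<Sum>z\<in>carrier_mat m' (Suc n). F x (z * \<iota>) * F x' (z * \<iota>') else 0) else 0)"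
      by (intro sum.cong refl) auto
    also have "\<dots> = (if \<iota> * x = \<iota>' * x' then \<Sum>z\<in>carrier_mat m' (Suc n). F x (z * \<iota>) * F x' (z * \<iota>') else 0)"
      using x \<iota> by (subst sum.delta') auto
    finally show "(\<Sum>X\<in>carrier_mat (Suc n) m. \<Sum>z\<in>carrier_mat m' (Suc n).
        if \<iota> * x = X \<and> \<iota>' * x' = X then F x (z * \<iota>) * F x' (z * \<iota>') else 0)
      = (if \<iota> * x = \<iota>' * x' then \<Sum>z\<in>carrier_mat m' (Suc n). F x (z * \<iota>) * F x' (z * \<iota>') else 0)" .
  qed
  finally show ?thesis .
qed

text \<open>The two supports leave only the pairs \<open>X = \<iota> * x\<close> and
  \<open>Z = z * \<pi>\<close>.\<close>

lemma inner2_ext_row_ext_col: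
  assumes \<iota>: "\<iota> \<in> carrier_mat (Suc n) n" and \<pi>: "\<pi> \<in> carrier_mat n (Suc n)"
  shows "inner2 (ext_row \<iota>) (ext_col \<pi>) = twist (\<pi> * \<iota>)"
proof -
  have "inner2 (ext_row \<iota>) (ext_col \<pi>) =
    (\<Sum>X\<in>carrier_mat (Suc n) m. \<Sum>Z\<in>carrier_mat m' (Suc n). \<Sum>x\<in>carrier_mat n m. \<Sum>z\<in>carrier_mat m' n.
      if \<iota> * x = X \<and> z * \<pi> = Z then F x (Z * \<iota>) * F (\<pi> * X) z else 0)"
    unfolding ext_row_def ext_col_def sum_product by (intro sum.cong refl) auto
  also have "\<dots> = (\<Sum>X\<in>carrier_mat (Suc n) m. \<Sum>x\<in>carrier_mat n m. \<Sum>z\<in>carrier_mat m' n.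
      \<Sum>Z\<in>carrier_mat m' (Suc n). if \<iota> * x = X \<and> z * \<pi> = Z then F x (Z * \<iota>) * F (\<pi> * X) z else 0)"
    by (subst sum.swap, rule sum.cong[OF refl], subst sum.swap, rule refl)
  also have "\<dots> = (\<Sum>x\<in>carrier_mat n m. \<Sum>z\<in>carrier_mat m' n. \<Sum>X\<in>carrier_mat (Suc n) m.
      \<Sum>Z\<in>carrier_mat m' (Suc n). if \<iota> * x = X \<and> z * \<pi> = Z then F x (Z * \<iota>) * F (\<pi> * X) z else 0)"
    by (subst sum.swap, rule sum.cong[OF refl], rule sum.swap)
  also have "\<dots> = (\<Sum>x\<in>carrier_mat n m. \<Sum>z\<in>carrier_mat m' n. F x (z * (\<pi> * \<iota>)) * F (\<pi> * \<iota> * x) z)"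
  proof (intro sum.cong refl)
    fix x z :: "'k mat" assume x: "x \<in> carrier_mat n m" "z \<in> carrier_mat m' n"
    have "(\<Sum>X\<in>carrier_mat (Suc n) m. \<Sum>Z\<in>carrier_mat m' (Suc n).
        if \<iota> * x = X \<and> z * \<pi> = Z then F x (Z * \<iota>) * F (\<pi> * X) z else 0)
      = (\<Sum>X\<in>carrier_mat (Suc n) m. if \<iota> * x = X then
          \<Sum>Z\<in>carrier_mat m' (Suc n). if z * \<pi> = Z then F x (Z * \<iota>) * F (\<pi> * X) z else 0 else 0)"
      by (intro sum.cong refl) auto
    also have "\<dots> = F x (z * \<pi> * \<iota>) * F (\<pi> * (\<iota> * x)) z"
      using x \<iota> \<pi> by (subst sum.delta', simp, subst sum.delta') auto
    also have "\<dots> = F x (z * (\<pi> * \<iota>)) * F (\<pi> * \<iota> * x) z"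
      using assoc_mult_mat[OF x(2) \<pi> \<iota>] assoc_mult_mat[OF \<pi> \<iota> x(1)] by simp
    finally show "(\<Sum>X\<in>carrier_mat (Suc n) m. \<Sum>Z\<in>carrier_mat m' (Suc n).
        if \<iota> * x = X \<and> z * \<pi> = Z then F x (Z * \<iota>) * F (\<pi> * X) z else 0)
      = F x (z * (\<pi> * \<iota>)) * F (\<pi> * \<iota> * x) z" .
  qed
  finally show ?thesis unfolding twist_def .
qed

text \<open>Translating the covectors by multiples of \<open>\<theta>\<close> is invisible on the
  first hyperplane and moves the restriction to the second one along
  \<open>\<theta> * \<iota>'\<close>. Vectors in both supports lie in both hyperplanes, so they are
  killed by \<open>\<theta>\<close>, and the second factor sums to zero.\<close>

lemma inner2_ext_row_eq_0:
  assumes \<iota>: "\<iota> \<in> carrier_mat (Suc n) n" "\<iota>' \<in> carrier_mat (Suc n) n"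
    and \<theta>: "\<theta> \<in> carrier_mat 1 (Suc n)" "\<theta> * \<iota> = 0\<^sub>m 1 n" "\<theta> * \<iota>' \<noteq> 0\<^sub>m 1 n"
  shows "inner2 (ext_row \<iota>) (ext_row \<iota>') = 0"
proof -
  have "(\<Sum>z\<in>carrier_mat m' (Suc n). F x (z * \<iota>) * F x' (z * \<iota>')) = 0"
    if x: "x \<in> carrier_mat n m" "x' \<in> carrier_mat n m" and eq: "\<iota> * x = \<iota>' * x'" for x x'
  proof (rule sum_translate_eq_0[where s = "\<lambda>z y. z + y * \<theta>" and Y = "carrier_mat m' 1"])
    fix y :: "'k mat" assume "y \<in> carrier_mat m' 1"
    then show "bij_betw (\<lambda>z. z + y * \<theta>) (carrier_mat m' (Suc n)) (carrier_mat m' (Suc n))"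
      using \<theta> by (intro bij_betw_add_mat) auto
  next
    fix z :: "'k mat" assume z: "z \<in> carrier_mat m' (Suc n)"
    have dist: "(z + y * \<theta>) * \<kappa> = z * \<kappa> + y * (\<theta> * \<kappa>)"
      if "y \<in> carrier_mat m' 1" "\<kappa> \<in> carrier_mat (Suc n) n" for y \<kappa>
      using that \<theta>(1) z add_mult_distrib_mat[of z m' "Suc n" "y * \<theta>" \<kappa> n]
        assoc_mult_mat[of y m' 1 \<theta> "Suc n" \<kappa> n] by simp
    have eq1: "(z + y * \<theta>) * \<iota> = z * \<iota>" if y: "y \<in> carrier_mat m' 1" for y
      using dist[OF y \<iota>(1)] y z \<iota>(1) \<theta>(2) by (auto intro!: eq_matI)
    have "(\<theta> * \<iota>') * x' = (\<theta> * \<iota>) * x"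
      using assoc_mult_mat[OF \<theta>(1) \<iota>(1) x(1)] assoc_mult_mat[OF \<theta>(1) \<iota>(2) x(2)] eq by simp
    then have "(\<theta> * \<iota>') * x' = 0\<^sub>m 1 m" using \<theta>(2) x by simp
    then have "(\<Sum>y\<in>carrier_mat m' 1. F x' (z * \<iota>' + y * (\<theta> * \<iota>'))) = 0"
      using \<theta> \<iota> x z by (intro sum_hyperplane) auto
    then show "(\<Sum>y\<in>carrier_mat m' 1. F x ((z + y * \<theta>) * \<iota>) * F x' ((z + y * \<theta>) * \<iota>')) = 0"
      using eq1 dist[OF _ \<iota>(2)] by (simp flip: sum_distrib_left)
  qed (use zero_in_carrier_mat in auto)
  then show ?thesis
    unfolding inner2_ext_row[OF \<iota>] by (intro sum.neutral ballI) simp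
qed

text \<open>By the splitting, \<open>z\<close> is determined by its restriction
  \<open>z * \<iota>\<close> and its values \<open>z * \<rho>\<close> on the complement; the latter
  take at most q^m' values.\<close>

lemma inner2_ext_row_le:
  assumes \<iota>: "\<iota> \<in> carrier_mat (Suc n) n" and \<tau>: "\<tau> \<in> carrier_mat n (Suc n)"
    and \<rho>: "\<rho> \<in> carrier_mat (Suc n) 1" and \<theta>: "\<theta> \<in> carrier_mat 1 (Suc n)"
    and \<tau>\<iota>: "\<tau> * \<iota> = 1\<^sub>m n" and id: "\<iota> * \<tau> + \<rho> * \<theta> = 1\<^sub>m (Suc n)"
  shows "inner2 (ext_row \<iota>) (ext_row \<iota>) \<le> real CARD('k) ^ m' * norm2"
proof -
  have inj: "x = x'" if "\<iota> * x = \<iota> * x'" "x \<in> carrier_mat n m" "x' \<in> carrier_mat n m" for x x'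
    using assoc_mult_mat[OF \<tau> \<iota> that(2)] assoc_mult_mat[OF \<tau> \<iota> that(3)] that \<tau>\<iota> by simp
  have "inner2 (ext_row \<iota>) (ext_row \<iota>) =
      (\<Sum>x\<in>carrier_mat n m. \<Sum>z\<in>carrier_mat m' (Suc n). (F x (z * \<iota>))\<^sup>2)"
    unfolding inner2_ext_row[OF \<iota> \<iota>]
  proof (rule sum.cong[OF refl])
    fix x :: "'k mat" assume x: "x \<in> carrier_mat n m"
    have "(\<Sum>x'\<in>carrier_mat n m.
        if \<iota> * x = \<iota> * x' then \<Sum>z\<in>carrier_mat m' (Suc n). F x (z * \<iota>) * F x' (z * \<iota>) else 0) =
      (\<Sum>x'\<in>carrier_mat n m.
        if x = x' then \<Sum>z\<in>carrier_mat m' (Suc n). F x (z * \<iota>) * F x' (z * \<iota>) else 0)"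
      using inj x by (intro sum.cong refl) auto
    also have "\<dots> = (\<Sum>z\<in>carrier_mat m' (Suc n). (F x (z * \<iota>))\<^sup>2)"
      using x by (subst sum.delta') (auto simp: power2_eq_square)
    finally show "(\<Sum>x'\<in>carrier_mat n m.
        if \<iota> * x = \<iota> * x' then \<Sum>z\<in>carrier_mat m' (Suc n). F x (z * \<iota>) * F x' (z * \<iota>) else 0) =
      (\<Sum>z\<in>carrier_mat m' (Suc n). (F x (z * \<iota>))\<^sup>2)" .
  qed
  also have "\<dots> \<le> (\<Sum>x\<in>carrier_mat n m. real CARD('k) ^ m' * (\<Sum>z\<in>carrier_mat m' n. (F x z)\<^sup>2))"
  proof (intro sum_mono)
    fix x :: "'k mat" assume x: "x \<in> carrier_mat n m"
    let ?j = "\<lambda>z. (z * \<iota>, z * \<rho>)"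
    have recover: "z = (z * \<iota>) * \<tau> + (z * \<rho>) * \<theta>" if "z \<in> carrier_mat m' (Suc n)" for z
      by (rule mat_split_right[OF \<iota> \<tau> \<rho> \<theta> id that])
    have inj: "inj_on ?j (carrier_mat m' (Suc n))"
      by (intro inj_onI) (metis recover prod.inject)
    have "(\<Sum>z\<in>carrier_mat m' (Suc n). (F x (z * \<iota>))\<^sup>2) =
        (\<Sum>(z, y)\<in>?j ` carrier_mat m' (Suc n). (F x z)\<^sup>2)"
      by (simp add: sum.reindex[OF inj])
    also have "\<dots> \<le> (\<Sum>(z, y)\<in>carrier_mat m' n \<times> (carrier_mat m' 1 :: 'k mat set). (F x z)\<^sup>2)"
      using \<iota> \<rho> by (intro sum_mono2) auto
    also have "\<dots> = real CARD('k) ^ m' * (\<Sum>z\<in>carrier_mat m' n. (F x z)\<^sup>2)"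
      by (simp add: sum.cartesian_product[symmetric] card_carrier_mat sum_distrib_left)
    finally show "(\<Sum>z\<in>carrier_mat m' (Suc n). (F x (z * \<iota>))\<^sup>2)
      \<le> real CARD('k) ^ m' * (\<Sum>z\<in>carrier_mat m' n. (F x z)\<^sup>2)" .
  qed
  also have "\<dots> = real CARD('k) ^ m' * norm2"
    by (simp add: norm2_def sum_distrib_left)
  finally show ?thesis .
qed

end

section \<open>Duality between vectors and covectors\<close>

lemma transpose_swap_iff: "transpose_mat A = B \<longleftrightarrow> A = transpose_mat B"
  by (metis Matrix.transpose_transpose)

lemma sum_carrier_mat_transpose:
  "(\<Sum>A\<in>carrier_mat n m. f (transpose_mat A)) = (\<Sum>A\<in>carrier_mat m n. f A)"
  by (rule sum.reindex_bij_witness[where i = transpose_mat and j = transpose_mat]) auto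

context invariant_matrix_function
begin

text \<open>Transposition exchanges lines with hyperplanes, so each statement on
  \<open>ext_row\<close> yields one on \<open>ext_col\<close> with \<open>m\<close> and
  \<open>m'\<close> exchanged.\<close>

lemma dual: "invariant_matrix_function n m' m (\<lambda>x z. F (transpose_mat z) (transpose_mat x))"
proof
  fix h h' x z :: "'k mat"
  assume h: "h \<in> carrier_mat n n" "h' \<in> carrier_mat n n" "h * h' = 1\<^sub>m n" "h' * h = 1\<^sub>m n"
    and x: "x \<in> carrier_mat n m'" "z \<in> carrier_mat m n"
  have "transpose_mat h * transpose_mat h' = 1\<^sub>m n" "transpose_mat h' * transpose_mat h = 1\<^sub>m n"
    using transpose_mult[OF h(2,1), symmetric] transpose_mult[OF h(1,2), symmetric]
    by (simp_all add: h(3,4) del: transpose_mult)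
  then have "F (transpose_mat h * transpose_mat z) (transpose_mat x) =
      F (transpose_mat z) (transpose_mat x * transpose_mat h)"
    using h x by (intro F_invariant) auto
  then show "F (transpose_mat z) (transpose_mat (h * x)) = F (transpose_mat (z * h)) (transpose_mat x)"
    using transpose_mult[OF h(1) x(1)] transpose_mult[OF x(2) h(1)] by simp
next
  fix p x z :: "'k mat"
  assume p: "p \<in> carrier_mat n 1" "p \<noteq> 0\<^sub>m n 1" and x: "x \<in> carrier_mat n m'" and z: "z \<in> carrier_mat m n"
    and zp: "z * p = 0\<^sub>m m 1"
  have "transpose_mat p * transpose_mat z = 0\<^sub>m 1 m"
    using transpose_mult[OF z p(1)] zp by simp
  moreover have "transpose_mat p \<noteq> 0\<^sub>m 1 n" using p by (simp add: transpose_swap_iff)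
  ultimately have "(\<Sum>y\<in>carrier_mat m' 1. F (transpose_mat z) (transpose_mat x + y * transpose_mat p)) = 0"
    using p x z by (intro sum_hyperplane) auto
  also have "(\<Sum>y\<in>carrier_mat m' 1. F (transpose_mat z) (transpose_mat x + y * transpose_mat p)) =
    (\<Sum>y\<in>carrier_mat 1 m'. F (transpose_mat z) (transpose_mat x + transpose_mat y * transpose_mat p))"
    by (rule sum_carrier_mat_transpose[symmetric])
  also have "\<dots> = (\<Sum>y\<in>carrier_mat 1 m'. F (transpose_mat z) (transpose_mat (x + p * y)))"
    using p x by (intro sum.cong refl) (simp add: transpose_add[of _ n m'] transpose_mult[of p n 1])
  finally show "(\<Sum>y\<in>carrier_mat 1 m'. F (transpose_mat z) (transpose_mat (x + p * y))) = 0" .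
next
  fix p x z :: "'k mat"
  assume p: "p \<in> carrier_mat 1 n" "p \<noteq> 0\<^sub>m 1 n" and x: "x \<in> carrier_mat n m'" and z: "z \<in> carrier_mat m n"
    and px: "p * x = 0\<^sub>m 1 m'"
  have "transpose_mat x * transpose_mat p = 0\<^sub>m m' 1"
    using transpose_mult[OF p(1) x] px by simp
  moreover have "transpose_mat p \<noteq> 0\<^sub>m n 1" using p by (simp add: transpose_swap_iff)
  ultimately have "(\<Sum>y\<in>carrier_mat 1 m. F (transpose_mat z + transpose_mat p * y) (transpose_mat x)) = 0"
    using p x z by (intro sum_line) auto
  also have "(\<Sum>y\<in>carrier_mat 1 m. F (transpose_mat z + transpose_mat p * y) (transpose_mat x)) =
    (\<Sum>y\<in>carrier_mat m 1. F (transpose_mat z + transpose_mat p * transpose_mat y) (transpose_mat x))"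
    by (rule sum_carrier_mat_transpose[symmetric])
  also have "\<dots> = (\<Sum>y\<in>carrier_mat m 1. F (transpose_mat (z + y * p)) (transpose_mat x))"
    using p z by (intro sum.cong refl) (simp add: transpose_add[of _ m n] transpose_mult[of _ m 1 p])
  finally show "(\<Sum>y\<in>carrier_mat m 1. F (transpose_mat (z + y * p)) (transpose_mat x)) = 0" .
qed

interpretation D: invariant_matrix_function n m' m "\<lambda>x z. F (transpose_mat z) (transpose_mat x)"
  by (rule dual)

lemma dual_norm2: "D.norm2 = norm2"
  unfolding D.norm2_def norm2_def
    by (subst sum_carrier_mat_transpose[where f = "\<lambda>x. \<Sum>z\<in>carrier_mat m n. (F (transpose_mat z) x)\<^sup>2"],
      subst sum.swap, rule sum_carrier_mat_transpose)

lemma dual_ext_row: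
  assumes "\<pi> \<in> carrier_mat n (Suc n)" "x \<in> carrier_mat (Suc n) m'" "z \<in> carrier_mat m (Suc n)"
  shows "D.ext_row (transpose_mat \<pi>) x z = ext_col \<pi> (transpose_mat z) (transpose_mat x)"
proof -
  have "D.ext_row (transpose_mat \<pi>) x z =
    (\<Sum>y\<in>carrier_mat n m'. if transpose_mat y * \<pi> = transpose_mat x
       then F (\<pi> * transpose_mat z) (transpose_mat y) else 0)"
    unfolding D.ext_row_def
  proof (intro sum.cong refl)
    fix y :: "'k mat" assume y: "y \<in> carrier_mat n m'"
    have "transpose_mat \<pi> * y = transpose_mat (transpose_mat y * \<pi>)"
      using y assms by (simp add: transpose_mult[of _ m' n])
    moreover have "transpose_mat (z * transpose_mat \<pi>) = \<pi> * transpose_mat z"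
      using assms by (simp add: transpose_mult[of z m "Suc n"])
    ultimately show "(if transpose_mat \<pi> * y = x then F (transpose_mat (z * transpose_mat \<pi>)) (transpose_mat y) else 0) =
      (if transpose_mat y * \<pi> = transpose_mat x then F (\<pi> * transpose_mat z) (transpose_mat y) else 0)"
      by (simp add: transpose_swap_iff)
  qed
  also have "\<dots> = ext_col \<pi> (transpose_mat z) (transpose_mat x)"
    unfolding ext_col_def
    by (rule sum_carrier_mat_transpose)
  finally show ?thesis .
qed

lemma dual_inner2:
  assumes "\<pi> \<in> carrier_mat n (Suc n)" "\<pi>' \<in> carrier_mat n (Suc n)"
  shows "D.inner2 (D.ext_row (transpose_mat \<pi>)) (D.ext_row (transpose_mat \<pi>')) = inner2 (ext_col \<pi>) (ext_col \<pi>')"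
proof -
  have "D.inner2 (D.ext_row (transpose_mat \<pi>)) (D.ext_row (transpose_mat \<pi>')) =
    (\<Sum>x\<in>carrier_mat (Suc n) m'. \<Sum>z\<in>carrier_mat m (Suc n).
      ext_col \<pi> (transpose_mat z) (transpose_mat x) * ext_col \<pi>' (transpose_mat z) (transpose_mat x))"
    using assms by (intro sum.cong refl) (simp add: dual_ext_row)
  also have "\<dots> = inner2 (ext_col \<pi>) (ext_col \<pi>')"
    by (subst sum_carrier_mat_transpose[where f = "\<lambda>x. \<Sum>z\<in>carrier_mat m (Suc n).
          ext_col \<pi> (transpose_mat z) x * ext_col \<pi>' (transpose_mat z) x"], subst sum.swap,
        rule sum_carrier_mat_transpose)
  finally show ?thesis .
qed

lemma inner2_ext_col_eq_0:
  assumes \<pi>: "\<pi> \<in> carrier_mat n (Suc n)" "\<pi>' \<in> carrier_mat n (Suc n)"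
    and u: "u \<in> carrier_mat (Suc n) 1" "\<pi> * u = 0\<^sub>m n 1" "\<pi>' * u \<noteq> 0\<^sub>m n 1"
  shows "inner2 (ext_col \<pi>) (ext_col \<pi>') = 0"
  unfolding dual_inner2[OF \<pi>, symmetric]
  by (rule D.inner2_ext_row_eq_0[where \<theta> = "transpose_mat u"])
     (use assms in \<open>auto simp: transpose_swap_iff simp flip: transpose_mult[OF \<pi>(1) u(1)] transpose_mult[OF \<pi>(2) u(1)]\<close>)

lemma inner2_ext_col_le:
  assumes \<pi>: "\<pi> \<in> carrier_mat n (Suc n)" and \<sigma>: "\<sigma> \<in> carrier_mat (Suc n) n"
    and \<kappa>: "\<kappa> \<in> carrier_mat 1 (Suc n)" and u: "u \<in> carrier_mat (Suc n) 1"
    and \<pi>\<sigma>: "\<pi> * \<sigma> = 1\<^sub>m n" and id: "\<sigma> * \<pi> + u * \<kappa> = 1\<^sub>m (Suc n)"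
  shows "inner2 (ext_col \<pi>) (ext_col \<pi>) \<le> real CARD('k) ^ m * norm2"
  unfolding dual_inner2[OF \<pi> \<pi>, symmetric] dual_norm2[symmetric]
proof (rule D.inner2_ext_row_le[where \<tau> = "transpose_mat \<sigma>" and \<rho> = "transpose_mat \<kappa>" and \<theta> = "transpose_mat u"])
  show "transpose_mat \<sigma> * transpose_mat \<pi> = 1\<^sub>m n"
    using transpose_mult[OF \<pi> \<sigma>] \<pi>\<sigma> by simp
  have "1\<^sub>m (Suc n) = transpose_mat (\<sigma> * \<pi> + u * \<kappa>)" by (simp add: id)
  also have "\<dots> = transpose_mat (\<sigma> * \<pi>) + transpose_mat (u * \<kappa>)"
    using assms by (intro transpose_add) auto
  also have "\<dots> = transpose_mat \<pi> * transpose_mat \<sigma> + transpose_mat \<kappa> * transpose_mat u"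
    unfolding transpose_mult[OF \<sigma> \<pi>] transpose_mult[OF u \<kappa>] ..
  finally show "transpose_mat \<pi> * transpose_mat \<sigma> + transpose_mat \<kappa> * transpose_mat u = 1\<^sub>m (Suc n)" ..
qed (use assms in auto)

text \<open>Hyperplanes are indexed by all nonzero covectors and lines by all nonzero vectors, not
  up to scalars. The resulting factor q - 1 occurs squared on both sides of Cauchy-Schwarz and
  cancels, as do the number of indices and \<open>norm2\<close>.\<close>

theorem twice_size_le:
  assumes "x \<in> carrier_mat n m" "z \<in> carrier_mat m' n" "F x z \<noteq> 0"
  shows "2 * n \<le> m + m'"
proof -
  let ?q = "real CARD('k)"
  define \<Theta> :: "'k mat set" where "\<Theta> = carrier_mat 1 (Suc n) - {0\<^sub>m 1 (Suc n)}"
  define U :: "'k mat set" where "U = carrier_mat (Suc n) 1 - {0\<^sub>m (Suc n) 1}"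
  define X :: "'k mat set" where "X = carrier_mat (Suc n) m"
  define Z :: "'k mat set" where "Z = carrier_mat m' (Suc n)"
  have "card {0, 1 :: 'k} \<le> CARD('k)" by (rule card_mono) auto
  then have q': "CARD('k) > 1" by simp
  then have q: "?q > 1" by simp
  have fin: "finite \<Theta>" "finite U" by (simp_all add: \<Theta>_def U_def)
  have norm: "norm2 > 0"
  proof -
    have "0 < (F x z)\<^sup>2" using assms by simp
    also have "\<dots> \<le> (\<Sum>z\<in>carrier_mat m' n. (F x z)\<^sup>2)"
      using assms by (intro member_le_sum) auto
    also have "\<dots> \<le> norm2"
      unfolding norm2_def using assms
      by (intro member_le_sum[where f = "\<lambda>x. \<Sum>z\<in>carrier_mat m' n. (F x z)\<^sup>2"]) (auto intro: sum_nonneg)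
    finally show ?thesis .
  qed
  define row_frame where "row_frame \<theta> \<iota> \<tau> \<rho> \<longleftrightarrow> \<iota> \<in> carrier_mat (Suc n) n \<and> \<tau> \<in> carrier_mat n (Suc n) \<and>
      \<rho> \<in> carrier_mat (Suc n) 1 \<and> \<tau> * \<iota> = 1\<^sub>m n \<and> \<theta> * \<iota> = 0\<^sub>m 1 n \<and> \<iota> * \<tau> + \<rho> * \<theta> = 1\<^sub>m (Suc n)"
    for \<theta> \<iota> \<tau> \<rho> :: "'k mat"
  define col_frame where "col_frame u \<pi> \<sigma> \<kappa> \<longleftrightarrow> \<pi> \<in> carrier_mat n (Suc n) \<and> \<sigma> \<in> carrier_mat (Suc n) n \<and>
      \<kappa> \<in> carrier_mat 1 (Suc n) \<and> \<pi> * \<sigma> = 1\<^sub>m n \<and> \<pi> * u = 0\<^sub>m n 1 \<and> \<sigma> * \<pi> + u * \<kappa> = 1\<^sub>m (Suc n)"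
    for u \<pi> \<sigma> \<kappa> :: "'k mat"
  have row_frameD: "\<iota> \<in> carrier_mat (Suc n) n" "\<tau> \<in> carrier_mat n (Suc n)" "\<rho> \<in> carrier_mat (Suc n) 1"
      "\<tau> * \<iota> = 1\<^sub>m n" "\<theta> * \<iota> = 0\<^sub>m 1 n" "\<iota> * \<tau> + \<rho> * \<theta> = 1\<^sub>m (Suc n)"
    if "row_frame \<theta> \<iota> \<tau> \<rho>" for \<theta> \<iota> \<tau> \<rho>
    using that unfolding row_frame_def by blast+
  have col_frameD: "\<pi> \<in> carrier_mat n (Suc n)" "\<sigma> \<in> carrier_mat (Suc n) n" "\<kappa> \<in> carrier_mat 1 (Suc n)"
      "\<pi> * \<sigma> = 1\<^sub>m n" "\<pi> * u = 0\<^sub>m n 1" "\<sigma> * \<pi> + u * \<kappa> = 1\<^sub>m (Suc n)"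
    if "col_frame u \<pi> \<sigma> \<kappa>" for u \<pi> \<sigma> \<kappa>
    using that unfolding col_frame_def by blast+
  have "\<exists>\<iota> \<tau> \<rho>. row_frame \<theta> \<iota> \<tau> \<rho>" if "\<theta> \<in> \<Theta>" for \<theta>
    using hyperplane_frame[of \<theta> n] that unfolding \<Theta>_def row_frame_def by (metis DiffD1 DiffD2 singletonI)
  then obtain \<iota> \<tau> \<rho> where row: "\<And>\<theta>. \<theta> \<in> \<Theta> \<Longrightarrow> row_frame \<theta> (\<iota> \<theta>) (\<tau> \<theta>) (\<rho> \<theta>)"
    by metis
  have "\<exists>\<pi> \<sigma> \<kappa>. col_frame u \<pi> \<sigma> \<kappa>" if u: "u \<in> U" for u
  proof -
    \<comment> \<open>A projection with kernel spanned by \<open>u\<close> is the transpose of a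
      hyperplane embedding for the covector u^T.\<close>
    have "transpose_mat u \<in> \<Theta>" using u by (simp add: U_def \<Theta>_def transpose_swap_iff)
    then have "row_frame (transpose_mat u) (\<iota> (transpose_mat u)) (\<tau> (transpose_mat u)) (\<rho> (transpose_mat u))"
      by (rule row)
    then obtain i t r where f: "i \<in> carrier_mat (Suc n) n" "t \<in> carrier_mat n (Suc n)" "r \<in> carrier_mat (Suc n) 1"
      "t * i = 1\<^sub>m n" "transpose_mat u * i = 0\<^sub>m 1 n" "i * t + r * transpose_mat u = 1\<^sub>m (Suc n)"
      unfolding row_frame_def by blast
    have u': "u \<in> carrier_mat (Suc n) 1" using u by (simp add: U_def)
    have "transpose_mat i * u = 0\<^sub>m n 1"
      using transpose_mult[of "transpose_mat u" 1 "Suc n" i n] u' f by simp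
    moreover have "transpose_mat i * transpose_mat t = 1\<^sub>m n"
      using transpose_mult[OF f(2,1)] f(4) by simp
    moreover have "transpose_mat t * transpose_mat i + u * transpose_mat r = 1\<^sub>m (Suc n)"
    proof -
      have "1\<^sub>m (Suc n) = transpose_mat (i * t + r * transpose_mat u)" by (simp add: f)
      also have "\<dots> = transpose_mat (i * t) + transpose_mat (r * transpose_mat u)"
        using f u' by (intro transpose_add) auto
      also have "\<dots> = transpose_mat t * transpose_mat i + u * transpose_mat r"
        using transpose_mult[OF f(1,2)] transpose_mult[of r "Suc n" 1 "transpose_mat u" "Suc n"] f u' by simp
      finally show ?thesis ..
    qed
    ultimately have "col_frame u (transpose_mat i) (transpose_mat t) (transpose_mat r)"
      using f u' unfolding col_frame_def by simp
    then show ?thesis by blast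
  qed
  then obtain \<pi> \<sigma> \<kappa> where col: "\<And>u. u \<in> U \<Longrightarrow> col_frame u (\<pi> u) (\<sigma> u) (\<kappa> u)"
    by metis
  define e where "e x z = (\<Sum>\<theta>\<in>\<Theta>. ext_row (\<iota> \<theta>) x z)" for x z
  define f where "f x z = (\<Sum>u\<in>U. ext_col (\<pi> u) x z)" for x z
  \<comment> \<open>Proportional covectors define the same hyperplane, but the choice may have given
    them different frames. Their extensions are therefore not identified; it suffices to bound the
    inner product by the common bound on the norms.\<close>
  have amgm: "inner2 a b \<le> C" if "inner2 a a \<le> C" "inner2 b b \<le> C" for a b C
  proof -
    have "2 * inner2 a b \<le> inner2 a a + inner2 b b"
      unfolding sum_distrib_left sum.distrib[symmetric]
    proof (intro sum_mono)
      fix x z show "2 * (a x z * b x z) \<le> a x z * a x z + b x z * b x z"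
        using sum_squares_bound[of "a x z" "b x z"] by (simp add: power2_eq_square)
    qed
    with that show ?thesis by linarith
  qed
  have bilinear: "inner2 (\<lambda>x z. \<Sum>i\<in>I. a i x z) (\<lambda>x z. \<Sum>j\<in>J. b j x z) = (\<Sum>i\<in>I. \<Sum>j\<in>J. inner2 (a i) (b j))"
    for a b and I J :: "'k mat set"
  proof -
    let ?A = "carrier_mat (Suc n) m \<times> carrier_mat m' (Suc n)"
    have prod: "inner2 f g = (\<Sum>p\<in>?A. f (fst p) (snd p) * g (fst p) (snd p))" for f g
      by (simp add: sum.cartesian_product split_def)
    show ?thesis
      unfolding prod unfolding sum_product
      by (subst sum.swap, rule sum.cong[OF refl], rule sum.swap)
  qed
  have card_scalars: "card {c :: 'k. c \<noteq> 0} = CARD('k) - 1"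
  proof -
    have "{c :: 'k. c \<noteq> 0} = UNIV - {0}" by auto
    then show ?thesis by (simp add: card_Diff_singleton)
  qed
  have card_le: "real (card {w \<in> W. \<exists>c. c \<noteq> 0 \<and> w = c \<cdot>\<^sub>m w0}) \<le> ?q - 1" for W and w0 :: "'k mat"
  proof -
    have "{w \<in> W. \<exists>c. c \<noteq> 0 \<and> w = c \<cdot>\<^sub>m w0} \<subseteq> (\<lambda>c. c \<cdot>\<^sub>m w0) ` {c. c \<noteq> 0}" by auto
    then have "card {w \<in> W. \<exists>c. c \<noteq> 0 \<and> w = c \<cdot>\<^sub>m w0} \<le> CARD('k) - 1"
      unfolding card_scalars[symmetric] by (intro surj_card_le) auto
    then show ?thesis using q by linarith
  qed
  \<comment> \<open>For fixed \<open>i\<close> only the at most q - 1 nonzero multiples of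
    \<open>i\<close> contribute.\<close>
  have sum_le: "(\<Sum>i\<in>I. \<Sum>j\<in>I. inner2 (a i) (a j)) \<le> real (card I) * ((?q - 1) * C)"
    if I: "finite I" and C: "C \<ge> 0" and orth: "\<And>i j. i \<in> I \<Longrightarrow> j \<in> I \<Longrightarrow> \<not> (\<exists>c. c \<noteq> 0 \<and> j = c \<cdot>\<^sub>m i) \<Longrightarrow> inner2 (a i) (a j) = 0"
      and le: "\<And>i. i \<in> I \<Longrightarrow> inner2 (a i) (a i) \<le> C" for I :: "'k mat set" and a C
  proof -
    have "(\<Sum>j\<in>I. inner2 (a i) (a j)) \<le> (?q - 1) * C" if i: "i \<in> I" for i
    proof -
      have "(\<Sum>j\<in>I. inner2 (a i) (a j)) = (\<Sum>j\<in>{j \<in> I. \<exists>c. c \<noteq> 0 \<and> j = c \<cdot>\<^sub>m i}. inner2 (a i) (a j))"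
        using I i orth by (intro sum.mono_neutral_right) auto
      also have "\<dots> \<le> (\<Sum>j\<in>{j \<in> I. \<exists>c. c \<noteq> 0 \<and> j = c \<cdot>\<^sub>m i}. C)"
        by (rule sum_mono, rule amgm) (use i le in auto)
      also have "\<dots> \<le> (?q - 1) * C"
        using card_le[of I i] C by (simp add: mult_right_mono)
      finally show ?thesis .
    qed
    then have "(\<Sum>i\<in>I. \<Sum>j\<in>I. inner2 (a i) (a j)) \<le> (\<Sum>i\<in>I. (?q - 1) * C)"
      by (rule sum_mono)
    then show ?thesis by simp
  qed
  have ee: "inner2 e e \<le> real (card \<Theta>) * ((?q - 1) * (?q ^ m' * norm2))"
    unfolding e_def bilinear
  proof (rule sum_le[OF fin(1)])
    fix \<theta> \<theta>' assume \<theta>: "\<theta> \<in> \<Theta>" "\<theta>' \<in> \<Theta>" and np: "\<not> (\<exists>c. c \<noteq> 0 \<and> \<theta>' = c \<cdot>\<^sub>m \<theta>)"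
    note r = row_frameD[OF row[OF \<theta>(1)]] and r' = row_frameD[OF row[OF \<theta>(2)]]
    have c: "\<theta>' \<in> carrier_mat 1 (Suc n)" "\<theta> \<in> carrier_mat 1 (Suc n)" using \<theta> by (simp_all add: \<Theta>_def)
    \<comment> \<open>A covector vanishing on the hyperplane of \<open>\<theta>\<close> is a
      multiple of \<open>\<theta>\<close>, by the splitting.\<close>
    have "\<theta>' * \<iota> \<theta> \<noteq> 0\<^sub>m 1 n"
    proof
      assume 0: "\<theta>' * \<iota> \<theta> = 0\<^sub>m 1 n"
      have "\<theta>' = \<theta>' * \<iota> \<theta> * \<tau> \<theta> + \<theta>' * \<rho> \<theta> * \<theta>"
        by (rule mat_split_right[OF r(1,2,3) c(2) r(6) c(1)])
      also have "\<dots> = (\<theta>' * \<rho> \<theta>) $$ (0, 0) \<cdot>\<^sub>m \<theta>"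
      proof -
        have "\<theta>' * \<rho> \<theta> \<in> carrier_mat 1 1" using r c by simp
        then show ?thesis using mult_mat_1_1(1)[OF _ c(2)] r c unfolding 0 by simp
      qed
      finally have eq: "\<theta>' = (\<theta>' * \<rho> \<theta>) $$ (0, 0) \<cdot>\<^sub>m \<theta>" .
      have "(\<theta>' * \<rho> \<theta>) $$ (0, 0) \<noteq> 0"
      proof
        assume "(\<theta>' * \<rho> \<theta>) $$ (0, 0) = 0"
        then have "\<theta>' = 0\<^sub>m 1 (Suc n)" using eq c by (auto simp: mat_eq_iff)
        then show False using \<theta> by (simp add: \<Theta>_def)
      qed
      with eq np show False by blast
    qed
    then show "inner2 (ext_row (\<iota> \<theta>)) (ext_row (\<iota> \<theta>')) = 0"
      using inner2_ext_row_eq_0[of "\<iota> \<theta>'" "\<iota> \<theta>" \<theta>'] r r' c by (simp add: mult.commute)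
  next
    fix \<theta> assume \<theta>: "\<theta> \<in> \<Theta>"
    then show "inner2 (ext_row (\<iota> \<theta>)) (ext_row (\<iota> \<theta>)) \<le> ?q ^ m' * norm2"
      using row[OF \<theta>] unfolding row_frame_def \<Theta>_def
      by (intro inner2_ext_row_le[of _ "\<tau> \<theta>" "\<rho> \<theta>" \<theta>]) auto
  qed (use norm in simp)
  have ff: "inner2 f f \<le> real (card U) * ((?q - 1) * (?q ^ m * norm2))"
    unfolding f_def bilinear
  proof (rule sum_le[OF fin(2)])
    fix u u' assume u: "u \<in> U" "u' \<in> U" and np: "\<not> (\<exists>c. c \<noteq> 0 \<and> u' = c \<cdot>\<^sub>m u)"
    note r = col_frameD[OF col[OF u(1)]] and r' = col_frameD[OF col[OF u(2)]]
    have c: "u' \<in> carrier_mat (Suc n) 1" "u \<in> carrier_mat (Suc n) 1" using u by (simp_all add: U_def)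
    have "\<pi> u * u' \<noteq> 0\<^sub>m n 1"
    proof
      assume 0: "\<pi> u * u' = 0\<^sub>m n 1"
      have "u' = \<sigma> u * (\<pi> u * u') + u * (\<kappa> u * u')"
        by (rule mat_split_left[OF r(2,1) c(2) r(3) r(6) c(1)])
      also have "\<dots> = (\<kappa> u * u') $$ (0, 0) \<cdot>\<^sub>m u"
      proof -
        have "\<kappa> u * u' \<in> carrier_mat 1 1" using r c by simp
        then show ?thesis using mult_mat_1_1(2)[OF _ c(2)] r c unfolding 0 by simp
      qed
      finally have eq: "u' = (\<kappa> u * u') $$ (0, 0) \<cdot>\<^sub>m u" .
      have "(\<kappa> u * u') $$ (0, 0) \<noteq> 0"
      proof
        assume "(\<kappa> u * u') $$ (0, 0) = 0"
        then have "u' = 0\<^sub>m (Suc n) 1" using eq c by (auto simp: mat_eq_iff)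
        then show False using u by (simp add: U_def)
      qed
      with eq np show False by blast
    qed
    then show "inner2 (ext_col (\<pi> u)) (ext_col (\<pi> u')) = 0"
      using inner2_ext_col_eq_0[of "\<pi> u'" "\<pi> u" u'] r r' c by (simp add: mult.commute)
  next
    fix u assume u: "u \<in> U"
    then show "inner2 (ext_col (\<pi> u)) (ext_col (\<pi> u)) \<le> ?q ^ m * norm2"
      using col[OF u] unfolding col_frame_def U_def
      by (intro inner2_ext_col_le[of _ "\<sigma> u" "\<kappa> u" u]) auto
  qed (use norm in simp)
  have inner_ef: "inner2 (ext_row (\<iota> \<theta>)) (ext_col (\<pi> u)) \<ge> (if \<theta> * u \<noteq> 0\<^sub>m 1 1 then norm2 else 0)"
    if \<theta>: "\<theta> \<in> \<Theta>" and u: "u \<in> U" for \<theta> u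
  proof -
    note r = row_frameD[OF row[OF \<theta>]] and r' = col_frameD[OF col[OF u]]
    have c: "\<theta> \<in> carrier_mat 1 (Suc n)" "u \<in> carrier_mat (Suc n) 1" using \<theta> u by (simp_all add: \<Theta>_def U_def)
    have h: "\<pi> u * \<iota> \<theta> \<in> carrier_mat n n" using r r' by auto
    \<comment> \<open>A kernel vector \<open>w\<close> gives \<open>v = \<iota> \<theta> * w\<close>
      both on the line of \<open>u\<close> and in the hyperplane of \<open>\<theta>\<close>. These
      meet in 0 when \<open>\<theta> * u\<close> is not 0, and \<open>\<iota> \<theta>\<close> is
      injective. If \<open>\<theta> * u = 0\<close>, the claim is only that the inner product is
      nonnegative, and it is 0 or \<open>norm2\<close> anyway.\<close>
    have "det (\<pi> u * \<iota> \<theta>) \<noteq> 0" if nz: "\<theta> * u \<noteq> 0\<^sub>m 1 1"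
    proof
      assume "det (\<pi> u * \<iota> \<theta>) = 0"
      then obtain w where w: "w \<in> carrier_mat n 1" "w \<noteq> 0\<^sub>m n 1" "\<pi> u * \<iota> \<theta> * w = 0\<^sub>m n 1"
        using det_0_iff_mat_prod_zero[OF h] by blast
      define v where "v = \<iota> \<theta> * w"
      have v: "v \<in> carrier_mat (Suc n) 1" using r w by (auto simp: v_def)
      have \<pi>v: "\<pi> u * v = 0\<^sub>m n 1"
        using r r' w assoc_mult_mat[of "\<pi> u" n "Suc n" "\<iota> \<theta>" n w 1] by (simp add: v_def)
      have \<theta>v: "\<theta> * v = 0\<^sub>m 1 1"
        using r w c assoc_mult_mat[of \<theta> 1 "Suc n" "\<iota> \<theta>" n w 1] by (simp add: v_def)
      have "v = \<sigma> u * (\<pi> u * v) + u * (\<kappa> u * v)"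
        by (rule mat_split_left[OF r'(2,1) c(2) r'(3) r'(6) v])
      then have vu: "v = u * (\<kappa> u * v)"
        unfolding \<pi>v using r' c v by simp
      have \<kappa>v: "\<kappa> u * v \<in> carrier_mat 1 1" using r' v by simp
      have "\<theta> * v = (\<theta> * u) * (\<kappa> u * v)"
        by (subst vu) (rule assoc_mult_mat[OF c \<kappa>v, symmetric])
      then have "(\<theta> * u) $$ (0, 0) * (\<kappa> u * v) $$ (0, 0) = 0"
        using \<theta>v c \<kappa>v r' v by (auto simp: mat_eq_iff scalar_prod_def)
      moreover have "(\<theta> * u) $$ (0, 0) \<noteq> 0" using nz c by (auto simp: mat_eq_iff)
      ultimately have "\<kappa> u * v = 0\<^sub>m 1 1" using r' v by (auto simp: mat_eq_iff)
      then have "v = 0\<^sub>m (Suc n) 1" using vu c by simp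
      moreover have "w = \<tau> \<theta> * v"
        using r w assoc_mult_mat[of "\<tau> \<theta>" n "Suc n" "\<iota> \<theta>" n w 1] by (simp add: v_def)
      ultimately show False using w r by simp
    qed
    then show ?thesis
      using inner2_ext_row_ext_col[of "\<iota> \<theta>" "\<pi> u"] r r' twist_invertible[OF h] twist_singular[OF h] norm
      by (cases "det (\<pi> u * \<iota> \<theta>) = 0") auto
  qed
  have ef: "inner2 e f \<ge> real (card \<Theta>) * (?q ^ n * (?q - 1) * norm2)"
  proof -
    have "(\<Sum>u\<in>U. inner2 (ext_row (\<iota> \<theta>)) (ext_col (\<pi> u))) \<ge> ?q ^ n * (?q - 1) * norm2" if \<theta>: "\<theta> \<in> \<Theta>" for \<theta>
    proof -
      note r = row_frameD[OF row[OF \<theta>]]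
      have c: "\<theta> \<in> carrier_mat 1 (Suc n)" using \<theta> by (simp add: \<Theta>_def)
      \<comment> \<open>The hyperplane injects into k^n through \<open>\<tau> \<theta>\<close>,
        which leaves at least q^(n+1) - q^n vectors transversal to it.\<close>
      let ?K = "{u \<in> carrier_mat (Suc n) 1. \<theta> * u = 0\<^sub>m 1 1}"
      have "inj_on (\<lambda>u. \<tau> \<theta> * u) ?K"
      proof (rule inj_on_inverseI[where g = "\<lambda>w. \<iota> \<theta> * w"])
        fix u assume "u \<in> ?K"
        then have u: "u \<in> carrier_mat (Suc n) 1" "\<theta> * u = 0\<^sub>m 1 1" by auto
        have "u = \<iota> \<theta> * (\<tau> \<theta> * u) + \<rho> \<theta> * (\<theta> * u)"
          by (rule mat_split_left[OF r(1,2,3) c r(6) u(1)])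
        also have "\<dots> = \<iota> \<theta> * (\<tau> \<theta> * u)" using r u by simp
        finally show "\<iota> \<theta> * (\<tau> \<theta> * u) = u" ..
      qed
      moreover have "(\<lambda>u. \<tau> \<theta> * u) ` ?K \<subseteq> carrier_mat n 1" using r by auto
      ultimately have "card ?K \<le> CARD('k) ^ n"
        using card_inj_on_le[of "\<lambda>u. \<tau> \<theta> * u" ?K "carrier_mat n 1"] by (simp add: card_carrier_mat)
      moreover have "card {u \<in> U. \<theta> * u \<noteq> 0\<^sub>m 1 1} = CARD('k) ^ Suc n - card ?K"
      proof -
        have "{u \<in> U. \<theta> * u \<noteq> 0\<^sub>m 1 1} = carrier_mat (Suc n) 1 - ?K"
          using c by (auto simp: U_def)
        moreover have "card (carrier_mat (Suc n) 1 - ?K :: 'k mat set) = card (carrier_mat (Suc n) 1 :: 'k mat set) - card ?K"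
          by (rule card_Diff_subset) auto
        ultimately show ?thesis by (simp add: card_carrier_mat)
      qed
      ultimately have "CARD('k) ^ Suc n \<le> card {u \<in> U. \<theta> * u \<noteq> 0\<^sub>m 1 1} + CARD('k) ^ n"
        by linarith
      then have "real (CARD('k) ^ Suc n) \<le> real (card {u \<in> U. \<theta> * u \<noteq> 0\<^sub>m 1 1} + CARD('k) ^ n)"
        by (rule of_nat_mono)
      then have "real (card {u \<in> U. \<theta> * u \<noteq> 0\<^sub>m 1 1}) \<ge> ?q ^ Suc n - ?q ^ n"
        by simp
      then have "?q ^ n * (?q - 1) * norm2 \<le> real (card {u \<in> U. \<theta> * u \<noteq> 0\<^sub>m 1 1}) * norm2"
        using norm by (intro mult_right_mono) (simp_all add: algebra_simps)
      also have "\<dots> = (\<Sum>u\<in>U. if \<theta> * u \<noteq> 0\<^sub>m 1 1 then norm2 else 0)"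
        using fin by (simp add: sum.If_cases Int_def)
      also have "\<dots> \<le> (\<Sum>u\<in>U. inner2 (ext_row (\<iota> \<theta>)) (ext_col (\<pi> u)))"
        using \<theta> inner_ef by (intro sum_mono) auto
      finally show ?thesis .
    qed
    then have "(\<Sum>\<theta>\<in>\<Theta>. ?q ^ n * (?q - 1) * norm2) \<le> (\<Sum>\<theta>\<in>\<Theta>. \<Sum>u\<in>U. inner2 (ext_row (\<iota> \<theta>)) (ext_col (\<pi> u)))"
      by (rule sum_mono)
    then show ?thesis unfolding e_def f_def bilinear by simp
  qed
  have cs: "(inner2 e f)\<^sup>2 \<le> inner2 e e * inner2 f f"
    using sum_mult_squared_le[of "\<lambda>p. e (fst p) (snd p)" "\<lambda>p. f (fst p) (snd p)" "carrier_mat (Suc n) m \<times> carrier_mat m' (Suc n)"]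
    by (simp add: sum.cartesian_product power2_eq_square split_def)
  have card: "card \<Theta> = card U" "card \<Theta> > 0"
  proof -
    have "card \<Theta> = CARD('k) ^ Suc n - 1" "card U = CARD('k) ^ Suc n - 1"
      by (simp_all add: \<Theta>_def U_def card_Diff_singleton card_carrier_mat)
    moreover have "CARD('k) ^ Suc n > 1"
      using q' by (rule one_less_power) simp
    ultimately show "card \<Theta> = card U" "card \<Theta> > 0" by simp_all
  qed
  \<comment> \<open>The factor shared by all three estimates; positive, so it can be cancelled at
    the end.\<close>
  define c where "c = real (card \<Theta>) * (?q - 1) * norm2"
  have c: "c > 0" using card q norm by (simp add: c_def)
  have ef': "?q ^ n * c \<le> inner2 e f"
    and ee': "inner2 e e \<le> ?q ^ m' * c" and ff': "inner2 f f \<le> ?q ^ m * c"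
    using ef ee ff by (simp_all add: c_def card ac_simps)
  have "(?q ^ n * c)\<^sup>2 \<le> (inner2 e f)\<^sup>2"
    using ef' c by (intro power_mono) auto
  also have "\<dots> \<le> inner2 e e * inner2 f f" by (rule cs)
  also have "\<dots> \<le> (?q ^ m' * c) * (?q ^ m * c)"
  proof (rule mult_mono[OF ee' ff'])
    show "0 \<le> inner2 f f" by (intro sum_nonneg) simp
    show "0 \<le> ?q ^ m' * c" using c by simp
  qed
  also have "\<dots> = ?q ^ (m + m') * c\<^sup>2"
    by (simp add: power2_eq_square power_add)
  also have "(?q ^ n * c)\<^sup>2 = ?q ^ (2 * n) * c\<^sup>2"
    by (simp add: power_mult_distrib power_mult[symmetric] mult.commute)
  finally have "?q ^ (2 * n) * c\<^sup>2 \<le> ?q ^ (m + m') * c\<^sup>2" .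
  then have "?q ^ (2 * n) \<le> ?q ^ (m + m')" using c by simp
  then show ?thesis using q by simp
qed

end

section \<open>Representations in coordinates\<close>

lemma linear_mapI:
  assumes "vectorspace (class_ring :: 'k::field ring) V" "vectorspace class_ring W"
    and "\<And>v. v \<in> carrier V \<Longrightarrow> T v \<in> carrier W"
    and "\<And>v w. v \<in> carrier V \<Longrightarrow> w \<in> carrier V \<Longrightarrow> T (v \<oplus>\<^bsub>V\<^esub> w) = T v \<oplus>\<^bsub>W\<^esub> T w"
    and "\<And>c v. v \<in> carrier V \<Longrightarrow> T (c \<odot>\<^bsub>V\<^esub> v) = c \<odot>\<^bsub>W\<^esub> T v"
  shows "linear_map (class_ring :: 'k ring) V W T"
proof -
  interpret V: vectorspace class_ring V by fact
  interpret W: vectorspace class_ring W by fact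
  show ?thesis
    by unfold_locales (use assms in \<open>auto simp: module_hom_def\<close>)
qed

lemma linear_mapD:
  assumes "linear_map (class_ring :: 'k::field ring) V W T"
  shows "vectorspace (class_ring :: 'k ring) V" "vectorspace (class_ring :: 'k ring) W"
    and "v \<in> carrier V \<Longrightarrow> T v \<in> carrier W"
    and "v \<in> carrier V \<Longrightarrow> w \<in> carrier V \<Longrightarrow> T (v \<oplus>\<^bsub>V\<^esub> w) = T v \<oplus>\<^bsub>W\<^esub> T w"
    and "v \<in> carrier V \<Longrightarrow> T (c \<odot>\<^bsub>V\<^esub> v) = c \<odot>\<^bsub>W\<^esub> T v"
    and "T \<zero>\<^bsub>V\<^esub> = \<zero>\<^bsub>W\<^esub>"
proof -
  interpret linear_map "class_ring :: 'k ring" V W T by fact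
  show "vectorspace (class_ring :: 'k ring) V" "vectorspace (class_ring :: 'k ring) W" by unfold_locales
  show "v \<in> carrier V \<Longrightarrow> T v \<in> carrier W" by simp
  show "v \<in> carrier V \<Longrightarrow> w \<in> carrier V \<Longrightarrow> T (v \<oplus>\<^bsub>V\<^esub> w) = T v \<oplus>\<^bsub>W\<^esub> T w" by simp
  show "v \<in> carrier V \<Longrightarrow> T (c \<odot>\<^bsub>V\<^esub> v) = c \<odot>\<^bsub>W\<^esub> T v"  by simp
  show "T \<zero>\<^bsub>V\<^esub> = \<zero>\<^bsub>W\<^esub>" by simp
qed

lemma vectorspaceD:
  assumes "vectorspace (class_ring :: 'k::field ring) V"
  shows "\<zero>\<^bsub>V\<^esub> \<in> carrier V"
    and "v \<in> carrier V \<Longrightarrow> w \<in> carrier V \<Longrightarrow> v \<oplus>\<^bsub>V\<^esub> w \<in> carrier V"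
    and "v \<in> carrier V \<Longrightarrow> c \<odot>\<^bsub>V\<^esub> v \<in> carrier V"
proof -
  interpret vectorspace "class_ring :: 'k ring" V by fact
  show "\<zero>\<^bsub>V\<^esub> \<in> carrier V" "v \<in> carrier V \<Longrightarrow> w \<in> carrier V \<Longrightarrow> v \<oplus>\<^bsub>V\<^esub> w \<in> carrier V"
     "v \<in> carrier V \<Longrightarrow> c \<odot>\<^bsub>V\<^esub> v \<in> carrier V" by auto
qed

lemma linear_map_comp:
  assumes "linear_map (class_ring :: 'k::field ring) U V S" "linear_map (class_ring :: 'k ring) V W T"
  shows "linear_map (class_ring :: 'k ring) U W (T \<circ> S)"
  using linear_mapD[OF assms(1)] linear_mapD[OF assms(2)] by (intro linear_mapI) auto

lemma linear_map_cong:
  assumes "linear_map (class_ring :: 'k::field ring) V W T" "\<And>v. v \<in> carrier V \<Longrightarrow> S v = T v"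
  shows "linear_map (class_ring :: 'k ring) V W S"
  using linear_mapD[OF assms(1)] vectorspaceD[OF linear_mapD(1)[OF assms(1)]] assms(2)
  by (intro linear_mapI) auto

lemma linear_map_inv_into:
  assumes T: "linear_map (class_ring :: 'k::field ring) V W T" and bij: "bij_betw T (carrier V) (carrier W)"
  shows "linear_map (class_ring :: 'k ring) W V (inv_into (carrier V) T)"
proof -
  note D = linear_mapD[OF T]
  let ?S = "inv_into (carrier V) T"
  have S: "?S w \<in> carrier V" "T (?S w) = w" if "w \<in> carrier W" for w
    using that bij by (auto simp: bij_betw_def inv_into_into f_inv_into_f)
  have eq: "?S w = v" if "T v = w" "v \<in> carrier V" for v w
    using that bij by (auto simp: bij_betw_def)
  show ?thesis
    by (intro linear_mapI D eq) (use S D vectorspaceD[OF D(1)] in auto)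
qed

text \<open>A surjection that respects the operations transports the axioms. It serves for
  quotients, whose operations are known only through representatives of cosets.\<close>

lemma vectorspace_image:
  assumes V: "vectorspace (class_ring :: 'k::field ring) V"
    and im: "\<phi> ` carrier V = carrier W" and zero: "\<phi> \<zero>\<^bsub>V\<^esub> = \<zero>\<^bsub>W\<^esub>"
    and add: "\<And>v w. v \<in> carrier V \<Longrightarrow> w \<in> carrier V \<Longrightarrow> \<phi> (v \<oplus>\<^bsub>V\<^esub> w) = \<phi> v \<oplus>\<^bsub>W\<^esub> \<phi> w"
    and smult: "\<And>c v. v \<in> carrier V \<Longrightarrow> \<phi> (c \<odot>\<^bsub>V\<^esub> v) = c \<odot>\<^bsub>W\<^esub> \<phi> v"
  shows "vectorspace (class_ring :: 'k ring) W"
proof -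
  interpret V: vectorspace "class_ring :: 'k ring" V by fact
  note hom = add[symmetric] smult[symmetric] zero[symmetric]
  have neg: "\<exists>w\<in>carrier V. v \<oplus>\<^bsub>V\<^esub> w = \<zero>\<^bsub>V\<^esub>" if "v \<in> carrier V" for v
    using that by (intro bexI[of _ "\<ominus>\<^bsub>V\<^esub> v"]) (auto simp: V.M.r_neg)
  show ?thesis
  proof (rule vs_criteria)
    show "field (class_ring :: 'k ring)" by (rule class_field)
    show "\<forall>v\<in>carrier W. \<exists>neg_v\<in>carrier W. v \<oplus>\<^bsub>W\<^esub> neg_v = \<zero>\<^bsub>W\<^esub>"
      unfolding im[symmetric] using neg by (auto simp: hom) (metis V.M.r_neg V.M.a_inv_closed)
  qed (unfold im[symmetric], use V.M.zero_closed in \<open>auto simp: hom class_ring_simps V.M.a_ac V.smult_l_distr[unfolded class_ring_simps]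
     V.smult_r_distr[unfolded class_ring_simps] V.smult_assoc1[unfolded class_ring_simps] V.smult_one[unfolded class_ring_simps]\<close>)
qed

section \<open>Coordinate spaces, matrices and bases\<close>

lemma vec_vectorspace [simp]: "vectorspace (class_ring :: 'k::field ring) (module_vec TYPE('k) n)"
  by (rule vec_vs)

lemma carrier_module_vec [simp]: "carrier (module_vec TYPE('k::field) n) = carrier_vec n"
  and add_module_vec [simp]: "add (module_vec TYPE('k::field) n) = (+)"
  and smult_module_vec [simp]: "module.smult (module_vec TYPE('k::field) n) = (\<cdot>\<^sub>v)"
  and zero_module_vec [simp]: "zero (module_vec TYPE('k::field) n) = 0\<^sub>v n"
  by (simp_all add: module_vec_simps)

lemma ex_linear_map_unit_vec:
  fixes W :: "('k::field, 'b) module"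
  assumes W: "vectorspace (class_ring :: 'k ring) W" and r: "\<And>j. j < n \<Longrightarrow> r j \<in> carrier W"
  shows "\<exists>T. linear_map (class_ring :: 'k ring) (module_vec TYPE('k) n) W T \<and> (\<forall>j<n. T (unit_vec n j) = r j)"
proof -
  interpret W: vectorspace "class_ring :: 'k ring" W by fact
  define T where "T v = finsum W (\<lambda>j. v $ j \<odot>\<^bsub>W\<^esub> r j) {..<n}" for v :: "'k vec"
  have fn: "(\<lambda>j. c j \<odot>\<^bsub>W\<^esub> r j) \<in> {..<n} \<rightarrow> carrier W" for c :: "nat \<Rightarrow> 'k"
    using r by (auto simp: class_ring_simps)
  have "linear_map (class_ring :: 'k ring) (module_vec TYPE('k) n) W T"
  proof (intro linear_mapI)
    fix v w :: "'k vec" assume v: "v \<in> carrier (module_vec TYPE('k) n)" "w \<in> carrier (module_vec TYPE('k) n)"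
    show "T v \<in> carrier W" unfolding T_def by (rule W.M.finsum_closed[OF fn])
    have "T (v \<oplus>\<^bsub>module_vec TYPE('k) n\<^esub> w) = finsum W (\<lambda>j. v $ j \<odot>\<^bsub>W\<^esub> r j \<oplus>\<^bsub>W\<^esub> w $ j \<odot>\<^bsub>W\<^esub> r j) {..<n}"
      unfolding T_def using v r
      by (intro W.M.finsum_cong') (auto simp: W.smult_l_distr[unfolded class_ring_simps] class_ring_simps)
    also have "\<dots> = T v \<oplus>\<^bsub>W\<^esub> T w" unfolding T_def by (rule W.M.finsum_addf[OF fn fn])
    finally show "T (v \<oplus>\<^bsub>module_vec TYPE('k) n\<^esub> w) = T v \<oplus>\<^bsub>W\<^esub> T w" .
  next
    fix c :: 'k and v :: "'k vec" assume v: "v \<in> carrier (module_vec TYPE('k) n)"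
    have "T (c \<odot>\<^bsub>module_vec TYPE('k) n\<^esub> v) = finsum W (\<lambda>j. c \<odot>\<^bsub>W\<^esub> (v $ j \<odot>\<^bsub>W\<^esub> r j)) {..<n}"
      unfolding T_def using v r
      by (intro W.M.finsum_cong') (auto simp: W.smult_assoc1[unfolded class_ring_simps] class_ring_simps)
    also have "\<dots> = c \<odot>\<^bsub>W\<^esub> T v" unfolding T_def
      by (rule W.finsum_smult[symmetric]) (use fn in \<open>auto simp: class_ring_simps\<close>)
    finally show "T (c \<odot>\<^bsub>module_vec TYPE('k) n\<^esub> v) = c \<odot>\<^bsub>W\<^esub> T v" .
  qed (use W in auto)
  moreover have "T (unit_vec n j) = r j" if j: "j < n" for j
  proof -
    have "T (unit_vec n j) = finsum W (\<lambda>i. if j = i then r i else \<zero>\<^bsub>W\<^esub>) {..<n}"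
      unfolding T_def using r j
      by (intro W.M.finsum_cong') (auto simp: W.smult_one[unfolded class_ring_simps] W.lmult_0[unfolded class_ring_simps])
    also have "\<dots> = r j" using r j by (intro W.M.finsum_singleton) auto
    finally show ?thesis .
  qed
  ultimately show ?thesis by blast
qed

lemma linear_map_vec_eqI:
  fixes W :: "('k::field, 'b) module"
  assumes S: "linear_map (class_ring :: 'k ring) (module_vec TYPE('k) n) W S"
    and T: "linear_map (class_ring :: 'k ring) (module_vec TYPE('k) n) W T"
    and eq: "\<And>j. j < n \<Longrightarrow> S (unit_vec n j) = T (unit_vec n j)"
    and v: "v \<in> carrier_vec n"
  shows "S v = T v"
proof -
  \<comment> \<open>Induction on the number of leading entries of \<open>v\<close> that are kept,
    the others being set to 0.\<close>
  have "S (vec n (\<lambda>j. if j < m then v $ j else 0)) = T (vec n (\<lambda>j. if j < m then v $ j else 0))" if "m \<le> n" for m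
    using that
  proof (induction m)
    case 0
    have "vec n (\<lambda>j. if j < 0 then v $ j else 0) = 0\<^sub>v n" by auto
    then show ?case using linear_mapD(6)[OF S] linear_mapD(6)[OF T] by simp
  next
    case (Suc m)
    have "vec n (\<lambda>j. if j < Suc m then v $ j else 0) =
      vec n (\<lambda>j. if j < m then v $ j else 0) + v $ m \<cdot>\<^sub>v unit_vec n m"
      using Suc.prems by (intro eq_vecI) (auto simp: less_Suc_eq)
    then show ?case
      using Suc linear_mapD(4,5)[OF S] linear_mapD(4,5)[OF T] eq[of m] by simp
  qed
  from this[of n] have "S (vec n (\<lambda>j. if j < n then v $ j else 0)) = T (vec n (\<lambda>j. if j < n then v $ j else 0))" by simp
  moreover have "vec n (\<lambda>j. if j < n then v $ j else 0) = v" using v by auto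
  ultimately show ?thesis by simp
qed

lemma linear_map_mult_mat_vec:
  fixes A :: "'k::field mat"
  assumes "A \<in> carrier_mat m n"
  shows "linear_map (class_ring :: 'k ring) (module_vec TYPE('k) n) (module_vec TYPE('k) m) (\<lambda>v. A *\<^sub>v v)"
  using assms by (intro linear_mapI) (auto simp: mult_add_distrib_mat_vec mult_mat_vec)

lemma mult_mat_unit_vec:
  fixes A :: "'k::field mat"
  assumes "A \<in> carrier_mat m n" "j < n"
  shows "A *\<^sub>v unit_vec n j = col A j"
  using assms by (intro eq_vecI) auto

lemma ex_mat_of_linear_map:
  fixes T :: "'k::field vec \<Rightarrow> 'k vec"
  assumes T: "linear_map (class_ring :: 'k ring) (module_vec TYPE('k) n) (module_vec TYPE('k) m) T"
  shows "\<exists>A\<in>carrier_mat m n. \<forall>v\<in>carrier_vec n. T v = A *\<^sub>v v"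
proof (intro bexI ballI)
  define A where "A = mat m n (\<lambda>(r, c). T (unit_vec n c) $ r)"
  show A: "A \<in> carrier_mat m n" by (simp add: A_def)
  fix v :: "'k vec" assume "v \<in> carrier_vec n"
  then show "T v = A *\<^sub>v v"
  proof (rule linear_map_vec_eqI[OF T linear_map_mult_mat_vec[OF A], rotated])
    fix j assume j: "j < n"
    then show "T (unit_vec n j) = A *\<^sub>v unit_vec n j"
      using linear_mapD(3)[OF T, of "unit_vec n j"]
      unfolding mult_mat_unit_vec[OF A j] by (intro eq_vecI) (auto simp: A_def)
  qed
qed

lemma ex_coordinates:
  fixes W :: "('k::field, 'b) module"
  assumes W: "vectorspace (class_ring :: 'k ring) W" and fd: "vectorspace.fin_dim (class_ring :: 'k ring) W"
  shows "\<exists>T. linear_map (class_ring :: 'k ring) (module_vec TYPE('k) (vectorspace.dim (class_ring :: 'k ring) W)) W T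
    \<and> bij_betw T (carrier_vec (vectorspace.dim (class_ring :: 'k ring) W)) (carrier W)"
proof -
  interpret W: vectorspace "class_ring :: 'k ring" W by fact
  let ?n = "W.dim"
  obtain B where B: "finite B" "W.basis B" using W.finite_basis_exists[OF fd] by blast
  then have card: "?n = card B" by (intro W.dim_basis)
  obtain r where r: "bij_betw r {..<card B} B"
    using ex_bij_betw_nat_finite[OF B(1)] by (auto simp: atLeast0LessThan)
  have BW: "B \<subseteq> carrier W" and li: "W.lin_indpt B" and gen: "W.span B = carrier W"
    using B(2) by (auto simp: W.basis_def)
  have rW: "r j \<in> carrier W" if "j < ?n" for j
    using that r BW card by (auto simp: bij_betw_def)
  obtain T where T: "linear_map (class_ring :: 'k ring) (module_vec TYPE('k) ?n) W T"
    and Tr: "\<And>j. j < ?n \<Longrightarrow> T (unit_vec ?n j) = r j"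
    using ex_linear_map_unit_vec[OF W, where n = ?n and r = r] rW by blast
  define s where "s = inv_into {..<card B} r"
  have s: "s (r j) = j" if "j < ?n" for j using that r card by (simp add: s_def bij_betw_def)
  \<comment> \<open>Rewriting \<open>T v\<close> as a linear combination indexed by the basis
    itself, instead of by positions, makes linear independence and spanning applicable.\<close>
  have lc: "T v = W.lincomb (\<lambda>b. v $ s b) B" if v: "v \<in> carrier_vec ?n" for v
  proof -
    have L: "linear_map (class_ring :: 'k ring) (module_vec TYPE('k) ?n) W (\<lambda>v. W.lincomb (\<lambda>b. v $ s b) B)"
    proof (intro linear_mapI)
      have sB: "s b < ?n" if "b \<in> B" for b
        using that r card inv_into_into[of b r "{..<card B}"] by (simp add: s_def bij_betw_def)
      have fn: "(\<lambda>b. c b \<odot>\<^bsub>W\<^esub> b) \<in> B \<rightarrow> carrier W" for c :: "'b \<Rightarrow> 'k"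
        using BW by (auto simp: class_ring_simps)
      fix v w :: "'k vec" assume v: "v \<in> carrier (module_vec TYPE('k) ?n)" "w \<in> carrier (module_vec TYPE('k) ?n)"
      show "W.lincomb (\<lambda>b. v $ s b) B \<in> carrier W" unfolding W.lincomb_def by (rule W.M.finsum_closed[OF fn])
      have "W.lincomb (\<lambda>b. (v \<oplus>\<^bsub>module_vec TYPE('k) ?n\<^esub> w) $ s b) B =
          finsum W (\<lambda>b. v $ s b \<odot>\<^bsub>W\<^esub> b \<oplus>\<^bsub>W\<^esub> w $ s b \<odot>\<^bsub>W\<^esub> b) B"
        unfolding W.lincomb_def using v BW sB
        by (intro W.M.finsum_cong') (auto simp: W.smult_l_distr[unfolded class_ring_simps] class_ring_simps subset_iff)
      also have "\<dots> = W.lincomb (\<lambda>b. v $ s b) B \<oplus>\<^bsub>W\<^esub> W.lincomb (\<lambda>b. w $ s b) B"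
        unfolding W.lincomb_def by (rule W.M.finsum_addf[OF fn fn])
      finally show "W.lincomb (\<lambda>b. (v \<oplus>\<^bsub>module_vec TYPE('k) ?n\<^esub> w) $ s b) B =
        W.lincomb (\<lambda>b. v $ s b) B \<oplus>\<^bsub>W\<^esub> W.lincomb (\<lambda>b. w $ s b) B" .
      fix c :: 'k
      have "W.lincomb (\<lambda>b. (c \<odot>\<^bsub>module_vec TYPE('k) ?n\<^esub> v) $ s b) B =
          finsum W (\<lambda>b. c \<odot>\<^bsub>W\<^esub> (v $ s b \<odot>\<^bsub>W\<^esub> b)) B"
        unfolding W.lincomb_def using v BW sB
        by (intro W.M.finsum_cong') (auto simp: W.smult_assoc1[unfolded class_ring_simps] class_ring_simps subset_iff)
      also have "\<dots> = c \<odot>\<^bsub>W\<^esub> W.lincomb (\<lambda>b. v $ s b) B"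
        unfolding W.lincomb_def
        by (rule W.finsum_smult[symmetric]) (use fn in \<open>auto simp: class_ring_simps\<close>)
      finally show "W.lincomb (\<lambda>b. (c \<odot>\<^bsub>module_vec TYPE('k) ?n\<^esub> v) $ s b) B = c \<odot>\<^bsub>W\<^esub> W.lincomb (\<lambda>b. v $ s b) B" .
    qed (use W in auto)
    show ?thesis
    proof (rule linear_map_vec_eqI[OF T L _ v])
      fix j assume j: "j < ?n"
      have rj: "r j \<in> B" using j r card by (auto simp: bij_betw_def)
      have "W.lincomb (\<lambda>b. unit_vec ?n j $ s b) B = finsum W (\<lambda>b. if r j = b then b else \<zero>\<^bsub>W\<^esub>) B"
        unfolding W.lincomb_def
      proof (intro W.M.finsum_cong')
        fix b assume b: "b \<in> B"
        then obtain i where i: "i < ?n" "b = r i" using r card by (auto simp: bij_betw_def)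
        then show "unit_vec ?n j $ s b \<odot>\<^bsub>W\<^esub> b = (if r j = b then b else \<zero>\<^bsub>W\<^esub>)"
          using j s BW b by (auto simp: W.smult_one[unfolded class_ring_simps] W.lmult_0[unfolded class_ring_simps] subset_iff)
            (metis s)+
      qed (use BW in auto)
      also have "\<dots> = r j" using rj B(1) BW by (intro W.M.finsum_singleton) auto
      finally show "T (unit_vec ?n j) = W.lincomb (\<lambda>b. unit_vec ?n j $ s b) B" using Tr[OF j] by simp
    qed
  qed
  have "inj_on T (carrier_vec ?n)"
  proof (rule inj_onI)
    fix v w assume v: "v \<in> carrier_vec ?n" "w \<in> carrier_vec ?n" and eq: "T v = T w"
    have u: "v + (-1) \<cdot>\<^sub>v w \<in> carrier_vec ?n" using v by simp
    have "T (v + (-1) \<cdot>\<^sub>v w) = T v \<oplus>\<^bsub>W\<^esub> (-1) \<odot>\<^bsub>W\<^esub> T w"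
      using linear_mapD(4,5)[OF T] v by simp
    also have "\<dots> = \<zero>\<^bsub>W\<^esub>"
      using W.smult_minus_1[of "T w"] linear_mapD(3)[OF T] v eq by (simp add: class_ring_simps W.M.r_neg)
    finally have 0: "W.lincomb (\<lambda>b. (v + (-1) \<cdot>\<^sub>v w) $ s b) B = \<zero>\<^bsub>W\<^esub>" using lc[OF u] by simp
    have z: "(v + (-1) \<cdot>\<^sub>v w) $ s b = 0" if "b \<in> B" for b
    proof (rule ccontr)
      assume "(v + (-1) \<cdot>\<^sub>v w) $ s b \<noteq> 0"
      then have "W.lin_dep B" using 0 that B(1)
        by (intro W.lin_dep_crit[of B B "\<lambda>b. (v + (-1) \<cdot>\<^sub>v w) $ s b" b]) (auto simp: class_ring_simps)
      with li show False by simp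
    qed
    show "v = w"
    proof (rule eq_vecI)
      fix j assume "j < dim_vec w"
      then have j: "j < ?n" using v by simp
      then have "r j \<in> B" using r card by (auto simp: bij_betw_def)
      from z[OF this] s[OF j] j v show "v $ j = w $ j" by simp
    qed (use v in auto)
  qed
  moreover have "T ` carrier_vec ?n = carrier W"
  proof
    show "T ` carrier_vec ?n \<subseteq> carrier W" using linear_mapD(3)[OF T] by auto
    show "carrier W \<subseteq> T ` carrier_vec ?n"
    proof
      fix w assume "w \<in> carrier W"
      then obtain a where a: "W.lincomb a B = w"
        using W.finite_in_span[OF B(1) BW, of w] gen by auto
      have "T (vec ?n (\<lambda>j. a (r j))) = W.lincomb (\<lambda>b. vec ?n (\<lambda>j. a (r j)) $ s b) B"
        by (rule lc) simp
      also have "\<dots> = W.lincomb a B"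
        unfolding W.lincomb_def
      proof (intro W.M.finsum_cong')
        fix b assume b: "b \<in> B"
        then obtain i where "i < ?n" "b = r i" using r card by (auto simp: bij_betw_def)
        then show "vec ?n (\<lambda>j. a (r j)) $ s b \<odot>\<^bsub>W\<^esub> b = a b \<odot>\<^bsub>W\<^esub> b" using s by simp
      qed (use BW in \<open>auto simp: class_ring_simps\<close>)
      finally show "w \<in> T ` carrier_vec ?n" using a by (intro image_eqI[of _ _ "vec ?n (\<lambda>j. a (r j))"]) auto
    qed
  qed
  ultimately show ?thesis using T unfolding bij_betw_def by blast
qed

section \<open>Isomorphisms and automorphisms of representations\<close>

lemma is_repD:
  assumes "is_rep Q M"
  shows "i \<in> verts Q \<Longrightarrow> vectorspace class_ring (rep_space M i)"
    and "i \<in> verts Q \<Longrightarrow> vectorspace.fin_dim class_ring (rep_space M i)"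
    and "a \<in> arcs Q \<Longrightarrow> linear_map class_ring (rep_space M (tail Q a)) (rep_space M (head Q a)) (rep_map M a)"
  using assms by (auto simp: is_rep_def)

lemma rep_map_closed:
  "is_rep Q M \<Longrightarrow> a \<in> arcs Q \<Longrightarrow> v \<in> carrier (rep_space M (tail Q a)) \<Longrightarrow>
    rep_map M a v \<in> carrier (rep_space M (head Q a))"
  by (rule linear_mapD(3)[OF is_repD(3)])

lemma is_rep_isoD:
  assumes "is_rep_iso Q M N g"
  shows "i \<in> verts Q \<Longrightarrow> linear_map class_ring (rep_space M i) (rep_space N i) (g i)"
    and "i \<in> verts Q \<Longrightarrow> bij_betw (g i) (carrier (rep_space M i)) (carrier (rep_space N i))"
    and "a \<in> arcs Q \<Longrightarrow> v \<in> carrier (rep_space M (tail Q a)) \<Longrightarrow>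
      g (head Q a) (rep_map M a v) = rep_map N a (g (tail Q a) v)"
  using assms by (auto simp: is_rep_iso_def)

lemma is_rep_iso_closed:
  "is_rep_iso Q M N g \<Longrightarrow> i \<in> verts Q \<Longrightarrow> v \<in> carrier (rep_space M i) \<Longrightarrow> g i v \<in> carrier (rep_space N i)"
  by (rule linear_mapD(3)[OF is_rep_isoD(1)])

context wf_digraph
begin

lemma is_rep_iso_comp:
  assumes f: "is_rep_iso G L M f" and g: "is_rep_iso G M N g"
  shows "is_rep_iso G L N (\<lambda>i. g i \<circ> f i)"
  unfolding is_rep_iso_def
proof (intro conjI ballI)
  fix i assume i: "i \<in> verts G"
  show "linear_map class_ring (rep_space L i) (rep_space N i) (g i \<circ> f i)"
    by (rule linear_map_comp[OF is_rep_isoD(1)[OF f i] is_rep_isoD(1)[OF g i]])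
  show "bij_betw (g i \<circ> f i) (carrier (rep_space L i)) (carrier (rep_space N i))"
    by (rule bij_betw_trans[OF is_rep_isoD(2)[OF f i] is_rep_isoD(2)[OF g i]])
next
  fix a v assume a: "a \<in> arcs G" and v: "v \<in> carrier (rep_space L (tail G a))"
  then show "(g (head G a) \<circ> f (head G a)) (rep_map L a v) = rep_map N a ((g (tail G a) \<circ> f (tail G a)) v)"
    using is_rep_isoD(3)[OF f a v] is_rep_isoD(3)[OF g a, of "f (tail G a) v"]
      is_rep_iso_closed[OF f _ v] by simp
qed

lemma is_rep_iso_inv:
  assumes M: "is_rep G M" and g: "is_rep_iso G M N g"
  shows "is_rep_iso G N M (\<lambda>i. inv_into (carrier (rep_space M i)) (g i))"
  unfolding is_rep_iso_def
proof (intro conjI ballI)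
  fix i assume i: "i \<in> verts G"
  note b = is_rep_isoD(1)[OF g i] is_rep_isoD(2)[OF g i]
  show "linear_map class_ring (rep_space N i) (rep_space M i) (inv_into (carrier (rep_space M i)) (g i))"
    by (rule linear_map_inv_into[OF b])
  show "bij_betw (inv_into (carrier (rep_space M i)) (g i)) (carrier (rep_space N i)) (carrier (rep_space M i))"
    by (rule bij_betw_inv_into[OF b(2)])
next
  fix a w assume a: "a \<in> arcs G" and w: "w \<in> carrier (rep_space N (tail G a))"
  have "bij_betw (g (tail G a)) (carrier (rep_space M (tail G a))) (carrier (rep_space N (tail G a)))"
    "bij_betw (g (head G a)) (carrier (rep_space M (head G a))) (carrier (rep_space N (head G a)))"
    using a by (auto intro: is_rep_isoD(2)[OF g])
  moreover from this(1) w obtain v where v: "v \<in> carrier (rep_space M (tail G a))" "w = g (tail G a) v"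
    by (auto simp: bij_betw_def)
  ultimately show "inv_into (carrier (rep_space M (head G a))) (g (head G a)) (rep_map N a w) =
    rep_map M a (inv_into (carrier (rep_space M (tail G a))) (g (tail G a)) w)"
    using is_rep_isoD(3)[OF g a v(1)] rep_map_closed[OF M a v(1)]
    by (metis bij_betw_def inv_into_f_f)
qed

lemma is_rep_iso_cong:
  assumes M: "is_rep G M" and g: "is_rep_iso G M N g"
    and eq: "\<And>i v. i \<in> verts G \<Longrightarrow> v \<in> carrier (rep_space M i) \<Longrightarrow> h i v = g i v"
  shows "is_rep_iso G M N h"
  unfolding is_rep_iso_def
proof (intro conjI ballI)
  fix i assume i: "i \<in> verts G"
  show "linear_map class_ring (rep_space M i) (rep_space N i) (h i)"
    by (rule linear_map_cong[OF is_rep_isoD(1)[OF g i] eq[OF i]])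
  show "bij_betw (h i) (carrier (rep_space M i)) (carrier (rep_space N i))"
    using is_rep_isoD(2)[OF g i] eq[OF i] by (simp cong: bij_betw_cong)
next
  fix a v assume a: "a \<in> arcs G" and v: "v \<in> carrier (rep_space M (tail G a))"
  then show "h (head G a) (rep_map M a v) = rep_map N a (h (tail G a) v)"
    using is_rep_isoD(3)[OF g a v] rep_map_closed[OF M a v] eq by simp
qed

lemma is_rep_iso_id: "is_rep G M \<Longrightarrow> is_rep_iso G M M (\<lambda>i v. v)"
  by (auto simp: is_rep_iso_def intro!: linear_mapI is_repD bij_betw_id[unfolded id_def])

lemma rep_isomorphic_refl: "is_rep G M \<Longrightarrow> rep_isomorphic G M M"
  using is_rep_iso_id unfolding rep_isomorphic_def by blast

lemma rep_isomorphic_sym: "is_rep G M \<Longrightarrow> rep_isomorphic G M N \<Longrightarrow> rep_isomorphic G N M"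
  using is_rep_iso_inv unfolding rep_isomorphic_def by blast

lemma rep_isomorphic_trans: "rep_isomorphic G L M \<Longrightarrow> rep_isomorphic G M N \<Longrightarrow> rep_isomorphic G L N"
  using is_rep_iso_comp unfolding rep_isomorphic_def by blast

lemma rep_dim_eq:
  assumes "is_rep G M" "rep_isomorphic G M N" "i \<in> verts G"
  shows "rep_dim N i = rep_dim M i"
proof -
  from assms obtain g where g: "is_rep_iso G M N g" by (auto simp: rep_isomorphic_def)
  interpret linear_map class_ring "rep_space M i" "rep_space N i" "g i"
    by (rule is_rep_isoD(1)[OF g assms(3)])
  show ?thesis
    using is_rep_isoD(2)[OF g assms(3)] is_repD(2)[OF assms(1,3)] dim_eq
    by (auto simp: rep_dim_def bij_betw_def)
qed

definition rep_isos ::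
  "('a, 'b, 'k::field, 'c) quiver_rep \<Rightarrow> ('a, 'b, 'k, 'd) quiver_rep \<Rightarrow> ('a \<Rightarrow> 'c \<Rightarrow> 'd) set" where
  "rep_isos M N = {g \<in> (\<Pi>\<^sub>E i\<in>verts G. carrier (rep_space M i) \<rightarrow>\<^sub>E carrier (rep_space N i)). is_rep_iso G M N g}"

lemma rep_automorphisms_eq: "rep_automorphisms G M = rep_isos M M"
  by (simp add: rep_automorphisms_def rep_isos_def)

definition restrict_family :: "('a, 'b, 'k::field, 'c) quiver_rep \<Rightarrow> ('a \<Rightarrow> 'c \<Rightarrow> 'd) \<Rightarrow> ('a \<Rightarrow> 'c \<Rightarrow> 'd)" where
  "restrict_family M g = (\<lambda>i\<in>verts G. \<lambda>v\<in>carrier (rep_space M i). g i v)"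

lemma restrict_family_apply [simp]:
  "i \<in> verts G \<Longrightarrow> v \<in> carrier (rep_space M i) \<Longrightarrow> restrict_family M g i v = g i v"
  by (simp add: restrict_family_def)

lemma restrict_family_in_rep_isos:
  assumes M: "is_rep G M" and g: "is_rep_iso G M N g"
  shows "restrict_family M g \<in> rep_isos M N"
proof -
  have "is_rep_iso G M N (restrict_family M g)"
    by (rule is_rep_iso_cong[OF M g]) simp
  then show ?thesis
    using is_rep_iso_closed[OF g] by (auto simp: rep_isos_def restrict_family_def)
qed

lemma rep_isosD: "g \<in> rep_isos M N \<Longrightarrow> is_rep_iso G M N g"
  by (simp add: rep_isos_def)

lemma rep_isos_eqI:
  assumes g: "g \<in> rep_isos M N" and h: "h \<in> rep_isos M N"
    and eq: "\<And>i v. i \<in> verts G \<Longrightarrow> v \<in> carrier (rep_space M i) \<Longrightarrow> g i v = h i v"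
  shows "g = h"
proof -
  have *: "g \<in> (\<Pi>\<^sub>E i\<in>verts G. carrier (rep_space M i) \<rightarrow>\<^sub>E carrier (rep_space N i))"
    "h \<in> (\<Pi>\<^sub>E i\<in>verts G. carrier (rep_space M i) \<rightarrow>\<^sub>E carrier (rep_space N i))"
    using g h by (auto simp: rep_isos_def)
  then show ?thesis
  proof (rule PiE_ext)
    fix i assume i: "i \<in> verts G"
    show "g i = h i" by (rule PiE_ext[OF PiE_mem[OF *(1) i] PiE_mem[OF *(2) i] eq[OF i]])
  qed
qed

text \<open>The isomorphisms onto \<open>N\<close> are a torsor under its automorphisms: composing
  with a fixed isomorphism is a bijection, up to restricting the families to be extensional.\<close>

lemma card_rep_isos:
  assumes M: "is_rep G M" and N: "is_rep G N" and iso: "rep_isomorphic G M N"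
  shows "card (rep_isos M N) = aut_count G N"
proof -
  from iso obtain g where g: "is_rep_iso G M N g" by (auto simp: rep_isomorphic_def)
  define g' where "g' i = inv_into (carrier (rep_space M i)) (g i)" for i
  have g': "is_rep_iso G N M g'" unfolding g'_def by (rule is_rep_iso_inv[OF M g])
  have inv: "g' i (g i v) = v" if "i \<in> verts G" "v \<in> carrier (rep_space M i)" for i v
    using is_rep_isoD(2)[OF g that(1)] that(2) by (simp add: g'_def bij_betw_def)
  have inv': "g i (g' i w) = w" if "i \<in> verts G" "w \<in> carrier (rep_space N i)" for i w
    using is_rep_isoD(2)[OF g that(1)] that(2) by (simp add: g'_def bij_betw_def f_inv_into_f)
  have A: "restrict_family M (\<lambda>i. h i \<circ> g i) \<in> rep_isos M N" if "h \<in> rep_isos N N" for h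
    by (rule restrict_family_in_rep_isos[OF M is_rep_iso_comp[OF g rep_isosD[OF that]]])
  have B: "restrict_family N (\<lambda>i. h i \<circ> g' i) \<in> rep_isos N N" if "h \<in> rep_isos M N" for h
    by (rule restrict_family_in_rep_isos[OF N is_rep_iso_comp[OF g' rep_isosD[OF that]]])
  have "bij_betw (\<lambda>h. restrict_family M (\<lambda>i. h i \<circ> g i)) (rep_isos N N) (rep_isos M N)"
  proof (rule bij_betwI[where g = "\<lambda>h. restrict_family N (\<lambda>i. h i \<circ> g' i)"])
    fix h assume h: "h \<in> rep_isos N N"
    show "restrict_family N (\<lambda>i. restrict_family M (\<lambda>i. h i \<circ> g i) i \<circ> g' i) = h"
      by (rule rep_isos_eqI[OF B[OF A[OF h]] h]) (use is_rep_iso_closed[OF g'] inv' in simp)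
  next
    fix h assume h: "h \<in> rep_isos M N"
    show "restrict_family M (\<lambda>i. restrict_family N (\<lambda>i. h i \<circ> g' i) i \<circ> g i) = h"
      by (rule rep_isos_eqI[OF A[OF B[OF h]] h]) (use is_rep_iso_closed[OF g] inv in simp)
  qed (use A B in auto)
  from bij_betw_same_card[OF this] show ?thesis
    unfolding aut_count_def rep_automorphisms_eq by simp
qed

end

lemma finite_carrier_vec [simp]: "finite (carrier_vec n :: 'k::finite vec set)"
proof -
  have "finite (vec n ` (({..<n}) \<rightarrow>\<^sub>E (UNIV :: 'k set)))" by (intro finite_imageI finite_PiE) auto
  moreover have "(carrier_vec n :: 'k vec set) \<subseteq> vec n ` (({..<n}) \<rightarrow>\<^sub>E (UNIV :: 'k set))"
  proof
    fix v :: "'k vec" assume "v \<in> carrier_vec n"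
    then show "v \<in> vec n ` (({..<n}) \<rightarrow>\<^sub>E (UNIV :: 'k set))"
      by (intro image_eqI[of _ _ "restrict (($) v) {..<n}"]) auto
  qed
  ultimately show ?thesis by (rule finite_subset[rotated])
qed

lemma is_rep_finite_carrier:
  fixes M :: "('v, 'e, 'k::{field, finite}, 'b) quiver_rep"
  assumes "is_rep Q M" "i \<in> verts Q"
  shows "finite (carrier (rep_space M i))"
proof -
  from ex_coordinates[OF is_repD(1,2)[OF assms]]
  obtain n and T :: "'k vec \<Rightarrow> 'b" where "bij_betw T (carrier_vec n) (carrier (rep_space M i))" by blast
  from bij_betw_finite[OF this] show ?thesis by simp
qed

lemma finite_imp_fin_dim:
  assumes "vectorspace (class_ring :: 'k::field ring) V" "finite (carrier V)"
  shows "vectorspace.fin_dim (class_ring :: 'k ring) V"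
proof -
  interpret vectorspace "class_ring :: 'k ring" V by fact
  have "span (carrier V) = carrier V"
    using in_own_span[of "carrier V"] span_is_subset2[of "carrier V"] by (intro equalityI) simp_all
  then show ?thesis unfolding fin_dim_def using assms(2) by blast
qed

context fin_digraph
begin

lemma finite_rep_isos:
  fixes M :: "('a, 'b, 'k::{field, finite}, 'c) quiver_rep" and N :: "('a, 'b, 'k, 'd) quiver_rep"
  assumes "is_rep G M" "is_rep G N"
  shows "finite (rep_isos M N)"
proof -
  have "finite (\<Pi>\<^sub>E i\<in>verts G. carrier (rep_space M i) \<rightarrow>\<^sub>E carrier (rep_space N i))"
  proof (rule finite_PiE)
    fix i assume i: "i \<in> verts G"
    show "finite (carrier (rep_space M i) \<rightarrow>\<^sub>E carrier (rep_space N i))"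
      by (rule finite_PiE) (rule is_rep_finite_carrier[OF assms(1) i] is_rep_finite_carrier[OF assms(2) i])+
  qed simp
  then show ?thesis unfolding rep_isos_def by simp
qed

lemma aut_count_pos:
  fixes M :: "('a, 'b, 'k::{field, finite}, 'c) quiver_rep"
  assumes "is_rep G M"
  shows "aut_count G M > 0"
  unfolding aut_count_def rep_automorphisms_eq
proof -
  have "rep_isos M M \<noteq> {}"
    using restrict_family_in_rep_isos[OF assms is_rep_iso_id[OF assms]] by blast
  with finite_rep_isos[OF assms assms] show "card (rep_isos M M) > 0"
    by (simp add: card_gt_0_iff)
qed

end

section \<open>Subrepresentations and quotients\<close>

lemma subspaceD:
  assumes "subspace (class_ring :: 'k::field ring) W V"
  shows "vectorspace (class_ring :: 'k ring) V" "W \<subseteq> carrier V" "\<zero>\<^bsub>V\<^esub> \<in> W"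
    and "v \<in> W \<Longrightarrow> w \<in> W \<Longrightarrow> v \<oplus>\<^bsub>V\<^esub> w \<in> W"
    and "v \<in> W \<Longrightarrow> c \<odot>\<^bsub>V\<^esub> v \<in> W"
    and "vectorspace (class_ring :: 'k ring) (V\<lparr>carrier := W\<rparr>)"
proof -
  interpret subspace "class_ring :: 'k ring" W V by fact
  interpret submodule "class_ring :: 'k ring" W V by (rule submod)
  show "vectorspace (class_ring :: 'k ring) V" by (rule vs)
  show "W \<subseteq> carrier V" by (rule subset)
  show "\<zero>\<^bsub>V\<^esub> \<in> W" by simp
  show "v \<in> W \<Longrightarrow> w \<in> W \<Longrightarrow> v \<oplus>\<^bsub>V\<^esub> w \<in> W" by simp
  show "v \<in> W \<Longrightarrow> c \<odot>\<^bsub>V\<^esub> v \<in> W" by simp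
  show "vectorspace (class_ring :: 'k ring) (V\<lparr>carrier := W\<rparr>)"
    by (rule vectorspace.subspace_is_vs[OF vs assms])
qed

lemma subspaceI:
  assumes "vectorspace (class_ring :: 'k::field ring) V" "W \<subseteq> carrier V" "\<zero>\<^bsub>V\<^esub> \<in> W"
    and "\<And>v w. v \<in> W \<Longrightarrow> w \<in> W \<Longrightarrow> v \<oplus>\<^bsub>V\<^esub> w \<in> W"
    and "\<And>c v. v \<in> W \<Longrightarrow> c \<odot>\<^bsub>V\<^esub> v \<in> W"
  shows "subspace (class_ring :: 'k ring) W V"
proof -
  interpret vectorspace "class_ring :: 'k ring" V by fact
  show ?thesis
    by unfold_locales (use assms in auto)
qed

context
  fixes V :: "('k::field, 'b) module" and W :: "'b set"
  assumes W: "subspace (class_ring :: 'k ring) W V"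
begin

interpretation V: vectorspace "class_ring :: 'k ring" V
  by (rule subspaceD(1)[OF W])

lemma subspace_abelian_subgroup: "abelian_subgroup W V"
proof (rule abelian_subgroupI3)
  show "additive_subgroup W V"
  proof (rule additive_subgroupI, unfold_locales)
    show "W \<subseteq> carrier (add_monoid V)" using subspaceD(2)[OF W] by simp
    fix x assume x: "x \<in> W"
    then have "x \<in> carrier V" using subspaceD(2)[OF W] by auto
    then have "\<ominus>\<^bsub>V\<^esub> x = (-1) \<odot>\<^bsub>V\<^esub> x"
      using V.smult_minus_1[of x] by (simp add: class_ring_simps)
    then show "inv\<^bsub>add_monoid V\<^esub> x \<in> W"
      using subspaceD(5)[OF W x] by (simp add: a_inv_def)
  qed (use subspaceD(3,4)[OF W] in auto)
  show "abelian_group V" by unfold_locales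
qed

interpretation S: abelian_subgroup W V by (rule subspace_abelian_subgroup)

lemma coset_eq_iff:
  assumes "v \<in> carrier V" "w \<in> carrier V"
  shows "W +>\<^bsub>V\<^esub> v = W +>\<^bsub>V\<^esub> w \<longleftrightarrow> (\<exists>u\<in>W. v = u \<oplus>\<^bsub>V\<^esub> w)"
proof
  assume "W +>\<^bsub>V\<^esub> v = W +>\<^bsub>V\<^esub> w"
  then have "v \<in> W +>\<^bsub>V\<^esub> w" using S.a_rcos_self[OF assms(1)] by simp
  then show "\<exists>u\<in>W. v = u \<oplus>\<^bsub>V\<^esub> w" by (auto simp: a_r_coset_def')
next
  assume "\<exists>u\<in>W. v = u \<oplus>\<^bsub>V\<^esub> w"
  then have "v \<in> W +>\<^bsub>V\<^esub> w" by (auto simp: a_r_coset_def')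
  then show "W +>\<^bsub>V\<^esub> v = W +>\<^bsub>V\<^esub> w"
    using S.a_repr_independence' assms by simp
qed

lemma coset_zero: "W +>\<^bsub>V\<^esub> \<zero>\<^bsub>V\<^esub> = W"
  using subspaceD(2)[OF W] by simp

lemma coset_eq_self_iff: "v \<in> carrier V \<Longrightarrow> W +>\<^bsub>V\<^esub> v = W \<longleftrightarrow> v \<in> W"
  using coset_eq_iff[of v "\<zero>\<^bsub>V\<^esub>"] coset_zero subspaceD(2)[OF W] by (auto simp: subset_iff)

lemma carrier_quotient: "carrier (quotient_module V W) = (\<lambda>v. W +>\<^bsub>V\<^esub> v) ` carrier V"
  by (auto simp: quotient_module_def A_RCOSETS_def')

lemma quotient_add:
  "v \<in> carrier V \<Longrightarrow> w \<in> carrier V \<Longrightarrow>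
    (W +>\<^bsub>V\<^esub> v) \<oplus>\<^bsub>quotient_module V W\<^esub> (W +>\<^bsub>V\<^esub> w) = W +>\<^bsub>V\<^esub> (v \<oplus>\<^bsub>V\<^esub> w)"
  by (simp add: quotient_module_def S.a_rcos_sum)

lemma quotient_zero: "\<zero>\<^bsub>quotient_module V W\<^esub> = W"
  by (simp add: quotient_module_def)

end

text \<open>As \<open>T\<close> maps \<open>W\<close> into \<open>W'\<close>, all members of the
  union are the same coset. This evaluates both the scalar multiplication and the arrows of a
  quotient, which are defined by such unions.\<close>

lemma coset_UN:
  fixes V :: "('k::field, 'b) module" and V' :: "('k, 'c) module"
  assumes W: "subspace (class_ring :: 'k ring) W V" and W': "subspace (class_ring :: 'k ring) W' V'"
    and v: "v \<in> carrier V"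
    and T: "\<And>v. v \<in> carrier V \<Longrightarrow> T v \<in> carrier V'" "\<And>v. v \<in> W \<Longrightarrow> T v \<in> W'"
      "\<And>v w. v \<in> carrier V \<Longrightarrow> w \<in> carrier V \<Longrightarrow> T (v \<oplus>\<^bsub>V\<^esub> w) = T v \<oplus>\<^bsub>V'\<^esub> T w"
  shows "(\<Union>x\<in>W +>\<^bsub>V\<^esub> v. W' +>\<^bsub>V'\<^esub> T x) = W' +>\<^bsub>V'\<^esub> T v"
proof -
  interpret S: abelian_subgroup W V by (rule subspace_abelian_subgroup[OF W])
  have *: "W' +>\<^bsub>V'\<^esub> T x = W' +>\<^bsub>V'\<^esub> T v" if "x \<in> W +>\<^bsub>V\<^esub> v" for x
  proof -
    from that obtain u where u: "u \<in> W" "x = u \<oplus>\<^bsub>V\<^esub> v" unfolding a_r_coset_def' by blast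
    have uV: "u \<in> carrier V" using u subspaceD(2)[OF W] by blast
    have x: "T x = T u \<oplus>\<^bsub>V'\<^esub> T v" unfolding u(2) by (rule T(3)[OF uV v])
    show ?thesis
      unfolding coset_eq_iff[OF W' T(1)[OF S.a_elemrcos_carrier[OF v that]] T(1)[OF v]]
      using x T(2)[OF u(1)] by blast
  qed
  have "(\<Union>x\<in>W +>\<^bsub>V\<^esub> v. W' +>\<^bsub>V'\<^esub> T x) = (\<Union>x\<in>W +>\<^bsub>V\<^esub> v. W' +>\<^bsub>V'\<^esub> T v)"
    by (rule SUP_cong[OF refl]) (rule *)
  also have "\<dots> = W' +>\<^bsub>V'\<^esub> T v"
    using S.a_rcos_self[OF v] by blast
  finally show ?thesis .
qed

lemma quotient_smult:
  assumes W: "subspace (class_ring :: 'k::field ring) W V" and v: "v \<in> carrier V"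
  shows "c \<odot>\<^bsub>quotient_module V W\<^esub> (W +>\<^bsub>V\<^esub> v) = W +>\<^bsub>V\<^esub> (c \<odot>\<^bsub>V\<^esub> v)"
proof -
  interpret V: vectorspace "class_ring :: 'k ring" V by (rule subspaceD(1)[OF W])
  have "(\<Union>x\<in>W +>\<^bsub>V\<^esub> v. W +>\<^bsub>V\<^esub> (c \<odot>\<^bsub>V\<^esub> x)) = W +>\<^bsub>V\<^esub> (c \<odot>\<^bsub>V\<^esub> v)"
    by (rule coset_UN[OF W W v])
       (use vectorspaceD(3)[OF subspaceD(1)[OF W]] subspaceD(5)[OF W] in
         \<open>auto simp: V.smult_r_distr[unfolded class_ring_simps]\<close>)
  then show ?thesis by (simp add: quotient_module_def)
qed

lemma quotient_linear_map:
  assumes W: "subspace (class_ring :: 'k::field ring) W V"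
  shows "linear_map (class_ring :: 'k ring) V (quotient_module V W) (\<lambda>v. W +>\<^bsub>V\<^esub> v)"
proof -
  have "vectorspace (class_ring :: 'k ring) (quotient_module V W)"
    by (rule vectorspace_image[OF subspaceD(1)[OF W], of "\<lambda>v. W +>\<^bsub>V\<^esub> v"])
       (simp_all add: carrier_quotient[OF W] coset_zero[OF W] quotient_zero[OF W] quotient_add[OF W] quotient_smult[OF W])
  then show ?thesis
    by (intro linear_mapI subspaceD(1)[OF W])
       (simp_all add: carrier_quotient[OF W] quotient_add[OF W] quotient_smult[OF W])
qed

lemma subrepsD:
  assumes "X \<in> subreps Q R"
  shows "i \<in> verts Q \<Longrightarrow> subspace class_ring (X i) (rep_space R i)"
    and "a \<in> arcs Q \<Longrightarrow> v \<in> X (tail Q a) \<Longrightarrow> rep_map R a v \<in> X (head Q a)"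
    and "X \<in> (\<Pi>\<^sub>E i\<in>verts Q. Pow (carrier (rep_space R i)))"
  using assms by (auto simp: subreps_def image_subset_iff)

context wf_digraph
begin

lemma rep_map_quotient:
  assumes R: "is_rep G R" and X: "X \<in> subreps G R" and a: "a \<in> arcs G"
    and v: "v \<in> carrier (rep_space R (tail G a))"
  shows "rep_map (quotient_rep G R X) a (X (tail G a) +>\<^bsub>rep_space R (tail G a)\<^esub> v) =
    X (head G a) +>\<^bsub>rep_space R (head G a)\<^esub> rep_map R a v"
proof -
  have ends: "tail G a \<in> verts G" "head G a \<in> verts G" using a by auto
  note L = linear_mapD[OF is_repD(3)[OF R a]]
  show ?thesis
    unfolding quotient_rep_def quiver_rep.simps
    by (rule coset_UN[OF subrepsD(1)[OF X ends(1)] subrepsD(1)[OF X ends(2)] v L(3) subrepsD(2)[OF X a] L(4)])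
qed

lemma is_rep_quotient:
  fixes R :: "('a, 'b, 'k::{field, finite}, 'c) quiver_rep"
  assumes R: "is_rep G R" and X: "X \<in> subreps G R"
  shows "is_rep G (quotient_rep G R X)"
  unfolding is_rep_def
proof (intro conjI ballI)
  have space: "rep_space (quotient_rep G R X) i = quotient_module (rep_space R i) (X i)" for i
    by (simp add: quotient_rep_def)
  fix i assume i: "i \<in> verts G"
  note q = quotient_linear_map[OF subrepsD(1)[OF X i]]
  show v: "vectorspace class_ring (rep_space (quotient_rep G R X) i)"
    unfolding space by (rule linear_mapD(2)[OF q])
  have "finite (carrier (rep_space (quotient_rep G R X) i))"
    unfolding space carrier_quotient[OF subrepsD(1)[OF X i]]
    by (rule finite_imageI[OF is_rep_finite_carrier[OF R i]])
  then show "vectorspace.fin_dim class_ring (rep_space (quotient_rep G R X) i)"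
    by (rule finite_imp_fin_dim[OF v])
next
  have space: "rep_space (quotient_rep G R X) i = quotient_module (rep_space R i) (X i)" for i
    by (simp add: quotient_rep_def)
  fix a assume a: "a \<in> arcs G"
  then have ends: "tail G a \<in> verts G" "head G a \<in> verts G" by auto
  note L = linear_mapD[OF is_repD(3)[OF R a]]
  note qt = linear_mapD[OF quotient_linear_map[OF subrepsD(1)[OF X ends(1)]]]
  note qh = linear_mapD[OF quotient_linear_map[OF subrepsD(1)[OF X ends(2)]]]
  note vt = vectorspaceD[OF is_repD(1)[OF R ends(1)]]
  note m = rep_map_quotient[OF R X a]
  have carr: "carrier (quotient_module (rep_space R (tail G a)) (X (tail G a))) =
      (\<lambda>v. X (tail G a) +>\<^bsub>rep_space R (tail G a)\<^esub> v) ` carrier (rep_space R (tail G a))"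
    by (rule carrier_quotient[OF subrepsD(1)[OF X ends(1)]])
  show "linear_map class_ring (rep_space (quotient_rep G R X) (tail G a)) (rep_space (quotient_rep G R X) (head G a))
      (rep_map (quotient_rep G R X) a)"
    unfolding space
  proof (rule linear_mapI[OF qt(2) qh(2)], unfold carr)
    fix C assume "C \<in> (\<lambda>v. X (tail G a) +>\<^bsub>rep_space R (tail G a)\<^esub> v) ` carrier (rep_space R (tail G a))"
    then obtain v where v: "v \<in> carrier (rep_space R (tail G a))" "C = X (tail G a) +>\<^bsub>rep_space R (tail G a)\<^esub> v" by blast
    show "rep_map (quotient_rep G R X) a C \<in> carrier (quotient_module (rep_space R (head G a)) (X (head G a)))"
      unfolding v(2) m[OF v(1)] by (rule qh(3)[OF L(3)[OF v(1)]])
    show "rep_map (quotient_rep G R X) a (c \<odot>\<^bsub>quotient_module (rep_space R (tail G a)) (X (tail G a))\<^esub> C) =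
      c \<odot>\<^bsub>quotient_module (rep_space R (head G a)) (X (head G a))\<^esub> rep_map (quotient_rep G R X) a C" for c
      unfolding v(2) qt(5)[OF v(1), symmetric] m[OF v(1)] m[OF vt(3)[OF v(1)]] L(5)[OF v(1)]
      by (rule qh(5)[OF L(3)[OF v(1)]])
    fix D assume "D \<in> (\<lambda>v. X (tail G a) +>\<^bsub>rep_space R (tail G a)\<^esub> v) ` carrier (rep_space R (tail G a))"
    then obtain w where w: "w \<in> carrier (rep_space R (tail G a))" "D = X (tail G a) +>\<^bsub>rep_space R (tail G a)\<^esub> w" by blast
    show "rep_map (quotient_rep G R X) a (C \<oplus>\<^bsub>quotient_module (rep_space R (tail G a)) (X (tail G a))\<^esub> D) =
      rep_map (quotient_rep G R X) a C \<oplus>\<^bsub>quotient_module (rep_space R (head G a)) (X (head G a))\<^esub> rep_map (quotient_rep G R X) a D"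
      unfolding v(2) w(2) qt(4)[OF v(1) w(1), symmetric] m[OF v(1)] m[OF w(1)] m[OF vt(2)[OF v(1) w(1)]] L(4)[OF v(1) w(1)]
      by (rule qh(4)[OF L(3)[OF v(1)] L(3)[OF w(1)]])
  qed
qed

lemma is_rep_subrep:
  fixes R :: "('a, 'b, 'k::{field, finite}, 'c) quiver_rep"
  assumes R: "is_rep G R" and X: "X \<in> subreps G R"
  shows "is_rep G (subrep R X)"
  unfolding is_rep_def
proof (intro conjI ballI)
  fix i assume i: "i \<in> verts G"
  note s = subspaceD[OF subrepsD(1)[OF X i]]
  show v: "vectorspace class_ring (rep_space (subrep R X) i)"
    using s(6) by (simp add: subrep_def)
  have "finite (carrier (rep_space (subrep R X) i))"
    using finite_subset[OF s(2) is_rep_finite_carrier[OF R i]] by (simp add: subrep_def)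
  then show "vectorspace.fin_dim class_ring (rep_space (subrep R X) i)"
    by (rule finite_imp_fin_dim[OF v])
next
  fix a assume a: "a \<in> arcs G"
  then have ends: "tail G a \<in> verts G" "head G a \<in> verts G" by auto
  note L = linear_mapD[OF is_repD(3)[OF R a]]
  note st = subspaceD[OF subrepsD(1)[OF X ends(1)]] and sh = subspaceD[OF subrepsD(1)[OF X ends(2)]]
  show "linear_map class_ring (rep_space (subrep R X) (tail G a)) (rep_space (subrep R X) (head G a))
      (rep_map (subrep R X) a)"
    using st sh L(4,5) subrepsD(2)[OF X a]
    by (intro linear_mapI) (auto simp: subrep_def subset_iff)
qed

section \<open>Representations given by matrices\<close>

definition point_rep :: "('a \<Rightarrow> nat) \<Rightarrow> ('b \<Rightarrow> 'k::field mat) \<Rightarrow> ('a, 'b, 'k, 'k vec) quiver_rep" where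
  "point_rep d x = \<lparr>rep_space = (\<lambda>i. module_vec TYPE('k) (d i)), rep_map = (\<lambda>a v. x a *\<^sub>v v)\<rparr>"

text \<open>The representation space of dimension \<open>d\<close>; isomorphism classes of that
  dimension are its orbits under base change at the vertices.\<close>

definition points :: "('a \<Rightarrow> nat) \<Rightarrow> ('b \<Rightarrow> 'k mat) set" where
  "points d = (\<Pi>\<^sub>E a\<in>arcs G. carrier_mat (d (head G a)) (d (tail G a)))"

lemma point_rep_simps [simp]:
  fixes x :: "'b \<Rightarrow> 'k::field mat"
  shows "rep_space (point_rep d x) i = module_vec TYPE('k) (d i)"
    and "rep_map (point_rep d x) a v = x a *\<^sub>v v"
  by (simp_all add: point_rep_def)

lemma pointsD: "x \<in> points d \<Longrightarrow> a \<in> arcs G \<Longrightarrow> x a \<in> carrier_mat (d (head G a)) (d (tail G a))"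
  by (auto simp: points_def)

lemma is_rep_point_rep:
  fixes x :: "'b \<Rightarrow> 'k::field mat"
  assumes "x \<in> points d"
  shows "is_rep G (point_rep d x)"
proof -
  have "vectorspace.fin_dim class_ring (module_vec TYPE('k) n)" for n
    by (rule vec_space.fin_dim)
  then show ?thesis
    unfolding is_rep_def using linear_map_mult_mat_vec[OF pointsD[OF assms]]
    by (auto simp: point_rep_def)
qed

lemma ex_isomorphic_point_rep:
  fixes N :: "('a, 'b, 'k::field, 'c) quiver_rep"
  assumes N: "is_rep G N" and d: "\<And>i. i \<in> verts G \<Longrightarrow> rep_dim N i = d i"
  shows "\<exists>x\<in>points d. rep_isomorphic G (point_rep d x) N"
proof -
  have "\<forall>i\<in>verts G. \<exists>T. linear_map (class_ring :: 'k ring) (module_vec TYPE('k) (d i)) (rep_space N i) T \<and>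
      bij_betw T (carrier_vec (d i)) (carrier (rep_space N i))"
    using ex_coordinates[OF is_repD(1,2)[OF N]] d by (simp add: rep_dim_def)
  then obtain g where g: "\<And>i. i \<in> verts G \<Longrightarrow> linear_map (class_ring :: 'k ring) (module_vec TYPE('k) (d i)) (rep_space N i) (g i)"
    "\<And>i. i \<in> verts G \<Longrightarrow> bij_betw (g i) (carrier_vec (d i)) (carrier (rep_space N i))"
    by metis
  define g' where "g' i = inv_into (carrier_vec (d i)) (g i)" for i
  have g': "linear_map (class_ring :: 'k ring) (rep_space N i) (module_vec TYPE('k) (d i)) (g' i)" if "i \<in> verts G" for i
    using linear_map_inv_into[OF g(1)[OF that]] g(2)[OF that] by (simp add: g'_def)
  have "\<forall>a\<in>arcs G. \<exists>A\<in>carrier_mat (d (head G a)) (d (tail G a)). \<forall>v\<in>carrier_vec (d (tail G a)).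
      g' (head G a) (rep_map N a (g (tail G a) v)) = A *\<^sub>v v"
  proof
    fix a assume a: "a \<in> arcs G"
    then have ends: "tail G a \<in> verts G" "head G a \<in> verts G" by auto
    have "linear_map (class_ring :: 'k ring) (module_vec TYPE('k) (d (tail G a))) (module_vec TYPE('k) (d (head G a)))
        (g' (head G a) \<circ> (rep_map N a \<circ> g (tail G a)))"
      by (intro linear_map_comp[OF linear_map_comp[OF g(1)[OF ends(1)] is_repD(3)[OF N a]] g'[OF ends(2)]])
    from ex_mat_of_linear_map[OF this]
    show "\<exists>A\<in>carrier_mat (d (head G a)) (d (tail G a)). \<forall>v\<in>carrier_vec (d (tail G a)).
      g' (head G a) (rep_map N a (g (tail G a) v)) = A *\<^sub>v v" by simp
  qed
  then obtain A where A: "\<And>a. a \<in> arcs G \<Longrightarrow> A a \<in> carrier_mat (d (head G a)) (d (tail G a))"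
    "\<And>a v. a \<in> arcs G \<Longrightarrow> v \<in> carrier_vec (d (tail G a)) \<Longrightarrow> g' (head G a) (rep_map N a (g (tail G a) v)) = A a *\<^sub>v v"
    by metis
  define x where "x = restrict A (arcs G)"
  have x: "x \<in> points d" using A(1) by (auto simp: x_def points_def)
  have "is_rep_iso G (point_rep d x) N g"
    unfolding is_rep_iso_def
  proof (intro conjI ballI)
    fix a v assume a: "a \<in> arcs G" and "v \<in> carrier (rep_space (point_rep d x) (tail G a))"
    then have v: "v \<in> carrier_vec (d (tail G a))" by simp
    have ends: "tail G a \<in> verts G" "head G a \<in> verts G" using a by auto
    have "rep_map N a (g (tail G a) v) \<in> carrier (rep_space N (head G a))"
      using linear_mapD(3)[OF g(1)[OF ends(1)]] v by (intro rep_map_closed[OF N a]) simp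
    then have "g (head G a) (g' (head G a) (rep_map N a (g (tail G a) v))) = rep_map N a (g (tail G a) v)"
      using g(2)[OF ends(2)] by (simp add: g'_def bij_betw_def f_inv_into_f)
    then show "g (head G a) (rep_map (point_rep d x) a v) = rep_map N a (g (tail G a) v)"
      using A(2)[OF a v] a by (simp add: x_def)
  qed (use g in simp_all)
  with x show ?thesis by (auto simp: rep_isomorphic_def)
qed

end

section \<open>Extensions of a coordinate subrepresentation\<close>

text \<open>\<open>J i\<close> lists the coordinates at \<open>i\<close> that belong to the
  subrepresentation. The second assumption says that all matrices are block triangular for this
  partition.\<close>

locale coordinate_subrep = fin_digraph G for G :: "('a, 'b) pre_digraph" +
  fixes d :: "'a \<Rightarrow> nat" and J :: "'a \<Rightarrow> nat set" and x :: "'b \<Rightarrow> 'k::{field, finite} mat"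
  assumes x_point: "x \<in> points d"
    and x_preserves: "\<And>a r c. a \<in> arcs G \<Longrightarrow> r < d (head G a) \<Longrightarrow> c < d (tail G a) \<Longrightarrow>
      c \<in> J (tail G a) \<Longrightarrow> r \<notin> J (head G a) \<Longrightarrow> x a $$ (r, c) = 0"
begin

definition coord :: "'a \<Rightarrow> 'k vec set" where
  "coord i = {v \<in> carrier_vec (d i). \<forall>j<d i. j \<notin> J i \<longrightarrow> v $ j = 0}"

definition coords :: "'a \<Rightarrow> 'k vec set" where
  "coords = restrict coord (verts G)"

abbreviation M :: "('a, 'b, 'k, 'k vec) quiver_rep" where "M \<equiv> point_rep d x"

lemma coord_carrier: "v \<in> coord i \<Longrightarrow> v \<in> carrier_vec (d i)"
  by (simp add: coord_def)

lemma x_carrier: "a \<in> arcs G \<Longrightarrow> x a \<in> carrier_mat (d (head G a)) (d (tail G a))"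
  by (rule pointsD[OF x_point])

lemma x_mult_carrier: "a \<in> arcs G \<Longrightarrow> v \<in> carrier_vec (d (tail G a)) \<Longrightarrow> x a *\<^sub>v v \<in> carrier_vec (d (head G a))"
  using x_carrier by (rule mult_mat_vec_carrier)

lemma x_mult_coord:
  assumes a: "a \<in> arcs G" and v: "v \<in> coord (tail G a)"
  shows "x a *\<^sub>v v \<in> coord (head G a)"
proof -
  have "(x a *\<^sub>v v) $ r = 0" if r: "r < d (head G a)" "r \<notin> J (head G a)" for r
  proof -
    have "(x a *\<^sub>v v) $ r = (\<Sum>c = 0..<d (tail G a). x a $$ (r, c) * v $ c)"
      using x_carrier[OF a] coord_carrier[OF v] r by (simp add: scalar_prod_def)
    also have "\<dots> = 0"
      using x_preserves[OF a r(1)] r v by (intro sum.neutral ballI) (auto simp: coord_def)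
    finally show ?thesis .
  qed
  then show ?thesis using x_mult_carrier[OF a coord_carrier[OF v]] by (simp add: coord_def)
qed

lemma subspace_coord: "subspace (class_ring :: 'k ring) (coord i) (module_vec TYPE('k) (d i))"
  by (rule subspaceI) (auto simp: coord_def)

lemma coord_closed:
  "v \<in> coord i \<Longrightarrow> w \<in> coord i \<Longrightarrow> v + w \<in> coord i"
  "v \<in> coord i \<Longrightarrow> c \<cdot>\<^sub>v v \<in> coord i"
  "0\<^sub>v (d i) \<in> coord i"
  by (auto simp: coord_def)

lemma is_rep_M: "is_rep G M"
  by (rule is_rep_point_rep[OF x_point])

lemma coords_subreps: "coords \<in> subreps G M"
  unfolding subreps_def
  using subspace_coord x_mult_coord by (auto simp: coords_def coord_carrier)

text \<open>A frame of \<open>R\<close> in which the subrepresentation and the quotient have the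
  matrices of \<open>x\<close>, while the block from the quotient to the subrepresentation is left
  open: intertwining is exact on the coordinate subspaces and holds elsewhere up to a vector in
  them.\<close>

definition is_adapted :: "('a, 'b, 'k, 'c) quiver_rep \<Rightarrow> ('a \<Rightarrow> 'k vec \<Rightarrow> 'c) \<Rightarrow> bool" where
  "is_adapted R g \<longleftrightarrow>
    (\<forall>i\<in>verts G. linear_map class_ring (module_vec TYPE('k) (d i)) (rep_space R i) (g i) \<and>
      bij_betw (g i) (carrier_vec (d i)) (carrier (rep_space R i))) \<and>
    (\<forall>a\<in>arcs G. \<forall>v\<in>coord (tail G a). rep_map R a (g (tail G a) v) = g (head G a) (x a *\<^sub>v v)) \<and>
    (\<forall>a\<in>arcs G. \<forall>v\<in>carrier_vec (d (tail G a)). \<exists>w\<in>coord (head G a).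
      rep_map R a (g (tail G a) v) = g (head G a) (x a *\<^sub>v v + w))"

definition adapted :: "('a, 'b, 'k, 'c) quiver_rep \<Rightarrow> ('a \<Rightarrow> 'c set) \<Rightarrow> ('a \<Rightarrow> 'k vec \<Rightarrow> 'c) set" where
  "adapted R X = {g \<in> (\<Pi>\<^sub>E i\<in>verts G. carrier_vec (d i) \<rightarrow>\<^sub>E carrier (rep_space R i)).
     is_adapted R g \<and> (\<forall>i\<in>verts G. g i ` coord i = X i)}"

lemma is_adaptedD:
  assumes "is_adapted R g"
  shows "i \<in> verts G \<Longrightarrow> linear_map class_ring (module_vec TYPE('k) (d i)) (rep_space R i) (g i)"
    and "i \<in> verts G \<Longrightarrow> bij_betw (g i) (carrier_vec (d i)) (carrier (rep_space R i))"
    and "a \<in> arcs G \<Longrightarrow> v \<in> coord (tail G a) \<Longrightarrow> rep_map R a (g (tail G a) v) = g (head G a) (x a *\<^sub>v v)"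
    and "a \<in> arcs G \<Longrightarrow> v \<in> carrier_vec (d (tail G a)) \<Longrightarrow>
      \<exists>w\<in>coord (head G a). rep_map R a (g (tail G a) v) = g (head G a) (x a *\<^sub>v v + w)"
  using assms by (auto simp: is_adapted_def)

lemma is_adapted_closed:
  "is_adapted R g \<Longrightarrow> i \<in> verts G \<Longrightarrow> v \<in> carrier_vec (d i) \<Longrightarrow> g i v \<in> carrier (rep_space R i)"
  using linear_mapD(3)[OF is_adaptedD(1)] by fastforce

lemma is_adapted_add:
  "is_adapted R g \<Longrightarrow> i \<in> verts G \<Longrightarrow> v \<in> carrier_vec (d i) \<Longrightarrow> w \<in> carrier_vec (d i) \<Longrightarrow>
    g i (v + w) = g i v \<oplus>\<^bsub>rep_space R i\<^esub> g i w"
  using linear_mapD(4)[OF is_adaptedD(1)] by fastforce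

lemma is_adapted_cong:
  assumes "is_adapted R g" and eq: "\<And>i v. i \<in> verts G \<Longrightarrow> v \<in> carrier_vec (d i) \<Longrightarrow> h i v = g i v"
  shows "is_adapted R h"
  unfolding is_adapted_def
proof (intro conjI ballI)
  note D = is_adaptedD[OF assms(1)]
  fix i assume i: "i \<in> verts G"
  show "linear_map class_ring (module_vec TYPE('k) (d i)) (rep_space R i) (h i)"
    using linear_map_cong[OF D(1)[OF i], of "h i"] eq[OF i] by simp
  show "bij_betw (h i) (carrier_vec (d i)) (carrier (rep_space R i))"
    using D(2)[OF i] eq[OF i] by (simp cong: bij_betw_cong)
next
  note D = is_adaptedD[OF assms(1)]
  fix a v assume a: "a \<in> arcs G" and v: "v \<in> coord (tail G a)"
  show "rep_map R a (h (tail G a) v) = h (head G a) (x a *\<^sub>v v)"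
    using D(3)[OF a v] eq a coord_carrier[OF v] x_mult_carrier[OF a] by simp
next
  note D = is_adaptedD[OF assms(1)]
  fix a and v :: "'k vec" assume a: "a \<in> arcs G" and v: "v \<in> carrier_vec (d (tail G a))"
  from D(4)[OF this] obtain w where "w \<in> coord (head G a)" "rep_map R a (g (tail G a) v) = g (head G a) (x a *\<^sub>v v + w)"
    by blast
  then show "\<exists>w\<in>coord (head G a). rep_map R a (h (tail G a) v) = h (head G a) (x a *\<^sub>v v + w)"
    using eq a v x_mult_carrier[OF a v] coord_carrier by (intro bexI[of _ w]) auto
qed

text \<open>Cuts a family down to an extensional one, so that adapted families can be compared and
  counted by their values on the carriers.\<close>

definition trim :: "('a \<Rightarrow> 'k vec \<Rightarrow> 'c) \<Rightarrow> 'a \<Rightarrow> 'k vec \<Rightarrow> 'c" where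
  "trim g = (\<lambda>i\<in>verts G. restrict (g i) (carrier_vec (d i)))"

lemma trim_apply [simp]: "i \<in> verts G \<Longrightarrow> v \<in> carrier_vec (d i) \<Longrightarrow> trim g i v = g i v"
  by (simp add: trim_def)

lemma trim_adapted:
  assumes g: "is_adapted R g" and X: "\<And>i. i \<in> verts G \<Longrightarrow> g i ` coord i = X i"
  shows "trim g \<in> adapted R X"
proof -
  have "is_adapted R (trim g)" by (rule is_adapted_cong[OF g]) simp
  moreover have "trim g i ` coord i = X i" if "i \<in> verts G" for i
    using X[OF that] that coord_carrier by (auto simp: image_iff coord_carrier)
  moreover have "trim g \<in> (\<Pi>\<^sub>E i\<in>verts G. carrier_vec (d i) \<rightarrow>\<^sub>E carrier (rep_space R i))"
    using is_adapted_closed[OF g] by (auto simp: trim_def)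
  ultimately show ?thesis by (simp add: adapted_def)
qed

lemma adapted_eqI:
  assumes "g \<in> adapted R X" "h \<in> adapted R Y"
    and "\<And>i v. i \<in> verts G \<Longrightarrow> v \<in> carrier_vec (d i) \<Longrightarrow> g i v = h i v"
  shows "g = h"
proof -
  have *: "g \<in> (\<Pi>\<^sub>E i\<in>verts G. carrier_vec (d i) \<rightarrow>\<^sub>E carrier (rep_space R i))"
    "h \<in> (\<Pi>\<^sub>E i\<in>verts G. carrier_vec (d i) \<rightarrow>\<^sub>E carrier (rep_space R i))"
    using assms by (auto simp: adapted_def)
  then show ?thesis
  proof (rule PiE_ext)
    fix i assume i: "i \<in> verts G"
    show "g i = h i" by (rule PiE_ext[OF PiE_mem[OF *(1) i] PiE_mem[OF *(2) i] assms(3)[OF i]])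
  qed
qed

lemma adaptedD:
  assumes "g \<in> adapted R X"
  shows "is_adapted R g" "i \<in> verts G \<Longrightarrow> g i ` coord i = X i"
  using assms by (auto simp: adapted_def)

text \<open>The adapted frames for \<open>(R, X)\<close> are a torsor under those for
  \<open>(M, coords)\<close>. Their number is thus one constant for all \<open>R\<close> and
  \<open>X\<close>, which is all that the double count asks of it.\<close>

lemma card_adapted:
  assumes "adapted R X \<noteq> {}"
  shows "card (adapted R X) = card (adapted M coords)"
proof -
  from assms obtain g where "g \<in> adapted R X" by blast
  note g = adaptedD(1)[OF this] and gX = adaptedD(2)[OF this]
  define g' where "g' i = inv_into (carrier_vec (d i)) (g i)" for i
  note D = is_adaptedD[OF g]
  have inv: "g' i (g i v) = v" if "i \<in> verts G" "v \<in> carrier_vec (d i)" for i v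
    using D(2)[OF that(1)] that(2) by (simp add: g'_def bij_betw_def)
  have inv': "g i (g' i w) = w" "g' i w \<in> carrier_vec (d i)" if "i \<in> verts G" "w \<in> carrier (rep_space R i)" for i w
    using D(2)[OF that(1)] that(2) by (simp_all add: g'_def bij_betw_def f_inv_into_f inv_into_into)
  have lin': "linear_map class_ring (rep_space R i) (module_vec TYPE('k) (d i)) (g' i)" if "i \<in> verts G" for i
    unfolding g'_def using linear_map_inv_into[OF D(1)[OF that]] D(2)[OF that] by simp
  have bij': "bij_betw (g' i) (carrier (rep_space R i)) (carrier_vec (d i))" if "i \<in> verts G" for i
    unfolding g'_def by (rule bij_betw_inv_into[OF D(2)[OF that]])
  have A: "trim (\<lambda>i. g i \<circ> h i) \<in> adapted R X" if "h \<in> adapted M coords" for h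
  proof (rule trim_adapted)
    note h = adaptedD(1)[OF that] and hX = adaptedD(2)[OF that]
    note H = is_adaptedD[OF h]
    have hc: "h i v \<in> carrier_vec (d i)" if "i \<in> verts G" "v \<in> carrier_vec (d i)" for i v
      using is_adapted_closed[OF h that] by simp
    have hcoord: "h i ` coord i = coord i" if "i \<in> verts G" for i
      using hX[OF that] that by (simp add: coords_def)
    have hadd: "h i (v + w) = h i v + h i w" if "i \<in> verts G" "v \<in> carrier_vec (d i)" "w \<in> carrier_vec (d i)" for i v w
      using is_adapted_add[OF h that] by simp
    show "(g i \<circ> h i) ` coord i = X i" if "i \<in> verts G" for i
      unfolding image_comp[symmetric] using hcoord[OF that] gX[OF that] by simp
    show "is_adapted R (\<lambda>i. g i \<circ> h i)"
      unfolding is_adapted_def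
    proof (intro conjI ballI)
      fix i assume i: "i \<in> verts G"
      show "linear_map class_ring (module_vec TYPE('k) (d i)) (rep_space R i) (g i \<circ> h i)"
        using linear_map_comp[OF H(1)[OF i]] D(1)[OF i] by simp
      show "bij_betw (g i \<circ> h i) (carrier_vec (d i)) (carrier (rep_space R i))"
        using bij_betw_trans[OF H(2)[OF i]] D(2)[OF i] by simp
    next
      fix a v assume a: "a \<in> arcs G" and v: "v \<in> coord (tail G a)"
      have ends: "tail G a \<in> verts G" "head G a \<in> verts G" using a by auto
      have "h (tail G a) v \<in> coord (tail G a)" using hcoord[OF ends(1)] v by blast
      then show "rep_map R a ((g (tail G a) \<circ> h (tail G a)) v) = (g (head G a) \<circ> h (head G a)) (x a *\<^sub>v v)"
        using D(3)[OF a] H(3)[OF a v] by simp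
    next
      fix a and v :: "'k vec" assume a: "a \<in> arcs G" and v: "v \<in> carrier_vec (d (tail G a))"
      have ends: "tail G a \<in> verts G" "head G a \<in> verts G" using a by auto
      obtain w1 where w1: "w1 \<in> coord (head G a)" "x a *\<^sub>v h (tail G a) v = h (head G a) (x a *\<^sub>v v + w1)"
        using H(4)[OF a v] by auto
      obtain w2 where w2: "w2 \<in> coord (head G a)"
        "rep_map R a (g (tail G a) (h (tail G a) v)) = g (head G a) (x a *\<^sub>v h (tail G a) v + w2)"
        using D(4)[OF a hc[OF ends(1) v]] by blast
      \<comment> \<open>\<open>h\<close> preserves the coordinate subspace, so the error of
        \<open>g\<close> can be moved inside \<open>h\<close>; the error of the composite is
        \<open>w1 + w3\<close>.\<close>
      from w2(1) hcoord[OF ends(2)] obtain w3 where w3: "w3 \<in> coord (head G a)" "w2 = h (head G a) w3" by blast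
      have xv: "x a *\<^sub>v v \<in> carrier_vec (d (head G a))" by (rule x_mult_carrier[OF a v])
      note c = coord_carrier[OF w1(1)] coord_carrier[OF w3(1)]
      have "x a *\<^sub>v h (tail G a) v + w2 = h (head G a) (x a *\<^sub>v v + w1 + w3)"
        unfolding w1(2) w3(2) using hadd[OF ends(2), of "x a *\<^sub>v v + w1" w3] xv c by simp
      also have "x a *\<^sub>v v + w1 + w3 = x a *\<^sub>v v + (w1 + w3)"
        using xv c by (rule assoc_add_vec)
      finally show "\<exists>w\<in>coord (head G a). rep_map R a ((g (tail G a) \<circ> h (tail G a)) v) =
          (g (head G a) \<circ> h (head G a)) (x a *\<^sub>v v + w)"
        using w2(2) coord_closed(1)[OF w1(1) w3(1)] by (intro bexI[of _ "w1 + w3"]) simp_all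
    qed
  qed
  have B: "trim (\<lambda>i. g' i \<circ> h i) \<in> adapted M coords" if "h \<in> adapted R X" for h
  proof (rule trim_adapted)
    note h = adaptedD(1)[OF that] and hX = adaptedD(2)[OF that]
    note H = is_adaptedD[OF h]
    have hc: "h i v \<in> carrier (rep_space R i)" if "i \<in> verts G" "v \<in> carrier_vec (d i)" for i v
      using is_adapted_closed[OF h that] by simp
    have k_coord: "g' i ` h i ` coord i = coord i" if "i \<in> verts G" for i
    proof -
      have "g' i ` h i ` coord i = (\<lambda>v. g' i (g i v)) ` coord i"
        unfolding hX[OF that] gX[OF that, symmetric] by (rule image_image)
      also have "\<dots> = (\<lambda>v. v) ` coord i"
        by (rule image_cong[OF refl]) (rule inv[OF that coord_carrier])
      finally show ?thesis by simp
    qed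
    show "(g' i \<circ> h i) ` coord i = coords i" if "i \<in> verts G" for i
      unfolding image_comp[symmetric] using k_coord that by (simp add: coords_def)
    have kc: "g' i (h i v) \<in> carrier_vec (d i)" if "i \<in> verts G" "v \<in> carrier_vec (d i)" for i v
      by (rule inv'(2)[OF that(1) hc[OF that]])
    have gk: "g i (g' i (h i v)) = h i v" if "i \<in> verts G" "v \<in> carrier_vec (d i)" for i v
      by (rule inv'(1)[OF that(1) hc[OF that]])
    have inj: "v = w" if "g i v = g i w" "i \<in> verts G" "v \<in> carrier_vec (d i)" "w \<in> carrier_vec (d i)" for i v w
      by (rule trans[OF trans[OF inv[OF that(2,3), symmetric] arg_cong[OF that(1), of "g' i"]] inv[OF that(2,4)]])
    show "is_adapted M (\<lambda>i. g' i \<circ> h i)"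
      unfolding is_adapted_def
    proof (intro conjI ballI)
      fix i assume i: "i \<in> verts G"
      show lin: "linear_map class_ring (module_vec TYPE('k) (d i)) (rep_space M i) (g' i \<circ> h i)"
        using linear_map_comp[OF H(1)[OF i] lin'[OF i]] by simp
      show "bij_betw (g' i \<circ> h i) (carrier_vec (d i)) (carrier (rep_space M i))"
        using bij_betw_trans[OF H(2)[OF i] bij'[OF i]] by simp
    next
      fix a v assume a: "a \<in> arcs G" and v: "v \<in> coord (tail G a)"
      have ends: "tail G a \<in> verts G" "head G a \<in> verts G" using a by auto
      have kv: "g' (tail G a) (h (tail G a) v) \<in> coord (tail G a)"
        using imageI[OF imageI[OF v, of "h (tail G a)"], of "g' (tail G a)"] k_coord[OF ends(1)] by simp
      have v': "v \<in> carrier_vec (d (tail G a))" by (rule coord_carrier[OF v])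
      have "g (head G a) (x a *\<^sub>v g' (tail G a) (h (tail G a) v)) = rep_map R a (h (tail G a) v)"
        using D(3)[OF a kv] gk[OF ends(1) v'] by simp
      also have "\<dots> = g (head G a) (g' (head G a) (h (head G a) (x a *\<^sub>v v)))"
        using H(3)[OF a v] gk[OF ends(2) x_mult_carrier[OF a v']] by simp
      finally show "rep_map M a ((g' (tail G a) \<circ> h (tail G a)) v) = (g' (head G a) \<circ> h (head G a)) (x a *\<^sub>v v)"
        using inj[OF _ ends(2) x_mult_carrier[OF a kc[OF ends(1) v']] kc[OF ends(2) x_mult_carrier[OF a v']]] by simp
    next
      fix a and v :: "'k vec" assume a: "a \<in> arcs G" and v: "v \<in> carrier_vec (d (tail G a))"
      have ends: "tail G a \<in> verts G" "head G a \<in> verts G" using a by auto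
      let ?k = "\<lambda>i v. g' i (h i v)"
      obtain w1 where w1: "w1 \<in> coord (head G a)" "rep_map R a (h (tail G a) v) = h (head G a) (x a *\<^sub>v v + w1)"
        using H(4)[OF a v] by blast
      obtain w2 where w2: "w2 \<in> coord (head G a)"
        "rep_map R a (g (tail G a) (?k (tail G a) v)) = g (head G a) (x a *\<^sub>v ?k (tail G a) v + w2)"
        using D(4)[OF a kc[OF ends(1) v]] by blast
      have "w2 \<in> g' (head G a) ` h (head G a) ` coord (head G a)"
        unfolding k_coord[OF ends(2)] by (rule w2(1))
      then obtain w3 where w3: "w3 \<in> coord (head G a)" "w2 = ?k (head G a) w3"
        unfolding image_image by (rule imageE)
      have xv: "x a *\<^sub>v v \<in> carrier_vec (d (head G a))" by (rule x_mult_carrier[OF a v])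
      have xkv: "x a *\<^sub>v ?k (tail G a) v \<in> carrier_vec (d (head G a))" by (rule x_mult_carrier[OF a kc[OF ends(1) v]])
      note c = coord_carrier[OF w1(1)] coord_carrier[OF w3(1)] coord_carrier[OF w2(1)]
      \<comment> \<open>The error of \<open>h\<close> minus the error of \<open>g\<close>
        transported by g'h; that the difference works is seen by cancelling \<open>w2\<close> on
        both sides.\<close>
      let ?w = "w1 + (-1) \<cdot>\<^sub>v w3"
      have w: "?w \<in> coord (head G a)" by (intro coord_closed w1 w3)
      have kadd: "?k (head G a) (u + w') = ?k (head G a) u + ?k (head G a) w'"
        if "u \<in> carrier_vec (d (head G a))" "w' \<in> carrier_vec (d (head G a))" for u w'
        using linear_mapD(4)[OF linear_map_comp[OF H(1)[OF ends(2)] lin'[OF ends(2)]]] that by simp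
      have "g (head G a) (x a *\<^sub>v ?k (tail G a) v + w2) = g (head G a) (?k (head G a) (x a *\<^sub>v v + w1))"
        using w1(2) w2(2) gk[OF ends(1) v] gk[OF ends(2), of "x a *\<^sub>v v + w1"] xv c by simp
      then have "x a *\<^sub>v ?k (tail G a) v + w2 = ?k (head G a) (x a *\<^sub>v v + w1)"
        by (rule inj[OF _ ends(2)]) (use xkv xv c kc[OF ends(2), of "x a *\<^sub>v v + w1"] in simp_all)
      also have "x a *\<^sub>v v + w1 = (x a *\<^sub>v v + ?w) + w3"
        using xv c by (intro eq_vecI) auto
      also have "?k (head G a) ((x a *\<^sub>v v + ?w) + w3) = ?k (head G a) (x a *\<^sub>v v + ?w) + w2"
        unfolding w3(2) using xv c by (intro kadd) auto
      finally have eq: "x a *\<^sub>v ?k (tail G a) v + w2 = ?k (head G a) (x a *\<^sub>v v + ?w) + w2" .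
      have "x a *\<^sub>v ?k (tail G a) v = ?k (head G a) (x a *\<^sub>v v + ?w)"
      proof -
        let ?u = "x a *\<^sub>v ?k (tail G a) v" and ?u' = "?k (head G a) (x a *\<^sub>v v + ?w)"
        have u': "?u' \<in> carrier_vec (d (head G a))"
          using xv coord_carrier[OF w] by (intro kc[OF ends(2)]) auto
        have "?u = (?u + w2) - w2" using xkv c x_carrier[OF a] by (intro eq_vecI) auto
        also have "\<dots> = ?u'" unfolding eq using u' c by (intro eq_vecI) auto
        finally show ?thesis .
      qed
      then show "\<exists>w\<in>coord (head G a). rep_map M a ((g' (tail G a) \<circ> h (tail G a)) v) =
          (g' (head G a) \<circ> h (head G a)) (x a *\<^sub>v v + w)"
        using w by (intro bexI[of _ ?w]) simp_all
    qed
  qed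
  have BA: "trim (\<lambda>i. g' i \<circ> trim (\<lambda>i. g i \<circ> h i) i) = h" if h: "h \<in> adapted M coords" for h
  proof (rule adapted_eqI[OF B[OF A[OF h]] h])
    fix i and v :: "'k vec" assume i: "i \<in> verts G" and v: "v \<in> carrier_vec (d i)"
    have "h i v \<in> carrier_vec (d i)"
      using is_adapted_closed[OF adaptedD(1)[OF h] i v] by simp
    then show "trim (\<lambda>i. g' i \<circ> trim (\<lambda>i. g i \<circ> h i) i) i v = h i v"
      by (simp add: i v inv)
  qed
  have AB: "trim (\<lambda>i. g i \<circ> trim (\<lambda>i. g' i \<circ> h i) i) = h" if h: "h \<in> adapted R X" for h
  proof (rule adapted_eqI[OF A[OF B[OF h]] h])
    fix i and v :: "'k vec" assume i: "i \<in> verts G" and v: "v \<in> carrier_vec (d i)"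
    note hv = is_adapted_closed[OF adaptedD(1)[OF h] i v]
    show "trim (\<lambda>i. g i \<circ> trim (\<lambda>i. g' i \<circ> h i) i) i v = h i v"
      by (simp add: i v inv'(1)[OF i hv] inv'(2)[OF i hv])
  qed
  let ?A = "\<lambda>h. trim (\<lambda>i. g i \<circ> h i)" and ?B = "\<lambda>h. trim (\<lambda>i. g' i \<circ> h i)"
  have A': "?A \<in> adapted M coords \<rightarrow> adapted R X"
  proof (rule Pi_I)
    fix h assume h: "h \<in> adapted M coords"
    show "?A h \<in> adapted R X" by (rule A[OF h])
  qed
  have B': "?B \<in> adapted R X \<rightarrow> adapted M coords"
  proof (rule Pi_I)
    fix h assume h: "h \<in> adapted R X"
    show "?B h \<in> adapted M coords" by (rule B[OF h])
  qed
  have "bij_betw ?A (adapted M coords) (adapted R X)"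
  proof (rule bij_betwI[OF A' B'])
    fix h assume h: "h \<in> adapted M coords"
    show "?B (?A h) = h" by (rule BA[OF h])
  next
    fix h assume h: "h \<in> adapted R X"
    show "?A (?B h) = h" by (rule AB[OF h])
  qed
  then have "card (adapted M coords) = card (adapted R X)" by (rule bij_betw_same_card)
  then show ?thesis by (rule sym)
qed

end

context coordinate_subrep
begin

lemma coords_apply [simp]: "i \<in> verts G \<Longrightarrow> coords i = coord i"
  by (simp add: coords_def)

lemma adapted_imp_subreps:
  assumes R: "is_rep G R" and X: "X \<in> (\<Pi>\<^sub>E i\<in>verts G. Pow (carrier (rep_space R i)))"
    and g: "g \<in> adapted R X"
  shows "X \<in> subreps G R"
proof -
  note gA = adaptedD(1)[OF g] and gX = adaptedD(2)[OF g]
  note D = is_adaptedD[OF gA]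
  have sub: "subspace class_ring (X i) (rep_space R i)" if i: "i \<in> verts G" for i
  proof (rule subspaceI)
    note L = linear_mapD[OF D(1)[OF i]]
    show "vectorspace class_ring (rep_space R i)" by (rule L(2))
    show "X i \<subseteq> carrier (rep_space R i)" using X i by auto
    have "g i (0\<^sub>v (d i)) \<in> g i ` coord i" by (rule imageI[OF coord_closed(3)])
    then show "\<zero>\<^bsub>rep_space R i\<^esub> \<in> X i" using L(6) gX[OF i] by simp
    fix v assume "v \<in> X i"
    then obtain v' where v': "v' \<in> coord i" "v = g i v'" unfolding gX[OF i, symmetric] by (rule imageE)
    show "c \<odot>\<^bsub>rep_space R i\<^esub> v \<in> X i" for c
    proof -
      have "c \<odot>\<^bsub>rep_space R i\<^esub> v = g i (c \<cdot>\<^sub>v v')" unfolding v'(2) using L(5)[of v' c] coord_carrier[OF v'(1)] by simp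
      also have "\<dots> \<in> X i" unfolding gX[OF i, symmetric] by (rule imageI[OF coord_closed(2)[OF v'(1)]])
      finally show ?thesis .
    qed
    fix w assume "w \<in> X i"
    then obtain w' where w': "w' \<in> coord i" "w = g i w'" unfolding gX[OF i, symmetric] by (rule imageE)
    have "v \<oplus>\<^bsub>rep_space R i\<^esub> w = g i (v' + w')"
      unfolding v'(2) w'(2) by (rule is_adapted_add[OF gA i coord_carrier[OF v'(1)] coord_carrier[OF w'(1)], symmetric])
    also have "\<dots> \<in> X i" unfolding gX[OF i, symmetric] by (rule imageI[OF coord_closed(1)[OF v'(1) w'(1)]])
    finally show "v \<oplus>\<^bsub>rep_space R i\<^esub> w \<in> X i" .
  qed
  have "rep_map R a v \<in> X (head G a)" if a: "a \<in> arcs G" and v: "v \<in> X (tail G a)" for a v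
  proof -
    have ends: "tail G a \<in> verts G" "head G a \<in> verts G" using a by auto
    from v obtain v' where v': "v' \<in> coord (tail G a)" "v = g (tail G a) v'"
      unfolding gX[OF ends(1), symmetric] by (rule imageE)
    show ?thesis
      unfolding v'(2) D(3)[OF a v'(1)] gX[OF ends(2), symmetric] by (rule imageI[OF x_mult_coord[OF a v'(1)]])
  qed
  then show ?thesis unfolding subreps_def using X sub by (auto simp: image_subset_iff)
qed

lemma adapted_imp_subrep_iso:
  assumes R: "is_rep G R" and X: "X \<in> subreps G R" and g: "g \<in> adapted R X"
  shows "is_rep_iso G (subrep M coords) (subrep R X) g"
  unfolding is_rep_iso_def
proof (intro conjI ballI)
  note gA = adaptedD(1)[OF g] and gX = adaptedD(2)[OF g]
  note D = is_adaptedD[OF gA]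
  fix i assume i: "i \<in> verts G"
  note L = linear_mapD[OF D(1)[OF i]]
  show "linear_map class_ring (rep_space (subrep M coords) i) (rep_space (subrep R X) i) (g i)"
    using subspaceD(6)[OF subspace_coord, of i] subspaceD(6)[OF subrepsD(1)[OF X i]] gX[OF i] L(4,5) coord_carrier i
    by (intro linear_mapI) (auto simp: subrep_def)
  have "inj_on (g i) (coord i)"
    using D(2)[OF i] coord_carrier by (auto simp: bij_betw_def intro: inj_on_subset)
  then show "bij_betw (g i) (carrier (rep_space (subrep M coords) i)) (carrier (rep_space (subrep R X) i))"
    using gX[OF i] i by (simp add: bij_betw_def subrep_def)
next
  fix a v assume a: "a \<in> arcs G" and "v \<in> carrier (rep_space (subrep M coords) (tail G a))"
  then show "g (head G a) (rep_map (subrep M coords) a v) = rep_map (subrep R X) a (g (tail G a) v)"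
    using is_adaptedD(3)[OF adaptedD(1)[OF g] a, of v] by (simp add: subrep_def)
qed

abbreviation coset :: "('a, 'b, 'k, 'c) quiver_rep \<Rightarrow> ('a \<Rightarrow> 'c set) \<Rightarrow> 'a \<Rightarrow> 'c \<Rightarrow> 'c set" where
  "coset R X i v \<equiv> X i +>\<^bsub>rep_space R i\<^esub> v"

lemma coset_M_eq: "coset M X i v = (\<lambda>u. u + v) ` X i"
  by (auto simp: a_r_coset_def')

text \<open>The error allowed in \<open>is_adapted\<close> lies in the coordinate subspace, so it
  disappears in the quotient.\<close>

lemma adapted_imp_quotient_iso:
  assumes R: "is_rep G R" and X: "X \<in> subreps G R" and g: "g \<in> adapted R X"
  shows "is_rep_iso G (quotient_rep G M coords) (quotient_rep G R X) (\<lambda>i C. g i ` C)"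
proof -
  note gA = adaptedD(1)[OF g] and gX = adaptedD(2)[OF g]
  note D = is_adaptedD[OF gA]
  have space: "rep_space (quotient_rep G N Y) i = quotient_module (rep_space N i) (Y i)"
    for N :: "('a, 'b, 'k, 'e) quiver_rep" and Y i
    by (simp add: quotient_rep_def)
  have \<gamma>: "g i ` coset M coords i v = coset R X i (g i v)" if i: "i \<in> verts G" and v: "v \<in> carrier_vec (d i)" for i v
  proof -
    have "g i ` coset M coords i v = (\<lambda>u. g i (u + v)) ` coord i"
      unfolding coset_M_eq using i by (simp add: image_image)
    also have "\<dots> = (\<lambda>u. g i u \<oplus>\<^bsub>rep_space R i\<^esub> g i v) ` coord i"
      by (rule image_cong[OF refl]) (rule is_adapted_add[OF gA i coord_carrier v])
    also have "\<dots> = (\<lambda>y. y \<oplus>\<^bsub>rep_space R i\<^esub> g i v) ` g i ` coord i"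
      by (rule image_image[symmetric])
    also have "\<dots> = coset R X i (g i v)"
      unfolding gX[OF i] a_r_coset_def' by blast
    finally show ?thesis .
  qed
  have carrM: "carrier (quotient_module (rep_space M i) (coords i)) = coset M coords i ` carrier_vec (d i)" if "i \<in> verts G" for i
    using carrier_quotient[OF subrepsD(1)[OF coords_subreps that]] by simp
  have carrR: "carrier (quotient_module (rep_space R i) (X i)) = coset R X i ` carrier (rep_space R i)" if "i \<in> verts G" for i
    by (rule carrier_quotient[OF subrepsD(1)[OF X that]])
  show ?thesis
    unfolding is_rep_iso_def space
  proof (intro conjI ballI)
    fix i assume i: "i \<in> verts G"
    note L = linear_mapD[OF D(1)[OF i]]
    note qM = linear_mapD[OF quotient_linear_map[OF subrepsD(1)[OF coords_subreps i]]]
    note qR = linear_mapD[OF quotient_linear_map[OF subrepsD(1)[OF X i]]]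
    note gc = is_adapted_closed[OF gA i]
    show "linear_map class_ring (quotient_module (rep_space M i) (coords i)) (quotient_module (rep_space R i) (X i)) ((`) (g i))"
    proof (rule linear_mapI[OF qM(2) qR(2)], unfold carrM[OF i])
      fix C assume "C \<in> coset M coords i ` carrier_vec (d i)"
      then obtain v where v: "C = coset M coords i v" "v \<in> carrier_vec (d i)" by (rule imageE)
      have v': "v \<in> carrier (rep_space M i)" using v by simp
      show "g i ` C \<in> carrier (quotient_module (rep_space R i) (X i))"
        unfolding v(1) \<gamma>[OF i v(2)] by (rule qR(3)[OF gc[OF v(2)]])
      show "g i ` (c \<odot>\<^bsub>quotient_module (rep_space M i) (coords i)\<^esub> C) =
          c \<odot>\<^bsub>quotient_module (rep_space R i) (X i)\<^esub> g i ` C" for c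
      proof -
        have "g i ` (c \<odot>\<^bsub>quotient_module (rep_space M i) (coords i)\<^esub> C) = g i ` coset M coords i (c \<cdot>\<^sub>v v)"
          unfolding v(1) qM(5)[OF v', symmetric] by simp
        also have "\<dots> = coset R X i (c \<odot>\<^bsub>rep_space R i\<^esub> g i v)"
          using \<gamma>[OF i, of "c \<cdot>\<^sub>v v"] L(5)[of v c] v(2) by simp
        also have "\<dots> = c \<odot>\<^bsub>quotient_module (rep_space R i) (X i)\<^esub> g i ` C"
          unfolding v(1) \<gamma>[OF i v(2)] by (rule qR(5)[OF gc[OF v(2)]])
        finally show ?thesis .
      qed
      fix C' assume "C' \<in> coset M coords i ` carrier_vec (d i)"
      then obtain w where w: "C' = coset M coords i w" "w \<in> carrier_vec (d i)" by (rule imageE)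
      have w': "w \<in> carrier (rep_space M i)" using w by simp
      have "g i ` (C \<oplus>\<^bsub>quotient_module (rep_space M i) (coords i)\<^esub> C') = g i ` coset M coords i (v + w)"
        unfolding v(1) w(1) qM(4)[OF v' w', symmetric] by simp
      also have "\<dots> = coset R X i (g i v \<oplus>\<^bsub>rep_space R i\<^esub> g i w)"
        unfolding \<gamma>[OF i add_carrier_vec[OF v(2) w(2)]] is_adapted_add[OF gA i v(2) w(2)] ..
      also have "\<dots> = g i ` C \<oplus>\<^bsub>quotient_module (rep_space R i) (X i)\<^esub> g i ` C'"
        unfolding v(1) w(1) \<gamma>[OF i v(2)] \<gamma>[OF i w(2)] by (rule qR(4)[OF gc[OF v(2)] gc[OF w(2)]])
      finally show "g i ` (C \<oplus>\<^bsub>quotient_module (rep_space M i) (coords i)\<^esub> C') =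
        g i ` C \<oplus>\<^bsub>quotient_module (rep_space R i) (X i)\<^esub> g i ` C'" .
    qed
    have im: "g i ` carrier_vec (d i) = carrier (rep_space R i)" and inj: "inj_on (g i) (carrier_vec (d i))"
      using D(2)[OF i] by (simp_all add: bij_betw_def)
    show "bij_betw ((`) (g i)) (carrier (quotient_module (rep_space M i) (coords i)))
        (carrier (quotient_module (rep_space R i) (X i)))"
      unfolding bij_betw_def carrM[OF i] carrR[OF i]
    proof
      have "coset M coords i v \<subseteq> carrier_vec (d i)" if "v \<in> carrier_vec (d i)" for v
        unfolding coset_M_eq using that i coord_carrier by auto
      then show "inj_on ((`) (g i)) (coset M coords i ` carrier_vec (d i))"
        by (intro inj_on_subset[OF inj_on_image_Pow[OF inj]]) auto
      have "(`) (g i) ` coset M coords i ` carrier_vec (d i) = (\<lambda>v. coset R X i (g i v)) ` carrier_vec (d i)"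
        unfolding image_image by (rule image_cong[OF refl]) (rule \<gamma>[OF i])
      also have "\<dots> = coset R X i ` carrier (rep_space R i)"
        unfolding im[symmetric] by (rule image_image[symmetric])
      finally show "(`) (g i) ` coset M coords i ` carrier_vec (d i) = coset R X i ` carrier (rep_space R i)" .
    qed
  next
    fix a C assume a: "a \<in> arcs G" and C: "C \<in> carrier (quotient_module (rep_space M (tail G a)) (coords (tail G a)))"
    have ends: "tail G a \<in> verts G" "head G a \<in> verts G" using a by auto
    from C obtain v where v: "C = coset M coords (tail G a) v" "v \<in> carrier_vec (d (tail G a))"
      unfolding carrM[OF ends(1)] by (rule imageE)
    have v': "v \<in> carrier (rep_space M (tail G a))" using v by simp
    from D(4)[OF a v(2)] obtain w where w: "w \<in> coord (head G a)"
      "rep_map R a (g (tail G a) v) = g (head G a) (x a *\<^sub>v v + w)" by blast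
    have xv: "x a *\<^sub>v v \<in> carrier_vec (d (head G a))" by (rule x_mult_carrier[OF a v(2)])
    have "g (head G a) ` rep_map (quotient_rep G M coords) a C = coset R X (head G a) (g (head G a) (x a *\<^sub>v v))"
      using rep_map_quotient[OF is_rep_M coords_subreps a v'] \<gamma>[OF ends(2) xv] by (simp add: v(1))
    also have "\<dots> = coset R X (head G a) (g (head G a) (w + x a *\<^sub>v v))"
    proof -
      have wX: "g (head G a) w \<in> X (head G a)" unfolding gX[OF ends(2), symmetric] by (rule imageI[OF w(1)])
      have "g (head G a) (w + x a *\<^sub>v v) = g (head G a) w \<oplus>\<^bsub>rep_space R (head G a)\<^esub> g (head G a) (x a *\<^sub>v v)"
        by (rule is_adapted_add[OF gA ends(2) coord_carrier[OF w(1)] xv])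
      then show ?thesis
        using coset_eq_iff[OF subrepsD(1)[OF X ends(2)], of "g (head G a) (w + x a *\<^sub>v v)" "g (head G a) (x a *\<^sub>v v)"]
          is_adapted_closed[OF gA ends(2)] xv coord_carrier[OF w(1)] wX by (metis add_carrier_vec)
    qed
    also have "w + x a *\<^sub>v v = x a *\<^sub>v v + w" by (rule comm_add_vec[OF coord_carrier[OF w(1)] xv])
    also have "coset R X (head G a) (g (head G a) (x a *\<^sub>v v + w)) = rep_map (quotient_rep G R X) a (g (tail G a) ` C)"
      unfolding v(1) \<gamma>[OF ends(1) v(2)] rep_map_quotient[OF R X a is_adapted_closed[OF gA ends(1) v(2)]] w(2) ..
    finally show "g (head G a) ` rep_map (quotient_rep G M coords) a C = rep_map (quotient_rep G R X) a (g (tail G a) ` C)" .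
  qed
qed

text \<open>A retraction onto \<open>coord i\<close>. Composing with it makes linear maps on
  \<open>coord i\<close> comparable on unit vectors.\<close>

definition proj :: "'a \<Rightarrow> 'k vec \<Rightarrow> 'k vec" where
  "proj i v = vec (d i) (\<lambda>j. if j \<in> J i then v $ j else 0)"

lemma proj_coord: "proj i v \<in> coord i"
  by (simp add: proj_def coord_def)

lemma proj_id: "v \<in> coord i \<Longrightarrow> proj i v = v"
  by (auto simp: proj_def coord_def)

lemma proj_linear: "linear_map class_ring (module_vec TYPE('k) (d i)) ((module_vec TYPE('k) (d i))\<lparr>carrier := coord i\<rparr>) (proj i)"
  using subspaceD(6)[OF subspace_coord, of i] proj_coord
  by (intro linear_mapI) (auto simp: proj_def)

text \<open>At every vertex the coordinate subspace has the remaining unit vectors as complement, so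
  the two isomorphisms can be glued to one linear map, and the five lemma makes it bijective. It
  need not commute with the arrows, only up to the error allowed in
  \<open>is_adapted\<close>.\<close>

lemma ex_adapted:
  assumes R: "is_rep G R" and X: "X \<in> subreps G R"
    and \<alpha>: "is_rep_iso G (subrep M coords) (subrep R X) \<alpha>"
    and \<beta>: "is_rep_iso G (quotient_rep G M coords) (quotient_rep G R X) \<beta>"
  shows "adapted R X \<noteq> {}"
proof -
  have spaceQ: "rep_space (quotient_rep G N Y) i = quotient_module (rep_space N i) (Y i)"
    for N :: "('a, 'b, 'k, 'e) quiver_rep" and Y i
    by (simp add: quotient_rep_def)
  have spaceM: "rep_space (subrep M coords) i = (module_vec TYPE('k) (d i))\<lparr>carrier := coord i\<rparr>" if "i \<in> verts G" for i
    using that by (simp add: subrep_def)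
  have spaceR: "rep_space (subrep R X) i = (rep_space R i)\<lparr>carrier := X i\<rparr>" for i
    by (simp add: subrep_def)
  have \<alpha>X: "\<alpha> i v \<in> X i" if "i \<in> verts G" "v \<in> coord i" for i v
    using is_rep_iso_closed[OF \<alpha> that(1), of v] that by (simp add: subrep_def)
  have XR: "v \<in> carrier (rep_space R i)" if "i \<in> verts G" "v \<in> X i" for i v
    using subspaceD(2)[OF subrepsD(1)[OF X that(1)]] that(2) by blast
  have qM: "linear_map class_ring (module_vec TYPE('k) (d i)) (quotient_module (rep_space M i) (coords i)) (coset M coords i)" if "i \<in> verts G" for i
    using quotient_linear_map[OF subrepsD(1)[OF coords_subreps that]] by simp
  have qR: "linear_map class_ring (rep_space R i) (quotient_module (rep_space R i) (X i)) (coset R X i)" if "i \<in> verts G" for i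
    by (rule quotient_linear_map[OF subrepsD(1)[OF X that]])
  have \<beta>q: "linear_map class_ring (quotient_module (rep_space M i) (coords i)) (quotient_module (rep_space R i) (X i)) (\<beta> i)" if "i \<in> verts G" for i
    using is_rep_isoD(1)[OF \<beta> that] by (simp add: spaceQ)
  have \<beta>b: "bij_betw (\<beta> i) (carrier (quotient_module (rep_space M i) (coords i))) (carrier (quotient_module (rep_space R i) (X i)))" if "i \<in> verts G" for i
    using is_rep_isoD(2)[OF \<beta> that] by (simp add: spaceQ)
  have "\<exists>g. linear_map class_ring (module_vec TYPE('k) (d i)) (rep_space R i) g \<and>
      (\<forall>v\<in>coord i. g v = \<alpha> i v) \<and> (\<forall>v\<in>carrier_vec (d i). coset R X i (g v) = \<beta> i (coset M coords i v))"
    if i: "i \<in> verts G" for i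
  proof -
    have "\<exists>y\<in>carrier (rep_space R i). coset R X i y = \<beta> i (coset M coords i (unit_vec (d i) j))" for j
    proof -
      have "\<beta> i (coset M coords i (unit_vec (d i) j)) \<in> carrier (quotient_module (rep_space R i) (X i))"
        using linear_mapD(3)[OF \<beta>q[OF i] linear_mapD(3)[OF qM[OF i]], of "unit_vec (d i) j"] by simp
      then show ?thesis unfolding carrier_quotient[OF subrepsD(1)[OF X i]] by auto
    qed
    then obtain y where y: "\<And>j. y j \<in> carrier (rep_space R i)"
      "\<And>j. coset R X i (y j) = \<beta> i (coset M coords i (unit_vec (d i) j))" by metis
    \<comment> \<open>Basis vectors of the subspace go where \<open>\<alpha>\<close> sends them;
      each other one goes to an arbitrary lift of the class given by \<open>\<beta>\<close>.\<close>
    define r where "r j = (if j \<in> J i then \<alpha> i (unit_vec (d i) j) else y j)" for j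
    have unit_coord: "unit_vec (d i) j \<in> coord i" if "j < d i" "j \<in> J i" for j
      using that by (auto simp: coord_def unit_vec_def)
    have rR: "r j \<in> carrier (rep_space R i)" if "j < d i" for j
      using XR[OF i \<alpha>X[OF i unit_coord[OF that]]] y(1) by (auto simp: r_def)
    from ex_linear_map_unit_vec[OF is_repD(1)[OF R i], of "d i" r] rR
    obtain g where g: "linear_map class_ring (module_vec TYPE('k) (d i)) (rep_space R i) g"
      and gr: "\<And>j. j < d i \<Longrightarrow> g (unit_vec (d i) j) = r j" by blast
    have incl: "linear_map class_ring ((rep_space R i)\<lparr>carrier := X i\<rparr>) (rep_space R i) (\<lambda>v. v)"
      using subspaceD(6)[OF subrepsD(1)[OF X i]] is_repD(1)[OF R i] XR[OF i] by (intro linear_mapI) auto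
    have inclM: "linear_map class_ring ((module_vec TYPE('k) (d i))\<lparr>carrier := coord i\<rparr>) (module_vec TYPE('k) (d i)) (\<lambda>v. v)"
      using subspaceD(6)[OF subspace_coord, of i] coord_carrier by (intro linear_mapI) auto
    have \<alpha>l: "linear_map class_ring ((module_vec TYPE('k) (d i))\<lparr>carrier := coord i\<rparr>) ((rep_space R i)\<lparr>carrier := X i\<rparr>) (\<alpha> i)"
      using is_rep_isoD(1)[OF \<alpha> i] spaceM[OF i] by (simp add: spaceR)
    have proj_unit: "proj i (unit_vec (d i) j) = (if j \<in> J i then unit_vec (d i) j else 0\<^sub>v (d i))" if "j < d i" for j
      using that by (auto simp: proj_def)
    have g0: "g (0\<^sub>v (d i)) = \<zero>\<^bsub>rep_space R i\<^esub>" using linear_mapD(6)[OF g] by simp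
    have \<alpha>0: "\<alpha> i (0\<^sub>v (d i)) = \<zero>\<^bsub>rep_space R i\<^esub>" using linear_mapD(6)[OF \<alpha>l] by simp
    have 1: "(g \<circ> ((\<lambda>v. v) \<circ> proj i)) v = ((\<lambda>v. v) \<circ> (\<alpha> i \<circ> proj i)) v" if "v \<in> carrier_vec (d i)" for v
    proof (rule linear_map_vec_eqI[OF linear_map_comp[OF linear_map_comp[OF proj_linear inclM] g]
          linear_map_comp[OF linear_map_comp[OF proj_linear \<alpha>l] incl] _ that])
      fix j assume "j < d i"
      then show "(g \<circ> ((\<lambda>v. v) \<circ> proj i)) (unit_vec (d i) j) = ((\<lambda>v. v) \<circ> (\<alpha> i \<circ> proj i)) (unit_vec (d i) j)"
        by (simp add: proj_unit gr r_def g0 \<alpha>0)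
    qed
    have "g v = \<alpha> i v" if "v \<in> coord i" for v
      using 1[OF coord_carrier[OF that]] proj_id[OF that] by simp
    moreover have "(coset R X i \<circ> g) v = (\<beta> i \<circ> coset M coords i) v" if "v \<in> carrier_vec (d i)" for v
    proof (rule linear_map_vec_eqI[OF linear_map_comp[OF g qR[OF i]] linear_map_comp[OF qM[OF i] \<beta>q[OF i]] _ that])
      fix j assume j: "j < d i"
      show "(coset R X i \<circ> g) (unit_vec (d i) j) = (\<beta> i \<circ> coset M coords i) (unit_vec (d i) j)"
      proof (cases "j \<in> J i")
        case True
        note u = unit_coord[OF j True]
        have "coset R X i (g (unit_vec (d i) j)) = X i"
          using coset_eq_self_iff[OF subrepsD(1)[OF X i]] XR[OF i] \<alpha>X[OF i u] gr[OF j] True by (simp add: r_def)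
        moreover have "coset M coords i (unit_vec (d i) j) = coords i"
          using coset_eq_self_iff[OF subrepsD(1)[OF coords_subreps i], of "unit_vec (d i) j"] u i by simp
        moreover have "\<beta> i (coords i) = X i"
          using linear_mapD(6)[OF \<beta>q[OF i]]
          unfolding quotient_zero[OF subrepsD(1)[OF coords_subreps i]] quotient_zero[OF subrepsD(1)[OF X i]] .
        ultimately show ?thesis by simp
      next
        case False
        then show ?thesis using gr[OF j] y(2) by (simp add: r_def)
      qed
    qed
    ultimately show ?thesis using g by auto
  qed
  then have "\<exists>g. \<forall>i\<in>verts G. linear_map class_ring (module_vec TYPE('k) (d i)) (rep_space R i) (g i) \<and>
      (\<forall>v\<in>coord i. g i v = \<alpha> i v) \<and> (\<forall>v\<in>carrier_vec (d i). coset R X i (g i v) = \<beta> i (coset M coords i v))"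
    by (intro bchoice ballI)
  then obtain g where g: "\<And>i. i \<in> verts G \<Longrightarrow> linear_map class_ring (module_vec TYPE('k) (d i)) (rep_space R i) (g i)"
    and g\<alpha>: "\<And>i v. i \<in> verts G \<Longrightarrow> v \<in> coord i \<Longrightarrow> g i v = \<alpha> i v"
    and g\<beta>: "\<And>i v. i \<in> verts G \<Longrightarrow> v \<in> carrier_vec (d i) \<Longrightarrow> coset R X i (g i v) = \<beta> i (coset M coords i v)"
    by blast
  have \<alpha>bij: "bij_betw (\<alpha> i) (coord i) (X i)" if "i \<in> verts G" for i
    using is_rep_isoD(2)[OF \<alpha> that] spaceM[OF that] by (simp add: spaceR)
  have gX: "g i ` coord i = X i" if "i \<in> verts G" for i
  proof -
    have "g i ` coord i = \<alpha> i ` coord i" by (rule image_cong[OF refl]) (rule g\<alpha>[OF that])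
    then show ?thesis using \<alpha>bij[OF that] by (simp add: bij_betw_def)
  qed
  have gc: "g i v \<in> carrier (rep_space R i)" if "i \<in> verts G" "v \<in> carrier_vec (d i)" for i v
    using linear_mapD(3)[OF g[OF that(1)], of v] that(2) by simp
  have gadd: "g i (v + w) = g i v \<oplus>\<^bsub>rep_space R i\<^esub> g i w" if "i \<in> verts G" "v \<in> carrier_vec (d i)" "w \<in> carrier_vec (d i)" for i v w
    using linear_mapD(4)[OF g[OF that(1)], of v w] that by simp
  have gbij: "bij_betw (g i) (carrier_vec (d i)) (carrier (rep_space R i))" if i: "i \<in> verts G" for i
    unfolding bij_betw_def
  proof
    \<comment> \<open>Injectivity of \<open>\<beta>\<close> puts \<open>v\<close> into the
      coordinate subspace, and there \<open>g\<close> is the injective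
      \<open>\<alpha>\<close>.\<close>
    have ker: "v = 0\<^sub>v (d i)" if v: "v \<in> carrier_vec (d i)" and 0: "g i v = \<zero>\<^bsub>rep_space R i\<^esub>" for v
    proof -
      have "\<beta> i (coset M coords i v) = X i"
        using g\<beta>[OF i v] coset_zero[OF subrepsD(1)[OF X i]] by (simp add: 0)
      also have "X i = \<beta> i (coset M coords i (0\<^sub>v (d i)))"
        using g\<beta>[OF i, of "0\<^sub>v (d i)"] linear_mapD(6)[OF g[OF i]] coset_zero[OF subrepsD(1)[OF X i]] by simp
      finally have "coset M coords i v = coset M coords i (0\<^sub>v (d i))"
        using inj_onD[OF bij_betw_imp_inj_on[OF \<beta>b[OF i]], of "coset M coords i v" "coset M coords i (0\<^sub>v (d i))"]
          linear_mapD(3)[OF qM[OF i]] v by simp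
      then have "v \<in> coords i"
        using coset_eq_self_iff[OF subrepsD(1)[OF coords_subreps i], of v] coset_zero[OF subrepsD(1)[OF coords_subreps i]] v
        by simp
      then have vc: "v \<in> coord i" using i by simp
      have "\<alpha> i v = \<alpha> i (0\<^sub>v (d i))"
        using g\<alpha>[OF i vc] g\<alpha>[OF i coord_closed(3)] 0 linear_mapD(6)[OF g[OF i]] by simp
      then show ?thesis
        using \<alpha>bij[OF i] vc coord_closed(3) by (auto simp: bij_betw_def dest!: inj_onD)
    qed
    show "inj_on (g i) (carrier_vec (d i))"
    proof (rule inj_onI)
      fix v w assume v: "v \<in> carrier_vec (d i)" and w: "w \<in> carrier_vec (d i)" and eq: "g i v = g i w"
      have "g i (v + (-1) \<cdot>\<^sub>v w) = g i (w + (-1) \<cdot>\<^sub>v w)"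
        using gadd[OF i v, of "(-1) \<cdot>\<^sub>v w"] gadd[OF i w, of "(-1) \<cdot>\<^sub>v w"] w eq by simp
      also have "w + (-1) \<cdot>\<^sub>v w = 0\<^sub>v (d i)" using w by (intro eq_vecI) auto
      finally have "v + (-1) \<cdot>\<^sub>v w = 0\<^sub>v (d i)"
        using linear_mapD(6)[OF g[OF i]] v w by (intro ker) auto
      then have z: "(v + (-1) \<cdot>\<^sub>v w) $ j = 0" if "j < d i" for j using that by simp
      show "v = w"
      proof (rule eq_vecI)
        fix j assume "j < dim_vec w"
        then show "v $ j = w $ j" using z[of j] v w by simp
      qed (use v w in auto)
    qed
    show "g i ` carrier_vec (d i) = carrier (rep_space R i)"
    proof
      show "g i ` carrier_vec (d i) \<subseteq> carrier (rep_space R i)" using gc[OF i] by blast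
      show "carrier (rep_space R i) \<subseteq> g i ` carrier_vec (d i)"
      proof
        fix y assume y: "y \<in> carrier (rep_space R i)"
        \<comment> \<open>Lift the class of \<open>y\<close> through \<open>\<beta>\<close>; what is
          missing lies in \<open>X i\<close>, the image of the coordinate subspace.\<close>
        have "coset R X i y \<in> \<beta> i ` carrier (quotient_module (rep_space M i) (coords i))"
          using \<beta>b[OF i] linear_mapD(3)[OF qR[OF i] y] by (simp add: bij_betw_def)
        then obtain v where v: "v \<in> carrier_vec (d i)" "coset R X i y = \<beta> i (coset M coords i v)"
          unfolding carrier_quotient[OF subrepsD(1)[OF coords_subreps i]] by auto
        have "coset R X i y = coset R X i (g i v)" using v(2) g\<beta>[OF i v(1)] by simp
        then obtain u where u: "u \<in> X i" "y = u \<oplus>\<^bsub>rep_space R i\<^esub> g i v"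
          unfolding coset_eq_iff[OF subrepsD(1)[OF X i] y gc[OF i v(1)]] by blast
        from u(1) obtain w where w: "u = g i w" "w \<in> coord i" unfolding gX[OF i, symmetric] by (rule imageE)
        have "y = g i (w + v)" unfolding u(2) w(1) by (rule gadd[OF i coord_carrier[OF w(2)] v(1), symmetric])
        then show "y \<in> g i ` carrier_vec (d i)"
          by (rule image_eqI) (rule add_carrier_vec[OF coord_carrier[OF w(2)] v(1)])
      qed
    qed
  qed
  have "is_adapted R g"
    unfolding is_adapted_def
  proof (intro conjI ballI)
    fix a v assume a: "a \<in> arcs G" and v: "v \<in> coord (tail G a)"
    have ends: "tail G a \<in> verts G" "head G a \<in> verts G" using a by auto
    have "v \<in> carrier (rep_space (subrep M coords) (tail G a))" using v spaceM[OF ends(1)] by simp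
    from is_rep_isoD(3)[OF \<alpha> a this]
    show "rep_map R a (g (tail G a) v) = g (head G a) (x a *\<^sub>v v)"
      unfolding g\<alpha>[OF ends(1) v] g\<alpha>[OF ends(2) x_mult_coord[OF a v]] by (simp add: subrep_def)
  next
    fix a and v :: "'k vec" assume a: "a \<in> arcs G" and v: "v \<in> carrier_vec (d (tail G a))"
    have ends: "tail G a \<in> verts G" "head G a \<in> verts G" using a by auto
    have v': "v \<in> carrier (rep_space M (tail G a))" using v by simp
    have cv: "coset M coords (tail G a) v \<in> carrier (rep_space (quotient_rep G M coords) (tail G a))"
      unfolding spaceQ using linear_mapD(3)[OF qM[OF ends(1)]] v by simp
    note xv = x_mult_carrier[OF a v]
    have Rgv: "rep_map R a (g (tail G a) v) \<in> carrier (rep_space R (head G a))"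
      by (rule rep_map_closed[OF R a gc[OF ends(1) v]])
    \<comment> \<open>The two ways around the arrow agree in the quotient of \<open>R\<close>, so
      they differ by an element of \<open>X\<close>, and this element is the image of the error
      vector.\<close>
    have "coset R X (head G a) (rep_map R a (g (tail G a) v)) = rep_map (quotient_rep G R X) a (\<beta> (tail G a) (coset M coords (tail G a) v))"
      unfolding g\<beta>[OF ends(1) v, symmetric] by (rule rep_map_quotient[OF R X a gc[OF ends(1) v], symmetric])
    also have "\<dots> = \<beta> (head G a) (rep_map (quotient_rep G M coords) a (coset M coords (tail G a) v))"
      by (rule is_rep_isoD(3)[OF \<beta> a cv, symmetric])
    also have "\<dots> = \<beta> (head G a) (coset M coords (head G a) (x a *\<^sub>v v))"
      using rep_map_quotient[OF is_rep_M coords_subreps a v'] by simp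
    also have "\<dots> = coset R X (head G a) (g (head G a) (x a *\<^sub>v v))"
      by (rule g\<beta>[OF ends(2) xv, symmetric])
    finally obtain u where u: "u \<in> X (head G a)"
      "rep_map R a (g (tail G a) v) = u \<oplus>\<^bsub>rep_space R (head G a)\<^esub> g (head G a) (x a *\<^sub>v v)"
      unfolding coset_eq_iff[OF subrepsD(1)[OF X ends(2)] Rgv gc[OF ends(2) xv]] by blast
    from u(1) obtain w where w: "u = g (head G a) w" "w \<in> coord (head G a)"
      unfolding gX[OF ends(2), symmetric] by (rule imageE)
    have "rep_map R a (g (tail G a) v) = g (head G a) (w + x a *\<^sub>v v)"
      unfolding u(2) w(1) by (rule gadd[OF ends(2) coord_carrier[OF w(2)] xv, symmetric])
    also have "w + x a *\<^sub>v v = x a *\<^sub>v v + w" by (rule comm_add_vec[OF coord_carrier[OF w(2)] xv])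
    finally show "\<exists>w\<in>coord (head G a). rep_map R a (g (tail G a) v) = g (head G a) (x a *\<^sub>v v + w)"
      using w(2) by blast
  qed (use g gbij in blast)+
  then have "trim g \<in> adapted R X" by (rule trim_adapted) (rule gX)
  then show ?thesis by blast
qed

end

section \<open>Cuspidal functions\<close>

context fin_digraph
begin

lemma rep_isomorphic_switch:
  assumes "is_rep G T" "is_rep G C" "rep_isomorphic G C S"
  shows "rep_isomorphic G T C \<longleftrightarrow> rep_isomorphic G S T"
proof
  assume "rep_isomorphic G T C"
  then show "rep_isomorphic G S T"
    by (rule rep_isomorphic_sym[OF assms(1) rep_isomorphic_trans[OF _ assms(3)]])
next
  assume "rep_isomorphic G S T"
  then show "rep_isomorphic G T C"
    by (rule rep_isomorphic_sym[OF assms(2) rep_isomorphic_trans[OF assms(3)]])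
qed

definition iso_class_of :: "('a, 'b, 'k::field, 'k vec) quiver_rep \<Rightarrow> ('a, 'b, 'k) iso_class" where
  "iso_class_of M = {N. is_rep G N \<and> rep_isomorphic G M N}"

lemma iso_class_of_in: "is_rep G M \<Longrightarrow> iso_class_of M \<in> iso_classes G"
  unfolding iso_classes_def quotient_def iso_class_of_def by auto

lemma iso_classes_cases:
  assumes "U \<in> iso_classes G"
  obtains M where "is_rep G M" "U = iso_class_of M"
  using assms unfolding iso_classes_def quotient_def iso_class_of_def by auto

lemma iso_class_of_eq_iff:
  assumes "is_rep G M" "is_rep G N"
  shows "iso_class_of M = iso_class_of N \<longleftrightarrow> rep_isomorphic G M N"
proof
  assume "iso_class_of M = iso_class_of N"
  moreover have "N \<in> iso_class_of N" using rep_isomorphic_refl assms by (simp add: iso_class_of_def)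
  ultimately show "rep_isomorphic G M N" by (auto simp: iso_class_of_def)
next
  assume iso: "rep_isomorphic G M N"
  show "iso_class_of M = iso_class_of N"
    unfolding iso_class_of_def
    using rep_isomorphic_trans[OF iso] rep_isomorphic_trans[OF rep_isomorphic_sym[OF assms(1) iso]] by blast
qed

lemma class_rep_iso_class_of:
  assumes "is_rep G M"
  shows "is_rep G (class_rep (iso_class_of M))" "rep_isomorphic G M (class_rep (iso_class_of M))"
proof -
  have "M \<in> iso_class_of M" using rep_isomorphic_refl assms by (simp add: iso_class_of_def)
  then have "class_rep (iso_class_of M) \<in> iso_class_of M" unfolding class_rep_def by (rule someI)
  then show "is_rep G (class_rep (iso_class_of M))" "rep_isomorphic G M (class_rep (iso_class_of M))"
    by (simp_all add: iso_class_of_def)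
qed

lemma class_rep_iso_classes:
  assumes "U \<in> iso_classes G"
  shows "class_rep U \<in> U" "is_rep G (class_rep U)" "iso_class_of (class_rep U) = U"
proof -
  from assms obtain M where M: "is_rep G M" "U = iso_class_of M" by (rule iso_classes_cases)
  show 1: "is_rep G (class_rep U)" unfolding M(2) by (rule class_rep_iso_class_of[OF M(1)])
  show "class_rep U \<in> U" using class_rep_iso_class_of[OF M(1)] by (simp add: M(2) iso_class_of_def)
  show "iso_class_of (class_rep U) = U"
    using iso_class_of_eq_iff[OF M(1) 1] class_rep_iso_class_of(2)[OF M(1)] by (simp add: M(2))
qed

text \<open>Quotients live on cosets, a carrier type outside that of the classes. Coordinates bring
  every representation back to \<open>'k vec\<close>.\<close>

lemma ex_iso_class:
  fixes N :: "('a, 'b, 'k::field, 'c) quiver_rep"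
  assumes "is_rep G N"
  obtains U :: "('a, 'b, 'k) iso_class" where "U \<in> iso_classes G" "rep_isomorphic G (class_rep U) N"
proof -
  obtain x where x: "x \<in> points (rep_dim N)" "rep_isomorphic G (point_rep (rep_dim N) x) N"
    using ex_isomorphic_point_rep[OF assms] by blast
  let ?M = "point_rep (rep_dim N) x"
  have M: "is_rep G ?M" by (rule is_rep_point_rep[OF x(1)])
  have "rep_isomorphic G (class_rep (iso_class_of ?M)) N"
    using rep_isomorphic_trans[OF rep_isomorphic_sym[OF M class_rep_iso_class_of(2)[OF M]] x(2)] .
  then show ?thesis using that iso_class_of_in[OF M] by blast
qed

lemma rep_dim_0_carrier:
  fixes N :: "('a, 'b, 'k::field, 'c) quiver_rep"
  assumes N: "is_rep G N" and i: "i \<in> verts G" and 0: "rep_dim N i = 0"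
    and v: "v \<in> carrier (rep_space N i)" "w \<in> carrier (rep_space N i)"
  shows "v = w"
proof -
  from ex_coordinates[OF is_repD(1,2)[OF N i]] 0
  obtain T :: "'k vec \<Rightarrow> 'c" where T: "T ` carrier_vec 0 = carrier (rep_space N i)"
    unfolding rep_dim_def bij_betw_def by auto
  from v obtain v' w' where "v' \<in> carrier_vec 0" "w' \<in> carrier_vec 0" "v = T v'" "w = T w'"
    unfolding T[symmetric] by blast
  moreover from this(1,2) have "v' = w'" by (intro eq_vecI) auto
  ultimately show ?thesis by simp
qed

lemma zero_class_carrier:
  fixes N :: "('a, 'b, 'k::field, 'c) quiver_rep"
  assumes U: "U \<in> iso_classes G" and N: "is_rep G N" "rep_isomorphic G (class_rep U) N"
    and zero: "U = zero_class G" and i: "i \<in> verts G"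
    and v: "v \<in> carrier (rep_space N i)" "w \<in> carrier (rep_space N i)"
  shows "v = w"
proof -
  note R = class_rep_iso_classes[OF U]
  have "rep_dim (class_rep U) i = 0" using R(1) i unfolding zero zero_class_def by blast
  then have "rep_dim N i = 0" using rep_dim_eq[OF R(2) N(2) i] by simp
  then show ?thesis using rep_dim_0_carrier[OF N(1) i _ v] by simp
qed

text \<open>At a pair of nonzero classes neither f \<otimes> 1 nor 1 \<otimes> f contributes. The
  power of \<nu> and the factor a_U a_V are nonzero and common to all terms, so they divide out and
  only 1 / a_R remains.\<close>

lemma cuspidal_coeff_eq_0:
  fixes f :: "('a, 'b, 'k::{field, finite}) hall_element"
  assumes f: "cuspidal G f" and U: "U \<in> iso_classes G" "U \<noteq> zero_class G" and V: "V \<in> iso_classes G" "V \<noteq> zero_class G"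
  shows "(\<Sum>R\<in>Poly_Mapping.keys f. Poly_Mapping.lookup f R *
      of_nat (hall_number G (class_rep R) (class_rep U) (class_rep V)) / of_nat (aut_count G (class_rep R))) = 0"
proof -
  let ?c = "complex_of_real (sqrt (real CARD('k))) powi
      euler_form G (\<lambda>i. int (rep_dim (class_rep U) i)) (\<lambda>i. int (rep_dim (class_rep V) i)) *
      (of_nat (aut_count G (class_rep U)) * of_nat (aut_count G (class_rep V)))"
  have "hall_comult G f (U, V) = hall_tensor f (hall_unit G) (U, V) + hall_tensor (hall_unit G) f (U, V)"
    using f by (simp add: cuspidal_def)
  also have "\<dots> = 0"
    using U V by (simp add: hall_tensor_def hall_unit_def lookup_single when_def)
  also have "hall_comult G f (U, V) = ?c * (\<Sum>R\<in>Poly_Mapping.keys f. Poly_Mapping.lookup f R *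
      of_nat (hall_number G (class_rep R) (class_rep U) (class_rep V)) / of_nat (aut_count G (class_rep R)))"
    using U V by (simp add: hall_comult_def comult_coeff_def sum_distrib_left mult_ac)
  finally have "?c * (\<Sum>R\<in>Poly_Mapping.keys f. Poly_Mapping.lookup f R *
      of_nat (hall_number G (class_rep R) (class_rep U) (class_rep V)) / of_nat (aut_count G (class_rep R))) = 0" .
  moreover have "?c \<noteq> 0"
    using aut_count_pos[OF class_rep_iso_classes(2)[OF U(1)]] aut_count_pos[OF class_rep_iso_classes(2)[OF V(1)]]
    by (simp add: power_int_eq_0_iff)
  ultimately show ?thesis by (simp only: mult_eq_0_iff simp_thms)
qed

text \<open>\<open>f\<close> viewed as a function on the representation space, constant on
  orbits.\<close>

definition point_value :: "('a, 'b, 'k::{field, finite}) hall_element \<Rightarrow> ('a \<Rightarrow> nat) \<Rightarrow> ('b \<Rightarrow> 'k mat) \<Rightarrow> complex" where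
  "point_value f d x = Poly_Mapping.lookup f (iso_class_of (point_rep d x))"

lemma finite_points: "finite (points d :: ('b \<Rightarrow> 'k::finite mat) set)"
  unfolding points_def by (intro finite_PiE) auto

lemma point_value_cong:
  assumes "x \<in> points d" "y \<in> points d" "rep_isomorphic G (point_rep d x) (point_rep d y)"
  shows "point_value f d x = point_value f d y"
  using assms iso_class_of_eq_iff[OF is_rep_point_rep[OF assms(1)] is_rep_point_rep[OF assms(2)]]
  by (simp add: point_value_def)

lemma ex_point_value_nonzero:
  assumes f: "f \<in> hall_algebra G" "f \<noteq> 0" "homogeneous G d f"
  shows "\<exists>x\<in>points d. point_value f d x \<noteq> 0"
proof -
  from f(2) obtain R where R: "R \<in> Poly_Mapping.keys f" by (meson all_not_in_conv keys_eq_empty)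
  then have "R \<in> iso_classes G" using f(1) by (auto simp: hall_algebra_def)
  note C = class_rep_iso_classes[OF this]
  obtain x where x: "x \<in> points d" "rep_isomorphic G (point_rep d x) (class_rep R)"
    using ex_isomorphic_point_rep[OF C(2), of d] f(3) R C(1) by (auto simp: homogeneous_def)
  have "iso_class_of (point_rep d x) = R"
    using iso_class_of_eq_iff[OF is_rep_point_rep[OF x(1)] C(2)] x(2) C(3) by simp
  then show ?thesis using x(1) R by (auto simp: point_value_def in_keys_iff)
qed

lemma finite_subreps:
  fixes R :: "('a, 'b, 'k::{field, finite}, 'c) quiver_rep"
  assumes R: "is_rep G R"
  shows "finite (subreps G R)"
proof -
  have "finite (\<Pi>\<^sub>E i\<in>verts G. Pow (carrier (rep_space R i)))"
  proof (rule finite_PiE)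
    fix i assume "i \<in> verts G"
    then show "finite (Pow (carrier (rep_space R i)))"
      using is_rep_finite_carrier[OF R] by simp
  qed simp
  then show ?thesis by (rule rev_finite_subset) (auto simp: subreps_def)
qed

end

section \<open>Hall numbers counted by matrices\<close>

context coordinate_subrep
begin

text \<open>The affine space through \<open>x\<close> in which exactly the block from quotient
  coordinates to subrepresentation coordinates varies. It consists of cocycles, not of extension
  classes, so isomorphic extensions are counted repeatedly.\<close>

definition extensions :: "('b \<Rightarrow> 'k mat) set" where
  "extensions = {z \<in> points d. \<forall>a\<in>arcs G. \<forall>r<d (head G a). \<forall>c<d (tail G a).
     \<not> (r \<in> J (head G a) \<and> c \<notin> J (tail G a)) \<longrightarrow> z a $$ (r, c) = x a $$ (r, c)}"

lemma extensions_points: "z \<in> extensions \<Longrightarrow> z \<in> points d"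
  by (simp add: extensions_def)

lemma rep_isos_extension_adapted:
  assumes z: "z \<in> extensions" and g: "g \<in> rep_isos (point_rep d z) R"
  shows "is_adapted R g"
  unfolding is_adapted_def
proof (intro conjI ballI)
  note g = rep_isosD[OF g]
  fix i assume i: "i \<in> verts G"
  show "linear_map class_ring (module_vec TYPE('k) (d i)) (rep_space R i) (g i)"
    using is_rep_isoD(1)[OF g i] by simp
  show "bij_betw (g i) (carrier_vec (d i)) (carrier (rep_space R i))"
    using is_rep_isoD(2)[OF g i] by simp
next
  note g = rep_isosD[OF g]
  fix a v assume a: "a \<in> arcs G" and v: "v \<in> coord (tail G a)"
  have za: "z a \<in> carrier_mat (d (head G a)) (d (tail G a))" by (rule pointsD[OF extensions_points[OF z] a])
  have "z a *\<^sub>v v = x a *\<^sub>v v"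
  proof (rule eq_vecI)
    fix r assume "r < dim_vec (x a *\<^sub>v v)"
    then have r: "r < d (head G a)" using x_carrier[OF a] by simp
    show "(z a *\<^sub>v v) $ r = (x a *\<^sub>v v) $ r"
      using r za x_carrier[OF a] coord_carrier[OF v] z a v
      by (auto simp: scalar_prod_def extensions_def coord_def intro!: sum.cong)
  qed (use za x_carrier[OF a] in simp)
  then show "rep_map R a (g (tail G a) v) = g (head G a) (x a *\<^sub>v v)"
    using is_rep_isoD(3)[OF g a, of v] coord_carrier[OF v] by simp
next
  note g = rep_isosD[OF g]
  fix a and v :: "'k vec" assume a: "a \<in> arcs G" and v: "v \<in> carrier_vec (d (tail G a))"
  have za: "z a \<in> carrier_mat (d (head G a)) (d (tail G a))" by (rule pointsD[OF extensions_points[OF z] a])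
  let ?w = "z a *\<^sub>v v - x a *\<^sub>v v"
  have "(z a *\<^sub>v v) $ r = (x a *\<^sub>v v) $ r" if "r < d (head G a)" "r \<notin> J (head G a)" for r
    using that za x_carrier[OF a] v z a
    by (auto simp: scalar_prod_def extensions_def intro!: sum.cong)
  then have w: "?w \<in> coord (head G a)"
    using za x_carrier[OF a] v by (auto simp: coord_def)
  have "z a *\<^sub>v v = x a *\<^sub>v v + ?w" using za x_carrier[OF a] v by (intro eq_vecI) auto
  then show "\<exists>w\<in>coord (head G a). rep_map R a (g (tail G a) v) = g (head G a) (x a *\<^sub>v v + w)"
    using is_rep_isoD(3)[OF g a, of v] v w by (intro bexI[of _ ?w]) simp_all
qed

text \<open>The matrices of \<open>R\<close> in the frame \<open>g\<close> are the wanted point;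
  adaptedness fixes all their entries outside the free block.\<close>

lemma adapted_rep_isos_extension:
  assumes R: "is_rep G R" and g: "g \<in> adapted R X"
  shows "\<exists>z\<in>extensions. g \<in> rep_isos (point_rep d z) R"
proof -
  note gA = adaptedD(1)[OF g]
  note D = is_adaptedD[OF gA]
  have "\<exists>A\<in>carrier_mat (d (head G a)) (d (tail G a)). \<forall>v\<in>carrier_vec (d (tail G a)).
      rep_map R a (g (tail G a) v) = g (head G a) (A *\<^sub>v v)" if a: "a \<in> arcs G" for a
  proof -
    have ends: "tail G a \<in> verts G" "head G a \<in> verts G" using a by auto
    let ?g' = "inv_into (carrier_vec (d (head G a))) (g (head G a))"
    have g': "linear_map class_ring (rep_space R (head G a)) (module_vec TYPE('k) (d (head G a))) ?g'"
      using linear_map_inv_into[OF D(1)[OF ends(2)]] D(2)[OF ends(2)] by simp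
    have "linear_map class_ring (module_vec TYPE('k) (d (tail G a))) (module_vec TYPE('k) (d (head G a)))
        (?g' \<circ> (rep_map R a \<circ> g (tail G a)))"
      by (rule linear_map_comp[OF linear_map_comp[OF D(1)[OF ends(1)] is_repD(3)[OF R a]] g'])
    from ex_mat_of_linear_map[OF this] obtain A where A: "A \<in> carrier_mat (d (head G a)) (d (tail G a))"
      "\<And>v. v \<in> carrier_vec (d (tail G a)) \<Longrightarrow> ?g' (rep_map R a (g (tail G a) v)) = A *\<^sub>v v" by auto
    have "rep_map R a (g (tail G a) v) = g (head G a) (A *\<^sub>v v)" if v: "v \<in> carrier_vec (d (tail G a))" for v
    proof -
      have "rep_map R a (g (tail G a) v) \<in> carrier (rep_space R (head G a))"
        by (rule rep_map_closed[OF R a is_adapted_closed[OF gA ends(1) v]])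
      then show ?thesis unfolding A(2)[OF v, symmetric]
        using D(2)[OF ends(2)] by (simp add: bij_betw_def f_inv_into_f)
    qed
    with A(1) show ?thesis by blast
  qed
  then have "\<exists>A. \<forall>a\<in>arcs G. A a \<in> carrier_mat (d (head G a)) (d (tail G a)) \<and>
      (\<forall>v\<in>carrier_vec (d (tail G a)). rep_map R a (g (tail G a) v) = g (head G a) (A a *\<^sub>v v))"
    by (intro bchoice) blast
  then obtain A where A: "\<And>a. a \<in> arcs G \<Longrightarrow> A a \<in> carrier_mat (d (head G a)) (d (tail G a))"
    and RA: "\<And>a v. a \<in> arcs G \<Longrightarrow> v \<in> carrier_vec (d (tail G a)) \<Longrightarrow> rep_map R a (g (tail G a) v) = g (head G a) (A a *\<^sub>v v)"
    by blast
  define z where "z = restrict A (arcs G)"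
  have za: "z a = A a" if "a \<in> arcs G" for a using that by (simp add: z_def)
  have zp: "z \<in> points d" using A by (auto simp: z_def points_def)
  have "z a $$ (r, c) = x a $$ (r, c)"
    if a: "a \<in> arcs G" and r: "r < d (head G a)" and c: "c < d (tail G a)"
      and J: "\<not> (r \<in> J (head G a) \<and> c \<notin> J (tail G a))" for a r c
  proof -
    have ends: "tail G a \<in> verts G" "head G a \<in> verts G" using a by auto
    let ?e = "unit_vec (d (tail G a)) c"
    have inj: "u = v" if "g (head G a) u = g (head G a) v" "u \<in> carrier_vec (d (head G a))" "v \<in> carrier_vec (d (head G a))" for u v
      by (rule inj_onD[OF bij_betw_imp_inj_on[OF D(2)[OF ends(2)]] that])
    have xe: "x a *\<^sub>v ?e \<in> carrier_vec (d (head G a))" by (rule x_mult_carrier[OF a]) simp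
    have Ae: "A a *\<^sub>v ?e \<in> carrier_vec (d (head G a))" using A[OF a] by (rule mult_mat_vec_carrier) simp
    have entry: "(x a *\<^sub>v ?e) $ r = x a $$ (r, c)" "(A a *\<^sub>v ?e) $ r = A a $$ (r, c)"
      using mult_mat_unit_vec[OF x_carrier[OF a] c] mult_mat_unit_vec[OF A[OF a] c] x_carrier[OF a] A[OF a] r c by simp_all
    \<comment> \<open>A column in \<open>J\<close> belongs to the subrepresentation, where the
      matrices agree exactly. In any other column they agree up to a vector of the coordinate
      subspace, whose entries in rows outside \<open>J\<close> are 0.\<close>
    have "(A a *\<^sub>v ?e) $ r = (x a *\<^sub>v ?e) $ r"
    proof (cases "c \<in> J (tail G a)")
      case True
      then have "?e \<in> coord (tail G a)" using c by (auto simp: coord_def unit_vec_def)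
      from D(3)[OF a this] have "g (head G a) (A a *\<^sub>v ?e) = g (head G a) (x a *\<^sub>v ?e)" using RA[OF a, of ?e] by simp
      from inj[OF this Ae xe] show ?thesis by simp
    next
      case False
      then have rJ: "r \<notin> J (head G a)" using J by simp
      from D(4)[OF a, of ?e] obtain w where w: "w \<in> coord (head G a)"
        "rep_map R a (g (tail G a) ?e) = g (head G a) (x a *\<^sub>v ?e + w)" by auto
      then have eq: "g (head G a) (A a *\<^sub>v ?e) = g (head G a) (x a *\<^sub>v ?e + w)" using RA[OF a, of ?e] by simp
      have "A a *\<^sub>v ?e = x a *\<^sub>v ?e + w"
        by (rule inj[OF eq Ae add_carrier_vec[OF xe coord_carrier[OF w(1)]]])
      moreover have "w $ r = 0" using w(1) r rJ by (simp add: coord_def)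
      moreover have "dim_vec w = d (head G a)" using coord_carrier[OF w(1)] by simp
      ultimately show ?thesis using r by simp
    qed
    then show ?thesis using entry za[OF a] by simp
  qed
  then have z: "z \<in> extensions" using zp by (simp add: extensions_def)
  have "is_rep_iso G (point_rep d z) R g"
    unfolding is_rep_iso_def using D(1,2) RA za by simp
  moreover have "g \<in> (\<Pi>\<^sub>E i\<in>verts G. carrier_vec (d i) \<rightarrow>\<^sub>E carrier (rep_space R i))"
    using g by (simp add: adapted_def)
  ultimately have "g \<in> rep_isos (point_rep d z) R" by (simp add: rep_isos_def)
  with z show ?thesis by blast
qed

text \<open>The frame \<open>g\<close> determines the matrices of \<open>R\<close> in it. Hence the
  sets of isomorphisms from different extensions are disjoint.\<close>

lemma rep_isos_point_unique:
  assumes z: "z \<in> points d" "z' \<in> points d" and g: "g \<in> rep_isos (point_rep d z) R" "g \<in> rep_isos (point_rep d z') R"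
  shows "z = z'"
proof -
  have eq: "z a = z' a" if a: "a \<in> arcs G" for a
  proof (rule eq_matI)
    have hd: "head G a \<in> verts G" using a by simp
    note zc = pointsD[OF z(1) a] pointsD[OF z(2) a]
    show "dim_row (z a) = dim_row (z' a)" "dim_col (z a) = dim_col (z' a)" using zc by auto
    fix r c assume "r < dim_row (z' a)" "c < dim_col (z' a)"
    then have r: "r < d (head G a)" and c: "c < d (tail G a)" using zc by auto
    let ?e = "unit_vec (d (tail G a)) c"
    have eq: "g (head G a) (z a *\<^sub>v ?e) = g (head G a) (z' a *\<^sub>v ?e)"
      using is_rep_isoD(3)[OF rep_isosD[OF g(1)] a, of ?e] is_rep_isoD(3)[OF rep_isosD[OF g(2)] a, of ?e] by simp
    have inj: "inj_on (g (head G a)) (carrier_vec (d (head G a)))"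
      using is_rep_isoD(2)[OF rep_isosD[OF g(1)] hd] by (simp add: bij_betw_def)
    have "z a *\<^sub>v ?e = z' a *\<^sub>v ?e"
      by (rule inj_onD[OF inj eq]) (use mult_mat_vec_carrier[OF zc(1)] mult_mat_vec_carrier[OF zc(2)] in simp_all)
    then have colz: "col (z a) c = col (z' a) c" using mult_mat_unit_vec[OF zc(1) c] mult_mat_unit_vec[OF zc(2) c] by simp
    show "z a $$ (r, c) = z' a $$ (r, c)" using arg_cong[of _ _ "\<lambda>v. v $ r", OF colz] zc r c by simp
  qed
  show ?thesis by (rule PiE_ext[OF z[unfolded points_def] eq])
qed

text \<open>The set counted by a Hall number, with the two classes given by the subrepresentation
  and the quotient of \<open>M\<close> themselves.\<close>

definition hall_subreps :: "('a, 'b, 'k, 'c) quiver_rep \<Rightarrow> ('a \<Rightarrow> 'c set) set" where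
  "hall_subreps R = {X \<in> subreps G R. rep_isomorphic G (subrep M coords) (subrep R X) \<and>
     rep_isomorphic G (quotient_rep G M coords) (quotient_rep G R X)}"

lemma Union_rep_isos_extensions:
  assumes R: "is_rep G R"
  shows "(\<Union>z\<in>extensions. rep_isos (point_rep d z) R) = (\<Union>X\<in>hall_subreps R. adapted R X)"
proof
  show "(\<Union>z\<in>extensions. rep_isos (point_rep d z) R) \<subseteq> (\<Union>X\<in>hall_subreps R. adapted R X)"
  proof
    fix g assume "g \<in> (\<Union>z\<in>extensions. rep_isos (point_rep d z) R)"
    then obtain z where z: "z \<in> extensions" and g: "g \<in> rep_isos (point_rep d z) R" by blast
    have gA: "is_adapted R g" by (rule rep_isos_extension_adapted[OF z g])
    define X where "X = (\<lambda>i\<in>verts G. g i ` coord i)"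
    have gX: "g \<in> adapted R X" using g gA by (simp add: adapted_def rep_isos_def X_def)
    have "X \<in> (\<Pi>\<^sub>E i\<in>verts G. Pow (carrier (rep_space R i)))"
      using is_adapted_closed[OF gA] coord_carrier by (auto simp: X_def)
    then have X: "X \<in> subreps G R" by (rule adapted_imp_subreps[OF R _ gX])
    have "X \<in> hall_subreps R"
      unfolding hall_subreps_def rep_isomorphic_def
      using X adapted_imp_subrep_iso[OF R X gX] adapted_imp_quotient_iso[OF R X gX] by blast
    with gX show "g \<in> (\<Union>X\<in>hall_subreps R. adapted R X)" by blast
  qed
  show "(\<Union>X\<in>hall_subreps R. adapted R X) \<subseteq> (\<Union>z\<in>extensions. rep_isos (point_rep d z) R)"
    using adapted_rep_isos_extension[OF R] by blast
qed

text \<open>A double count of adapted frames of \<open>R\<close>: an extension isomorphic to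
  \<open>R\<close> supports \<open>aut_count G R\<close> of them, a subrepresentation of the right
  type supports the constant of \<open>card_adapted\<close>. This is Riedtmann's formula with
  cocycles in place of extension classes.\<close>

lemma card_extensions:
  assumes R: "is_rep G R"
  shows "card {z \<in> extensions. rep_isomorphic G (point_rep d z) R} * aut_count G R =
    card (hall_subreps R) * card (adapted M coords)"
proof -
  have finE: "finite extensions"
    by (rule finite_subset[OF _ finite_points]) (rule subsetI, rule extensions_points)
  have "card {z \<in> extensions. rep_isomorphic G (point_rep d z) R} * aut_count G R =
      (\<Sum>z | z \<in> extensions \<and> rep_isomorphic G (point_rep d z) R. aut_count G R)" by simp
  also have "\<dots> = (\<Sum>z | z \<in> extensions \<and> rep_isomorphic G (point_rep d z) R. card (rep_isos (point_rep d z) R))"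
  proof (rule sum.cong[OF refl])
    fix z assume "z \<in> {z. z \<in> extensions \<and> rep_isomorphic G (point_rep d z) R}"
    then have "z \<in> extensions" "rep_isomorphic G (point_rep d z) R" by simp_all
    from card_rep_isos[OF is_rep_point_rep[OF extensions_points[OF this(1)]] R this(2)]
    show "aut_count G R = card (rep_isos (point_rep d z) R)" by (rule sym)
  qed
  also have "\<dots> = (\<Sum>z\<in>extensions. card (rep_isos (point_rep d z) R))"
  proof (rule sum.mono_neutral_left[OF finE])
    show "\<forall>z\<in>extensions - {z. z \<in> extensions \<and> rep_isomorphic G (point_rep d z) R}. card (rep_isos (point_rep d z) R) = 0"
    proof
      fix z assume "z \<in> extensions - {z. z \<in> extensions \<and> rep_isomorphic G (point_rep d z) R}"
      then have "\<not> rep_isomorphic G (point_rep d z) R" by simp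
      then have "rep_isos (point_rep d z) R = {}" unfolding rep_isomorphic_def rep_isos_def by blast
      then show "card (rep_isos (point_rep d z) R) = 0" by simp
    qed
  qed auto
  also have "\<dots> = card (\<Union>z\<in>extensions. rep_isos (point_rep d z) R)"
  proof (rule card_UN_disjoint[symmetric, OF finE])
    show "\<forall>z\<in>extensions. finite (rep_isos (point_rep d z) R)"
      by (rule ballI) (rule finite_rep_isos[OF is_rep_point_rep[OF extensions_points] R])
    show "\<forall>z\<in>extensions. \<forall>z'\<in>extensions. z \<noteq> z' \<longrightarrow> rep_isos (point_rep d z) R \<inter> rep_isos (point_rep d z') R = {}"
    proof (intro ballI impI equals0I)
      fix z z' g assume z: "z \<in> extensions" "z' \<in> extensions" "z \<noteq> z'"
        and "g \<in> rep_isos (point_rep d z) R \<inter> rep_isos (point_rep d z') R"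
      then have "g \<in> rep_isos (point_rep d z) R" "g \<in> rep_isos (point_rep d z') R" by simp_all
      from rep_isos_point_unique[OF extensions_points[OF z(1)] extensions_points[OF z(2)] this] z(3)
      show False by simp
    qed
  qed
  also have "\<dots> = card (\<Union>X\<in>hall_subreps R. adapted R X)"
    unfolding Union_rep_isos_extensions[OF R] ..
  also have "\<dots> = (\<Sum>X\<in>hall_subreps R. card (adapted R X))"
  proof (rule card_UN_disjoint)
    show "finite (hall_subreps R)" using finite_subreps[OF R] by (simp add: hall_subreps_def)
    have "finite (\<Union>X\<in>hall_subreps R. adapted R X)"
      unfolding Union_rep_isos_extensions[OF R, symmetric]
      by (rule finite_UN_I[OF finE finite_rep_isos[OF is_rep_point_rep[OF extensions_points] R]])
    note fin = this
    show "\<forall>X\<in>hall_subreps R. finite (adapted R X)"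
    proof
      fix X assume "X \<in> hall_subreps R"
      then have "adapted R X \<subseteq> (\<Union>X\<in>hall_subreps R. adapted R X)" by blast
      then show "finite (adapted R X)" by (rule finite_subset[OF _ fin])
    qed
    show "\<forall>X\<in>hall_subreps R. \<forall>Y\<in>hall_subreps R. X \<noteq> Y \<longrightarrow> adapted R X \<inter> adapted R Y = {}"
    proof (intro ballI impI)
      fix X Y assume X: "X \<in> hall_subreps R" and Y: "Y \<in> hall_subreps R" and neq: "X \<noteq> Y"
      have "X = Y" if g: "g \<in> adapted R X" "g \<in> adapted R Y" for g
      proof (rule PiE_ext)
        show "X \<in> (\<Pi>\<^sub>E i\<in>verts G. Pow (carrier (rep_space R i)))" "Y \<in> (\<Pi>\<^sub>E i\<in>verts G. Pow (carrier (rep_space R i)))"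
          using subrepsD(3)[of X G R] subrepsD(3)[of Y G R] X Y unfolding hall_subreps_def by blast+
        fix i assume i: "i \<in> verts G"
        show "X i = Y i" using adaptedD(2)[OF g(1) i] adaptedD(2)[OF g(2) i] by simp
      qed
      with neq show "adapted R X \<inter> adapted R Y = {}" by blast
    qed
  qed
  also have "\<dots> = (\<Sum>X\<in>hall_subreps R. card (adapted M coords))"
  proof (rule sum.cong[OF refl])
    fix X assume "X \<in> hall_subreps R"
    then have "adapted R X \<noteq> {}"
      using ex_adapted[OF R, of X] unfolding hall_subreps_def rep_isomorphic_def by blast
    then show "card (adapted R X) = card (adapted M coords)" by (rule card_adapted)
  qed
  finally show ?thesis by simp
qed

text \<open>By the double count a class R occurs among the extensions with multiplicity proportional
  to its Hall number divided by a_R, which is its weight in the coefficient of the coproduct. The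
  coordinates \<open>j\<close> and \<open>j'\<close> witness that subrepresentation and quotient are
  nonzero, so that coefficient vanishes.\<close>

theorem sum_extensions_eq_0:
  assumes f: "cuspidal G f"
    and J1: "i \<in> verts G" "j < d i" "j \<in> J i" and J2: "i' \<in> verts G" "j' < d i'" "j' \<notin> J i'"
  shows "(\<Sum>z\<in>extensions. point_value f d z) = 0"
proof -
  have finE: "finite extensions"
    by (rule finite_subset[OF _ finite_points]) (rule subsetI, rule extensions_points)
  note sM = is_rep_subrep[OF is_rep_M coords_subreps] and qM = is_rep_quotient[OF is_rep_M coords_subreps]
  obtain V :: "('a, 'b, 'k) iso_class" where V: "V \<in> iso_classes G" "rep_isomorphic G (class_rep V) (subrep M coords)"
    using ex_iso_class[OF sM] .
  obtain U :: "('a, 'b, 'k) iso_class" where U: "U \<in> iso_classes G" "rep_isomorphic G (class_rep U) (quotient_rep G M coords)"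
    using ex_iso_class[OF qM] .
  have V0: "V \<noteq> zero_class G"
  proof
    assume zero: "V = zero_class G"
    have sp: "carrier (rep_space (subrep M coords) i) = coord i" using J1(1) by (simp add: subrep_def)
    have "(unit_vec (d i) j :: 'k vec) \<in> coord i" using J1(2,3) by (auto simp: coord_def)
    then have "unit_vec (d i) j = (0\<^sub>v (d i) :: 'k vec)"
      using zero_class_carrier[OF V(1) sM V(2) zero J1(1), unfolded sp] coord_closed(3)[of i] by iprover
    from arg_cong[OF this, of "\<lambda>v. v $ j"] show False using J1(2) by simp
  qed
  have U0: "U \<noteq> zero_class G"
  proof
    assume zero: "U = zero_class G"
    note sub = subrepsD(1)[OF coords_subreps J2(1)]
    have carr: "coset M coords i' v \<in> carrier (rep_space (quotient_rep G M coords) i')" if "v \<in> carrier_vec (d i')" for v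
      using carrier_quotient[OF sub] that by (simp add: quotient_rep_def)
    have "coset M coords i' (unit_vec (d i') j') = coset M coords i' (0\<^sub>v (d i'))"
      by (rule zero_class_carrier[OF U(1) qM U(2) zero J2(1) carr[OF unit_vec_carrier] carr[OF zero_carrier_vec]])
    then have "unit_vec (d i') j' \<in> coords i'"
      using coset_eq_self_iff[OF sub, of "unit_vec (d i') j'"] coset_zero[OF sub] by simp
    then show False using J2 by (auto simp: coord_def)
  qed
  let ?c = "card (adapted M coords)"
  \<comment> \<open>The chosen representatives of the classes may be replaced by the actual
    subrepresentation and quotient of \<open>M\<close>, despite their different carrier
    types.\<close>
  have hall: "hall_number G R (class_rep U) (class_rep V) = card (hall_subreps R)" if R: "is_rep G R" for R :: "('a, 'b, 'k, 'k vec) quiver_rep"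
  proof -
    have "rep_isomorphic G (subrep R X) (class_rep V) \<longleftrightarrow> rep_isomorphic G (subrep M coords) (subrep R X)" if X: "X \<in> subreps G R" for X
      by (rule rep_isomorphic_switch[OF is_rep_subrep[OF R X] class_rep_iso_classes(2)[OF V(1)] V(2)])
    moreover have "rep_isomorphic G (quotient_rep G R X) (class_rep U) \<longleftrightarrow> rep_isomorphic G (quotient_rep G M coords) (quotient_rep G R X)"
      if X: "X \<in> subreps G R" for X
      by (rule rep_isomorphic_switch[OF is_rep_quotient[OF R X] class_rep_iso_classes(2)[OF U(1)] U(2)])
    ultimately have "{X \<in> subreps G R. rep_isomorphic G (subrep R X) (class_rep V) \<and> rep_isomorphic G (quotient_rep G R X) (class_rep U)} = hall_subreps R"
      unfolding hall_subreps_def by auto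
    then show ?thesis unfolding hall_number_def by (simp only:)
  qed
  have fH: "f \<in> hall_algebra G" using f by (simp add: cuspidal_def)
  have key: "of_nat (card {z \<in> extensions. iso_class_of (point_rep d z) = R}) =
      (of_nat ?c :: complex) * (of_nat (hall_number G (class_rep R) (class_rep U) (class_rep V)) / of_nat (aut_count G (class_rep R)))"
    if R: "R \<in> Poly_Mapping.keys f" for R
  proof -
    have "R \<in> iso_classes G" using R fH by (auto simp: hall_algebra_def)
    note C = class_rep_iso_classes[OF this]
    have "{z \<in> extensions. iso_class_of (point_rep d z) = R} = {z \<in> extensions. rep_isomorphic G (point_rep d z) (class_rep R)}"
    proof (rule Collect_cong, rule conj_cong[OF refl])
      fix z assume "z \<in> extensions"
      from iso_class_of_eq_iff[OF is_rep_point_rep[OF extensions_points[OF this]] C(2)]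
      show "iso_class_of (point_rep d z) = R \<longleftrightarrow> rep_isomorphic G (point_rep d z) (class_rep R)"
        unfolding C(3) .
    qed
    then have "card {z \<in> extensions. iso_class_of (point_rep d z) = R} * aut_count G (class_rep R) =
        hall_number G (class_rep R) (class_rep U) (class_rep V) * ?c"
      unfolding hall[OF C(2)] using card_extensions[OF C(2)] by (simp only:)
    then have "(of_nat (card {z \<in> extensions. iso_class_of (point_rep d z) = R} * aut_count G (class_rep R)) :: complex) =
        of_nat (hall_number G (class_rep R) (class_rep U) (class_rep V) * ?c)" by (simp only:)
    moreover have "(of_nat (aut_count G (class_rep R)) :: complex) \<noteq> 0" using aut_count_pos[OF C(2)] by simp
    ultimately show ?thesis unfolding of_nat_mult times_divide_eq_right by (simp only: nonzero_eq_divide_eq mult.commute[of "of_nat ?c"] simp_thms)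
  qed
  \<comment> \<open>Points whose class is not among the keys have value 0, so sorting the points by
    the keys of \<open>f\<close> loses nothing.\<close>
  have "(\<Sum>z\<in>extensions. point_value f d z) =
      (\<Sum>z\<in>extensions. \<Sum>R\<in>Poly_Mapping.keys f. if iso_class_of (point_rep d z) = R then Poly_Mapping.lookup f R else 0)"
    unfolding point_value_def
    by (rule sum.cong[OF refl]) (simp add: sum.delta in_keys_iff)
  also have "\<dots> = (\<Sum>R\<in>Poly_Mapping.keys f. \<Sum>z\<in>extensions. if iso_class_of (point_rep d z) = R then Poly_Mapping.lookup f R else 0)"
    by (rule sum.swap)
  also have "\<dots> = (\<Sum>R\<in>Poly_Mapping.keys f. of_nat (card {z \<in> extensions. iso_class_of (point_rep d z) = R}) * Poly_Mapping.lookup f R)"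
    by (rule sum.cong[OF refl]) (use finE in \<open>simp add: sum.If_cases Int_def\<close>)
  also have "\<dots> = (\<Sum>R\<in>Poly_Mapping.keys f. of_nat ?c * (Poly_Mapping.lookup f R *
      of_nat (hall_number G (class_rep R) (class_rep U) (class_rep V)) / of_nat (aut_count G (class_rep R))))"
    by (rule sum.cong[OF refl]) (simp only: key times_divide_eq_right times_divide_eq_left mult_ac)
  also have "\<dots> = of_nat ?c * 0"
    unfolding sum_distrib_left[symmetric] cuspidal_coeff_eq_0[OF f U(1) U0 V(1) V0] ..
  finally show ?thesis by simp
qed

end

context fin_digraph
begin

text \<open>In dimension 0 the function is a multiple of 1 = [0]. Then \<Delta>(1) = 1 \<otimes> 1,
  whereas cuspidality would demand twice that.\<close>

lemma cuspidal_dim_nonzero: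
  fixes f :: "('a, 'b, 'k::{field, finite}) hall_element"
  assumes f: "cuspidal G f" "f \<noteq> 0" "homogeneous G d f"
  shows "\<exists>i\<in>verts G. d i \<noteq> 0"
proof (rule ccontr)
  assume "\<not> (\<exists>i\<in>verts G. d i \<noteq> 0)"
  then have d0: "d i = 0" if "i \<in> verts G" for i using that by blast
  have fH: "f \<in> hall_algebra G" using f by (simp add: cuspidal_def)
  have keys0: "R = zero_class G" "R \<in> iso_classes G" if R: "R \<in> Poly_Mapping.keys f" for R
  proof -
    show Ri: "R \<in> iso_classes G" using R fH by (auto simp: hall_algebra_def)
    note C = class_rep_iso_classes[OF Ri]
    have dim: "rep_dim N i = 0" if "N \<in> R" "i \<in> verts G" for N i
      using f(3) R that d0 by (auto simp: homogeneous_def)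
    obtain x where x: "x \<in> points d" "rep_isomorphic G (point_rep d x) (class_rep R)"
      using ex_isomorphic_point_rep[OF C(2), of d] dim C(1) d0 by auto
    have "N \<in> R" if N: "is_rep G N" "\<And>i. i \<in> verts G \<Longrightarrow> rep_dim N i = 0" for N
    proof -
      obtain y where y: "y \<in> points d" "rep_isomorphic G (point_rep d y) N"
        using ex_isomorphic_point_rep[OF N(1), of d] N(2) d0 by auto
      \<comment> \<open>All matrices have size 0 x 0, so there is only one point and only one
        class.\<close>
      have "x = y"
      proof (rule PiE_ext[OF x(1)[unfolded points_def] y(1)[unfolded points_def]])
        fix a assume a: "a \<in> arcs G"
        show "x a = y a"
          using pointsD[OF x(1) a] pointsD[OF y(1) a] d0[OF head_in_verts[OF a]] by (intro eq_matI) auto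
      qed
      then have "rep_isomorphic G (class_rep R) N"
        using rep_isomorphic_trans[OF rep_isomorphic_sym[OF is_rep_point_rep[OF x(1)] x(2)]] y(2) by simp
      then have "N \<in> iso_class_of (class_rep R)" using N by (simp add: iso_class_of_def)
      then show ?thesis using C(3) by simp
    qed
    moreover have "is_rep G N" if "N \<in> R" for N
      using that C(3) by (auto simp: iso_class_of_def)
    ultimately show "R = zero_class G" using dim by (auto simp: zero_class_def)
  qed
  obtain R where R: "R \<in> Poly_Mapping.keys f" using f(2) by (meson all_not_in_conv keys_eq_empty)
  have keys: "Poly_Mapping.keys f = {R}" using R keys0(1) by blast
  note C = class_rep_iso_classes[OF keys0(2)[OF R]]
  have dim: "rep_dim (class_rep R) i = 0" if "i \<in> verts G" for i
    using C(1) that keys0(1)[OF R] by (auto simp: zero_class_def)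
  note single = rep_dim_0_carrier[OF C(2) _ dim]
  let ?a = "aut_count G (class_rep R)" and ?h = "hall_number G (class_rep R) (class_rep R) (class_rep R)"
  have "hall_comult G f (R, R) = hall_tensor f (hall_unit G) (R, R) + hall_tensor (hall_unit G) f (R, R)"
    using f by (simp add: cuspidal_def)
  also have "\<dots> = 2 * Poly_Mapping.lookup f R"
    using keys0(1)[OF R] by (simp add: hall_tensor_def hall_unit_def)
  \<comment> \<open>Here U, V and R are all the zero class: \<nu> has exponent 0 and one of the
    automorphism counts cancels. What is left is \<open>?h * ?a\<close>, and each factor is at most
    1.\<close>
  also have "hall_comult G f (R, R) = Poly_Mapping.lookup f R * (of_nat ?h * (of_nat ?a * of_nat ?a / of_nat ?a))"
  proof -
    have "euler_form G (\<lambda>i. int (rep_dim (class_rep R) i)) (\<lambda>i. int (rep_dim (class_rep R) i)) = 0"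
      unfolding euler_form_def by (simp add: dim)
    then show ?thesis using keys0(2)[OF R] by (simp add: hall_comult_def comult_coeff_def keys)
  qed
  finally have "Poly_Mapping.lookup f R * of_nat (?h * ?a) = Poly_Mapping.lookup f R * of_nat 2"
    using aut_count_pos[OF C(2)] by simp
  then have "(of_nat (?h * ?a) :: complex) = of_nat 2"
    using R by (simp add: in_keys_iff)
  then have 2: "?h * ?a = 2" by (simp only: of_nat_eq_iff)
  have "?a \<le> 1"
    unfolding aut_count_def rep_automorphisms_eq
  proof (rule card_le_Suc0_iff_eq[THEN iffD2, folded One_nat_def])
    show "finite (rep_isos (class_rep R) (class_rep R))" by (rule finite_rep_isos[OF C(2) C(2)])
    show "\<forall>g\<in>rep_isos (class_rep R) (class_rep R). \<forall>h\<in>rep_isos (class_rep R) (class_rep R). g = h"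
    proof (intro ballI)
      fix g h assume g: "g \<in> rep_isos (class_rep R) (class_rep R)" and h: "h \<in> rep_isos (class_rep R) (class_rep R)"
      show "g = h"
      proof (rule rep_isos_eqI[OF g h])
        fix i v assume i: "i \<in> verts G" and v: "v \<in> carrier (rep_space (class_rep R) i)"
        show "g i v = h i v"
          by (rule single[OF i i is_rep_iso_closed[OF rep_isosD[OF g] i v] is_rep_iso_closed[OF rep_isosD[OF h] i v]])
      qed
    qed
  qed
  moreover have "?h \<le> 1"
    unfolding hall_number_def
  proof (rule card_le_Suc0_iff_eq[THEN iffD2, folded One_nat_def])
    let ?H = "{X \<in> subreps G (class_rep R). rep_isomorphic G (subrep (class_rep R) X) (class_rep R) \<and>
      rep_isomorphic G (quotient_rep G (class_rep R) X) (class_rep R)}"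
    show "finite ?H" using finite_subreps[OF C(2)] by (rule rev_finite_subset) blast
    show "\<forall>X\<in>?H. \<forall>Y\<in>?H. X = Y"
    proof (intro ballI)
      fix X Y assume "X \<in> ?H" "Y \<in> ?H"
      then have X: "X \<in> subreps G (class_rep R)" and Y: "Y \<in> subreps G (class_rep R)" by auto
      have eq: "Z i = {\<zero>\<^bsub>rep_space (class_rep R) i\<^esub>}" if Z: "Z \<in> subreps G (class_rep R)" and i: "i \<in> verts G" for Z i
      proof
        note sub = subspaceD[OF subrepsD(1)[OF Z i]]
        note zero = vectorspaceD(1)[OF is_repD(1)[OF C(2) i]]
        show "Z i \<subseteq> {\<zero>\<^bsub>rep_space (class_rep R) i\<^esub>}"
        proof
          fix v assume "v \<in> Z i"
          then have "v \<in> carrier (rep_space (class_rep R) i)" using sub(2) by blast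
          from single[OF i i this zero] show "v \<in> {\<zero>\<^bsub>rep_space (class_rep R) i\<^esub>}" by simp
        qed
        show "{\<zero>\<^bsub>rep_space (class_rep R) i\<^esub>} \<subseteq> Z i" using sub(3) by simp
      qed
      show "X = Y"
      proof (rule PiE_ext[OF subrepsD(3)[OF X] subrepsD(3)[OF Y]])
        fix i assume i: "i \<in> verts G"
        show "X i = Y i" unfolding eq[OF X i] eq[OF Y i] ..
      qed
    qed
  qed
  ultimately have "?h * ?a \<le> 1 * 1" by (intro mult_le_mono)
  with 2 show False by simp
qed

end

section \<open>Null vectors and embedded affine diagrams\<close>

text \<open>Orientations are forgotten and fullness is not demanded: \<open>G\<close> may have more
  arcs, even between vertices in the image. Arcs are mapped too, so that multiple edges stay
  distinct.\<close>

definition embeds :: "('w, 'f) pre_digraph \<Rightarrow> ('v, 'e) pre_digraph \<Rightarrow> bool" where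
  "embeds H G \<longleftrightarrow> (\<exists>\<phi> \<psi>. inj_on \<phi> (verts H) \<and> \<phi> ` verts H \<subseteq> verts G \<and>
     inj_on \<psi> (arcs H) \<and> \<psi> ` arcs H \<subseteq> arcs G \<and>
     (\<forall>a\<in>arcs H. \<phi> ` {tail H a, head H a} = {tail G (\<psi> a), head G (\<psi> a)}))"

text \<open>Both ends of a loop count, so this is the kernel of the affine Cartan matrix.\<close>

definition null_vector :: "('v, 'e) pre_digraph \<Rightarrow> ('v \<Rightarrow> int) \<Rightarrow> bool" where
  "null_vector G \<delta> \<longleftrightarrow> (\<forall>i\<in>verts G. \<delta> i > 0 \<and> 2 * \<delta> i =
     (\<Sum>a\<in>arcs G. (if tail G a = i then \<delta> (head G a) else 0) + (if head G a = i then \<delta> (tail G a) else 0)))"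

text \<open>Phrased by vertex sets closed under arcs, since such a set is what splits a
  representation into two summands.\<close>

definition connected_graph :: "('v, 'e) pre_digraph \<Rightarrow> bool" where
  "connected_graph G \<longleftrightarrow> verts G \<noteq> {} \<and> (\<forall>A\<subseteq>verts G. A \<noteq> {} \<longrightarrow>
     (\<forall>a\<in>arcs G. tail G a \<in> A \<longleftrightarrow> head G a \<in> A) \<longrightarrow> A = verts G)"

text \<open>\<open>\<delta>\<close> lies in the radical of the symmetric form, so it pairs to zero
  with every \<open>x\<close>; this is that pairing, with the vertex part and the arc part on
  separate sides.\<close>

lemma (in fin_digraph) null_vector_pairing:
  assumes "null_vector G \<delta>"
  shows "(\<Sum>i\<in>verts G. 2 * \<delta> i * x i) =
    (\<Sum>a\<in>arcs G. \<delta> (head G a) * x (tail G a) + \<delta> (tail G a) * x (head G a))"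
proof -
  have "(\<Sum>i\<in>verts G. 2 * \<delta> i * x i) = (\<Sum>i\<in>verts G. \<Sum>a\<in>arcs G.
      (if tail G a = i then \<delta> (head G a) * x i else 0) + (if head G a = i then \<delta> (tail G a) * x i else 0))"
  proof (rule sum.cong[OF refl])
    fix i assume "i \<in> verts G"
    then have "2 * \<delta> i * x i = (\<Sum>a\<in>arcs G. (if tail G a = i then \<delta> (head G a) else 0) +
        (if head G a = i then \<delta> (tail G a) else 0)) * x i"
      using assms by (simp add: null_vector_def)
    also have "\<dots> = (\<Sum>a\<in>arcs G. (if tail G a = i then \<delta> (head G a) * x i else 0) +
        (if head G a = i then \<delta> (tail G a) * x i else 0))"
      unfolding sum_distrib_right by (intro sum.cong refl) (simp add: distrib_right)
    finally show "2 * \<delta> i * x i = (\<Sum>a\<in>arcs G. (if tail G a = i then \<delta> (head G a) * x i else 0) +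
        (if head G a = i then \<delta> (tail G a) * x i else 0))" .
  qed
  also have "\<dots> = (\<Sum>a\<in>arcs G. \<Sum>i\<in>verts G.
      (if tail G a = i then \<delta> (head G a) * x i else 0) + (if head G a = i then \<delta> (tail G a) * x i else 0))"
    by (rule sum.swap)
  also have "\<dots> = (\<Sum>a\<in>arcs G. \<delta> (head G a) * x (tail G a) + \<delta> (tail G a) * x (head G a))"
    by (intro sum.cong refl) (simp add: sum.distrib)
  finally show ?thesis .
qed

text \<open>
  Pairing the null vector \<open>d\<close> of \<open>G\<close> with the null vector of an embedded \<open>H\<close> shows that no further arc
  of \<open>G\<close> touches \<open>H\<close>.
\<close>

lemma embeds_imp_same_underlying_graph:
  assumes G: "fin_digraph G" "connected_graph G" "null_vector G d"
    and H: "fin_digraph H" "verts H \<noteq> {}" "null_vector H \<delta>" and emb: "embeds H G"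
  shows "same_underlying_graph G H"
proof -
  interpret G: fin_digraph G by fact
  interpret H: fin_digraph H by fact
  from emb obtain \<phi> \<psi> where \<phi>: "inj_on \<phi> (verts H)" "\<phi> ` verts H \<subseteq> verts G"
    and \<psi>: "inj_on \<psi> (arcs H)" "\<psi> ` arcs H \<subseteq> arcs G"
    and ends: "\<And>a. a \<in> arcs H \<Longrightarrow> {\<phi> (tail H a), \<phi> (head H a)} = {tail G (\<psi> a), head G (\<psi> a)}"
    unfolding embeds_def by auto
  \<comment> \<open>The null vector of \<open>H\<close> carried to \<open>G\<close> and extended by
    0.\<close>
  define \<delta>' where "\<delta>' i = (if i \<in> \<phi> ` verts H then \<delta> (inv_into (verts H) \<phi> i) else 0)" for i
  have \<delta>': "\<delta>' (\<phi> v) = \<delta> v" if "v \<in> verts H" for v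
    using \<phi>(1) that by (simp add: \<delta>'_def)
  have dpos: "d i > 0" if "i \<in> verts G" for i using G(3) that by (simp add: null_vector_def)
  have \<delta>pos: "\<delta> i > 0" if "i \<in> verts H" for i using H(3) that by (simp add: null_vector_def)
  have \<delta>'_nonneg: "\<delta>' i \<ge> 0" for i
    using \<delta>pos inv_into_into[of i \<phi> "verts H"] by (force simp: \<delta>'_def)
  define w where "w a = d (head G a) * \<delta>' (tail G a) + d (tail G a) * \<delta>' (head G a)" for a
  have w_nonneg: "w a \<ge> 0" if "a \<in> arcs G" for a
    using that dpos[of "head G a"] dpos[of "tail G a"] \<delta>'_nonneg by (simp add: w_def)
  \<comment> \<open>The vertex sum 2 \<Sum> d \<delta>' equals the weight of all arcs of
    \<open>G\<close>, as \<open>d\<close> is null, and the weight of the arcs coming from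
    \<open>H\<close>, as \<open>\<delta>\<close> is null. The remaining arcs have nonnegative
    weights with sum 0.\<close>
  have "(\<Sum>a\<in>arcs G. w a) = (\<Sum>i\<in>verts G. 2 * d i * \<delta>' i)"
    unfolding w_def by (rule G.null_vector_pairing[OF G(3), symmetric])
  also have "\<dots> = (\<Sum>i\<in>\<phi> ` verts H. 2 * d i * \<delta>' i)"
    using \<phi>(2) by (intro sum.mono_neutral_right) (auto simp: \<delta>'_def)
  also have "\<dots> = (\<Sum>v\<in>verts H. 2 * \<delta> v * d (\<phi> v))"
    by (simp add: sum.reindex[OF \<phi>(1)] \<delta>' mult_ac)
  also have "\<dots> = (\<Sum>b\<in>arcs H. \<delta> (head H b) * d (\<phi> (tail H b)) + \<delta> (tail H b) * d (\<phi> (head H b)))"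
    by (rule H.null_vector_pairing[OF H(3)])
  also have "\<dots> = (\<Sum>b\<in>arcs H. w (\<psi> b))"
  proof (rule sum.cong[OF refl])
    fix b assume b: "b \<in> arcs H"
    then have "\<delta> (head H b) = \<delta>' (\<phi> (head H b))" "\<delta> (tail H b) = \<delta>' (\<phi> (tail H b))"
      by (simp_all add: \<delta>')
    then show "\<delta> (head H b) * d (\<phi> (tail H b)) + \<delta> (tail H b) * d (\<phi> (head H b)) = w (\<psi> b)"
      using ends[OF b] by (auto simp: w_def doubleton_eq_iff)
  qed
  also have "\<dots> = (\<Sum>a\<in>\<psi> ` arcs H. w a)" by (simp add: sum.reindex[OF \<psi>(1)])
  finally have "(\<Sum>a\<in>arcs G - \<psi> ` arcs H. w a) = 0"
    using sum_diff[OF G.finite_arcs \<psi>(2), of w] by simp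
  then have w0: "w a = 0" if "a \<in> arcs G - \<psi> ` arcs H" for a
    using that w_nonneg by (subst (asm) sum_nonneg_eq_0_iff) auto
  have outside: "tail G a \<notin> \<phi> ` verts H \<and> head G a \<notin> \<phi> ` verts H" if a: "a \<in> arcs G - \<psi> ` arcs H" for a
  proof -
    have pos: "\<delta>' i > 0" if "i \<in> \<phi> ` verts H" for i
      using that \<delta>pos \<delta>' by auto
    have nonneg: "d (head G a) * \<delta>' (tail G a) \<ge> 0" "d (tail G a) * \<delta>' (head G a) \<ge> 0"
      using a dpos[of "head G a"] dpos[of "tail G a"] \<delta>'_nonneg by simp_all
    have "d (head G a) * \<delta>' (tail G a) = 0" "d (tail G a) * \<delta>' (head G a) = 0"
      using w0[OF a] nonneg unfolding w_def by linarith+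
    then have "\<delta>' (tail G a) = 0" "\<delta>' (head G a) = 0"
      using a dpos[of "head G a"] dpos[of "tail G a"] by auto
    then show ?thesis using pos[of "tail G a"] pos[of "head G a"] by auto
  qed
  have inside: "tail G (\<psi> b) \<in> \<phi> ` verts H \<and> head G (\<psi> b) \<in> \<phi> ` verts H" if b: "b \<in> arcs H" for b
  proof -
    have "{\<phi> (tail H b), \<phi> (head H b)} \<subseteq> \<phi> ` verts H" using b by auto
    then show ?thesis unfolding ends[OF b] by simp
  qed
  \<comment> \<open>An arc from \<open>H\<close> has both ends in the image and any other arc has
    none, so connectedness makes the image everything.\<close>
  have "\<forall>a\<in>arcs G. tail G a \<in> \<phi> ` verts H \<longleftrightarrow> head G a \<in> \<phi> ` verts H"
    using outside inside by blast
  then have \<phi>_onto: "\<phi> ` verts H = verts G"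
    using G(2) \<phi>(2) H(2) unfolding connected_graph_def by blast
  then have \<psi>_onto: "\<psi> ` arcs H = arcs G"
    using outside \<psi>(2) G.tail_in_verts by blast
  let ?\<phi> = "inv_into (verts H) \<phi>" and ?\<psi> = "inv_into (arcs H) \<psi>"
  have "bij_betw ?\<phi> (verts G) (verts H)" "bij_betw ?\<psi> (arcs G) (arcs H)"
    using \<phi>(1) \<psi>(1) \<phi>_onto \<psi>_onto by (simp_all add: bij_betw_inv_into bij_betw_imageI)
  moreover have "?\<phi> ` {tail G a, head G a} = {tail H (?\<psi> a), head H (?\<psi> a)}" if "a \<in> arcs G" for a
  proof -
    from that obtain b where b: "b \<in> arcs H" "a = \<psi> b" using \<psi>_onto by blast
    have "?\<phi> ` {tail G a, head G a} = ?\<phi> ` {\<phi> (tail H b), \<phi> (head H b)}"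
      using ends[OF b(1)] b(2) by simp
    also have "\<dots> = {tail H b, head H b}" using \<phi>(1) b(1) by simp
    finally show ?thesis using \<psi>(1) b by simp
  qed
  ultimately show ?thesis unfolding same_underlying_graph_def by blast
qed

section \<open>Embeddings from lists of edges\<close>

definition adj :: "('v, 'e) pre_digraph \<Rightarrow> 'v \<Rightarrow> 'v \<Rightarrow> bool" where
  "adj G u v \<longleftrightarrow> (\<exists>a\<in>arcs G. {tail G a, head G a} = {u, v})"

lemma adj_sym: "adj G u v \<Longrightarrow> adj G v u"
  by (auto simp: adj_def insert_commute)

text \<open>Edges that differ as unordered pairs stay different under an injective
  \<open>\<phi>\<close>, so arbitrary choices of arcs are automatically injective. The double edge
  of \<open>affine_A 1\<close> is not of this kind and gets its own argument.\<close>

lemma embeds_graph_of_edges: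
  assumes es: "distinct (map (\<lambda>(p, q). {p, q}) es)" "\<And>p q. (p, q) \<in> set es \<Longrightarrow> p < n \<and> q < n \<and> adj G (\<phi> p) (\<phi> q)"
    and \<phi>: "inj_on \<phi> {..<n}" "\<phi> ` {..<n} \<subseteq> verts G"
  shows "embeds (graph_of_edges n es) G"
proof -
  have "\<forall>k\<in>{..<length es}. \<exists>a. a \<in> arcs G \<and> {tail G a, head G a} = {\<phi> (fst (es ! k)), \<phi> (snd (es ! k))}"
  proof
    fix k assume "k \<in> {..<length es}"
    then have "(fst (es ! k), snd (es ! k)) \<in> set es" by simp
    then show "\<exists>a. a \<in> arcs G \<and> {tail G a, head G a} = {\<phi> (fst (es ! k)), \<phi> (snd (es ! k))}"
      using es(2) unfolding adj_def by blast
  qed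
  then obtain \<psi> where \<psi>: "\<And>k. k < length es \<Longrightarrow> \<psi> k \<in> arcs G"
    "\<And>k. k < length es \<Longrightarrow> {tail G (\<psi> k), head G (\<psi> k)} = {\<phi> (fst (es ! k)), \<phi> (snd (es ! k))}"
    by (metis bchoice lessThan_iff)
  have lt: "fst (es ! k) < n" "snd (es ! k) < n" if "k < length es" for k
    using es(2)[of "fst (es ! k)" "snd (es ! k)"] nth_mem[OF that] by simp_all
  have "inj_on \<psi> {..<length es}"
  proof (rule inj_onI)
    fix k l assume k: "k \<in> {..<length es}" and l: "l \<in> {..<length es}" and eq: "\<psi> k = \<psi> l"
    have "\<phi> ` {fst (es ! k), snd (es ! k)} = \<phi> ` {fst (es ! l), snd (es ! l)}"
      using \<psi>(2)[of k] \<psi>(2)[of l] k l eq by simp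
    then have "{fst (es ! k), snd (es ! k)} = {fst (es ! l), snd (es ! l)}"
      using k l lt by (subst (asm) inj_on_image_eq_iff[OF \<phi>(1)]) auto
    then have "map (\<lambda>(p, q). {p, q}) es ! k = map (\<lambda>(p, q). {p, q}) es ! l"
      using k l by (simp add: split_def)
    then show "k = l" using es(1) k l nth_eq_iff_index_eq[OF es(1), of k l] by simp
  qed
  then show ?thesis
    unfolding embeds_def graph_of_edges_def
    using \<phi> \<psi> by (intro exI[of _ \<phi>] exI[of _ \<psi>]) auto
qed

lemma notin_imageI: "(\<And>i. i \<in> A \<Longrightarrow> y \<noteq> f i) \<Longrightarrow> y \<notin> f ` A"
  by auto

lemma disjoint_imagesI: "(\<And>i j. i \<in> A \<Longrightarrow> j \<in> B \<Longrightarrow> f i \<noteq> g j) \<Longrightarrow> f ` A \<inter> g ` B = {}"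
  by auto

text \<open>A walk without backtracking; in a forest it never returns to a vertex.\<close>

definition reduced_walk :: "('v \<Rightarrow> 'v \<Rightarrow> bool) \<Rightarrow> (nat \<Rightarrow> 'v) \<Rightarrow> nat \<Rightarrow> bool" where
  "reduced_walk E w L \<longleftrightarrow> (\<forall>k<L. E (w k) (w (Suc k))) \<and> (\<forall>k. Suc (Suc k) \<le> L \<longrightarrow> w k \<noteq> w (Suc (Suc k)))"

section \<open>Forests with a positive harmonic function\<close>

abbreviation "edges_D n \<equiv> [(0, 2), (1, 2)] @ map (\<lambda>i. (i, i + 1)) [2..<n - 2] @ [(n - 2, n - 1), (n - 2, n)]"
abbreviation "edges_E6 \<equiv> [(0, 1), (1, 2), (0, 3), (3, 4), (0, 5), (5, 6)]"
abbreviation "edges_E7 \<equiv> [(0, 1), (0, 2), (2, 3), (3, 4), (0, 5), (5, 6), (6, 7)]"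
abbreviation "edges_E8 \<equiv> [(0, 1), (0, 2), (2, 3), (0, 4), (4, 5), (5, 6), (6, 7), (7, 8)]"

text \<open>What remains of a graph with a null vector when no \<open>affine_A n\<close> embeds: a
  loop would be n = 0, parallel arcs n = 1, and a cycle on n + 1 distinct vertices the case n \<ge>
  2 in \<open>acyclic\<close>.\<close>

locale harmonic_forest =
  fixes V :: "'v set" and E :: "'v \<Rightarrow> 'v \<Rightarrow> bool" and d :: "'v \<Rightarrow> int"
  assumes finite_V: "finite V" and nonempty_V: "V \<noteq> {}"
    and E_V: "E u v \<Longrightarrow> u \<in> V \<and> v \<in> V" and E_sym: "E u v \<Longrightarrow> E v u" and E_irrefl: "\<not> E u u"
    and acyclic: "n \<ge> 2 \<Longrightarrow> inj_on c {..n} \<Longrightarrow> (\<And>k. k < n \<Longrightarrow> E (c k) (c (Suc k))) \<Longrightarrow> \<not> E (c n) (c 0)"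
    and d_pos: "v \<in> V \<Longrightarrow> d v > 0" and harmonic: "v \<in> V \<Longrightarrow> 2 * d v = (\<Sum>u | E v u. d u)"
begin

lemma finite_nbrs: "finite {u. E v u}"
  using finite_V by (rule rev_finite_subset) (use E_V in auto)

abbreviation "deg v \<equiv> card {u. E v u}"

text \<open>A shortest return to a vertex has no inner repetition. Its length is neither 1, as there
  are no loops, nor 2, as the walk does not turn back, so it is a cycle.\<close>

lemma reduced_walk_inj:
  assumes w: "reduced_walk E w L"
  shows "inj_on w {..L}"
proof (rule ccontr)
  assume "\<not> inj_on w {..L}"
  then have ex: "\<exists>l s. l > 0 \<and> s + l \<le> L \<and> w s = w (s + l)"
    unfolding inj_on_def
    by (metis atMost_iff less_imp_add_positive linorder_less_linear)
  define l where "l = (LEAST l. \<exists>s. l > 0 \<and> s + l \<le> L \<and> w s = w (s + l))"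
  from ex have "\<exists>s. l > 0 \<and> s + l \<le> L \<and> w s = w (s + l)"
    unfolding l_def by (rule LeastI_ex)
  then obtain s where s: "l > 0" "s + l \<le> L" "w s = w (s + l)" by blast
  have min: "w p \<noteq> w (p + k)" if "0 < k" "k < l" "p + k \<le> L" for p k
    using not_less_Least[OF that(2)[unfolded l_def]] that by blast
  have step: "E (w k) (w (Suc k))" if "k < L" for k using w that by (simp add: reduced_walk_def)
  have "l \<noteq> 1" using s step[of s] E_irrefl by auto
  moreover have "l \<noteq> 2" using s w by (auto simp: reduced_walk_def)
  ultimately have l: "l \<ge> 3" using s(1) by linarith
  let ?c = "\<lambda>k. w (s + k)"
  have "inj_on ?c {..l - 1}"
  proof (rule inj_onI)
    fix j k assume jk: "j \<in> {..l - 1}" "k \<in> {..l - 1}" "w (s + j) = w (s + k)"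
    show "j = k"
    proof (rule ccontr)
      assume "j \<noteq> k"
      then consider "j < k" | "k < j" by linarith
      then show False
      proof cases
        case 1
        then have "0 < k - j" "k - j < l" "s + j + (k - j) \<le> L" using jk(2) s(2) l by auto
        from min[OF this] show False using 1 jk(3) by simp
      next
        case 2
        then have "0 < j - k" "j - k < l" "s + k + (j - k) \<le> L" using jk(1) s(2) l by auto
        from min[OF this] show False using 2 jk(3) by simp
      qed
    qed
  qed
  moreover have "E (?c k) (?c (Suc k))" if "k < l - 1" for k using step[of "s + k"] s(2) that by simp
  moreover have "E (?c (l - 1)) (?c 0)" using step[of "s + (l - 1)"] s l by simp
  moreover have "2 \<le> l - 1" using l by simp
  ultimately show False using acyclic[of "l - 1" ?c] by blast
qed

text \<open>At a vertex of degree 2 there is exactly one way on without turning back. Following it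
  must end, because the walk is injective and \<open>V\<close> is finite.\<close>

lemma ex_arm:
  assumes cw: "E c w"
  obtains v K where "K \<ge> 1" "reduced_walk E v K" "v 0 = c" "v 1 = w"
    "\<And>k. 0 < k \<Longrightarrow> k < K \<Longrightarrow> deg (v k) = 2" "deg (v K) \<noteq> 2"
proof -
  \<comment> \<open>The state is the pair of previous and current vertex, since the next step
    depends on both. The walk is defined forever but meaningful only up to the first degree other
    than 2.\<close>
  define f where "f = rec_nat (c, w) (\<lambda>_ (p, q). (q, SOME x. E q x \<and> x \<noteq> p))"
  define v where "v k = fst (f k)" for k
  have f: "f k = (v k, v (Suc k))" for k by (simp add: f_def v_def split_def)
  have v01: "v 0 = c" "v 1 = w" using f[of 0] by (simp_all add: f_def v_def)
  have vSS: "v (Suc (Suc k)) = (SOME x. E (v (Suc k)) x \<and> x \<noteq> v k)" for k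
  proof -
    have "f (Suc k) = (v (Suc k), SOME x. E (v (Suc k)) x \<and> x \<noteq> v k)"
      using f[of k] by (simp add: f_def)
    then show ?thesis using f[of "Suc k"] by simp
  qed
  have next_step: "E (v (Suc k)) (v (Suc (Suc k))) \<and> v (Suc (Suc k)) \<noteq> v k" if "deg (v (Suc k)) = 2" for k
  proof -
    have "\<exists>x. E (v (Suc k)) x \<and> x \<noteq> v k"
    proof (rule ccontr)
      assume "\<not> ?thesis"
      then have "{u. E (v (Suc k)) u} \<subseteq> {v k}" by blast
      then have "deg (v (Suc k)) \<le> 1" using card_mono[of "{v k}"] by fastforce
      with that show False by simp
    qed
    then show ?thesis unfolding vSS by (rule someI_ex)
  qed
  have walk: "reduced_walk E v L" if "\<And>k. 0 < k \<Longrightarrow> k < L \<Longrightarrow> deg (v k) = 2" for L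
    unfolding reduced_walk_def
  proof (intro conjI allI impI)
    fix k assume k: "k < L"
    show "E (v k) (v (Suc k))"
    proof (cases k)
      case 0 then show ?thesis using cw v01 by simp
    next
      case (Suc j) then show ?thesis using next_step[of j] that[of k] k by simp
    qed
  next
    fix k assume "Suc (Suc k) \<le> L"
    then show "v k \<noteq> v (Suc (Suc k))" using next_step[of k] that[of "Suc k"] by auto
  qed
  have "\<exists>k>0. deg (v k) \<noteq> 2"
  proof (rule ccontr)
    assume "\<not> ?thesis"
    then have all: "deg (v k) = 2" if "k > 0" for k using that by blast
    \<comment> \<open>A walk with this many steps visits one vertex more than \<open>V\<close>
      has.\<close>
    let ?L = "card V"
    have w: "reduced_walk E v ?L" by (rule walk) (rule all)
    have "v k \<in> V" if "k \<le> ?L" for k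
    proof (cases k)
      case 0 then show ?thesis using cw E_V v01 by auto
    next
      case (Suc j) then show ?thesis using w that E_V[of "v j" "v k"] by (simp add: reduced_walk_def)
    qed
    then have "card {..?L} \<le> card V"
      using card_inj_on_le[OF reduced_walk_inj[OF w] _ finite_V] by blast
    then show False by simp
  qed
  then have K: "(LEAST k. k > 0 \<and> deg (v k) \<noteq> 2) > 0 \<and> deg (v (LEAST k. k > 0 \<and> deg (v k) \<noteq> 2)) \<noteq> 2"
    by (rule LeastI_ex[of "\<lambda>k. k > 0 \<and> deg (v k) \<noteq> 2", simplified])
  define K where "K = (LEAST k. k > 0 \<and> deg (v k) \<noteq> 2)"
  have below: "deg (v k) = 2" if "0 < k" "k < K" for k
    using not_less_Least[OF that(2)[unfolded K_def]] that(1) by simp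
  show ?thesis
    by (rule that[of K v]) (use K walk[of K] below v01 in \<open>auto simp: K_def[symmetric]\<close>)
qed

text \<open>Summing harmonicity over \<open>V\<close> gives \<Sum> (2 - deg v) d v = 0. Without
  branching no term is negative, so every degree is 2 and an arm could not end.\<close>

lemma ex_branch_vertex: "\<exists>c\<in>V. deg c \<ge> 3"
proof (rule ccontr)
  assume no: "\<not> ?thesis"
  have "(\<Sum>v\<in>V. 2 * d v) = (\<Sum>v\<in>V. \<Sum>u\<in>V. if E v u then d u else 0)"
  proof (rule sum.cong[OF refl])
    fix v assume "v \<in> V"
    have "{u. E v u} = {u \<in> V. E v u}" using E_V by blast
    then show "2 * d v = (\<Sum>u\<in>V. if E v u then d u else 0)"
      using harmonic[OF \<open>v \<in> V\<close>] finite_V by (simp add: sum.inter_filter)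
  qed
  also have "\<dots> = (\<Sum>u\<in>V. \<Sum>v\<in>V. if E v u then d u else 0)" by (rule sum.swap)
  also have "\<dots> = (\<Sum>u\<in>V. int (deg u) * d u)"
  proof (rule sum.cong[OF refl])
    fix u assume "u \<in> V"
    have "{v. E u v} = {v \<in> V. E v u}" using E_V E_sym by blast
    then show "(\<Sum>v\<in>V. if E v u then d u else 0) = int (deg u) * d u"
      using finite_V by (simp add: sum.inter_filter[symmetric])
  qed
  finally have "(\<Sum>v\<in>V. (2 - int (deg v)) * d v) = 0"
    by (simp add: left_diff_distrib sum_subtractf)
  moreover have "(2 - int (deg v)) * d v \<ge> 0" if "v \<in> V" for v
    using no that d_pos[OF that] by (intro mult_nonneg_nonneg) (auto simp: not_le less_Suc_eq_le numeral_3_eq_3)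
  ultimately have "(2 - int (deg v)) * d v = 0" if "v \<in> V" for v
    using sum_nonneg_eq_0_iff[OF finite_V, of "\<lambda>v. (2 - int (deg v)) * d v"] that by blast
  then have deg2: "deg v = 2" if "v \<in> V" for v
    using that d_pos[OF that] by fastforce
  obtain c where c: "c \<in> V" using nonempty_V by blast
  have "{u. E c u} \<noteq> {}"
  proof
    assume "{u. E c u} = {}"
    then have "deg c = 0" by (simp only: card.empty)
    with deg2[OF c] show False by simp
  qed
  then obtain w where "E c w" by blast
  then obtain v K where "K \<ge> 1" "reduced_walk E v K" "deg (v K) \<noteq> 2" by (rule ex_arm)
  moreover from this(1) obtain j where "K = Suc j" by (cases K) auto
  ultimately have "E (v j) (v K)" unfolding reduced_walk_def by simp
  then have "v K \<in> V" using E_V by blast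
  then show False using deg2 \<open>deg (v K) \<noteq> 2\<close> by blast
qed

definition leaf_arm :: "'v \<Rightarrow> (nat \<Rightarrow> 'v) \<Rightarrow> nat \<Rightarrow> bool" where
  "leaf_arm c v K \<longleftrightarrow> K \<ge> 1 \<and> reduced_walk E v K \<and> v 0 = c \<and>
     (\<forall>k. 0 < k \<longrightarrow> k < K \<longrightarrow> deg (v k) = 2) \<and> deg (v K) = 1"

text \<open>Along the arm, harmonicity is the recurrence of an arithmetic progression, and at the
  leaf it says that the neighbour has twice the value. So \<open>d\<close> takes the multiples 1, 2,
  3, ... of its value at the leaf.\<close>

lemma leaf_arm_values:
  assumes "leaf_arm c v K"
  shows "d c = (int K + 1) * d (v K)" "d (v 1) = int K * d (v K)" "d (v K) > 0"
proof -
  from assms have K: "K \<ge> 1" and w: "reduced_walk E v K" and v0: "v 0 = c"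
    and deg2: "\<And>k. 0 < k \<Longrightarrow> k < K \<Longrightarrow> deg (v k) = 2" and leaf: "deg (v K) = 1"
    by (auto simp: leaf_arm_def)
  have step: "E (v k) (v (Suc k))" if "k < K" for k using w that by (simp add: reduced_walk_def)
  have stepV: "v k \<in> V" if "k \<le> K" for k
    using E_V[OF step[of k]] E_V[OF step[of "k - 1"]] that K by (cases k) (auto simp: le_less)
  show pos: "d (v K) > 0" by (rule d_pos[OF stepV]) simp
  have nbr_leaf: "{u. E (v K) u} = {v (K - 1)}"
  proof -
    have "{v (K - 1)} \<subseteq> {u. E (v K) u}" using E_sym[OF step[of "K - 1"]] K by simp
    then show ?thesis using card_subset_eq[OF finite_nbrs, of "{v (K - 1)}" "v K"] leaf by simp
  qed
  have nbr: "{u. E (v (Suc k)) u} = {v k, v (Suc (Suc k))}" if "Suc k < K" for k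
  proof -
    have "{v k, v (Suc (Suc k))} \<subseteq> {u. E (v (Suc k)) u}" using E_sym[OF step[of k]] step[of "Suc k"] that by simp
    moreover have "v k \<noteq> v (Suc (Suc k))" using w that by (simp add: reduced_walk_def)
    ultimately show ?thesis
      using card_subset_eq[OF finite_nbrs, of "{v k, v (Suc (Suc k))}" "v (Suc k)"] deg2[of "Suc k"] that by simp
  qed
  \<comment> \<open>\<open>k\<close> is the distance from the leaf. Two consecutive values are
    carried along because the recurrence has order 2.\<close>
  have *: "d (v (K - k)) = (int k + 1) * d (v K) \<and> d (v (K - Suc k)) = (int k + 2) * d (v K)" if "k < K" for k
    using that
  proof (induction k)
    case 0
    have "2 * d (v K) = d (v (K - 1))" using harmonic[OF stepV[of K]] nbr_leaf by simp
    then show ?case by simp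
  next
    case (Suc k)
    define j where "j = K - Suc (Suc k)"
    have j: "K - Suc k = Suc j" "K - k = Suc (Suc j)" "Suc j < K" using Suc.prems by (auto simp: j_def)
    have "v j \<noteq> v (Suc (Suc j))" using w j(3) by (simp add: reduced_walk_def)
    then have "2 * d (v (Suc j)) = d (v j) + d (v (Suc (Suc j)))"
      using harmonic[OF stepV[of "Suc j"]] nbr[OF j(3)] j(3) by simp
    moreover have "d (v (Suc (Suc j))) = (int k + 1) * d (v K)" "d (v (Suc j)) = (int k + 2) * d (v K)"
      using Suc.IH Suc.prems unfolding j by simp_all
    ultimately show ?case unfolding j j_def[symmetric] by (simp add: algebra_simps)
  qed
  have "d (v (K - (K - 1))) = (int (K - 1) + 1) * d (v K) \<and> d (v (K - Suc (K - 1))) = (int (K - 1) + 2) * d (v K)"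
    using *[of "K - 1"] K by simp
  then show "d c = (int K + 1) * d (v K)" "d (v 1) = int K * d (v K)"
    using K v0 by (simp_all add: of_nat_diff algebra_simps)
qed

text \<open>Walking back along \<open>u\<close> and then out along \<open>v\<close> does not turn
  back at the common start, so the whole is a reduced walk and thus injective.\<close>

lemma arms_disjoint:
  assumes u: "reduced_walk E u K" "K \<ge> 1" and v: "reduced_walk E v L" "L \<ge> 1" and c: "u 0 = v 0" "u 1 \<noteq> v 1"
    and i: "i \<le> K" and j: "j \<le> L" and eq: "u i = v j"
  shows "i = 0 \<and> j = 0"
proof -
  define w where "w k = (if k \<le> K then u (K - k) else v (k - K))" for k
  have "reduced_walk E w (K + L)"
    unfolding reduced_walk_def
  proof (intro conjI allI impI)
    fix k assume k: "k < K + L"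
    show "E (w k) (w (Suc k))"
    proof (cases "k < K")
      case True
      then have "E (u (K - Suc k)) (u (Suc (K - Suc k)))" using u by (simp add: reduced_walk_def)
      with True show ?thesis using E_sym by (simp add: w_def Suc_diff_Suc)
    next
      case False
      then have "E (v (k - K)) (v (Suc (k - K)))" using v k by (simp add: reduced_walk_def)
      with False show ?thesis using c(1) by (auto simp: w_def Suc_diff_le)
    qed
  next
    fix k assume k: "Suc (Suc k) \<le> K + L"
    consider "Suc (Suc k) \<le> K" | "Suc k = K" | "K \<le> k" by linarith
    then show "w k \<noteq> w (Suc (Suc k))"
    proof cases
      case 1
      define j where "j = K - Suc (Suc k)"
      have j: "K - k = Suc (Suc j)" "Suc (Suc j) \<le> K" using 1 by (auto simp: j_def)
      have "u j \<noteq> u (Suc (Suc j))" using u(1) j(2) by (simp add: reduced_walk_def)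
      with 1 j(1) show ?thesis by (simp add: w_def j_def[symmetric])
    next
      case 2
      then have "K - k = 1" "Suc (Suc k) - K = 1" by auto
      with 2 c show ?thesis by (auto simp: w_def)
    next
      case 3
      define j where "j = k - K"
      have "k = K + j" using 3 by (simp add: j_def)
      moreover have "v j \<noteq> v (Suc (Suc j))" using v(1) k 3 by (simp add: reduced_walk_def j_def)
      ultimately show ?thesis using c(1) by (auto simp: w_def)
    qed
  qed
  from reduced_walk_inj[OF this] have inj: "inj_on w {..K + L}" .
  have "w (K - i) = w (K + j)" using eq i c(1) by (auto simp: w_def)
  from inj_onD[OF inj this] have "K - i = K + j" using i j by simp
  then show ?thesis using i u(2) by linarith
qed

definition embeds_edges :: "nat \<Rightarrow> (nat \<times> nat) list \<Rightarrow> bool" where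
  "embeds_edges n es \<longleftrightarrow> (\<exists>\<phi>. inj_on \<phi> {..<n} \<and> \<phi> ` {..<n} \<subseteq> V \<and> (\<forall>(p, q)\<in>set es. E (\<phi> p) (\<phi> q)))"

lemma embeds_edgesI:
  assumes "distinct xs" "set xs \<subseteq> V" "length xs = n" "\<And>p q. (p, q) \<in> set es \<Longrightarrow> E (xs ! p) (xs ! q)"
  shows "embeds_edges n es"
  unfolding embeds_edges_def
proof (intro exI conjI)
  show "inj_on ((!) xs) {..<n}" using assms(1,3) by (intro inj_on_nth) auto
  show "(!) xs ` {..<n} \<subseteq> V" using assms(2,3) nth_mem by fastforce
  show "\<forall>(p, q)\<in>set es. E (xs ! p) (xs ! q)" using assms(4) by blast
qed

text \<open>Listed in this order, the K + 5 vertices carry the numbering of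
  \<open>affine_D (K + 4)\<close>. For K = 0 the spine is a single vertex with four leaves.\<close>

lemma embeds_D:
  assumes walk: "\<And>k. k < K \<Longrightarrow> E (v k) (v (Suc k))" and ends: "E (v 0) q" "E (v 0) r" "E (v K) s" "E (v K) t"
    and dist: "distinct ([q, r] @ map v [0..<Suc K] @ [s, t])"
  shows "embeds_edges (Suc (K + 4)) (edges_D (K + 4))"
proof (rule embeds_edgesI[OF dist])
  let ?xs = "[q, r] @ map v [0..<Suc K] @ [s, t]"
  have "v k \<in> V" if "k \<le> K" for k
    using that E_V[OF walk[of k]] E_V[OF ends(3)] by (cases "k = K") auto
  then show "set ?xs \<subseteq> V" using ends E_V by auto
  have mid: "?xs ! (k + 2) = v k" if "k \<le> K" for k
    using that by (simp add: nth_append del: upt_Suc)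
  have last: "?xs ! (K + 3) = s" "?xs ! (K + 4) = t"
    by (simp_all add: nth_append del: upt_Suc)
  fix p q' assume "(p, q') \<in> set (edges_D (K + 4))"
  then consider "p = 0" "q' = 2" | "p = 1" "q' = 2" | i where "2 \<le> i" "i < K + 2" "p = i" "q' = i + 1"
    | "p = K + 2" "q' = K + 3" | "p = K + 2" "q' = K + 4" by auto
  then show "E (?xs ! p) (?xs ! q')"
  proof cases
    case 1 then show ?thesis using mid[of 0] ends(1) E_sym by simp
  next
    case 2 then show ?thesis using mid[of 0] ends(2) E_sym by simp
  next
    case (3 i)
    define k where "k = i - 2"
    have "p = k + 2" "q' = Suc k + 2" "k < K" using 3 by (auto simp: k_def)
    then show ?thesis using mid[of k] mid[of "Suc k"] walk[of k] by simp
  next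
    case 4 then show ?thesis using mid[of K] last ends(3) by simp
  next
    case 5 then show ?thesis using mid[of K] last ends(4) by simp
  qed
qed simp

text \<open>Dividing by a + b + c, the equations become 1/(K+1) + 1/(L+1) + 1/(M+1) = 1, whose
  ordered solutions have denominators (3,3,3), (2,4,4) and (2,3,6).\<close>

lemma star_lengths:
  fixes K L M :: nat and a b c :: int
  assumes pos: "a > 0" "b > 0" "c > 0" and le: "K \<ge> 1" "K \<le> L" "L \<le> M"
    and eq: "(int K + 1) * a = a + b + c" "(int L + 1) * b = a + b + c" "(int M + 1) * c = a + b + c"
  shows "(K, L, M) \<in> {(2, 2, 2), (1, 3, 3), (1, 2, 5)}"
proof -
  \<comment> \<open>The larger factor belongs to the smaller value; ordering
    \<open>c \<le> b \<le> a\<close> bounds \<open>K\<close> and then \<open>L\<close>.\<close>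
  have ba: "b \<le> a"
  proof (rule ccontr)
    assume "\<not> ?thesis"
    then have "(int K + 1) * a < (int L + 1) * b" using le pos by (intro mult_le_less_imp_less) auto
    with eq show False by simp
  qed
  have cb: "c \<le> b"
  proof (rule ccontr)
    assume "\<not> ?thesis"
    then have "(int L + 1) * b < (int M + 1) * c" using le pos by (intro mult_le_less_imp_less) auto
    with eq show False by simp
  qed
  have "(int K + 1) * a \<le> 3 * a" using eq(1) ba cb by linarith
  then have "K \<le> 2" using pos by simp
  then consider "K = 2" | "K = 1" using le by linarith
  then show ?thesis
  proof cases
    case 1
    then have "b = a" "c = a" using eq(1) ba cb by simp_all
    with eq pos have "(int L + 1) * a = 3 * a" "(int M + 1) * a = 3 * a" by simp_all
    with pos have "int L + 1 = 3" "int M + 1 = 3" by simp_all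
    then show ?thesis using 1 by simp
  next
    case 2
    then have a: "a = b + c" using eq(1) by simp
    then have L: "(int L + 1) * b = 2 * b + 2 * c" "(int M + 1) * c = 2 * b + 2 * c" using eq by simp_all
    then have "(int L + 1) * b \<le> 4 * b" using cb by simp
    then have "L \<le> 3" using pos by simp
    then consider "L = 3" | "L = 2" | "L = 1" using le by linarith
    then show ?thesis
    proof cases
      case 1
      then have "b = c" using L(1) by simp
      with L(2) have "(int M + 1) * c = 4 * c" by simp
      with pos have "int M + 1 = 4" by simp
      then show ?thesis using 1 2 by simp
    next
      assume "L = 2"
      then have "b = 2 * c" using L(1) by simp
      with L(2) have "(int M + 1) * c = 6 * c" by simp
      with pos have "int M + 1 = 6" by simp
      then show ?thesis using \<open>L = 2\<close> 2 by simp
    next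
      assume "L = 1"
      then show ?thesis using L(1) pos by simp
    qed
  qed
qed

lemma embeds_star:
  assumes arms: "leaf_arm c u K" "leaf_arm c v L" "leaf_arm c w M" and nbrs: "{x. E c x} = {u 1, v 1, w 1}"
    and dist: "u 1 \<noteq> v 1" "u 1 \<noteq> w 1" "v 1 \<noteq> w 1" and le: "K \<le> L" "L \<le> M"
  shows "embeds_edges 7 edges_E6 \<or> embeds_edges 8 edges_E7 \<or> embeds_edges 9 edges_E8"
proof -
  note U = arms(1)[unfolded leaf_arm_def] and V' = arms(2)[unfolded leaf_arm_def] and W = arms(3)[unfolded leaf_arm_def]
  have E: "E (u k) (u (Suc k))" if "k < K" for k using U that by (simp add: reduced_walk_def)
  have Ev: "E (v k) (v (Suc k))" if "k < L" for k using V' that by (simp add: reduced_walk_def)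
  have Ew: "E (w k) (w (Suc k))" if "k < M" for k using W that by (simp add: reduced_walk_def)
  have c: "u 0 = c" "v 0 = c" "w 0 = c" using U V' W by simp_all
  have cV: "c \<in> V" using E_V[OF E[of 0]] U by simp
  note val = leaf_arm_values[OF arms(1)] leaf_arm_values[OF arms(2)] leaf_arm_values[OF arms(3)]
  \<comment> \<open>On each arm the neighbour of \<open>c\<close> has value \<open>d c\<close> minus
    the value at the leaf, so harmonicity at \<open>c\<close> makes \<open>d c\<close> the sum of
    the three leaf values.\<close>
  have "2 * d c = d (u 1) + d (v 1) + d (w 1)"
    using harmonic[OF cV] nbrs dist by simp
  then have "d c = d (u K) + d (v L) + d (w M)" using val by (simp add: algebra_simps)
  then have lengths: "(K, L, M) \<in> {(2, 2, 2), (1, 3, 3), (1, 2, 5)}"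
    using val U le by (intro star_lengths[of "d (u K)" "d (v L)" "d (w M)"]) simp_all
  let ?xs = "c # map u [1..<Suc K] @ map v [1..<Suc L] @ map w [1..<Suc M]"
  have dis: "u i \<noteq> v j" if "1 \<le> i" "i \<le> K" "1 \<le> j" "j \<le> L" for i j
    using arms_disjoint[of u K v L i j] U V' dist that by auto
  have dis2: "u i \<noteq> w j" if "1 \<le> i" "i \<le> K" "1 \<le> j" "j \<le> M" for i j
    using arms_disjoint[of u K w M i j] U W dist that by auto
  have dis3: "v i \<noteq> w j" if "1 \<le> i" "i \<le> L" "1 \<le> j" "j \<le> M" for i j
    using arms_disjoint[of v L w M i j] V' W dist that by auto
  have inj: "inj_on u {..K}" "inj_on v {..L}" "inj_on w {..M}"
    using U V' W by (auto intro: reduced_walk_inj)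
  have c_notin: "c \<noteq> u i" if "1 \<le> i" "i \<le> K" for i using inj_onD[OF inj(1), of 0 i] that c by auto
  have c_notin2: "c \<noteq> v i" if "1 \<le> i" "i \<le> L" for i using inj_onD[OF inj(2), of 0 i] that c by auto
  have c_notin3: "c \<noteq> w i" if "1 \<le> i" "i \<le> M" for i using inj_onD[OF inj(3), of 0 i] that c by auto
  have injs: "inj_on u {1..<Suc K}" "inj_on v {1..<Suc L}" "inj_on w {1..<Suc M}"
    by (rule inj_on_subset[OF inj(1)], auto) (rule inj_on_subset[OF inj(2)], auto, rule inj_on_subset[OF inj(3)], auto)
  have distinct: "distinct ?xs"
  proof -
    have "c \<notin> u ` {1..<Suc K}" "c \<notin> v ` {1..<Suc L}" "c \<notin> w ` {1..<Suc M}"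
      by (rule notin_imageI, rule c_notin c_notin2 c_notin3; simp)+
    moreover have "u ` {1..<Suc K} \<inter> v ` {1..<Suc L} = {}" "u ` {1..<Suc K} \<inter> w ` {1..<Suc M} = {}"
      "v ` {1..<Suc L} \<inter> w ` {1..<Suc M} = {}"
      by (rule disjoint_imagesI, rule dis dis2 dis3; simp)+
    ultimately show ?thesis using injs by (simp add: distinct_map Int_Un_distrib del: upt_Suc One_nat_def)
  qed
  have inV: "u (Suc k) \<in> V" if "k < K" for k using E_V[OF E[OF that]] by simp
  have inV2: "v (Suc k) \<in> V" if "k < L" for k using E_V[OF Ev[OF that]] by simp
  have inV3: "w (Suc k) \<in> V" if "k < M" for k using E_V[OF Ew[OF that]] by simp
  have "u ` {1..<Suc K} \<subseteq> V" "v ` {1..<Suc L} \<subseteq> V" "w ` {1..<Suc M} \<subseteq> V"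
  proof -
    show "u ` {1..<Suc K} \<subseteq> V"
    proof
      fix y assume "y \<in> u ` {1..<Suc K}"
      then obtain k where "k < K" "y = u (Suc k)" by (auto simp: Suc_le_eq gr0_conv_Suc)
      then show "y \<in> V" using inV by simp
    qed
    show "v ` {1..<Suc L} \<subseteq> V"
    proof
      fix y assume "y \<in> v ` {1..<Suc L}"
      then obtain k where "k < L" "y = v (Suc k)" by (auto simp: Suc_le_eq gr0_conv_Suc)
      then show "y \<in> V" using inV2 by simp
    qed
    show "w ` {1..<Suc M} \<subseteq> V"
    proof
      fix y assume "y \<in> w ` {1..<Suc M}"
      then obtain k where "k < M" "y = w (Suc k)" by (auto simp: Suc_le_eq gr0_conv_Suc)
      then show "y \<in> V" using inV3 by simp
    qed
  qed
  then have sub: "set ?xs \<subseteq> V" using cV by (auto simp del: upt_Suc)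
  from lengths consider "K = 2" "L = 2" "M = 2" | "K = 1" "L = 3" "M = 3" | "K = 1" "L = 2" "M = 5" by auto
  then show ?thesis
  proof cases
    case 1
    have "embeds_edges 7 edges_E6"
      by (rule embeds_edgesI[OF distinct sub])
         (use 1 c E[of 0] E[of 1] Ev[of 0] Ev[of 1] Ew[of 0] Ew[of 1] in \<open>auto simp: numeral_eq_Suc\<close>)
    then show ?thesis by simp
  next
    case 2
    have "embeds_edges 8 edges_E7"
      by (rule embeds_edgesI[OF distinct sub])
         (use 2 c E[of 0] Ev[of 0] Ev[of 1] Ev[of 2] Ew[of 0] Ew[of 1] Ew[of 2] in \<open>auto simp: numeral_eq_Suc\<close>)
    then show ?thesis by simp
  next
    case 3
    have "embeds_edges 9 edges_E8"
      by (rule embeds_edgesI[OF distinct sub])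
         (use 3 c E[of 0] Ev[of 0] Ev[of 1] Ew[of 0] Ew[of 1] Ew[of 2] Ew[of 3] Ew[of 4] in \<open>auto simp: numeral_eq_Suc\<close>)
    then show ?thesis by simp
  qed
qed

text \<open>Four neighbours of a branch vertex already form D_4. With three, each arm ends either in
  another branch vertex, which gives some D_n, or in a leaf; if all end in leaves, the arm lengths
  are forced.\<close>

theorem embeds_affine_tree:
  "(\<exists>n\<ge>4. embeds_edges (Suc n) (edges_D n)) \<or> embeds_edges 7 edges_E6 \<or> embeds_edges 8 edges_E7 \<or> embeds_edges 9 edges_E8"
proof -
  obtain c where c: "c \<in> V" "deg c \<ge> 3" using ex_branch_vertex by blast
  show ?thesis
  proof (cases "deg c = 3")
    case False
    with c have "4 \<le> deg c" by simp
    then obtain T where T: "T \<subseteq> {x. E c x}" "card T = 4" by (rule obtain_subset_with_card_n)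
    then obtain xs where xs: "set xs = T" "distinct xs" "length xs = 4"
      using finite_subset[OF T(1) finite_nbrs] finite_distinct_list distinct_card by metis
    then obtain q r s t where qrst: "xs = [q, r, s, t]" by (auto simp: length_Suc_conv numeral_eq_Suc)
    have adj: "E c q" "E c r" "E c s" "E c t" using T(1) xs(1) qrst by auto
    have "embeds_edges (Suc (0 + 4)) (edges_D (0 + 4))"
      by (rule embeds_D[of 0 "\<lambda>_. c" q r s t]) (use adj xs(2) qrst E_irrefl in auto)
    then show ?thesis by auto
  next
    case True
    then obtain p q r where pqr: "{x. E c x} = {p, q, r}" "p \<noteq> q" "p \<noteq> r" "q \<noteq> r"
      by (auto simp: card_3_iff)
    have D: ?thesis if arm: "K \<ge> 1" "reduced_walk E v K" "v 0 = c" "deg (v K) \<ge> 3"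
      and q: "E c q" "E c r" "q \<noteq> r" "v 1 \<noteq> q" "v 1 \<noteq> r" for K v q r
    proof -
      have Ev: "E (v k) (v (Suc k))" if "k < K" for k using arm(2) that by (simp add: reduced_walk_def)
      \<comment> \<open>The far branch vertex has two neighbours besides the one from which the arm
        arrives; they become the other pair of leaves.\<close>
      have "deg (v K) - 1 \<le> card ({x. E (v K) x} - {v (K - 1)})"
        using diff_card_le_card_Diff[of "{v (K - 1)}" "{x. E (v K) x}"] by simp
      then have "2 \<le> card ({x. E (v K) x} - {v (K - 1)})" using arm(4) by linarith
      then obtain T where T: "T \<subseteq> {x. E (v K) x} - {v (K - 1)}" "card T = 2" by (rule obtain_subset_with_card_n)
      from T(2) obtain s t where st: "T = {s, t}" "s \<noteq> t" by (auto simp: card_2_iff)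
      have adj: "E (v K) s" "E (v K) t" "s \<noteq> v (K - 1)" "t \<noteq> v (K - 1)" using T(1) st by auto
      \<comment> \<open>Prolonging the arm by \<open>x\<close> keeps it reduced. Disjointness from
        the short arms at \<open>c\<close> and injectivity then show that \<open>x\<close> is
        new.\<close>
      have walk: "reduced_walk E (\<lambda>k. if k \<le> K then v k else x) (Suc K)" if x: "E (v K) x" "x \<noteq> v (K - 1)" for x
        unfolding reduced_walk_def
      proof (intro conjI allI impI)
        fix k assume "k < Suc K"
        then show "E (if k \<le> K then v k else x) (if Suc k \<le> K then v (Suc k) else x)"
          using Ev[of k] x(1) by (cases "k = K") auto
      next
        fix k assume k: "Suc (Suc k) \<le> Suc K"
        show "(if k \<le> K then v k else x) \<noteq> (if Suc (Suc k) \<le> K then v (Suc (Suc k)) else x)"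
        proof (cases "Suc k = K")
          case True
          then have "k = K - 1" by simp
          then show ?thesis using x(2) True by auto
        next
          case False
          then show ?thesis using k arm(2) by (simp add: reduced_walk_def)
        qed
      qed
      have short: "reduced_walk E (\<lambda>k. if k = 0 then c else y) 1" if "E c y" for y
        using that by (simp add: reduced_walk_def)
      have apart: "y \<noteq> x \<and> (\<forall>k\<le>K. y \<noteq> v k)" if y: "E c y" "v 1 \<noteq> y" and x: "E (v K) x" "x \<noteq> v (K - 1)" for x y
      proof -
        note A = arms_disjoint[OF walk[OF x] _ short[OF y(1)], of _ 1]
        have "x \<noteq> y" using A[of "Suc K"] arm(1,3) y(2) by auto
        moreover have "v k \<noteq> y" if "k \<le> K" for k using A[of k] that arm(1,3) y(2) by auto
        ultimately show ?thesis by auto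
      qed
      have x_notin: "x \<noteq> v k" if x: "E (v K) x" "x \<noteq> v (K - 1)" and k: "k \<le> K" for x k
        using inj_onD[OF reduced_walk_inj[OF walk[OF x]], of "Suc K" k] k by auto
      have injv: "inj_on v {0..<Suc K}"
        using reduced_walk_inj[OF arm(2)] by (rule inj_on_subset) auto
      have "s \<notin> v ` {0..<Suc K}" "t \<notin> v ` {0..<Suc K}"
        by (rule notin_imageI, rule x_notin[OF adj(1,3)] x_notin[OF adj(2,4)]; simp)+
      moreover note apart[OF q(1,4) adj(1,3)] apart[OF q(1,4) adj(2,4)] apart[OF q(2,5) adj(1,3)] apart[OF q(2,5) adj(2,4)]
      moreover have "q \<notin> v ` {0..<Suc K}"
        by (rule notin_imageI) (use apart[OF q(1,4) adj(1,3)] in simp)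
      moreover have "r \<notin> v ` {0..<Suc K}"
        by (rule notin_imageI) (use apart[OF q(2,5) adj(1,3)] in simp)
      ultimately have "distinct ([q, r] @ map v [0..<Suc K] @ [s, t])"
        using st(2) q(3) injv by (simp add: distinct_map del: upt_Suc)
      then have "embeds_edges (Suc (K + 4)) (edges_D (K + 4))"
        using Ev q arm(3) adj by (intro embeds_D[of K v q r s t]) auto
      then show ?thesis by (intro disjI1 exI[of _ "K + 4"]) simp
    qed
    have arm_cases: "?thesis \<or> (\<exists>v K. leaf_arm c v K \<and> v 1 = x)" if x: "E c x" for x
    proof -
      obtain v K where v: "K \<ge> 1" "reduced_walk E v K" "v 0 = c" "v 1 = x"
        "\<And>k. 0 < k \<Longrightarrow> k < K \<Longrightarrow> deg (v k) = 2" "deg (v K) \<noteq> 2" using ex_arm[OF x] by metis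
      obtain j where j: "K = Suc j" using v(1) by (cases K) auto
      have "E (v K) (v j)" using v(2) E_sym unfolding j reduced_walk_def by blast
      then have "deg (v K) \<noteq> 0" using finite_nbrs by (auto simp: card_eq_0_iff)
      with v(6) consider "deg (v K) = 1" | "deg (v K) \<ge> 3" by linarith
      then show ?thesis
      proof cases
        case 1
        then show ?thesis using v by (auto simp: leaf_arm_def)
      next
        case 2
        have "\<exists>y z. E c y \<and> E c z \<and> y \<noteq> z \<and> x \<noteq> y \<and> x \<noteq> z"
        proof -
          have "x \<in> {p, q, r}" "E c p" "E c q" "E c r" using x pqr(1) by auto
          then show ?thesis using pqr(2-4) by blast
        qed
        then show ?thesis using D[OF v(1-3) 2] v(4) by blast
      qed
    qed
    have "E c p" "E c q" "E c r" using pqr(1) by auto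
    note nbrs = this
    show ?thesis
    proof (rule ccontr)
      assume no: "\<not> ?thesis"
      obtain u K where u: "leaf_arm c u K" "u 1 = p" using arm_cases[OF nbrs(1)] no by blast
      obtain v L where v: "leaf_arm c v L" "v 1 = q" using arm_cases[OF nbrs(2)] no by blast
      obtain w M where w: "leaf_arm c w M" "w 1 = r" using arm_cases[OF nbrs(3)] no by blast
      \<comment> \<open>Stated for arms sorted by length; the six orders of the three arms reduce to
        it.\<close>
      have star: False if arms: "leaf_arm c u K" "leaf_arm c v L" "leaf_arm c w M" "K \<le> L" "L \<le> M"
        and n: "{x. E c x} = {u 1, v 1, w 1}" "u 1 \<noteq> v 1" "u 1 \<noteq> w 1" "v 1 \<noteq> w 1" for u v w K L M
        using embeds_star[OF arms(1-3)] that no by simp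
      consider "K \<le> L" "L \<le> M" | "K \<le> M" "M \<le> L" | "L \<le> K" "K \<le> M" | "L \<le> M" "M \<le> K" | "M \<le> K" "K \<le> L" | "M \<le> L" "L \<le> K"
        by linarith
      then show False
      proof cases
        case 1 show False by (rule star[OF u(1) v(1) w(1) 1]) (use pqr u v w in auto)
      next
        case 2 show False by (rule star[OF u(1) w(1) v(1) 2]) (use pqr u v w in auto)
      next
        case 3 show False by (rule star[OF v(1) u(1) w(1) 3]) (use pqr u v w in auto)
      next
        case 4 show False by (rule star[OF v(1) w(1) u(1) 4]) (use pqr u v w in auto)
      next
        case 5 show False by (rule star[OF w(1) u(1) v(1) 5]) (use pqr u v w in auto)
      next
        case 6 show False by (rule star[OF w(1) v(1) u(1) 6]) (use pqr u v w in auto)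
      qed
    qed
  qed
qed

end

section \<open>Null vectors of the affine diagrams\<close>

lemma fin_digraph_graph_of_edges:
  assumes "\<And>p q. (p, q) \<in> set es \<Longrightarrow> p < n \<and> q < n"
  shows "fin_digraph (graph_of_edges n es)"
proof -
  have "fst (es ! k) < n \<and> snd (es ! k) < n" if "k < length es" for k
    using assms[of "fst (es ! k)" "snd (es ! k)"] nth_mem[OF that] by simp
  then show ?thesis by unfold_locales (simp_all add: graph_of_edges_def)
qed

text \<open>The right-hand side of \<open>null_vector\<close> as a sum over the edge list, which can
  be evaluated on concrete diagrams.\<close>

definition neighbour_sum :: "(nat \<times> nat) list \<Rightarrow> (nat \<Rightarrow> int) \<Rightarrow> nat \<Rightarrow> int" where
  "neighbour_sum es \<delta> i = (\<Sum>(p, q)\<leftarrow>es. (if p = i then \<delta> q else 0) + (if q = i then \<delta> p else 0))"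

lemma neighbour_sum_simps [simp]:
  "neighbour_sum [] \<delta> i = 0"
  "neighbour_sum ((p, q) # es) \<delta> i = (if p = i then \<delta> q else 0) + (if q = i then \<delta> p else 0) + neighbour_sum es \<delta> i"
  "neighbour_sum (es @ fs) \<delta> i = neighbour_sum es \<delta> i + neighbour_sum fs \<delta> i"
  by (simp_all add: neighbour_sum_def)

lemma neighbour_sum_map_upt:
  "neighbour_sum (map (\<lambda>k. (g k, h k)) [m..<n]) \<delta> i =
    (\<Sum>k\<in>{m..<n}. (if g k = i then \<delta> (h k) else 0) + (if h k = i then \<delta> (g k) else 0))"
  unfolding neighbour_sum_def by (simp add: interv_sum_list_conv_sum_set_nat o_def del: upt_Suc)

lemma null_vector_graph_of_edges:
  assumes "\<And>i. i < n \<Longrightarrow> \<delta> i > 0 \<and> neighbour_sum es \<delta> i = 2 * \<delta> i"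
  shows "null_vector (graph_of_edges n es) \<delta>"
proof -
  have "neighbour_sum es \<delta> i = (\<Sum>k<length es. (if fst (es ! k) = i then \<delta> (snd (es ! k)) else 0) +
      (if snd (es ! k) = i then \<delta> (fst (es ! k)) else 0))" for i
    unfolding neighbour_sum_def sum_list_sum_nth by (simp add: split_def atLeast0LessThan)
  then show ?thesis using assms by (simp add: null_vector_def graph_of_edges_def cong: if_cong)
qed

lemma same_underlying_graph_of_edgesI:
  assumes G: "fin_digraph G" "connected_graph G" "null_vector G d"
    and emb: "embeds (graph_of_edges n es) G"
    and n: "n > 0" and es: "\<And>p q. (p, q) \<in> set es \<Longrightarrow> p < n \<and> q < n"
    and \<delta>: "\<And>i. i < n \<Longrightarrow> \<delta> i > 0 \<and> neighbour_sum es \<delta> i = 2 * \<delta> i"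
  shows "same_underlying_graph G (graph_of_edges n es)"
proof (rule embeds_imp_same_underlying_graph[OF G fin_digraph_graph_of_edges[OF es] _ null_vector_graph_of_edges[OF \<delta>] emb])
  show "verts (graph_of_edges n es) \<noteq> {}" using n by (auto simp: graph_of_edges_def)
qed

lemma Suc_mod_eq_if: "k < n \<Longrightarrow> Suc k mod n = (if Suc k = n then 0 else Suc k)"
  by auto

lemma same_underlying_graph_affine_A:
  assumes G: "fin_digraph G" "connected_graph G" "null_vector G d" and emb: "embeds (affine_A n) G"
  shows "same_underlying_graph G (affine_A n)"
  unfolding affine_A_def
proof (rule same_underlying_graph_of_edgesI[OF G, where \<delta> = "\<lambda>_. 1"])
  show "embeds (graph_of_edges (n + 1) (map (\<lambda>i. (i, (i + 1) mod (n + 1))) [0..<n + 1])) G"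
    using emb by (simp only: affine_A_def)
  fix p q assume "(p, q) \<in> set (map (\<lambda>i. (i, (i + 1) mod (n + 1))) [0..<n + 1])"
  then have "p < n + 1" "q = (p + 1) mod (n + 1)" by (auto simp del: upt_Suc)
  then show "p < n + 1 \<and> q < n + 1" by simp
next
  fix i assume i: "i < n + 1"
  \<comment> \<open>The cyclic predecessor of \<open>i\<close>. For n = 0 it is \<open>i\<close>
    itself, and the loop is counted once at each end.\<close>
  define j where "j = (if i = 0 then n else i - 1)"
  have j: "j < n + 1" using i unfolding j_def by presburger
  have pred: "(k + 1) mod (n + 1) = i \<longleftrightarrow> k = j" if "k < n + 1" for k
    using that i Suc_mod_eq_if[of k "n + 1"] by (auto simp: j_def split: if_splits)
  have "neighbour_sum (map (\<lambda>i. (i, (i + 1) mod (n + 1))) [0..<n + 1]) (\<lambda>_. 1) i =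
      (\<Sum>k\<in>{0..<n + 1}. (if k = i then 1 else 0) + (if k = j then 1 else 0))"
    unfolding neighbour_sum_map_upt by (rule sum.cong[OF refl]) (simp only: pred atLeastLessThan_iff)
  also have "\<dots> = 2" using i j by (simp add: sum.distrib del: sum.op_ivl_Suc)
  finally show "(1::int) > 0 \<and> neighbour_sum (map (\<lambda>i. (i, (i + 1) mod (n + 1))) [0..<n + 1]) (\<lambda>_. 1) i = 2 * 1"
    by simp
qed simp

lemma embeds_affine_A_loop:
  assumes "a \<in> arcs G" "tail G a = head G a" "tail G a \<in> verts G"
  shows "embeds (affine_A 0) G"
  unfolding affine_A_def by (rule embeds_graph_of_edges[of _ _ _ "\<lambda>_. tail G a"]) (use assms in \<open>auto simp: adj_def inj_on_def\<close>)

lemma embeds_affine_A_parallel: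
  assumes "a \<in> arcs G" "b \<in> arcs G" "a \<noteq> b" "{tail G a, head G a} = {tail G b, head G b}"
    "tail G a \<noteq> head G a" "tail G a \<in> verts G" "head G a \<in> verts G"
  shows "embeds (affine_A 1) G"
  unfolding embeds_def
proof (intro exI conjI)
  let ?\<phi> = "\<lambda>i::nat. if i = 0 then tail G a else head G a" and ?\<psi> = "\<lambda>i::nat. if i = 0 then a else b"
  have sets: "verts (affine_A 1) = {0, 1}" "arcs (affine_A 1) = {0, 1}"
    by (auto simp: affine_A_def graph_of_edges_def)
  have ends: "tail (affine_A 1) 0 = 0" "head (affine_A 1) 0 = 1" "tail (affine_A 1) 1 = 1" "head (affine_A 1) 1 = 0"
    by (simp_all add: affine_A_def graph_of_edges_def)
  show "inj_on ?\<phi> (verts (affine_A 1))" "?\<phi> ` verts (affine_A 1) \<subseteq> verts G"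
    "inj_on ?\<psi> (arcs (affine_A 1))" "?\<psi> ` arcs (affine_A 1) \<subseteq> arcs G"
    using assms unfolding sets by (auto simp: inj_on_def)
  show "\<forall>k\<in>arcs (affine_A 1). ?\<phi> ` {tail (affine_A 1) k, head (affine_A 1) k} = {tail G (?\<psi> k), head G (?\<psi> k)}"
  proof
    fix k assume "k \<in> arcs (affine_A 1)"
    then consider "k = 0" | "k = 1" unfolding sets by blast
    then show "?\<phi> ` {tail (affine_A 1) k, head (affine_A 1) k} = {tail G (?\<psi> k), head G (?\<psi> k)}"
    proof cases
      case 1 then show ?thesis by (simp only: ends) auto
    next
      case 2 then show ?thesis using assms(4) by (simp only: ends) auto
    qed
  qed
qed

lemma embeds_affine_A_cycle:
  assumes n: "n \<ge> 2" and c: "inj_on c {..n}" "c ` {..n} \<subseteq> verts G"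
    and step: "\<And>k. k < n \<Longrightarrow> adj G (c k) (c (Suc k))" and last: "adj G (c n) (c 0)"
  shows "embeds (affine_A n) G"
  unfolding affine_A_def
proof (rule embeds_graph_of_edges[of _ _ _ c])
  \<comment> \<open>For n \<ge> 2 consecutive pairs on the cycle are different; for n = 1 both would
    be the same pair.\<close>
  have "inj_on (\<lambda>i. {i, (i + 1) mod (n + 1)}) {0..<n + 1}"
  proof (rule inj_onI)
    fix i j assume ij: "i \<in> {0..<n + 1}" "j \<in> {0..<n + 1}" "{i, (i + 1) mod (n + 1)} = {j, (j + 1) mod (n + 1)}"
    then show "i = j"
      using n Suc_mod_eq_if[of i "n + 1"] Suc_mod_eq_if[of j "n + 1"] by (auto simp: doubleton_eq_iff split: if_splits)
  qed
  then show "distinct (map (\<lambda>(p, q). {p, q}) (map (\<lambda>i. (i, (i + 1) mod (n + 1))) [0..<n + 1]))"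
    by (simp add: distinct_map o_def del: upt_Suc)
  have eq: "{..<n + 1} = {..n}" by auto
  show "inj_on c {..<n + 1}" "c ` {..<n + 1} \<subseteq> verts G" unfolding eq by (fact c)+
  fix p q assume "(p, q) \<in> set (map (\<lambda>i. (i, (i + 1) mod (n + 1))) [0..<n + 1])"
  then have pq: "p < n + 1" "q = (if Suc p = n + 1 then 0 else Suc p)"
    using Suc_mod_eq_if[of p "n + 1"] by (auto simp del: upt_Suc)
  then show "p < n + 1 \<and> q < n + 1 \<and> adj G (c p) (c q)"
    using step[of p] last by (cases "p = n") auto
qed

text \<open>Without loops and parallel arcs, sending an arc at \<open>i\<close> to its other end is
  a bijection onto the neighbours of \<open>i\<close>.\<close>

lemma (in fin_digraph) null_vector_harmonic:
  assumes null: "null_vector G \<delta>" and i: "i \<in> verts G"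
    and loopless: "\<And>a. a \<in> arcs G \<Longrightarrow> tail G a \<noteq> head G a"
    and simple: "\<And>a b. a \<in> arcs G \<Longrightarrow> b \<in> arcs G \<Longrightarrow> {tail G a, head G a} = {tail G b, head G b} \<Longrightarrow> a = b"
  shows "2 * \<delta> i = (\<Sum>u | adj G i u. \<delta> u)"
proof -
  let ?A = "{a \<in> arcs G. tail G a = i \<or> head G a = i}" and ?o = "\<lambda>a. if tail G a = i then head G a else tail G a"
  have ends: "{tail G a, head G a} = {i, ?o a}" if "a \<in> ?A" for a using that by auto
  have inj: "inj_on ?o ?A"
  proof (rule inj_onI)
    fix a b assume a: "a \<in> ?A" and b: "b \<in> ?A" and eq: "?o a = ?o b"
    have "{tail G a, head G a} = {tail G b, head G b}" unfolding ends[OF a] ends[OF b] eq ..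
    with a b simple show "a = b" by blast
  qed
  have img: "?o ` ?A = {u. adj G i u}"
  proof
    show "?o ` ?A \<subseteq> {u. adj G i u}" using ends unfolding adj_def by blast
    show "{u. adj G i u} \<subseteq> ?o ` ?A"
    proof
      fix u assume "u \<in> {u. adj G i u}"
      then obtain a where a: "a \<in> arcs G" "{tail G a, head G a} = {i, u}" by (auto simp: adj_def)
      then have "a \<in> ?A" "?o a = u" by (auto simp: doubleton_eq_iff)
      then show "u \<in> ?o ` ?A" by blast
    qed
  qed
  have "2 * \<delta> i = (\<Sum>a\<in>arcs G. (if tail G a = i then \<delta> (head G a) else 0) + (if head G a = i then \<delta> (tail G a) else 0))"
    using null i by (simp add: null_vector_def)
  also have "\<dots> = (\<Sum>a\<in>arcs G. if tail G a = i \<or> head G a = i then \<delta> (?o a) else 0)"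
    by (rule sum.cong[OF refl]) (use loopless in fastforce)
  also have "\<dots> = (\<Sum>a\<in>?A. \<delta> (?o a))" by (rule sum.inter_filter[symmetric]) simp
  also have "\<dots> = (\<Sum>u\<in>?o ` ?A. \<delta> u)" by (rule sum.reindex[OF inj, symmetric, unfolded o_def])
  finally show ?thesis unfolding img .
qed

lemma all_less_numeral: "(\<forall>i<n. P i) \<longleftrightarrow> list_all P [0..<n]"
  by (auto simp: list_all_iff)

lemma distinct_edges_D:
  fixes m :: nat
  shows "distinct (map (\<lambda>(p, q). {p, q}) (edges_D (m + 4)))"
proof -
  let ?M = "(\<lambda>i. {i, i + 1}) ` {2..<m + 4 - 2}"
  have "inj_on (\<lambda>i. {i, i + 1}) {2..<m + 4 - 2}"
    by (rule inj_onI) (auto simp: doubleton_eq_iff)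
  then have distM: "distinct (map (\<lambda>(p, q). {p, q}) (map (\<lambda>i. (i, i + 1)) [2..<m + 4 - 2]))"
    by (simp add: distinct_map o_def del: upt_Suc)
  have setM: "set (map (\<lambda>(p, q). {p, q}) (map (\<lambda>i. (i, i + 1)) [2..<m + 4 - 2])) = ?M"
    by (simp only: set_map image_image set_upt prod.case)
  have notin: "{p, q} \<notin> ?M" if "p + 1 \<noteq> q \<or> p = m + 2" "p < q" for p q
  proof
    assume "{p, q} \<in> ?M"
    then obtain i where "i < m + 2" "{p, q} = {i, i + 1}" by auto
    with that show False by (auto simp: doubleton_eq_iff)
  qed
  note distM setM
  moreover have "{0, 2} \<notin> ?M" "{m + 4 - 2, m + 4 - 1} \<notin> ?M" "{m + 4 - 2, m + 4} \<notin> ?M"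
    by (rule notin; simp)+
  moreover have "{1, 2} \<notin> ?M"
  proof
    assume "{1, 2} \<in> ?M"
    then obtain i :: nat where "2 \<le> i" "{1, 2} = {i, i + 1}" by fastforce
    then show False by (auto simp: doubleton_eq_iff)
  qed
  moreover have "{0, 2} \<noteq> {1::nat, 2}" "{0, 2} \<noteq> {m + 4 - 2, m + 4 - 1}" "{0, 2} \<noteq> {m + 4 - 2, m + 4}"
    "{1, 2} \<noteq> {m + 4 - 2, m + 4 - 1}" "{1, 2} \<noteq> {m + 4 - 2, m + 4}" "{m + 4 - 2, m + 4 - 1} \<noteq> {m + 4 - 2, m + 4}"
    by (auto simp: doubleton_eq_iff)
  ultimately show ?thesis
    by (simp only: map_append list.map prod.case distinct_append distinct.simps set_append list.set Int_insert_left Int_insert_right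
      Un_iff insert_iff empty_iff Int_empty_left Int_empty_right Int_Un_distrib) simp
qed

text \<open>The marks of D_n: 1 at the four leaves, numbered 0, 1, n - 1 and n, and 2 along the
  spine.\<close>

lemma neighbour_sum_D:
  assumes i: "i < m + 5" and \<delta>: "\<delta> = (\<lambda>k. if k < 2 \<or> k > m + 4 - 2 then 1 else 2)"
  shows "neighbour_sum (edges_D (m + 4)) \<delta> i = 2 * \<delta> i"
proof -
  have "neighbour_sum (map (\<lambda>i. (i, i + 1)) [2..<m + 4 - 2]) \<delta> i =
      (\<Sum>k\<in>{2..<m + 2}. (if k = i then 2 else 0) + (if k = i - 1 \<and> i \<noteq> 0 then 2 else 0))"
    unfolding neighbour_sum_map_upt by (rule sum.cong) (auto simp: \<delta>)
  also have "\<dots> = (if 2 \<le> i \<and> i < m + 2 then 2 else 0) + (if 3 \<le> i \<and> i < m + 3 then 2 else 0)"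
    by (cases i) (auto simp: sum.distrib)
  finally have mid: "neighbour_sum (map (\<lambda>i. (i, i + 1)) [2..<m + 4 - 2]) \<delta> i =
      (if 2 \<le> i \<and> i < m + 2 then 2 else 0) + (if 3 \<le> i \<and> i < m + 3 then 2 else 0)" .
  show ?thesis
    unfolding neighbour_sum_simps mid using i unfolding \<delta> by simp linarith
qed

theorem is_affine_quiver_if_null_vector:
  assumes G: "fin_digraph G" "connected_graph G" "null_vector G d"
  shows "is_affine_quiver G"
proof (cases "\<exists>n. embeds (affine_A n) G")
  case True
  then show ?thesis using same_underlying_graph_affine_A[OF G] unfolding is_affine_quiver_def by blast
next
  case False
  interpret fin_digraph G by fact
  have loopless: "tail G a \<noteq> head G a" if "a \<in> arcs G" for a
    using embeds_affine_A_loop[of a G] that False by auto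
  have simple: "a = b" if "a \<in> arcs G" "b \<in> arcs G" "{tail G a, head G a} = {tail G b, head G b}" for a b
    using embeds_affine_A_parallel[of a G b] that loopless False by auto
  \<comment> \<open>With no cycle diagram embedded, the graph is simple and acyclic, and the null
    vector becomes a harmonic function on neighbours.\<close>
  interpret harmonic_forest "verts G" "adj G" d
  proof
    show "verts G \<noteq> {}" using G(2) by (simp add: connected_graph_def)
    show "adj G u v \<Longrightarrow> u \<in> verts G \<and> v \<in> verts G" for u v by (auto simp: adj_def doubleton_eq_iff)
    then have adj_verts: "adj G u v \<Longrightarrow> u \<in> verts G" for u v by blast
    show "adj G u v \<Longrightarrow> adj G v u" for u v by (rule adj_sym)
    show "\<not> adj G u u" for u
    proof
      assume "adj G u u"
      then obtain a where "a \<in> arcs G" "{tail G a, head G a} = {u, u}" unfolding adj_def by blast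
      with loopless[of a] show False by auto
    qed
    show "v \<in> verts G \<Longrightarrow> d v > 0" for v using G(3) by (simp add: null_vector_def)
    show "v \<in> verts G \<Longrightarrow> 2 * d v = (\<Sum>u | adj G v u. d u)" for v
      by (rule null_vector_harmonic[OF G(3) _ loopless simple])
    show "\<not> adj G (c n) (c 0)" if n: "n \<ge> 2" and inj: "inj_on c {..n}" and step: "\<And>k. k < n \<Longrightarrow> adj G (c k) (c (Suc k))" for c n
    proof
      assume last: "adj G (c n) (c 0)"
      have "c k \<in> verts G" if "k \<le> n" for k
        using adj_verts[OF last] adj_verts[OF step] that by (cases "k = n") auto
      then have "c ` {..n} \<subseteq> verts G" by auto
      then have "embeds (affine_A n) G" by (rule embeds_affine_A_cycle[OF n inj _ step last])
      with False show False by blast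
    qed
  qed simp
  have same: "same_underlying_graph G (graph_of_edges n es)"
    if emb: "embeds_edges n es" and dist: "distinct (map (\<lambda>(p, q). {p, q}) es)" and n: "n > 0"
      and es: "\<forall>(p, q)\<in>set es. p < n \<and> q < n" and \<delta>: "\<forall>i<n. \<delta> i > 0 \<and> neighbour_sum es \<delta> i = 2 * \<delta> i" for n es \<delta>
  proof (rule same_underlying_graph_of_edgesI[OF G _ n, where \<delta> = \<delta>])
    from emb obtain \<phi> where "inj_on \<phi> {..<n}" "\<phi> ` {..<n} \<subseteq> verts G" "\<forall>(p, q)\<in>set es. adj G (\<phi> p) (\<phi> q)"
      unfolding embeds_edges_def by blast
    then show "embeds (graph_of_edges n es) G" by (intro embeds_graph_of_edges[OF dist]) (use es in auto)
  qed (use es \<delta> in auto)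
  have D: "same_underlying_graph G (affine_D n)" if n: "n \<ge> 4" and emb: "embeds_edges (Suc n) (edges_D n)" for n
  proof -
    from n obtain m where m: "n = m + 4" by (metis add.commute le_Suc_ex)
    let ?\<delta> = "\<lambda>k. if k < 2 \<or> k > m + 4 - 2 then 1 else 2 :: int"
    have emb': "embeds_edges (m + 4 + 1) (edges_D (m + 4))"
      using emb unfolding m Suc_eq_plus1 .
    show ?thesis
      unfolding affine_D_def m
    proof (rule same[OF emb', of ?\<delta>])
      show "distinct (map (\<lambda>(p, q). {p, q}) (edges_D (m + 4)))" by (rule distinct_edges_D)
      show "0 < m + 4 + 1" by simp
      show "\<forall>(p, q)\<in>set (edges_D (m + 4)). p < m + 4 + 1 \<and> q < m + 4 + 1" by auto
      show "\<forall>i<m + 4 + 1. ?\<delta> i > 0 \<and> neighbour_sum (edges_D (m + 4)) ?\<delta> i = 2 * ?\<delta> i"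
      proof (intro allI impI conjI)
        fix i assume "i < m + 4 + 1"
        then have "i < m + 5" by simp
        from neighbour_sum_D[OF this refl]
        show "neighbour_sum (edges_D (m + 4)) ?\<delta> i = 2 * ?\<delta> i" .
      qed simp
    qed
  qed
  \<comment> \<open>The lists here and below are the marks of the exceptional diagrams, the
    coefficients of the minimal imaginary root, with the centre first. Along an arm they decrease
    linearly.\<close>
  have E6: "same_underlying_graph G affine_E6" if "embeds_edges 7 edges_E6"
    unfolding affine_E6_def
    by (rule same[OF that, of "(!) [3, 2, 1, 2, 1, 2, 1]"])
       (simp_all add: doubleton_eq_iff all_less_numeral numeral_eq_Suc)
  have E7: "same_underlying_graph G affine_E7" if "embeds_edges 8 edges_E7"
    unfolding affine_E7_def
    by (rule same[OF that, of "(!) [4, 2, 3, 2, 1, 3, 2, 1]"])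
       (simp_all add: doubleton_eq_iff all_less_numeral numeral_eq_Suc)
  have E8: "same_underlying_graph G affine_E8" if "embeds_edges 9 edges_E8"
    unfolding affine_E8_def
    by (rule same[OF that, of "(!) [6, 3, 4, 2, 5, 4, 3, 2, 1]"])
       (simp_all add: doubleton_eq_iff all_less_numeral numeral_eq_Suc)
  from embeds_affine_tree D E6 E7 E8 show ?thesis unfolding is_affine_quiver_def by blast
qed

section \<open>The inequality at a vertex\<close>

text \<open>
  The matrices on the arcs into the loopless vertex \<open>i\<close> are collected as the blocks of a single matrix
  \<open>\<xi>\<close>, those on the arcs out of \<open>i\<close> as the blocks of \<open>\<zeta>\<close>; all other arcs keep the matrices of \<open>x0\<close>.
\<close>

locale vertex_star = fin_digraph G for G :: "('a, 'b) pre_digraph" +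
  fixes d :: "'a \<Rightarrow> nat" and i :: 'a and x0 :: "'b \<Rightarrow> 'k::{field, finite} mat"
    and m m' :: nat and \<sigma> \<tau> :: "'b \<times> nat \<Rightarrow> nat"
  assumes i: "i \<in> verts G" and loopless: "\<And>a. a \<in> arcs G \<Longrightarrow> head G a = i \<Longrightarrow> tail G a \<noteq> i"
    and x0: "x0 \<in> points d"
    and \<sigma>: "bij_betw \<sigma> (SIGMA a:{a \<in> arcs G. head G a = i}. {..<d (tail G a)}) {..<m}"
    and \<tau>: "bij_betw \<tau> (SIGMA a:{a \<in> arcs G. tail G a = i}. {..<d (head G a)}) {..<m'}"
begin

abbreviation "n \<equiv> d i"

definition glue :: "'k mat \<Rightarrow> 'k mat \<Rightarrow> 'b \<Rightarrow> 'k mat" where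
  "glue \<xi> \<zeta> = (\<lambda>a\<in>arcs G.
     if head G a = i then mat n (d (tail G a)) (\<lambda>(r, c). \<xi> $$ (r, \<sigma> (a, c)))
     else if tail G a = i then mat (d (head G a)) n (\<lambda>(r, c). \<zeta> $$ (\<tau> (a, r), c))
     else x0 a)"

text \<open>With \<open>outgoing\<close> this inverts \<open>glue\<close>: each column is traced
  back through \<open>\<sigma>\<close> to an arc and a column of its matrix.\<close>

definition incoming :: "('b \<Rightarrow> 'k mat) \<Rightarrow> 'k mat" where
  "incoming z = mat n m (\<lambda>(r, k). case inv_into (SIGMA a:{a \<in> arcs G. head G a = i}. {..<d (tail G a)}) \<sigma> k of
     (a, c) \<Rightarrow> z a $$ (r, c))"

definition outgoing :: "('b \<Rightarrow> 'k mat) \<Rightarrow> 'k mat" where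
  "outgoing z = mat m' n (\<lambda>(k, c). case inv_into (SIGMA a:{a \<in> arcs G. tail G a = i}. {..<d (head G a)}) \<tau> k of
     (a, r) \<Rightarrow> z a $$ (r, c))"

lemma \<sigma>_less: "a \<in> arcs G \<Longrightarrow> head G a = i \<Longrightarrow> c < d (tail G a) \<Longrightarrow> \<sigma> (a, c) < m"
  using bij_betwE[OF \<sigma>] by auto

lemma \<tau>_less: "a \<in> arcs G \<Longrightarrow> tail G a = i \<Longrightarrow> r < d (head G a) \<Longrightarrow> \<tau> (a, r) < m'"
  using bij_betwE[OF \<tau>] by auto

lemma ex_\<sigma>:
  assumes "k < m"
  obtains a c where "a \<in> arcs G" "head G a = i" "c < d (tail G a)" "k = \<sigma> (a, c)"
proof -
  from assms have "k \<in> \<sigma> ` (SIGMA a:{a \<in> arcs G. head G a = i}. {..<d (tail G a)})"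
    using bij_betw_imp_surj_on[OF \<sigma>] by simp
  then show ?thesis using that by auto
qed

lemma ex_\<tau>:
  assumes "k < m'"
  obtains a r where "a \<in> arcs G" "tail G a = i" "r < d (head G a)" "k = \<tau> (a, r)"
proof -
  from assms have "k \<in> \<tau> ` (SIGMA a:{a \<in> arcs G. tail G a = i}. {..<d (head G a)})"
    using bij_betw_imp_surj_on[OF \<tau>] by simp
  then show ?thesis using that by auto
qed

lemma dim_incoming [simp]: "dim_row (incoming z) = n" "dim_col (incoming z) = m"
  and dim_outgoing [simp]: "dim_row (outgoing z) = m'" "dim_col (outgoing z) = n"
  by (simp_all add: incoming_def outgoing_def)

lemma incoming_index:
  assumes "r < n" "a \<in> arcs G" "head G a = i" "c < d (tail G a)"
  shows "incoming z $$ (r, \<sigma> (a, c)) = z a $$ (r, c)"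
proof -
  have "inv_into (SIGMA a:{a \<in> arcs G. head G a = i}. {..<d (tail G a)}) \<sigma> (\<sigma> (a, c)) = (a, c)"
    by (rule inv_into_f_f[OF bij_betw_imp_inj_on[OF \<sigma>]]) (use assms in simp)
  then show ?thesis using assms \<sigma>_less by (simp add: incoming_def)
qed

lemma outgoing_index:
  assumes "c < n" "a \<in> arcs G" "tail G a = i" "r < d (head G a)"
  shows "outgoing z $$ (\<tau> (a, r), c) = z a $$ (r, c)"
proof -
  have "inv_into (SIGMA a:{a \<in> arcs G. tail G a = i}. {..<d (head G a)}) \<tau> (\<tau> (a, r)) = (a, r)"
    by (rule inv_into_f_f[OF bij_betw_imp_inj_on[OF \<tau>]]) (use assms in simp)
  then show ?thesis using assms \<tau>_less by (simp add: outgoing_def)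
qed

lemma glue_head: "a \<in> arcs G \<Longrightarrow> head G a = i \<Longrightarrow> glue \<xi> \<zeta> a = mat n (d (tail G a)) (\<lambda>(r, c). \<xi> $$ (r, \<sigma> (a, c)))"
  by (simp add: glue_def)

lemma glue_tail: "a \<in> arcs G \<Longrightarrow> tail G a = i \<Longrightarrow> glue \<xi> \<zeta> a = mat (d (head G a)) n (\<lambda>(r, c). \<zeta> $$ (\<tau> (a, r), c))"
  using loopless by (auto simp: glue_def)

lemma glue_other: "a \<in> arcs G \<Longrightarrow> head G a \<noteq> i \<Longrightarrow> tail G a \<noteq> i \<Longrightarrow> glue \<xi> \<zeta> a = x0 a"
  by (simp add: glue_def)

lemma glue_points: "glue \<xi> \<zeta> \<in> points d"
  unfolding points_def
proof (rule PiE_I)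
  fix a assume a: "a \<in> arcs G"
  show "glue \<xi> \<zeta> a \<in> carrier_mat (d (head G a)) (d (tail G a))"
  proof (cases "head G a = i")
    case True
    then show ?thesis by (simp add: glue_head[OF a])
  next
    case False
    then show ?thesis
      using pointsD[OF x0 a] by (cases "tail G a = i") (simp_all add: glue_tail[OF a] glue_other[OF a])
  qed
qed (simp add: glue_def)

lemma glue_incoming_outgoing:
  assumes z: "z \<in> points d" and other: "\<And>a. a \<in> arcs G \<Longrightarrow> head G a \<noteq> i \<Longrightarrow> tail G a \<noteq> i \<Longrightarrow> z a = x0 a"
  shows "glue (incoming z) (outgoing z) = z"
proof (rule PiE_ext[OF glue_points[unfolded points_def] z[unfolded points_def]])
  fix a assume a: "a \<in> arcs G"
  note za = pointsD[OF z a]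
  consider "head G a = i" | "tail G a = i" | "head G a \<noteq> i" "tail G a \<noteq> i" by blast
  then show "glue (incoming z) (outgoing z) a = z a"
  proof cases
    case 1
    show ?thesis unfolding glue_head[OF a 1] using za 1 incoming_index[OF _ a 1] by (intro eq_matI) auto
  next
    case 2
    show ?thesis unfolding glue_tail[OF a 2] using za 2 outgoing_index[OF _ a 2] by (intro eq_matI) auto
  next
    case 3
    then show ?thesis using other[OF a] glue_other[OF a] by simp
  qed
qed

text \<open>The two points differ by a change of basis at \<open>i\<close>. As there is no loop at
  \<open>i\<close>, it acts on incoming matrices only from the left and on outgoing ones only from
  the right, so both blocks transform as a whole.\<close>

lemma glue_mult_eq:
  assumes h: "h \<in> carrier_mat n n" "h' \<in> carrier_mat n n" "h * h' = 1\<^sub>m n" "h' * h = 1\<^sub>m n"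
    and \<xi>: "\<xi> \<in> carrier_mat n m" and \<zeta>: "\<zeta> \<in> carrier_mat m' n"
  shows "point_value f d (glue (h * \<xi>) \<zeta>) = point_value f d (glue \<xi> (\<zeta> * h))"
proof (rule point_value_cong[OF glue_points glue_points])
  let ?g = "\<lambda>j v. if j = i then h' *\<^sub>v v else v"
  have cancel: "h' *\<^sub>v (h *\<^sub>v v) = v" "h *\<^sub>v (h' *\<^sub>v v) = v" if "v \<in> carrier_vec n" for v
    using that assoc_mult_mat_vec[OF h(2,1) that] assoc_mult_mat_vec[OF h(1,2) that] h(3,4) by simp_all
  have "is_rep_iso G (point_rep d (glue (h * \<xi>) \<zeta>)) (point_rep d (glue \<xi> (\<zeta> * h))) ?g"
    unfolding is_rep_iso_def
  proof (intro conjI ballI)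
    fix j assume "j \<in> verts G"
    show "linear_map class_ring (rep_space (point_rep d (glue (h * \<xi>) \<zeta>)) j) (rep_space (point_rep d (glue \<xi> (\<zeta> * h))) j) (?g j)"
    proof (cases "j = i")
      case True
      show ?thesis unfolding point_rep_simps if_P[OF True] unfolding True by (rule linear_map_mult_mat_vec[OF h(2)])
    next
      case False
      show ?thesis unfolding point_rep_simps if_not_P[OF False] by (rule linear_mapI) auto
    qed
    show "bij_betw (?g j) (carrier (rep_space (point_rep d (glue (h * \<xi>) \<zeta>)) j)) (carrier (rep_space (point_rep d (glue \<xi> (\<zeta> * h))) j))"
    proof (cases "j = i")
      case True
      have "bij_betw (\<lambda>v. h' *\<^sub>v v) (carrier_vec n) (carrier_vec n)"
        by (rule bij_betw_byWitness[where f' = "\<lambda>v. h *\<^sub>v v"]) (use cancel h in auto)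
      then show ?thesis using True by simp
    next
      case False
      then show ?thesis by (simp add: bij_betw_def inj_on_def)
    qed
  next
    fix a v assume a: "a \<in> arcs G" and "v \<in> carrier (rep_space (point_rep d (glue (h * \<xi>) \<zeta>)) (tail G a))"
    then have v: "v \<in> carrier_vec (d (tail G a))" by simp
    consider "head G a = i" | "tail G a = i" | "head G a \<noteq> i" "tail G a \<noteq> i" by blast
    then have "?g (head G a) (glue (h * \<xi>) \<zeta> a *\<^sub>v v) = glue \<xi> (\<zeta> * h) a *\<^sub>v ?g (tail G a) v"
    proof cases
      case 1
      let ?X = "mat n (d (tail G a)) (\<lambda>(r, c). \<xi> $$ (r, \<sigma> (a, c)))"
      have X: "?X \<in> carrier_mat n (d (tail G a))" by simp
      have "mat n (d (tail G a)) (\<lambda>(r, c). (h * \<xi>) $$ (r, \<sigma> (a, c))) = h * ?X"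
        by (rule eq_matI) (use h(1) \<xi> \<sigma>_less[OF a 1] in \<open>auto simp: scalar_prod_def\<close>)
      then have "glue (h * \<xi>) \<zeta> a *\<^sub>v v = h *\<^sub>v (?X *\<^sub>v v)"
        unfolding glue_head[OF a 1] using assoc_mult_mat_vec[OF h(1) X v] by simp
      then show ?thesis
        using 1 loopless[OF a 1] cancel(1)[OF mult_mat_vec_carrier[OF X v]] by (simp add: glue_head[OF a 1])
    next
      case 2
      let ?Z = "mat (d (head G a)) n (\<lambda>(r, c). \<zeta> $$ (\<tau> (a, r), c))"
      have Z: "?Z \<in> carrier_mat (d (head G a)) n" by simp
      have ne: "head G a \<noteq> i" using loopless[OF a] 2 by blast
      have v': "v \<in> carrier_vec n" using v 2 by simp
      have "mat (d (head G a)) n (\<lambda>(r, c). (\<zeta> * h) $$ (\<tau> (a, r), c)) = ?Z * h"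
        by (rule eq_matI) (use h(1) \<zeta> \<tau>_less[OF a 2] in \<open>auto simp: scalar_prod_def\<close>)
      then have "glue \<xi> (\<zeta> * h) a *\<^sub>v (h' *\<^sub>v v) = ?Z *\<^sub>v (h *\<^sub>v (h' *\<^sub>v v))"
        unfolding glue_tail[OF a 2] using assoc_mult_mat_vec[OF Z h(1) mult_mat_vec_carrier[OF h(2) v']] by simp
      then show ?thesis using 2 ne cancel(2)[OF v'] by (simp add: glue_tail[OF a 2])
    next
      case 3
      then show ?thesis by (simp add: glue_other[OF a])
    qed
    then show "?g (head G a) (rep_map (point_rep d (glue (h * \<xi>) \<zeta>)) a v) =
        rep_map (point_rep d (glue \<xi> (\<zeta> * h))) a (?g (tail G a) v)" by (simp only: point_rep_simps)
  qed
  then show "rep_isomorphic G (point_rep d (glue (h * \<xi>) \<zeta>)) (point_rep d (glue \<xi> (\<zeta> * h)))"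
    unfolding rep_isomorphic_def by blast
qed

text \<open>The subrepresentation is the first coordinate line at \<open>i\<close> and 0 elsewhere;
  it is one because the outgoing matrices kill that line. Its free block is the first row of
  \<open>\<xi>\<close>, and the coordinate \<open>(j, k)\<close> survives in the quotient.\<close>

lemma sum_line_e0:
  assumes f: "cuspidal G f" and n: "n > 0" and other: "j \<in> verts G" "k < d j" "(j, k) \<noteq> (i, 0)"
    and \<xi>: "\<xi> \<in> carrier_mat n m" and \<zeta>: "\<zeta> \<in> carrier_mat m' n" and zero: "\<And>l. l < m' \<Longrightarrow> \<zeta> $$ (l, 0) = 0"
  shows "(\<Sum>y\<in>carrier_mat 1 m. point_value f d (glue (\<xi> + mat n 1 (\<lambda>(r, _). of_bool (r = 0)) * y) \<zeta>)) = 0"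
proof -
  let ?e = "mat n 1 (\<lambda>(r, _). of_bool (r = 0)) :: 'k mat" and ?J = "\<lambda>j. if j = i then {0} else {} :: nat set"
  interpret coordinate_subrep G d ?J "glue \<xi> \<zeta>"
  proof
    show "glue \<xi> \<zeta> \<in> points d" by (rule glue_points)
    fix a r c assume a: "a \<in> arcs G" and rc: "r < d (head G a)" "c < d (tail G a)" "c \<in> ?J (tail G a)" "r \<notin> ?J (head G a)"
    then have t: "tail G a = i" "c = 0" by (auto split: if_splits)
    show "glue \<xi> \<zeta> a $$ (r, c) = 0"
      unfolding glue_tail[OF a t(1)] using rc t n zero[OF \<tau>_less[OF a t(1) rc(1)]] by simp
  qed
  have ey: "(\<xi> + ?e * y) $$ (r, l) = \<xi> $$ (r, l) + of_bool (r = 0) * y $$ (0, l)" if "y \<in> carrier_mat 1 m" "r < n" "l < m" for y r l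
    using that \<xi> by (simp add: scalar_prod_def)
  have "(\<Sum>z\<in>extensions. point_value f d z) = (\<Sum>y\<in>carrier_mat 1 m. point_value f d (glue (\<xi> + ?e * y) \<zeta>))"
  \<comment> \<open>An extension is recovered from the change in row 0 of its incoming matrix; all
    other entries are those of \<open>glue \<xi> \<zeta>\<close>.\<close>
  proof (rule sum.reindex_bij_witness[where j = "\<lambda>z. mat 1 m (\<lambda>(_, l). incoming z $$ (0, l) - \<xi> $$ (0, l))"
      and i = "\<lambda>y. glue (\<xi> + ?e * y) \<zeta>"])
    fix z assume z: "z \<in> extensions"
    note zp = extensions_points[OF z]
    have fixed: "z a $$ (r, c) = glue \<xi> \<zeta> a $$ (r, c)"
      if a: "a \<in> arcs G" "r < d (head G a)" "c < d (tail G a)" "\<not> (head G a = i \<and> r = 0)" for a r c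
    proof -
      have "\<not> (r \<in> ?J (head G a) \<and> c \<notin> ?J (tail G a))" using a(4) by auto
      then show ?thesis using z a(1-3) unfolding extensions_def by blast
    qed
    let ?y = "mat 1 m (\<lambda>(_, l). incoming z $$ (0, l) - \<xi> $$ (0, l))"
    show "?y \<in> carrier_mat 1 m" by simp
    have "\<xi> + ?e * ?y = incoming z"
    proof (rule eq_matI)
      fix r l assume "r < dim_row (incoming z)" "l < dim_col (incoming z)"
      then have rl: "r < n" "l < m" by simp_all
      obtain a c where a: "a \<in> arcs G" "head G a = i" "c < d (tail G a)" "l = \<sigma> (a, c)" using ex_\<sigma>[OF rl(2)] .
      have "incoming z $$ (r, l) = \<xi> $$ (r, l)" if "r \<noteq> 0"
        using fixed[OF a(1) _ a(3), of r] that rl(1) a(2,3) unfolding a(4) incoming_index[OF rl(1) a(1-3)] glue_head[OF a(1,2)] by simp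
      then show "(\<xi> + ?e * ?y) $$ (r, l) = incoming z $$ (r, l)" using rl by (subst ey) auto
    qed (use \<xi> in auto)
    moreover have "\<zeta> = outgoing z"
    proof (rule eq_matI)
      fix l c assume "l < dim_row (outgoing z)" "c < dim_col (outgoing z)"
      then have lc: "l < m'" "c < n" by simp_all
      obtain a r where a: "a \<in> arcs G" "tail G a = i" "r < d (head G a)" "l = \<tau> (a, r)" using ex_\<tau>[OF lc(1)] .
      have "head G a \<noteq> i" using loopless[OF a(1)] a(2) by blast
      then show "\<zeta> $$ (l, c) = outgoing z $$ (l, c)"
        using fixed[OF a(1,3), of c] lc(2) a(2,3) unfolding a(4) outgoing_index[OF lc(2) a(1-3)] glue_tail[OF a(1,2)] by simp
    qed (use \<zeta> in auto)
    moreover have "glue (incoming z) (outgoing z) = z"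
    proof (rule glue_incoming_outgoing[OF zp])
      fix a assume a: "a \<in> arcs G" "head G a \<noteq> i" "tail G a \<noteq> i"
      show "z a = x0 a"
        using pointsD[OF zp a(1)] pointsD[OF x0 a(1)] fixed[OF a(1)] a(2) unfolding glue_other[OF a] by (intro eq_matI) auto
    qed
    ultimately show eq: "glue (\<xi> + ?e * ?y) \<zeta> = z" by simp
    show "point_value f d (glue (\<xi> + ?e * ?y) \<zeta>) = point_value f d z" unfolding eq ..
  next
    fix y :: "'k mat" assume y: "y \<in> carrier_mat 1 m"
    show "glue (\<xi> + ?e * y) \<zeta> \<in> extensions"
      unfolding extensions_def
    proof (intro CollectI conjI ballI allI impI glue_points)
      fix a r c assume a: "a \<in> arcs G" and rc: "r < d (head G a)" "c < d (tail G a)" "\<not> (r \<in> ?J (head G a) \<and> c \<notin> ?J (tail G a))"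
      show "glue (\<xi> + ?e * y) \<zeta> a $$ (r, c) = glue \<xi> \<zeta> a $$ (r, c)"
      proof (cases "head G a = i")
        case True
        then have "r \<noteq> 0" using rc(3) loopless[OF a] by auto
        then show ?thesis unfolding glue_head[OF a True] using rc True ey[OF y _ \<sigma>_less[OF a True rc(2)]] by simp
      next
        case False
        then show ?thesis by (cases "tail G a = i") (simp_all add: glue_tail[OF a] glue_other[OF a])
      qed
    qed
    show "mat 1 m (\<lambda>(_, l). incoming (glue (\<xi> + ?e * y) \<zeta>) $$ (0, l) - \<xi> $$ (0, l)) = y"
    proof (rule eq_matI)
      fix r l assume "r < dim_row y" "l < dim_col y"
      then have rl: "r = 0" "l < m" using y by auto
      obtain a c where a: "a \<in> arcs G" "head G a = i" "c < d (tail G a)" "l = \<sigma> (a, c)" using ex_\<sigma>[OF rl(2)] .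
      have "incoming (glue (\<xi> + ?e * y) \<zeta>) $$ (0, l) = (\<xi> + ?e * y) $$ (0, l)"
        unfolding a(4) incoming_index[OF n a(1-3)] glue_head[OF a(1,2)] using n a(3) by simp
      then show "mat 1 m (\<lambda>(_, l). incoming (glue (\<xi> + ?e * y) \<zeta>) $$ (0, l) - \<xi> $$ (0, l)) $$ (r, l) = y $$ (r, l)"
        using rl ey[OF y n rl(2)] by simp
    qed (use y in auto)
  qed
  moreover have "(\<Sum>z\<in>extensions. point_value f d z) = 0"
    by (rule sum_extensions_eq_0[OF f i n _ other(1,2)]) (use other in auto)
  ultimately show ?thesis by simp
qed

text \<open>The subrepresentation is everything except coordinate 0 at \<open>i\<close>, and the
  incoming matrices respect it because their first row is 0. The quotient is one-dimensional at
  \<open>i\<close>, the free block is the first column of \<open>\<zeta>\<close>, and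
  \<open>(j, k)\<close> lies in the subrepresentation.\<close>

lemma sum_hyperplane_e0:
  assumes f: "cuspidal G f" and n: "n > 0" and other: "j \<in> verts G" "k < d j" "(j, k) \<noteq> (i, 0)"
    and \<xi>: "\<xi> \<in> carrier_mat n m" and \<zeta>: "\<zeta> \<in> carrier_mat m' n" and zero: "\<And>l. l < m \<Longrightarrow> \<xi> $$ (0, l) = 0"
  shows "(\<Sum>y\<in>carrier_mat m' 1. point_value f d (glue \<xi> (\<zeta> + y * mat 1 n (\<lambda>(_, c). of_bool (c = 0))))) = 0"
proof -
  let ?e = "mat 1 n (\<lambda>(_, c). of_bool (c = 0)) :: 'k mat" and ?J = "\<lambda>j. if j = i then {0<..} else UNIV :: nat set"
  interpret coordinate_subrep G d ?J "glue \<xi> \<zeta>"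
  proof
    show "glue \<xi> \<zeta> \<in> points d" by (rule glue_points)
    fix a r c assume a: "a \<in> arcs G" and rc: "r < d (head G a)" "c < d (tail G a)" "c \<in> ?J (tail G a)" "r \<notin> ?J (head G a)"
    then have t: "head G a = i" "r = 0" by (auto split: if_splits)
    show "glue \<xi> \<zeta> a $$ (r, c) = 0"
      unfolding glue_head[OF a t(1)] using rc t n zero[OF \<sigma>_less[OF a t(1) rc(2)]] by simp
  qed
  have ey: "(\<zeta> + y * ?e) $$ (l, c) = \<zeta> $$ (l, c) + y $$ (l, 0) * of_bool (c = 0)" if "y \<in> carrier_mat m' 1" "c < n" "l < m'" for y l c
    using that \<zeta> by (simp add: scalar_prod_def)
  have "(\<Sum>z\<in>extensions. point_value f d z) = (\<Sum>y\<in>carrier_mat m' 1. point_value f d (glue \<xi> (\<zeta> + y * ?e)))"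
  proof (rule sum.reindex_bij_witness[where j = "\<lambda>z. mat m' 1 (\<lambda>(l, _). outgoing z $$ (l, 0) - \<zeta> $$ (l, 0))"
      and i = "\<lambda>y. glue \<xi> (\<zeta> + y * ?e)"])
    fix z assume z: "z \<in> extensions"
    note zp = extensions_points[OF z]
    have fixed: "z a $$ (r, c) = glue \<xi> \<zeta> a $$ (r, c)"
      if a: "a \<in> arcs G" "r < d (head G a)" "c < d (tail G a)" "\<not> (tail G a = i \<and> c = 0)" for a r c
    proof -
      have "\<not> (r \<in> ?J (head G a) \<and> c \<notin> ?J (tail G a))" using a(4) by auto
      then show ?thesis using z a(1-3) unfolding extensions_def by blast
    qed
    let ?y = "mat m' 1 (\<lambda>(l, _). outgoing z $$ (l, 0) - \<zeta> $$ (l, 0))"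
    show "?y \<in> carrier_mat m' 1" by simp
    have "\<zeta> + ?y * ?e = outgoing z"
    proof (rule eq_matI)
      fix l c assume "l < dim_row (outgoing z)" "c < dim_col (outgoing z)"
      then have lc: "l < m'" "c < n" by simp_all
      obtain a r where a: "a \<in> arcs G" "tail G a = i" "r < d (head G a)" "l = \<tau> (a, r)" using ex_\<tau>[OF lc(1)] .
      have "outgoing z $$ (l, c) = \<zeta> $$ (l, c)" if "c \<noteq> 0"
        using fixed[OF a(1,3), of c] that lc(2) a(2,3) unfolding a(4) outgoing_index[OF lc(2) a(1-3)] glue_tail[OF a(1,2)] by simp
      then show "(\<zeta> + ?y * ?e) $$ (l, c) = outgoing z $$ (l, c)" using lc by (subst ey) auto
    qed (use \<zeta> in auto)
    moreover have "\<xi> = incoming z"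
    proof (rule eq_matI)
      fix r l assume "r < dim_row (incoming z)" "l < dim_col (incoming z)"
      then have rl: "r < n" "l < m" by simp_all
      obtain a c where a: "a \<in> arcs G" "head G a = i" "c < d (tail G a)" "l = \<sigma> (a, c)" using ex_\<sigma>[OF rl(2)] .
      have "tail G a \<noteq> i" using loopless[OF a(1,2)] .
      then show "\<xi> $$ (r, l) = incoming z $$ (r, l)"
        using fixed[OF a(1) _ a(3), of r] rl(1) a(2,3) unfolding a(4) incoming_index[OF rl(1) a(1-3)] glue_head[OF a(1,2)] by simp
    qed (use \<xi> in auto)
    moreover have "glue (incoming z) (outgoing z) = z"
    proof (rule glue_incoming_outgoing[OF zp])
      fix a assume a: "a \<in> arcs G" "head G a \<noteq> i" "tail G a \<noteq> i"
      show "z a = x0 a"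
        using pointsD[OF zp a(1)] pointsD[OF x0 a(1)] fixed[OF a(1)] a(3) unfolding glue_other[OF a] by (intro eq_matI) auto
    qed
    ultimately show eq: "glue \<xi> (\<zeta> + ?y * ?e) = z" by simp
    show "point_value f d (glue \<xi> (\<zeta> + ?y * ?e)) = point_value f d z" unfolding eq ..
  next
    fix y :: "'k mat" assume y: "y \<in> carrier_mat m' 1"
    show "glue \<xi> (\<zeta> + y * ?e) \<in> extensions"
      unfolding extensions_def
    proof (intro CollectI conjI ballI allI impI glue_points)
      fix a r c assume a: "a \<in> arcs G" and rc: "r < d (head G a)" "c < d (tail G a)" "\<not> (r \<in> ?J (head G a) \<and> c \<notin> ?J (tail G a))"
      show "glue \<xi> (\<zeta> + y * ?e) a $$ (r, c) = glue \<xi> \<zeta> a $$ (r, c)"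
      proof (cases "tail G a = i")
        case True
        then have "head G a \<noteq> i" using loopless[OF a] by blast
        then have "c \<noteq> 0" using rc(3) True by simp
        then show ?thesis unfolding glue_tail[OF a True] using rc True ey[OF y _ \<tau>_less[OF a True rc(1)]] by simp
      next
        case False
        then show ?thesis by (cases "head G a = i") (simp_all add: glue_head[OF a] glue_other[OF a])
      qed
    qed
    show "mat m' 1 (\<lambda>(l, _). outgoing (glue \<xi> (\<zeta> + y * ?e)) $$ (l, 0) - \<zeta> $$ (l, 0)) = y"
    proof (rule eq_matI)
      fix l c assume "l < dim_row y" "c < dim_col y"
      then have lc: "c = 0" "l < m'" using y by auto
      obtain a r where a: "a \<in> arcs G" "tail G a = i" "r < d (head G a)" "l = \<tau> (a, r)" using ex_\<tau>[OF lc(2)] .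
      have "outgoing (glue \<xi> (\<zeta> + y * ?e)) $$ (l, 0) = (\<zeta> + y * ?e) $$ (l, 0)"
        unfolding a(4) outgoing_index[OF n a(1-3)] glue_tail[OF a(1,2)] using n a(3) by simp
      then show "mat m' 1 (\<lambda>(l, _). outgoing (glue \<xi> (\<zeta> + y * ?e)) $$ (l, 0) - \<zeta> $$ (l, 0)) $$ (l, c) = y $$ (l, c)"
        using lc ey[OF y n lc(2)] by simp
    qed (use y in auto)
  qed
  moreover have "(\<Sum>z\<in>extensions. point_value f d z) = 0"
    by (rule sum_extensions_eq_0[OF f other(1,2) _ i n]) (use other in auto)
  ultimately show ?thesis by simp
qed

text \<open>Invariance under base change at \<open>i\<close> reduces an arbitrary line or hyperplane
  to the coordinate one. The real or the imaginary part is taken because the estimate is for real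
  functions, and all the conditions are linear in the values.\<close>

lemma twice_dim_le:
  assumes f: "cuspidal G f" and n: "n > 0" and other: "j \<in> verts G" "k < d j" "(j, k) \<noteq> (i, 0)"
    and \<phi>: "\<phi> = Re \<or> \<phi> = Im" and val: "\<phi> (point_value f d x0) \<noteq> 0"
  shows "2 * n \<le> m + m'"
proof -
  have \<phi>_sum: "\<phi> (\<Sum>y\<in>A. h y) = (\<Sum>y\<in>A. \<phi> (h y))" for A :: "'k mat set" and h
    using \<phi> by auto
  have \<phi>_0: "\<phi> 0 = 0" using \<phi> by auto
  interpret invariant_matrix_function n m m' "\<lambda>\<xi> \<zeta>. \<phi> (point_value f d (glue \<xi> \<zeta>))"
  proof
    show "\<phi> (point_value f d (glue (h * \<xi>) \<zeta>)) = \<phi> (point_value f d (glue \<xi> (\<zeta> * h)))"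
      if "h \<in> carrier_mat n n" "h' \<in> carrier_mat n n" "h * h' = 1\<^sub>m n" "h' * h = 1\<^sub>m n"
        "\<xi> \<in> carrier_mat n m" "\<zeta> \<in> carrier_mat m' n" for h h' \<xi> \<zeta>
      unfolding glue_mult_eq[OF that] ..
  next
    fix p \<xi> \<zeta> :: "'k mat"
    assume p: "p \<in> carrier_mat n 1" "p \<noteq> 0\<^sub>m n 1" and \<xi>: "\<xi> \<in> carrier_mat n m" and \<zeta>: "\<zeta> \<in> carrier_mat m' n"
      and zero: "\<zeta> * p = 0\<^sub>m m' 1"
    let ?e = "mat n 1 (\<lambda>(r, _). of_bool (r = 0)) :: 'k mat"
    obtain g h where g: "g \<in> carrier_mat n n" "h \<in> carrier_mat n n" "g * h = 1\<^sub>m n" "h * g = 1\<^sub>m n"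
      and col: "\<And>r. r < n \<Longrightarrow> g $$ (r, 0) = p $$ (r, 0)"
      by (rule ex_invertible_mat_first_col[OF p]) (rule that)
    have e: "?e \<in> carrier_mat n 1" by simp
    have ge: "g * ?e = p"
    proof (rule eq_matI)
      fix r c assume rc: "r < dim_row p" "c < dim_col p"
      have "(g * ?e) $$ (r, c) = (\<Sum>k\<in>{0..<n}. if k = 0 then g $$ (r, k) else 0)"
        using rc g(1) p(1) by (auto simp: scalar_prod_def intro!: sum.cong)
      also have "\<dots> = p $$ (r, c)" using rc p(1) n col[of r] by simp
      finally show "(g * ?e) $$ (r, c) = p $$ (r, c)" .
    qed (use g p in auto)
    have zero': "(\<zeta> * g) $$ (l, 0) = 0" if l: "l < m'" for l
    proof -
      have "(\<zeta> * g) $$ (l, 0) = (\<zeta> * p) $$ (l, 0)"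
        using l n \<zeta> g(1) p(1) col by (auto simp: scalar_prod_def intro!: sum.cong)
      then show ?thesis using zero l by simp
    qed
    \<comment> \<open>\<open>g\<close> sends the first unit vector to \<open>p\<close>, so pulling
      it out turns the shift along \<open>p\<close> into a shift of the first row.\<close>
    have shift: "\<xi> + p * y = g * (h * \<xi> + ?e * y)" if y: "y \<in> carrier_mat 1 m" for y
    proof -
      have "g * (h * \<xi> + ?e * y) = g * (h * \<xi>) + g * (?e * y)"
        by (rule mult_add_distrib_mat[OF g(1) mult_carrier_mat[OF g(2) \<xi>] mult_carrier_mat[OF e y]])
      also have "g * (h * \<xi>) = \<xi>" using assoc_mult_mat[OF g(1,2) \<xi>] g(3) \<xi> by simp
      also have "g * (?e * y) = p * y" using assoc_mult_mat[OF g(1) e y] ge by simp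
      finally show ?thesis by simp
    qed
    have "(\<Sum>y\<in>carrier_mat 1 m. point_value f d (glue (\<xi> + p * y) \<zeta>)) =
        (\<Sum>y\<in>carrier_mat 1 m. point_value f d (glue (h * \<xi> + ?e * y) (\<zeta> * g)))"
    proof (intro sum.cong refl)
      fix y :: "'k mat" assume y: "y \<in> carrier_mat 1 m"
      show "point_value f d (glue (\<xi> + p * y) \<zeta>) = point_value f d (glue (h * \<xi> + ?e * y) (\<zeta> * g))"
        unfolding shift[OF y]
        by (rule glue_mult_eq[OF g add_carrier_mat[OF mult_carrier_mat[OF e y]] \<zeta>])
    qed
    also have "\<dots> = 0"
      by (rule sum_line_e0[OF f n other mult_carrier_mat[OF g(2) \<xi>] mult_carrier_mat[OF \<zeta> g(1)]]) (rule zero')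
    finally show "(\<Sum>y\<in>carrier_mat 1 m. \<phi> (point_value f d (glue (\<xi> + p * y) \<zeta>))) = 0"
      unfolding \<phi>_sum[symmetric] by (simp only: \<phi>_0)
  next
    fix p \<xi> \<zeta> :: "'k mat"
    assume p: "p \<in> carrier_mat 1 n" "p \<noteq> 0\<^sub>m 1 n" and \<xi>: "\<xi> \<in> carrier_mat n m" and \<zeta>: "\<zeta> \<in> carrier_mat m' n"
      and zero: "p * \<xi> = 0\<^sub>m 1 m"
    let ?e = "mat 1 n (\<lambda>(_, c). of_bool (c = 0)) :: 'k mat"
    have "p\<^sup>T \<in> carrier_mat n 1" "p\<^sup>T \<noteq> 0\<^sub>m n 1" using p by (auto simp: mat_eq_iff)
    then obtain g' h' where g': "g' \<in> carrier_mat n n" "h' \<in> carrier_mat n n" "g' * h' = 1\<^sub>m n" "h' * g' = 1\<^sub>m n"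
      and col: "\<And>r. r < n \<Longrightarrow> g' $$ (r, 0) = p\<^sup>T $$ (r, 0)" using ex_invertible_mat_first_col by metis
    define g h where "g = g'\<^sup>T" and "h = h'\<^sup>T"
    have g: "g \<in> carrier_mat n n" "h \<in> carrier_mat n n" using g' by (simp_all add: g_def h_def)
    have "g * h = 1\<^sub>m n" "h * g = 1\<^sub>m n"
      unfolding g_def h_def transpose_mult[OF g'(2,1), symmetric] transpose_mult[OF g'(1,2), symmetric] g'(3,4) by simp_all
    note g = g this
    have row: "g $$ (0, r) = p $$ (0, r)" if "r < n" for r
      using col[OF that] that n p(1) g'(1) by (simp add: g_def)
    have e: "?e \<in> carrier_mat 1 n" by simp
    have eg: "?e * g = p"
    proof (rule eq_matI)
      fix r c assume rc: "r < dim_row p" "c < dim_col p"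
      have "(?e * g) $$ (r, c) = (\<Sum>k\<in>{0..<n}. if k = 0 then g $$ (k, c) else 0)"
        using rc g(1) p(1) by (auto simp: scalar_prod_def intro!: sum.cong)
      also have "\<dots> = p $$ (r, c)" using rc p(1) n row[of c] by simp
      finally show "(?e * g) $$ (r, c) = p $$ (r, c)" .
    qed (use g p in auto)
    have zero': "(g * \<xi>) $$ (0, l) = 0" if l: "l < m" for l
    proof -
      have "(g * \<xi>) $$ (0, l) = (p * \<xi>) $$ (0, l)"
        using l n \<xi> g(1) p(1) row by (auto simp: scalar_prod_def intro!: sum.cong)
      then show ?thesis using zero l by simp
    qed
    have shift: "\<zeta> + y * p = (\<zeta> * h + y * ?e) * g" if y: "y \<in> carrier_mat m' 1" for y
    proof -
      have "(\<zeta> * h + y * ?e) * g = \<zeta> * h * g + y * ?e * g"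
        by (rule add_mult_distrib_mat[OF mult_carrier_mat[OF \<zeta> g(2)] mult_carrier_mat[OF y e] g(1)])
      also have "\<zeta> * h * g = \<zeta>" using assoc_mult_mat[OF \<zeta> g(2,1)] g(4) \<zeta> by simp
      also have "y * ?e * g = y * p" using assoc_mult_mat[OF y e g(1)] eg by simp
      finally show ?thesis by simp
    qed
    have "(\<Sum>y\<in>carrier_mat m' 1. point_value f d (glue \<xi> (\<zeta> + y * p))) =
        (\<Sum>y\<in>carrier_mat m' 1. point_value f d (glue (g * \<xi>) (\<zeta> * h + y * ?e)))"
    proof (intro sum.cong refl)
      fix y :: "'k mat" assume y: "y \<in> carrier_mat m' 1"
      show "point_value f d (glue \<xi> (\<zeta> + y * p)) = point_value f d (glue (g * \<xi>) (\<zeta> * h + y * ?e))"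
        unfolding shift[OF y]
        by (rule glue_mult_eq[OF g \<xi> add_carrier_mat[OF mult_carrier_mat[OF y e]], symmetric])
    qed
    also have "\<dots> = 0"
      by (rule sum_hyperplane_e0[OF f n other mult_carrier_mat[OF g(1) \<xi>] mult_carrier_mat[OF \<zeta> g(2)]]) (rule zero')
    finally show "(\<Sum>y\<in>carrier_mat m' 1. \<phi> (point_value f d (glue \<xi> (\<zeta> + y * p)))) = 0"
      unfolding \<phi>_sum[symmetric] by (simp only: \<phi>_0)
  qed
  \<comment> \<open>The nonzero value at \<open>x0\<close> is thus a value of the invariant
    function.\<close>
  have "glue (incoming x0) (outgoing x0) = x0" by (rule glue_incoming_outgoing[OF x0 refl])
  then show ?thesis
    using val by (intro twice_size_le[of "incoming x0" "outgoing x0"]) auto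
qed

end

section \<open>From one vertex to the whole support\<close>

context fin_digraph
begin

text \<open>The coordinate \<open>(j, k)\<close> excludes the dimension of the simple representation
  at \<open>i\<close>, which is cuspidal and violates the bound. The columns entering
  \<open>i\<close> and the rows leaving it are counted by the dimensions at the far ends of the
  arcs.\<close>

lemma cuspidal_vertex_inequality:
  fixes f :: "('a, 'b, 'k::{field, finite}) hall_element"
  assumes f: "cuspidal G f" "f \<noteq> 0" "homogeneous G d f"
    and i1: "i \<in> verts G" "d i > 0" and loopless: "\<And>a. a \<in> arcs G \<Longrightarrow> head G a = i \<Longrightarrow> tail G a \<noteq> i"
    and other: "j \<in> verts G" "k < d j" "(j, k) \<noteq> (i, 0)"
  shows "2 * d i \<le> (\<Sum>a\<in>arcs G. (if tail G a = i then d (head G a) else 0) + (if head G a = i then d (tail G a) else 0))"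
proof -
  let ?A = "SIGMA a:{a \<in> arcs G. head G a = i}. {..<d (tail G a)}" and ?B = "SIGMA a:{a \<in> arcs G. tail G a = i}. {..<d (head G a)}"
  obtain x0 :: "'b \<Rightarrow> 'k mat" where x: "x0 \<in> points d" "point_value f d x0 \<noteq> 0"
    using ex_point_value_nonzero[OF _ f(2,3)] f(1) unfolding cuspidal_def by blast
  have fin: "finite ?A" "finite ?B" by simp_all
  obtain \<sigma> where \<sigma>: "bij_betw \<sigma> ?A {..<card ?A}" using ex_bij_betw_finite_nat[OF fin(1)] unfolding atLeast0LessThan by blast
  obtain \<tau> where \<tau>: "bij_betw \<tau> ?B {..<card ?B}" using ex_bij_betw_finite_nat[OF fin(2)] unfolding atLeast0LessThan by blast
  interpret vertex_star G d i x0 "card ?A" "card ?B" \<sigma> \<tau>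
    by unfold_locales (fact i1(1) loopless x(1) \<sigma> \<tau>)+
  obtain \<phi> where "\<phi> = Re \<or> \<phi> = Im" "\<phi> (point_value f d x0) \<noteq> 0"
    using x(2) by (auto simp: complex_eq_iff)
  from twice_dim_le[OF f(1) i1(2) other this] have "2 * d i \<le> card ?A + card ?B" .
  also have "card ?A = (\<Sum>a\<in>arcs G. if head G a = i then d (tail G a) else 0)"
    by (simp add: card_SigmaI sum.inter_filter)
  also have "card ?B = (\<Sum>a\<in>arcs G. if tail G a = i then d (head G a) else 0)"
    by (simp add: card_SigmaI sum.inter_filter)
  finally show ?thesis unfolding sum.distrib by (simp only: add.commute)
qed

lemma cuspidal_support_connected:
  fixes f :: "('a, 'b, 'k::{field, finite}) hall_element"
  assumes f: "cuspidal G f" "f \<noteq> 0" "homogeneous G d f"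
    and A: "i \<in> A" "i \<in> verts G" "d i > 0"
    and closed: "\<And>a. a \<in> arcs G \<Longrightarrow> d (tail G a) > 0 \<Longrightarrow> d (head G a) > 0 \<Longrightarrow> tail G a \<in> A \<longleftrightarrow> head G a \<in> A"
    and j: "j \<in> verts G" "d j > 0"
  shows "j \<in> A"
proof (rule ccontr)
  assume "j \<notin> A"
  obtain x :: "'b \<Rightarrow> 'k mat" where x: "x \<in> points d" "point_value f d x \<noteq> 0"
    using ex_point_value_nonzero[OF _ f(2,3)] f(1) unfolding cuspidal_def by blast
  let ?J = "\<lambda>i. if i \<in> A then UNIV else {} :: nat set"
  have no: "tail G a \<in> A \<longleftrightarrow> head G a \<in> A" if "a \<in> arcs G" "r < d (head G a)" "c < d (tail G a)" for a r c
    using closed[OF that(1)] that(2,3) by simp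
  interpret coordinate_subrep G d ?J x
  proof
    show "x \<in> points d" by (fact x(1))
    show "x a $$ (r, c) = 0" if "a \<in> arcs G" "r < d (head G a)" "c < d (tail G a)" "c \<in> ?J (tail G a)" "r \<notin> ?J (head G a)" for a r c
      using no[OF that(1-3)] that(4,5) by (simp split: if_splits)
  qed
  \<comment> \<open>No arc between nonzero spaces crosses the border of \<open>A\<close>, so the
    free block is empty.\<close>
  have "extensions = {x}"
  proof
    show "extensions \<subseteq> {x}"
    proof
      fix z assume z: "z \<in> extensions"
      have "z a = x a" if a: "a \<in> arcs G" for a
      proof (rule eq_matI)
        fix r c assume "r < dim_row (x a)" "c < dim_col (x a)"
        then have rc: "r < d (head G a)" "c < d (tail G a)" using pointsD[OF x(1) a] by auto
        then have "\<not> (r \<in> ?J (head G a) \<and> c \<notin> ?J (tail G a))" using no[OF a rc] by simp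
        then show "z a $$ (r, c) = x a $$ (r, c)" using z a rc unfolding extensions_def by blast
      qed (use pointsD[OF x(1) a] pointsD[OF extensions_points[OF z] a] in auto)
      then have "z = x" by (rule PiE_ext[OF extensions_points[OF z, unfolded points_def] x(1)[unfolded points_def]])
      then show "z \<in> {x}" by simp
    qed
    show "{x} \<subseteq> extensions" using x(1) by (simp add: extensions_def)
  qed
  moreover have "(\<Sum>z\<in>extensions. point_value f d z) = 0"
    by (rule sum_extensions_eq_0[OF f(1) A(2,3) _ j]) (use A(1) \<open>j \<notin> A\<close> in simp_all)
  ultimately show False using x(2) by simp
qed

lemma sum_vertices_arcs:
  fixes x y :: "'a \<Rightarrow> 'c::comm_ring_1"
  shows "(\<Sum>i\<in>verts G. x i * (\<Sum>a\<in>arcs G. (if tail G a = i then y (head G a) else 0) + (if head G a = i then y (tail G a) else 0))) =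
    (\<Sum>a\<in>arcs G. x (tail G a) * y (head G a) + x (head G a) * y (tail G a))"
  unfolding sum_distrib_left
proof (subst sum.swap, rule sum.cong[OF refl])
  fix a assume a: "a \<in> arcs G"
  have "(\<Sum>i\<in>verts G. x i * ((if tail G a = i then y (head G a) else 0) + (if head G a = i then y (tail G a) else 0))) =
      (\<Sum>i\<in>verts G. (if tail G a = i then x i * y (head G a) else 0) + (if head G a = i then x i * y (tail G a) else 0))"
    by (rule sum.cong[OF refl]) (simp add: distrib_left)
  also have "\<dots> = x (tail G a) * y (head G a) + x (head G a) * y (tail G a)"
    using a by (simp add: sum.distrib)
  finally show "(\<Sum>i\<in>verts G. x i * ((if tail G a = i then y (head G a) else 0) + (if head G a = i then y (tail G a) else 0))) =
      x (tail G a) * y (head G a) + x (head G a) * y (tail G a)" .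
qed

end

theorem theorem8p2:
  fixes Q :: "('v, 'e) pre_digraph" and d :: "'v \<Rightarrow> nat"
  assumes "fin_digraph Q"
    and "cuspidal_dimension Q TYPE('k::{field, finite}) d"
    and "isotropic Q d"
  shows "is_affine_quiver (supp Q d)"
proof -
  interpret fin_digraph Q by fact
  obtain f :: "('v, 'e, 'k) hall_element" where f: "cuspidal Q f" "f \<noteq> 0" "homogeneous Q d f"
    using assms(2) unfolding cuspidal_dimension_def by blast
  let ?D = "\<lambda>i. int (d i)"
  define N where "N i = (\<Sum>a\<in>arcs Q. (if tail Q a = i then ?D (head Q a) else 0) + (if head Q a = i then ?D (tail Q a) else 0))" for i
  have form: "sym_euler_form Q ?D ?D = 2 * ((\<Sum>i\<in>verts Q. ?D i * ?D i) - (\<Sum>a\<in>arcs Q. ?D (tail Q a) * ?D (head Q a)))"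
    by (simp add: sym_euler_form_def euler_form_def)
  then have null: "(\<Sum>i\<in>verts Q. ?D i * ?D i) = (\<Sum>a\<in>arcs Q. ?D (tail Q a) * ?D (head Q a))"
    using assms(3) by (simp add: isotropic_def)
  \<comment> \<open>A loop at \<open>i\<close> alone contributes 2 d_i to \<open>N i\<close>;
    cuspidality is called upon only at loopless vertices.\<close>
  have le: "2 * ?D i \<le> N i" if i: "i \<in> verts Q" "d i > 0" for i
  proof (cases "\<exists>a\<in>arcs Q. head Q a = i \<and> tail Q a = i")
    case True
    then obtain a where a: "a \<in> arcs Q" "head Q a = i" "tail Q a = i" by blast
    then have "2 * ?D i = (if tail Q a = i then ?D (head Q a) else 0) + (if head Q a = i then ?D (tail Q a) else 0)" by simp
    also have "\<dots> \<le> N i" unfolding N_def by (rule member_le_sum) (use a(1) in auto)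
    finally show ?thesis .
  next
    case False
    \<comment> \<open>Otherwise \<open>d\<close> would be the unit vector at the loopless vertex
      \<open>i\<close>, for which (d, d) = 2.\<close>
    have "\<exists>j k. j \<in> verts Q \<and> k < d j \<and> (j, k) \<noteq> (i, 0)"
    proof (rule ccontr)
      assume "\<not> ?thesis"
      then have no: "k = 0 \<and> j = i" if "j \<in> verts Q" "k < d j" for j k using that by blast
      have "d i = 1" using no[OF i(1), of 1] i(2) by linarith
      moreover have zero: "d j = 0" if "j \<in> verts Q" "j \<noteq> i" for j using no[OF that(1), of 0] that(2) by blast
      ultimately have "(\<Sum>j\<in>verts Q. ?D j * ?D j) = (\<Sum>j\<in>verts Q. if j = i then 1 else 0)"
        by (intro sum.cong) auto
      moreover have "(\<Sum>a\<in>arcs Q. ?D (tail Q a) * ?D (head Q a)) = 0"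
      proof (rule sum.neutral, rule ballI)
        fix a assume a: "a \<in> arcs Q"
        then have "tail Q a \<noteq> i \<or> head Q a \<noteq> i" using False by blast
        then show "?D (tail Q a) * ?D (head Q a) = 0" using zero[of "tail Q a"] zero[of "head Q a"] a by auto
      qed
      ultimately show False using null i(1) by simp
    qed
    then obtain j k where other: "j \<in> verts Q" "k < d j" "(j, k) \<noteq> (i, 0)" by blast
    from False have "2 * d i \<le> (\<Sum>a\<in>arcs Q. (if tail Q a = i then d (head Q a) else 0) + (if head Q a = i then d (tail Q a) else 0))"
      by (intro cuspidal_vertex_inequality[OF f i _ other]) blast
    then have "int (2 * d i) \<le> int (\<Sum>a\<in>arcs Q. (if tail Q a = i then d (head Q a) else 0) + (if head Q a = i then d (tail Q a) else 0))"
      by (simp only: of_nat_le_iff)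
    also have "\<dots> = N i" unfolding N_def of_nat_sum by (rule sum.cong) auto
    finally show ?thesis by simp
  qed
  have nonneg: "0 \<le> ?D i * (N i - 2 * ?D i)" if "i \<in> verts Q" for i
    using le[OF that] by (cases "d i = 0") auto
  \<comment> \<open>The sum of these nonnegative terms is -(d, d) = 0, so the inequality is an
    equality at every vertex of the support.\<close>
  have "(\<Sum>i\<in>verts Q. ?D i * (N i - 2 * ?D i)) = (\<Sum>i\<in>verts Q. ?D i * N i) - 2 * (\<Sum>i\<in>verts Q. ?D i * ?D i)"
    by (simp add: right_diff_distrib sum_subtractf sum_distrib_left mult_ac)
  also have "(\<Sum>i\<in>verts Q. ?D i * N i) = (\<Sum>a\<in>arcs Q. ?D (tail Q a) * ?D (head Q a) + ?D (head Q a) * ?D (tail Q a))"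
    unfolding N_def by (rule sum_vertices_arcs)
  also have "\<dots> = 2 * (\<Sum>a\<in>arcs Q. ?D (tail Q a) * ?D (head Q a))"
    by (simp add: sum_distrib_left mult_ac)
  finally have "(\<Sum>i\<in>verts Q. ?D i * (N i - 2 * ?D i)) = 0" using null by simp
  then have "?D i * (N i - 2 * ?D i) = 0" if "i \<in> verts Q" for i
    using sum_nonneg_eq_0_iff[OF finite_verts, of "\<lambda>i. ?D i * (N i - 2 * ?D i)"] nonneg that by blast
  then have N: "N i = 2 * ?D i" if "i \<in> verts Q" "d i \<noteq> 0" for i using that by fastforce
  have sets: "verts (supp Q d) = {i \<in> verts Q. d i \<noteq> 0}"
    "arcs (supp Q d) = {a \<in> arcs Q. d (tail Q a) \<noteq> 0 \<and> d (head Q a) \<noteq> 0}"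
    "tail (supp Q d) = tail Q" "head (supp Q d) = head Q"
    by (auto simp: supp_def)
  show ?thesis
  proof (rule is_affine_quiver_if_null_vector[of _ ?D])
    show "fin_digraph (supp Q d)" by unfold_locales (auto simp: sets)
    show "null_vector (supp Q d) ?D"
      unfolding null_vector_def sets
    proof (intro ballI conjI)
      fix i assume i: "i \<in> {i \<in> verts Q. d i \<noteq> 0}"
      then show "?D i > 0" by simp
      have "2 * ?D i = N i" using N i by simp
      \<comment> \<open>An arc from \<open>i\<close> to a vertex outside the support contributes 0,
        so passing to the full subquiver preserves the equation.\<close>
      also have "\<dots> = (\<Sum>a\<in>{a \<in> arcs Q. d (tail Q a) \<noteq> 0 \<and> d (head Q a) \<noteq> 0}.
          (if tail Q a = i then ?D (head Q a) else 0) + (if head Q a = i then ?D (tail Q a) else 0))"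
        unfolding N_def by (rule sum.mono_neutral_right) (use i in auto)
      finally show "2 * ?D i = (\<Sum>a\<in>{a \<in> arcs Q. d (tail Q a) \<noteq> 0 \<and> d (head Q a) \<noteq> 0}.
          (if tail Q a = i then ?D (head Q a) else 0) + (if head Q a = i then ?D (tail Q a) else 0))" .
    qed
    show "connected_graph (supp Q d)"
      unfolding connected_graph_def sets
    proof (intro conjI allI impI)
      show "{i \<in> verts Q. d i \<noteq> 0} \<noteq> {}" using cuspidal_dim_nonzero[OF f] by blast
      fix A assume A: "A \<subseteq> {i \<in> verts Q. d i \<noteq> 0}" "A \<noteq> {}"
        "\<forall>a\<in>{a \<in> arcs Q. d (tail Q a) \<noteq> 0 \<and> d (head Q a) \<noteq> 0}. tail Q a \<in> A \<longleftrightarrow> head Q a \<in> A"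
      from A(2) obtain i where i: "i \<in> A" by blast
      have "j \<in> A" if "j \<in> verts Q" "d j \<noteq> 0" for j
        by (rule cuspidal_support_connected[OF f i]) (use A i that in auto)
      with A(1) show "A = {i \<in> verts Q. d i \<noteq> 0}" by blast
    qed
  qed
qed

end
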